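(* Let $M\subset S^{31}$ be an isoparametric hypersurface with four principal curvatures of multiplicities $(7,8)$, let $x\in M_+$ be a point of Condition A, and let $x^*\in M_-$ be its mirror point with associated orthogonal multiplication $\circ$ on $\mathbb O$, angle $\theta$ and third fundamental form ${\bf q}^*$. Suppose $\theta\ne0$ and $\theta\neq\pi$. For all $X,Y\in\mathbb O$ and all $Z\in\mathbb O$ we have $${\bf q}^*(X,Y,Z)=X(Y\circ Z)-Y\circ(XZ).$$ Thus the hypersurfaces are of the type constructed by Ferus, Karcher and Münzner.
   Context: Octonions. $\mathbb O=\mathbb H\oplus\mathbb H$ with product $(a,b)(c,d)=(ac-\bar d b,\ da+b\bar c)$, conjugation $\overline{(a,b)}=(\bar a,-b)$, inner product $\langle x,y\rangle=(x\bar y+y\bar x)/2$, and standard orthonormal basis $(e_0,\dots,e_7)=(1,i,j,k,\epsilon,i\epsilon,j\epsilon,k\epsilon)$, $\epsilon=(0,1)$. $\mathrm{Im}(\mathbb O)=\mathrm{span}(e_1,\dots,e_7)$; $J_a(z)=e_az$. Isoparametric setting. $(m_1,m_2)=(7,8)$. $M\subset S^{31}$ is a regular level set in $S^{31}$ of its Cartan–Münzner polynomial $F:\mathbb R^{32}\to\mathbb R$, homogeneous of degree 4 with $|\nabla F|^2=16|x|^6$, $\Delta F=8(m_2-m_1)|x|^2$. $M_\pm=F^{-1}(\pm1)\cap S^{31}$ are the focal submanifolds, of codimension $m_1+1$ and $m_2+1$ in the sphere. Fundamental forms. At $x\in M_+$, with orthonormal basis ${\bf n}_0,\dots,{\bf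 n}_{m_1}$ of the normal space to $M_+$ in the sphere, $y$ tangent to $M_+$ at $x$, $w=\sum w_a{\bf n}_a$, $$F(tx+y+w)=t^4+(2|y|^2-6|w|^2)t^2+8\Big(\sum_a p_aw_a\Big)t+|y|^4-6|y|^2|w|^2+|w|^4-2\sum_a p_a^2+8\sum_a q_aw_a+2\sum_{a,b}\langle\nabla p_a,\nabla p_b\rangle w_aw_b .$$ Here $p_a(y)=\langle S_{{\bf n}_a}y,y\rangle$ ($S_{\bf n}$ the shape operator) are the components of the second fundamental form and the cubic forms $q_a(y)$ are the components of the third fundamental form. On $M_-$ the same definitions are used with $-F$ in place of $F$. Condition A. $x\in M_+$ is of Condition A if the shape operators $S_{\bf n}$ of $M_+$ at $x$ have the same kernel for all unit normals ${\bf n}$. Mirror points. Let $x\in M_+$ be of Condition A, ${\bf n}_0,\dots,{\bf n}_7$ an orthonormal normal basis at $x$, and $V_+,V_-,V_0$ the eigenspaces of $S_{{\bf n}_0}$ for $1,-1,0$. With respect to $V_+\oplus V_-\oplus V_0$, $S_{{\bf n}_a}$ ($a\ge1$) has off-diagonal block $A_a:V_-\to V_+$, its transpose, and zeros elsewhere. The point $x^\#={\bf n}_0$ lies in $M_+$ and is of Condition A; its normal space is $\mathbb Rx\oplus V_0$, and the shape operator at $x^\#$ in direction $x$ has eigenspaces $V_+,V_-,\mathrm{span}({\bf n}_1,\dots,{\bf n}_7)$ for $1,-1,0$. For an orthonormal basis of $V_0$, $A^\#_a:V_-\to V_+$ denotes the block at $x^\#$ for the $a$th basis vector of $V_0$.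 Bases are chosen so that $V_\pm\simeq\mathbb O$ with $A_a=J_a$, and $V_0\simeq\mathrm{Im}(\mathbb O)$ with $A_a^\#$ skew-symmetric and $A_a^\#(e_0)=e_a$. The bilinear product $\circ$ on $\mathbb O$ is defined by $e_0\circ e_b=e_b$, $e_a\circ e_b=A_a^\#(e_b)$ for $1\le a\le 7$. The mirror point of $x$ on $M_-$ is $x^*=(x+{\bf n}_0)/\sqrt2$, with normal vector ${\bf n}_0^*=(x-{\bf n}_0)/\sqrt2$; the eigenspaces of $S_{{\bf n}_0^*}$ are $V_+^*=\mathrm{span}({\bf n}_1,\dots,{\bf n}_7)\simeq\mathrm{Im}(\mathbb O)$ (${\bf n}_a\leftrightarrow e_a$), $V_-^*=V_0\simeq\mathrm{Im}(\mathbb O)$, $V_0^*=V_-\simeq\mathbb O$ for $1,-1,0$, and the normal space to $M_-$ at $x^*$ is $\mathbb R{\bf n}_0^*\oplus V_+$, $V_+\simeq\mathbb O$. The ${\bf n}_0^*$-component of the third fundamental form at $x^*$ vanishes; ${\bf q}^*=\sum_{a=0}^7q_a^*e_a$ collects its components along $V_+\simeq\mathbb O$. It is multilinear in the components $X\in V_+^*$, $Y\in V_-^*$, $Z\in V_0^*$ of a tangent vector, and is written ${\bf q}^*(X,Y,Z)$; it is extended multilinearly to all $X,Y\in\mathbb O$ by ${\bf q}^*(e_0,Y,Z)={\bf q}^*(X,e_0,Z)=0$. Angle. The product $\circ$ is either $x\circ y=(x(y\bar\alpha))\alpha$ or $x\circ y=\alpha((\bar\alpha y)x)$ for a unit vector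 $\alpha\in\mathbb O$; write $\alpha=\cos(\theta)e_0+\sin(\theta)e$ with $e$ a purely imaginary unit vector and $\theta$ an angle (a real number modulo $2\pi$). The Ferus–Karcher–Münzner hypersurfaces: for such a $\circ$, define on $\mathbb R^{32}=\mathbb O^4$ the symmetric Clifford system $P_{-1}(A,X,Y,B)=(A,-X,Y,-B)$, $P_a(A,X,Y,B)=(-Xe_a,-A\bar e_a,-B\circ\bar e_a,-Y\circ e_a)$, $0\le a\le7$; then $-F(x)=|x|^4-2\sum_{a=-1}^7\langle P_ax,x\rangle^2$ and $M_-=\{|x|=1,\ \langle P_ax,x\rangle=0\ \forall a\}$.
   Formalization: The stated conventions fix the bases only up to one common sign (of n_1..n_7, the basis of V_0 and V_- ≃ O), which reverses q*; the formula is therefore proved for each admissible choice of bases or for the choice with this sign changed, with the same product ∘. *)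

theory Defs
  imports "HOL-Analysis.Analysis" "HOL-Library.Real_Mod"
begin

section \<open>Octonions\<close>

text \<open>The quaternions \<open>a + b j\<close> are pairs \<open>(a, b)\<close> of complex numbers, obtained by the same doubling
  formula as the octonions from the quaternions; here \<open>j = (0, 1)\<close> and \<open>k = i j = (0, \<i>)\<close>.  The
  product type supplies the Euclidean inner product and norm.\<close>

type_synonym quaternion = "complex \<times> complex"
type_synonym octonion = "quaternion \<times> quaternion"

fun qcnj :: "quaternion \<Rightarrow> quaternion" where
  "qcnj (a, b) = (cnj a, - b)"

fun qmul :: "quaternion \<Rightarrow> quaternion \<Rightarrow> quaternion" where
  "qmul (a, b) (c, d) = (a * c - cnj d * b, d * a + b * cnj c)"

fun ocnj :: "octonion \<Rightarrow> octonion" where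
  "ocnj (a, b) = (qcnj a, - b)"

fun omul :: "octonion \<Rightarrow> octonion \<Rightarrow> octonion"  (infixl \<open>\<cdot>\<close> 70) where
  "(a, b) \<cdot> (c, d) = (qmul a c - qmul (qcnj d) b, qmul d a + qmul b (qcnj c))"

text \<open>The standard basis \<open>1, i, j, k, \<epsilon>, i \<epsilon>, j \<epsilon>, k \<epsilon>\<close> with \<open>\<epsilon> = (0, 1)\<close>; only indices below 8 are used.\<close>

definition oe :: "nat \<Rightarrow> octonion" where
  "oe k = [((1, 0), 0), ((\<i>, 0), 0), ((0, 1), 0), ((0, \<i>), 0),
           (0, (1, 0)), (0, (\<i>, 0)), (0, (0, 1)), (0, (0, \<i>))] ! k"

lemma oe_products:
  "oe 1 \<cdot> oe 2 = oe 3" "oe 1 \<cdot> oe 4 = oe 5" "oe 2 \<cdot> oe 4 = oe 6" "oe 3 \<cdot> oe 4 = oe 7"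
  by (simp_all add: oe_def zero_prod_def)

lemma inner_octonion_eq:
  "(x \<cdot> ocnj y + y \<cdot> ocnj x) /\<^sub>R 2 = inner x y *\<^sub>R oe 0"
  by (cases x; cases y; cases "fst x"; cases "snd x"; cases "fst y"; cases "snd y")
     (auto simp: oe_def zero_prod_def complex_eq_iff inner_complex_def algebra_simps)


section \<open>Submanifolds, normal spaces and shape operators\<close>

primrec Ck_on :: "nat \<Rightarrow> 'a::euclidean_space set \<Rightarrow> ('a \<Rightarrow> 'b::real_normed_vector) \<Rightarrow> bool" where
  "Ck_on 0 U f = continuous_on U f"
| "Ck_on (Suc k) U f =
     (f differentiable_on U \<and> (\<forall>v. Ck_on k U (\<lambda>x. frechet_derivative f (at x) v)))"

text \<open>\<open>C\<^sup>\<infinity>\<close> on an open set.\<close>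

definition smooth_on :: "'a::euclidean_space set \<Rightarrow> ('a \<Rightarrow> 'b::real_normed_vector) \<Rightarrow> bool" where
  "smooth_on U f \<longleftrightarrow> (\<forall>k. Ck_on k U f)"

text \<open>Embedded submanifolds of dimension \<open>d\<close>, by slice charts.\<close>

definition submanifold :: "nat \<Rightarrow> 'a::euclidean_space set \<Rightarrow> bool" where
  "submanifold d M \<longleftrightarrow>
     (\<forall>p\<in>M. \<exists>W W' \<Phi> \<Psi> L. open W \<and> open (W' :: 'a set) \<and> p \<in> W \<and>
        homeomorphism W W' \<Phi> \<Psi> \<and> smooth_on W \<Phi> \<and> smooth_on W' \<Psi> \<and>
        subspace L \<and> dim L = d \<and> \<Phi> ` (M \<inter> W) = L \<inter> W')"

definition smooth_curve_in :: "'a::euclidean_space set \<Rightarrow> real \<Rightarrow> (real \<Rightarrow> 'a) \<Rightarrow> bool" where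
  "smooth_curve_in M \<epsilon> \<gamma> \<longleftrightarrow>
     \<epsilon> > 0 \<and> smooth_on {-\<epsilon><..<\<epsilon>} \<gamma> \<and> (\<forall>s\<in>{-\<epsilon><..<\<epsilon>}. \<gamma> s \<in> M)"

definition tangent_space :: "'a::euclidean_space set \<Rightarrow> 'a \<Rightarrow> 'a set" where
  "tangent_space M x =
     {v. \<exists>\<epsilon> \<gamma>. smooth_curve_in M \<epsilon> \<gamma> \<and> \<gamma> 0 = x \<and> (\<gamma> has_vector_derivative v) (at 0)}"

text \<open>For \<open>M\<close> in the unit sphere: the normal space of \<open>M\<close> in the sphere.\<close>

definition normal_space :: "'a::euclidean_space set \<Rightarrow> 'a \<Rightarrow> 'a set" where
  "normal_space M x = {\<nu>. inner \<nu> x = 0 \<and> (\<forall>v\<in>tangent_space M x. inner \<nu> v = 0)}"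

text \<open>Weingarten's formula: \<open>S\<^sub>\<nu> y\<close> is minus the tangential part of the derivative, in the direction \<open>y\<close>,
  of a normal field \<open>N\<close> extending \<open>\<nu>\<close>.  Differentiating in the ambient Euclidean space instead of the
  sphere only changes the radial component.\<close>

definition shape_operator :: "'a::euclidean_space set \<Rightarrow> 'a \<Rightarrow> 'a \<Rightarrow> 'a \<Rightarrow> 'a" where
  "shape_operator M x \<nu> y =
     (THE v. v \<in> tangent_space M x \<and>
        (\<forall>\<epsilon> \<gamma> N N'. smooth_curve_in M \<epsilon> \<gamma> \<and> \<gamma> 0 = x \<and> (\<gamma> has_vector_derivative y) (at 0) \<and>
            smooth_on {-\<epsilon><..<\<epsilon>} N \<and> (\<forall>s\<in>{-\<epsilon><..<\<epsilon>}. N s \<in> normal_space M (\<gamma> s)) \<and>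
            N 0 = \<nu> \<and> (N has_vector_derivative N') (at 0) \<longrightarrow>
            (\<forall>z\<in>tangent_space M x. inner v z = - inner N' z)))"

definition shape_eigenspace :: "'a::euclidean_space set \<Rightarrow> 'a \<Rightarrow> 'a \<Rightarrow> real \<Rightarrow> 'a set" where
  "shape_eigenspace M x \<nu> c = {y \<in> tangent_space M x. shape_operator M x \<nu> y = c *\<^sub>R y}"

definition orthonormal_basis :: "'i set \<Rightarrow> ('i \<Rightarrow> 'a::euclidean_space) \<Rightarrow> 'a set \<Rightarrow> bool" where
  "orthonormal_basis I b V \<longleftrightarrow>
     (\<forall>i\<in>I. \<forall>j\<in>I. inner (b i) (b j) = (if i = j then 1 else 0)) \<and> span (b ` I) = V"


section \<open>Isoparametric hypersurfaces with four principal curvatures\<close>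

definition laplacian :: "('a::euclidean_space \<Rightarrow> real) \<Rightarrow> 'a \<Rightarrow> real" where
  "laplacian F x =
     (\<Sum>b\<in>Basis. frechet_derivative (\<lambda>z. frechet_derivative F (at z) b) (at x) b)"

definition cartan_munzner :: "nat \<Rightarrow> nat \<Rightarrow> ('a::euclidean_space \<Rightarrow> real) \<Rightarrow> bool" where
  "cartan_munzner m1 m2 F \<longleftrightarrow>
     real_polynomial_function F \<and> (\<forall>c x. F (c *\<^sub>R x) = c ^ 4 * F x) \<and>
     (\<forall>x. \<exists>D. GDERIV F x :> D \<and> (norm D)\<^sup>2 = 16 * norm x ^ 6) \<and>
     (\<forall>x. laplacian F x = 8 * (real m2 - real m1) * (norm x)\<^sup>2)"

text \<open>Level sets in the unit sphere on which the spherical gradient has no zero.\<close>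

definition regular_level_set :: "('a::euclidean_space \<Rightarrow> real) \<Rightarrow> 'a set \<Rightarrow> bool" where
  "regular_level_set F M \<longleftrightarrow>
     (\<exists>c. M = {x \<in> sphere 0 1. F x = c}) \<and> M \<noteq> {} \<and>
     (\<forall>x\<in>M. \<exists>v. inner v x = 0 \<and> frechet_derivative F (at x) v \<noteq> 0)"

text \<open>\<open>focal F\<close> is \<open>M\<^sub>+\<close>, and \<open>focal (\<lambda>z. - F z)\<close> is \<open>M\<^sub>-\<close>.\<close>

definition focal :: "('a::euclidean_space \<Rightarrow> real) \<Rightarrow> 'a set" where
  "focal F = {x \<in> sphere 0 1. F x = 1}"

definition isoparametric :: "nat \<Rightarrow> nat \<Rightarrow> ('a::euclidean_space \<Rightarrow> real) \<Rightarrow> 'a set \<Rightarrow> bool" where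
  "isoparametric m1 m2 F M \<longleftrightarrow>
     cartan_munzner m1 m2 F \<and> regular_level_set F M \<and>
     submanifold (DIM('a) - 1 - (m1 + 1)) (focal F) \<and>
     submanifold (DIM('a) - 1 - (m2 + 1)) (focal (\<lambda>z. - F z))"

definition second_form :: "('a::euclidean_space \<Rightarrow> real) \<Rightarrow> 'a \<Rightarrow> 'a \<Rightarrow> 'a \<Rightarrow> real" where
  "second_form F x \<nu> y = inner (shape_operator (focal F) x \<nu> y) y"

text \<open>The gradient of a function that is only given on the linear subspace \<open>V\<close>.\<close>

definition gradient_on :: "'a::euclidean_space set \<Rightarrow> ('a \<Rightarrow> real) \<Rightarrow> 'a \<Rightarrow> 'a" where
  "gradient_on V f y =
     (THE g. g \<in> V \<and>
        (\<forall>v\<in>V. ((\<lambda>s. f (y + s *\<^sub>R v)) has_real_derivative inner g v) (at 0)))"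

text \<open>\<open>q i\<close> (\<open>i \<in> I\<close>) are the components, with respect to the orthonormal normal basis \<open>n\<close>, of the third
  fundamental form of \<open>focal F\<close> at \<open>x\<close>.  The expansion determines \<open>q\<close> on the tangent space.\<close>

definition third_fundamental_form ::
  "('a::euclidean_space \<Rightarrow> real) \<Rightarrow> 'a \<Rightarrow> 'i set \<Rightarrow> ('i \<Rightarrow> 'a) \<Rightarrow> ('i \<Rightarrow> 'a \<Rightarrow> real) \<Rightarrow> bool" where
  "third_fundamental_form F x I n q \<longleftrightarrow>
     orthonormal_basis I n (normal_space (focal F) x) \<and>
     (\<forall>t w. \<forall>y\<in>tangent_space (focal F) x.
        let p = (\<lambda>a. second_form F x (n a));
            dp = (\<lambda>a. gradient_on (tangent_space (focal F) x) (p a) y);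
            W = (\<Sum>a\<in>I. w a *\<^sub>R n a)
        in F (t *\<^sub>R x + y + W) =
             t ^ 4 + (2 * (norm y)\<^sup>2 - 6 * (norm W)\<^sup>2) * t\<^sup>2 + 8 * (\<Sum>a\<in>I. p a y * w a) * t
             + norm y ^ 4 - 6 * (norm y)\<^sup>2 * (norm W)\<^sup>2 + norm W ^ 4
             - 2 * (\<Sum>a\<in>I. (p a y)\<^sup>2) + 8 * (\<Sum>a\<in>I. q a y * w a)
             + 2 * (\<Sum>a\<in>I. \<Sum>b\<in>I. inner (dp a) (dp b) * w a * w b))"


section \<open>Condition A and mirror points\<close>

definition condition_A :: "('a::euclidean_space \<Rightarrow> real) \<Rightarrow> 'a \<Rightarrow> bool" where
  "condition_A F x \<longleftrightarrow> x \<in> focal F \<and>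
     (\<forall>\<nu>\<in>normal_space (focal F) x. \<forall>\<nu>'\<in>normal_space (focal F) x.
        norm \<nu> = 1 \<longrightarrow> norm \<nu>' = 1 \<longrightarrow>
        shape_eigenspace (focal F) x \<nu> 0 = shape_eigenspace (focal F) x \<nu>' 0)"

text \<open>The block \<open>V\<^sub>- \<rightarrow> V\<^sub>+\<close> of \<open>S\<close>, in the octonionic coordinates \<open>\<phi>\<^sub>+\<close> and \<open>\<phi>\<^sub>-\<close> of \<open>V\<^sub>+\<close> and \<open>V\<^sub>-\<close>; for an
  isometric \<open>\<phi>\<^sub>+\<close> the adjoint is the orthogonal projection to \<open>V\<^sub>+\<close> followed by the inverse of \<open>\<phi>\<^sub>+\<close>.\<close>

definition block ::
  "(octonion \<Rightarrow> 'a::euclidean_space) \<Rightarrow> (octonion \<Rightarrow> 'a) \<Rightarrow> ('a \<Rightarrow> 'a) \<Rightarrow> octonion \<Rightarrow> octonion" where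
  "block \<phi>p \<phi>m S z = adjoint \<phi>p (S (\<phi>m z))"

definition mirror_block ::
  "('a::euclidean_space \<Rightarrow> real) \<Rightarrow> (nat \<Rightarrow> 'a) \<Rightarrow> (octonion \<Rightarrow> 'a) \<Rightarrow> (octonion \<Rightarrow> 'a) \<Rightarrow> (nat \<Rightarrow> 'a) \<Rightarrow>
   nat \<Rightarrow> octonion \<Rightarrow> octonion" where
  "mirror_block F n \<phi>p \<phi>m u a = block \<phi>p \<phi>m (shape_operator (focal F) (n 0) (u a))"

text \<open>The choice of bases at \<open>x\<close>: \<open>n 0, \<dots>, n 7\<close> span the normal space, \<open>\<phi>p\<close> and \<open>\<phi>m\<close> identify the
  octonions with \<open>V\<^sub>+\<close> and \<open>V\<^sub>-\<close>, and \<open>u 1, \<dots>, u 7\<close> span \<open>V\<^sub>0\<close>, with \<open>u a\<close> corresponding to \<open>oe a\<close>.\<close>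

definition adapted_bases ::
  "('a::euclidean_space \<Rightarrow> real) \<Rightarrow> 'a \<Rightarrow> (nat \<Rightarrow> 'a) \<Rightarrow> (octonion \<Rightarrow> 'a) \<Rightarrow> (octonion \<Rightarrow> 'a) \<Rightarrow>
   (nat \<Rightarrow> 'a) \<Rightarrow> bool" where
  "adapted_bases F x n \<phi>p \<phi>m u \<longleftrightarrow>
     orthonormal_basis {0..7} n (normal_space (focal F) x) \<and>
     linear \<phi>p \<and> (\<forall>z. norm (\<phi>p z) = norm z) \<and> range \<phi>p = shape_eigenspace (focal F) x (n 0) 1 \<and>
     linear \<phi>m \<and> (\<forall>z. norm (\<phi>m z) = norm z) \<and> range \<phi>m = shape_eigenspace (focal F) x (n 0) (-1) \<and>
     orthonormal_basis {1..7} u (shape_eigenspace (focal F) x (n 0) 0) \<and>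
     (\<forall>a\<in>{1..7}. \<forall>z. block \<phi>p \<phi>m (shape_operator (focal F) x (n a)) z = oe a \<cdot> z) \<and>
     (\<forall>a\<in>{1..7}. (\<forall>z w. inner (mirror_block F n \<phi>p \<phi>m u a z) w
                       = - inner z (mirror_block F n \<phi>p \<phi>m u a w)) \<and>
                 mirror_block F n \<phi>p \<phi>m u a (oe 0) = oe a)"

text \<open>The bilinear product with \<open>e\<^sub>0 \<circ> e\<^sub>b = e\<^sub>b\<close> and \<open>e\<^sub>a \<circ> e\<^sub>b = A\<^sub>a\<^sup># e\<^sub>b\<close> for \<open>a > 0\<close>.\<close>

definition mirror_product ::
  "('a::euclidean_space \<Rightarrow> real) \<Rightarrow> (nat \<Rightarrow> 'a) \<Rightarrow> (octonion \<Rightarrow> 'a) \<Rightarrow> (octonion \<Rightarrow> 'a) \<Rightarrow> (nat \<Rightarrow> 'a) \<Rightarrow>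
   octonion \<Rightarrow> octonion \<Rightarrow> octonion" where
  "mirror_product F n \<phi>p \<phi>m u x y =
     (\<Sum>a=0..7. \<Sum>b=0..7. (inner x (oe a) * inner y (oe b)) *\<^sub>R
        (if a = 0 then oe b else mirror_block F n \<phi>p \<phi>m u a (oe b)))"

definition mirror_point :: "'a::euclidean_space \<Rightarrow> (nat \<Rightarrow> 'a) \<Rightarrow> 'a" where
  "mirror_point x n = (x + n 0) /\<^sub>R sqrt 2"

text \<open>The orthonormal basis of the normal space to \<open>M\<^sub>-\<close> at the mirror point: the index \<open>-1\<close> stands for
  the special normal \<open>n\<^sub>0\<^sup>* = (x - n\<^sub>0) / \<surd>2\<close>, and \<open>0, \<dots>, 7\<close> for the standard basis of \<open>V\<^sub>+\<close>.\<close>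

definition mirror_normal ::
  "'a::euclidean_space \<Rightarrow> (nat \<Rightarrow> 'a) \<Rightarrow> (octonion \<Rightarrow> 'a) \<Rightarrow> int \<Rightarrow> 'a" where
  "mirror_normal x n \<phi>p a = (if a = -1 then (x - n 0) /\<^sub>R sqrt 2 else \<phi>p (oe (nat a)))"

text \<open>The \<open>V\<^sub>+\<close>-part of the third fundamental form at the mirror point, evaluated at the tangent vector
  \<open>X + Y + Z\<close> with \<open>X \<in> V\<^sub>+\<^sup>* = span (n 1, \<dots>, n 7)\<close>, \<open>Y \<in> V\<^sub>-\<^sup>* = V\<^sub>0\<close> and \<open>Z \<in> V\<^sub>0\<^sup>* = V\<^sub>-\<close>.  The
  \<open>oe 0\<close>-components of \<open>X\<close> and \<open>Y\<close> are ignored, which is the extension by zero to all octonions.\<close>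

definition mirror_third_form ::
  "(nat \<Rightarrow> 'a::euclidean_space) \<Rightarrow> (octonion \<Rightarrow> 'a) \<Rightarrow> (nat \<Rightarrow> 'a) \<Rightarrow> (int \<Rightarrow> 'a \<Rightarrow> real) \<Rightarrow>
   octonion \<Rightarrow> octonion \<Rightarrow> octonion \<Rightarrow> octonion" where
  "mirror_third_form n \<phi>m u q X Y Z =
     (\<Sum>a=0..7. q (int a) ((\<Sum>b=1..7. inner X (oe b) *\<^sub>R n b) +
                          (\<Sum>b=1..7. inner Y (oe b) *\<^sub>R u b) + \<phi>m Z) *\<^sub>R oe a)"

text \<open>\<open>adapted_bases\<close> and \<open>mirror_product\<close> are unchanged when \<open>n 1, \<dots>, n 7\<close>, \<open>u 1, \<dots>, u 7\<close> and \<open>\<phi>m\<close> are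
  all replaced by their negatives, whereas \<open>mirror_third_form\<close> changes its sign.  A formula for the
  latter therefore involves a choice of this common sign \<open>s\<close>; the distinguished normal \<open>n 0\<close> is kept.\<close>

definition sign_normals :: "real \<Rightarrow> (nat \<Rightarrow> 'a::euclidean_space) \<Rightarrow> nat \<Rightarrow> 'a" where
  "sign_normals s n a = (if a = 0 then n 0 else s *\<^sub>R n a)"


section \<open>The hypersurfaces of Ferus, Karcher and Muenzner\<close>

type_synonym octonion4 = "octonion \<times> octonion \<times> octonion \<times> octonion"

definition symmetric_clifford_system ::
  "'i set \<Rightarrow> ('i \<Rightarrow> 'a::euclidean_space \<Rightarrow> 'a) \<Rightarrow> bool" where
  "symmetric_clifford_system I P \<longleftrightarrow>
     (\<forall>a\<in>I. linear (P a) \<and> (\<forall>v w. inner (P a v) w = inner v (P a w))) \<and>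
     (\<forall>a\<in>I. \<forall>b\<in>I. \<forall>v. P a (P b v) + P b (P a v) = (if a = b then 2 else 0) *\<^sub>R v)"

fun fkm_system :: "(octonion \<Rightarrow> octonion \<Rightarrow> octonion) \<Rightarrow> int \<Rightarrow> octonion4 \<Rightarrow> octonion4" where
  "fkm_system circ a (A, X, Y, B) =
     (if a = -1 then (A, - X, Y, - B)
      else (- (X \<cdot> oe (nat a)), - (A \<cdot> ocnj (oe (nat a))),
            - circ B (ocnj (oe (nat a))), - circ Y (oe (nat a))))"

text \<open>The negative of the Cartan-Muenzner polynomial, so that \<open>M\<^sub>-\<close> is the common zero set of the
  quadratic forms in the sphere.\<close>

definition fkm_polynomial :: "(octonion \<Rightarrow> octonion \<Rightarrow> octonion) \<Rightarrow> octonion4 \<Rightarrow> real" where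
  "fkm_polynomial circ v =
     norm v ^ 4 - 2 * (\<Sum>a\<in>{-1..7}. (inner (fkm_system circ a v) v)\<^sup>2)"

text \<open>Up to an isometry \<open>T\<close> of the ambient Euclidean spaces, \<open>M\<close> is a hypersurface of the construction
  with the product \<open>circ\<close>, and \<open>F\<close> is its polynomial.\<close>

definition fkm_type ::
  "(octonion \<Rightarrow> octonion \<Rightarrow> octonion) \<Rightarrow> ('a::euclidean_space \<Rightarrow> real) \<Rightarrow> 'a set \<Rightarrow> bool" where
  "fkm_type circ F M \<longleftrightarrow>
     symmetric_clifford_system {-1..7} (fkm_system circ) \<and>
     (\<exists>T. linear T \<and> bij T \<and> (\<forall>z. norm (T z) = norm z) \<and>
        (\<forall>z. - F z = fkm_polynomial circ (T z)) \<and>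
        regular_level_set (fkm_polynomial circ) (T ` M))"

end

theory Submission
  imports Defs "HOL-Computational_Algebra.Polynomial"
begin

text \<open>Write \<open>F z = \<langle>G z z z, z\<rangle>\<close> with \<open>G\<close> symmetric and trilinear.  The equation for the gradient says
  \<open>|G z z z| = |z|\<^sup>3\<close>, and its polarizations at a focal point \<open>p\<close> express the normal space, the tangent space
  and the shape operators through \<open>G p\<close>; the Laplacian supplies the dimensions.  In the octonionic coordinates
  at a point of Condition A this determines \<open>F\<close> up to a single trilinear map \<open>m\<close> with \<open>q\<^sup>* = - 2 m\<close>.
  What remains of the equations says that \<open>m X Y Z\<close> is orthogonal to \<open>Z\<close>, to \<open>X \<cdot> Z\<close> and to \<open>Y \<star> Z\<close>, where
  \<open>\<star>\<close> is the twisted product, and that \<open>q\<^sup>*\<close> has the norm of the commutator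
  \<open>X \<cdot> (Y \<star> Z) - Y \<star> (X \<cdot> Z)\<close>.  By a deformation argument for Clifford systems, orthogonality gives
  \<open>m X Y Z = (A X) \<cdot> Z - a \<cdot> (X \<cdot> Z)\<close> for each \<open>Y\<close>, with \<open>A\<close> skew and \<open>a = A e\<^sub>0\<close>, and similarly for \<open>\<star>\<close>.
  Comparing the two shapes through infinitesimal triality leaves only multiples of the commutator when
  \<open>\<alpha>\<close> is not real; the norm fixes the multiple up to the sign that the choice of bases absorbs.  Finally
  \<open>z \<mapsto> ((W + Z)/\<surd>2, X\<^sup>-, Y, (W - Z)/\<surd>2)\<close>, with \<open>X\<^sup>-\<close> the conjugate of \<open>X\<close>, takes \<open>F\<close> into the explicit polynomial.\<close>

section \<open>Unital composition products on the octonions\<close>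

text \<open>Facts about multiplications are proved for an arbitrary unital composition product
  because two products occur with equal rights: the octonion product describes the shape operators
  at \<open>x\<close>, the twisted one those at \<open>n 0\<close>, which is again a focal point.
  Orthogonality of m X Y Z to X \<cdot> Z is a linearized Clifford relation, which is why a
  deformation argument applies. The hard orthogonality is the one to Z: it comes from F on V_+ +
  V_-, computed from the data at \<open>x\<close> and then required to be compatible with every
  other normal direction at \<open>n 0\<close>. For fixed imaginary Y the freedom in m is a skew map
  V, and triality turns Z -> m X Y Z into twice the bracket of V with the bivector X wedge e0. The
  shape seen from the twisted product makes these brackets off-diagonal for a plane, or
  anticommuting with a complex structure, according to the side of the twist. In the first case e0
  has to lie outside the plane, that is, \<alpha> outside the span of e0 and Y. For real \<alpha> no
  Y qualifies; otherwise only the multiples of the imaginary part of \<alpha> are missing, and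
  linearity in Y supplies them.\<close>

lemma oct_split:
  fixes x :: octonion
  obtains a1 a2 b1 b2 c1 c2 d1 d2 where "x = ((Complex a1 a2, Complex b1 b2), (Complex c1 c2, Complex d1 d2))"
  by (metis complex.exhaust surj_pair)

lemma oe_0: "oe 0 = ((1, 0), 0)" by (simp add: oe_def)

lemmas oct_simps = oe_0 zero_prod_def complex_eq_iff inner_complex_def

lemma omul_one [simp]: "oe 0 \<cdot> x = x" "x \<cdot> oe 0 = x"
  by (cases x rule: oct_split; simp add: oct_simps)+

lemma bounded_bilinear_omul: "bounded_bilinear (\<cdot>)"
proof -
  have "bilinear (\<cdot>)"
    unfolding bilinear_def linear_iff
    by (auto simp: complex_eq_iff scaleR_prod_def algebra_simps)
  then show ?thesis by (simp add: bilinear_conv_bounded_bilinear)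
qed

lemma omul_adjoint_left: "inner (x \<cdot> y) z = inner y (ocnj x \<cdot> z)"
  by (cases x rule: oct_split; cases y rule: oct_split; cases z rule: oct_split)
     (simp add: inner_complex_def algebra_simps)

lemma ocnj_eq: "ocnj x = (2 * inner x (oe 0)) *\<^sub>R oe 0 - x"
  by (cases x rule: oct_split) (simp add: oct_simps)

text \<open>The left alternative law x(xz) = (xx)z in polarized form. It replaces associativity
  whenever left multiplications have to be moved past each other.\<close>

lemma alt_left: "(x \<cdot> y) \<cdot> z + (y \<cdot> x) \<cdot> z = x \<cdot> (y \<cdot> z) + y \<cdot> (x \<cdot> z)"
  by (cases x; cases y; cases z; cases "fst x"; cases "snd x"; cases "fst y"; cases "snd y"; cases "fst z"; cases "snd z")
     (simp add: algebra_simps)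

lemma alt_right: "(x \<cdot> y) \<cdot> z + (x \<cdot> z) \<cdot> y = x \<cdot> (y \<cdot> z) + x \<cdot> (z \<cdot> y)"
  by (cases x; cases y; cases z; cases "fst x"; cases "snd x"; cases "fst y"; cases "snd y"; cases "fst z"; cases "snd z")
     (simp add: algebra_simps)

lemma ocnj_omul_self: "ocnj x \<cdot> (x \<cdot> y) = (norm x)\<^sup>2 *\<^sub>R y"
  unfolding power2_norm_eq_inner
  by (cases x rule: oct_split; cases y rule: oct_split)
     (simp add: inner_complex_def complex_eq_iff algebra_simps)

lemma norm_omul: "norm (x \<cdot> y) = norm x * norm y"
proof -
  have "(norm (x \<cdot> y))\<^sup>2 = (norm x * norm y)\<^sup>2"
    by (simp add: power2_norm_eq_inner [of "x \<cdot> y"] omul_adjoint_left [of x y] ocnj_omul_self power_mult_distrib)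
       (simp add: power2_norm_eq_inner)
  then show ?thesis by (simp add: power2_eq_iff_nonneg)
qed

text \<open>Serves both the octonion product (prefix \<open>O\<close>) and the mirror product
  (prefix \<open>C\<close>). Only the composition law and the unit are assumed, so that nothing has
  to be known in advance about the twist.\<close>

locale unital_composition =
  fixes mul :: "octonion \<Rightarrow> octonion \<Rightarrow> octonion"  (infixl \<open>\<star>\<close> 70)
  assumes bilin: "bounded_bilinear (\<star>)"
    and norm_mul: "norm (x \<star> y) = norm x * norm y"
    and one_left [simp]: "oe 0 \<star> x = x"
    and one_right [simp]: "x \<star> oe 0 = x"
begin

sublocale bounded_bilinear mul by (rule bilin)

lemma inner_mul_left: "inner (x \<star> y) (x \<star> z) = (norm x)\<^sup>2 * inner y z"
proof -
  have "inner (x \<star> y) (x \<star> z) = ((norm (x \<star> (y + z)))\<^sup>2 - (norm (x \<star> y))\<^sup>2 - (norm (x \<star> z))\<^sup>2) / 2"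
    by (simp add: dot_norm add_right)
  also have "\<dots> = (norm x)\<^sup>2 * inner y z"
    by (simp add: dot_norm norm_mul power_mult_distrib algebra_simps)
  finally show ?thesis .
qed

lemma inner_mul_right: "inner (y \<star> x) (z \<star> x) = (norm x)\<^sup>2 * inner y z"
proof -
  have "inner (y \<star> x) (z \<star> x) = ((norm ((y + z) \<star> x))\<^sup>2 - (norm (y \<star> x))\<^sup>2 - (norm (z \<star> x))\<^sup>2) / 2"
    by (simp add: dot_norm add_left)
  also have "\<dots> = (norm x)\<^sup>2 * inner y z"
    by (simp add: dot_norm norm_mul power_mult_distrib algebra_simps)
  finally show ?thesis .
qed

text \<open>Polarization of \<open>inner_mul_left\<close> in the outer factor. Putting
  \<open>oe 0\<close> for one factor yields the adjoints of the multiplications, and these in turn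
  yield the Clifford relations.\<close>

lemma inner_mul_swap: "inner (x \<star> y) (z \<star> w) + inner (z \<star> y) (x \<star> w) = 2 * inner x z * inner y w"
proof -
  have "inner ((x + z) \<star> y) ((x + z) \<star> w) = (norm (x + z))\<^sup>2 * inner y w"
    by (rule inner_mul_left)
  then have "inner (x \<star> y) (z \<star> w) + inner (z \<star> y) (x \<star> w)
      = ((norm (x + z))\<^sup>2 - (norm x)\<^sup>2 - (norm z)\<^sup>2) * inner y w"
    by (simp add: add_left inner_add_left inner_add_right inner_mul_left algebra_simps)
  then show ?thesis by (simp add: dot_norm [of x z])
qed

lemma adjoint_left: "inner (x \<star> y) z = inner y (ocnj x \<star> z)"
  using inner_mul_swap [of x y "oe 0" z]
  by (simp add: ocnj_eq diff_left scaleR_left inner_diff_right algebra_simps)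

lemma adjoint_right: "inner (y \<star> x) z = inner y (z \<star> ocnj x)"
  using inner_mul_swap [of y x z "oe 0"]
  by (simp add: ocnj_eq diff_right scaleR_right inner_diff_right algebra_simps inner_commute)

lemma cnj_mul_self: "ocnj x \<star> (x \<star> y) = (norm x)\<^sup>2 *\<^sub>R y"
  by (rule vector_eq_rdot [THEN iffD1]) (simp add: adjoint_left [symmetric] inner_mul_left inner_commute)

lemma mul_cnj_self: "(y \<star> x) \<star> ocnj x = (norm x)\<^sup>2 *\<^sub>R y"
proof (rule vector_eq_ldot [THEN iffD1], rule allI)
  fix z show "inner z (y \<star> x \<star> ocnj x) = inner z ((norm x)\<^sup>2 *\<^sub>R y)"
    using adjoint_right [of z x "y \<star> x"] by (simp add: inner_mul_right)
qed

end

lemma omul_unital_composition: "unital_composition (\<cdot>)"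
  by (intro unital_composition.intro bounded_bilinear_omul norm_omul omul_one)

section \<open>Infinitesimal deformations of Clifford systems\<close>

lemma skew_polar:
  fixes V :: "'a::real_inner \<Rightarrow> 'a"
  assumes "linear V" and "\<And>z. inner (V z) z = 0"
  shows "inner (V z) w = - inner z (V w)"
  using assms(2) [of "z + w"] assms(2) [of z] assms(2) [of w]
  by (simp add: linear_add [OF assms(1)] inner_add_left inner_add_right inner_commute)

lemma eq_uminus_self:
  fixes x :: "'a::real_vector"
  assumes "x = - x" shows "x = 0"
proof -
  have "2 *\<^sub>R x = x + x" by (rule scaleR_2)
  also have "\<dots> = 0" by (metis assms add.right_inverse)
  finally show ?thesis by simp
qed

text \<open>The hypothesis on \<open>D\<close> is the first-order part of the Clifford relations for
  S_i + t D_i, and the conclusion says that such a deformation comes from rotating source and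
  target. The operators are corrected one after the other: the residue of the next one is split
  evenly between the two sides, and the Clifford relations keep the operators already treated
  intact.\<close>

lemma clifford_deformation:
  fixes S S' D :: "nat \<Rightarrow> 'a::euclidean_space \<Rightarrow> 'a"
  assumes lin: "\<And>i. linear (S i)" "\<And>i. linear (S' i)" "\<And>i. linear (D i)"
    and adj: "\<And>i z w. inner (S i z) w = inner z (S' i w)"
    and cl: "\<And>i j z. i < k \<Longrightarrow> j < k \<Longrightarrow> S' i (S j z) + S' j (S i z) = (if i = j then 2 else 0) *\<^sub>R z"
    and cl': "\<And>i j z. i < k \<Longrightarrow> j < k \<Longrightarrow> S i (S' j z) + S j (S' i z) = (if i = j then 2 else 0) *\<^sub>R z"
    and dfm: "\<And>i j z. i < k \<Longrightarrow> j < k \<Longrightarrow> inner (S i z) (D j z) + inner (S j z) (D i z) = 0"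
  shows "\<exists>V V'. linear V \<and> linear V' \<and> (\<forall>z. inner (V z) z = 0) \<and> (\<forall>z. inner (V' z) z = 0) \<and>
    (\<forall>i<k. \<forall>z. D i z = S i (V z) + V' (S i z))"
proof -
  have main: "n \<le> k \<Longrightarrow> \<exists>V V'. linear V \<and> linear V' \<and>
      (\<forall>z. inner (V z) z = 0) \<and> (\<forall>z. inner (V' z) z = 0) \<and>
      (\<forall>i<n. \<forall>z. D i z = S i (V z) + V' (S i z))" for n
  proof (induction n)
    case 0
    show ?case by (intro exI [of _ "\<lambda>z. 0"]) (simp add: linear_zero)
  next
    case (Suc n)
    then obtain V V' where V: "linear V" "\<And>z. inner (V z) z = 0"
      and V': "linear V'" "\<And>z. inner (V' z) z = 0"
      and eq: "\<And>i z. i < n \<Longrightarrow> D i z = S i (V z) + V' (S i z)"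
      by auto
    have n: "n < k" using Suc by simp
    note la = linear_add [OF lin(1)] linear_add [OF lin(2)] linear_add [OF V(1)] linear_add [OF V'(1)]
    have SS: "S' i (S i z) = z" "S i (S' i z) = z" if "i < k" for i z
      using cl [OF that that, of z] cl' [OF that that, of z] by (simp_all flip: scaleR_2)
    \<comment> \<open>What the rotations found so far leave of \<open>D n\<close>. It inherits the
      deformation relation, in which the residues of smaller index are already zero; hence
      \<open>E z\<close> is orthogonal to all \<open>S i z\<close> with
      \<open>i \<le> n\<close>.\<close>
    define E where "E z = D n z - S n (V z) - V' (S n z)" for z
    have linE: "linear E"
      unfolding E_def using lin V(1) V'(1)
      by (intro linear_compose_sub linear_compose [unfolded o_def, of V "S n"]
          linear_compose [unfolded o_def, of "S n" V']) auto
    define F where "F = adjoint E"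
    have linF: "linear F" and F: "\<And>z w. inner (E z) w = inner z (F w)"
      unfolding F_def using linE by (auto simp: adjoint_linear adjoint_works)
    have E0: "inner (E z) (S i z) = 0" if "i \<le> n" for i z
    proof (cases "i = n")
      case True
      have "inner (S n z) (S n (V z)) = 0" by (simp add: adj SS n V inner_commute [of z])
      then show ?thesis
        using dfm [OF n n, of z] V' (2) [of "S n z"] True
        by (simp add: E_def inner_diff_right inner_commute)
    next
      case False
      then have i: "i < n" "i < k" using that n by auto
      have "inner (S n z) (S i (V z)) + inner (S i z) (S n (V z)) = 0"
        using cl [OF n i(2), of "V z"] False
        by (simp add: adj flip: inner_add_right)
      then show ?thesis
        using dfm [OF i(2) n, of z] skew_polar [OF V', of "S n z" "S i z"]
        by (simp add: E_def eq [OF i(1)] inner_diff_right inner_add_right inner_commute)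
    qed
    have E1: "inner (E z) (S i w) = - inner (E w) (S i z)" if "i \<le> n" for i z w
      using E0 [OF that, of "z + w"] E0 [OF that, of z] E0 [OF that, of w]
      by (simp add: la linear_add [OF linE] inner_add_left inner_add_right)
    have SE: "S' i (E z) = - F (S i z)" if "i \<le> n" for i z
    proof (rule vector_eq_ldot [THEN iffD1], rule allI)
      fix w show "inner w (S' i (E z)) = inner w (- F (S i z))"
        using E1 [OF that, of z w] by (simp add: F flip: adj) (simp add: inner_commute flip: F)
    qed
    have ES: "E (S' i w) = - S i (F w)" if "i \<le> n" for i w
    proof (rule vector_eq_rdot [THEN iffD1], rule allI)
      fix v
      have i: "i < k" using that n by simp
      have "inner (E (S' i w)) v = inner (E (S' i w)) (S i (S' i v))" by (simp add: SS i)
      also have "\<dots> = - inner (E (S' i v)) w" using E1 [OF that, of "S' i w" "S' i v"] by (simp add: SS i)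
      also have "\<dots> = - inner (S i (F w)) v" by (simp add: F adj inner_commute [of "S' i v"])
      finally show "inner (E (S' i w)) v = inner (- S i (F w)) v" by simp
    qed
    \<comment> \<open>Since \<open>S n\<close> and \<open>S' n\<close> are inverse to each other,
      each of the two corrections contributes one half of \<open>E\<close>.\<close>
    define V1 where "V1 z = (1/2) *\<^sub>R S' n (E z)" for z
    define V1' where "V1' z = (1/2) *\<^sub>R E (S' n z)" for z
    have l1: "linear V1" "linear V1'"
      unfolding V1_def V1'_def using lin linE
      by (auto intro!: linear_compose_scale_right linear_compose [unfolded o_def, of _ E] linear_compose [unfolded
        o_def, of E])
    have k1: "inner (V1 z) z = 0" "inner (V1' z) z = 0" for z
      using E0 [of n z] E0 [of n "S' n z"] by (simp_all add: V1_def V1'_def inner_commute [of "S' n _"] SS n flip: adj)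
        (simp add: inner_commute)
    have kill: "S i (V1 z) + V1' (S i z) = 0" if i: "i < n" for i z
    proof -
      have ik: "i < k" "i \<noteq> n" using i n by auto
      have a: "S i (S' n (E z)) = - S n (S' i (E z))"
        using cl' [OF ik(1) n, of "E z"] ik by (simp add: eq_neg_iff_add_eq_0)
      have b: "E (S' n (S i z)) = - E (S' i (S n z))"
        using cl [OF ik(1) n, of z] ik
        by (simp add: eq_neg_iff_add_eq_0 flip: linear_add [OF linE])
           (simp add: add.commute linear_0 [OF linE])
      \<comment> \<open>The anticommutation relations on one side and the adjoint relations
        \<open>SE\<close>, \<open>ES\<close> on both exhibit the sum as its own negative.\<close>
      have "S i (S' n (E z)) + E (S' n (S i z)) = - (S i (S' n (E z)) + E (S' n (S i z)))"
        using i by (subst (1) a, subst (1) b)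
          (simp add: SE ES linear_neg [OF lin(1)] linear_neg [OF lin(2)])
      then have "S i (S' n (E z)) + E (S' n (S i z)) = 0" by (rule eq_uminus_self)
      then show ?thesis
        by (simp add: V1_def V1'_def linear_scale [OF lin(1)] flip: scaleR_add_right)
    qed
    have new: "S n (V1 z) + V1' (S n z) = E z" for z
      by (simp add: V1_def V1'_def linear_scale [OF lin(1)] SS n flip: scaleR_add_left)
    show ?case
    proof (intro exI conjI allI impI)
      show "linear (\<lambda>z. V z + V1 z)" "linear (\<lambda>z. V' z + V1' z)"
        using V(1) V'(1) l1 by (auto intro: linear_compose_add)
      show "inner (V z + V1 z) z = 0" "inner (V' z + V1' z) z = 0" for z
        by (simp_all add: inner_add_left V V' k1)
      fix i z assume "i < Suc n"
      then consider "i < n" | "i = n" by linarith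
      then show "D i z = S i (V z + V1 z) + (V' (S i z) + V1' (S i z))"
      proof cases
        case 1 then show ?thesis using kill [OF 1, of z] eq [OF 1, of z] by (simp add: la)
      next
        case 2 then show ?thesis using new [of z] by (simp add: la E_def algebra_simps)
      qed
    qed
  qed
  show ?thesis by (rule main) simp
qed

section \<open>The standard basis and expansions in it\<close>

lemma oe_values:
  "oe 0 = ((1, 0), 0)" "oe 1 = ((\<i>, 0), 0)" "oe 2 = ((0, 1), 0)" "oe 3 = ((0, \<i>), 0)"
  "oe 4 = (0, (1, 0))" "oe 5 = (0, (\<i>, 0))" "oe 6 = (0, (0, 1))" "oe 7 = (0, (0, \<i>))"
  by (simp_all add: oe_def)

lemma sum_0_7: "(\<Sum>a=0..7. f a) = f 0 + f 1 + f 2 + f 3 + f 4 + f 5 + f 6 + f (7::nat)"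
  for f :: "nat \<Rightarrow> 'a::comm_monoid_add"
  by (simp add: eval_nat_numeral add.assoc)

lemma le_7_cases: "i \<le> 7 \<Longrightarrow> i \<in> {0, 1, 2, 3, 4, 5, 6, 7::nat}"
  by auto

lemma inner_oe:
  assumes "i \<le> 7" "j \<le> 7"
  shows "inner (oe i) (oe j) = (if i = j then 1 else 0)"
proof -
  have "\<forall>i\<in>{0, 1, 2, 3, 4, 5, 6, 7::nat}. \<forall>j\<in>{0, 1, 2, 3, 4, 5, 6, 7::nat}.
      inner (oe i) (oe j) = (if i = j then 1 else 0)"
    by (simp add: oe_values [simplified] zero_prod_def inner_complex_def)
  with assms show ?thesis using le_7_cases by blast
qed

lemma norm_oe: "i \<le> 7 \<Longrightarrow> norm (oe i) = 1"
  by (simp add: norm_eq_sqrt_inner inner_oe)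

lemma oe_expansion: "(\<Sum>a=0..7. inner x (oe a) *\<^sub>R oe a) = x"
  by (cases x rule: oct_split)
     (simp add: sum_0_7 oe_values [simplified] zero_prod_def inner_complex_def complex_eq_iff)

lemma oe_parseval: "(\<Sum>a=0..7. inner x (oe a) * inner y (oe a)) = inner x y"
proof -
  have "inner y x = inner y (\<Sum>a=0..7. inner x (oe a) *\<^sub>R oe a)" by (simp only: oe_expansion)
  also have "\<dots> = (\<Sum>a=0..7. inner x (oe a) * inner y (oe a))" by (simp only: inner_sum_right inner_scaleR_right)
  finally show ?thesis by (simp only: inner_commute [of x y])
qed

lemma oe_expansion_im: "inner x (oe 0) = 0 \<Longrightarrow> (\<Sum>a=1..7. inner x (oe a) *\<^sub>R oe a) = x"
  using oe_expansion [of x] by (simp add: sum.atLeast_Suc_atMost)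

lemma linear_eq_oe:
  assumes "linear f" "linear g" "\<And>a. a \<in> {0..7} \<Longrightarrow> f (oe a) = g (oe a)"
  shows "f x = g x"
proof -
  have "f (\<Sum>a=0..7. inner x (oe a) *\<^sub>R oe a) = g (\<Sum>a=0..7. inner x (oe a) *\<^sub>R oe a)"
    using assms(3) by (simp add: linear_sum [OF assms(1)] linear_sum [OF assms(2)]
      linear_scale [OF assms(1)] linear_scale [OF assms(2)])
  then show ?thesis by (simp only: oe_expansion)
qed

lemma linear_eq_oe_im:
  assumes "linear f" "linear g" "\<And>a. a \<in> {1..7} \<Longrightarrow> f (oe a) = g (oe a)" "inner x (oe 0) = 0"
  shows "f x = g x"
proof -
  have "f (\<Sum>a=1..7. inner x (oe a) *\<^sub>R oe a) = g (\<Sum>a=1..7. inner x (oe a) *\<^sub>R oe a)"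
    using assms(3) by (simp add: linear_sum [OF assms(1)] linear_sum [OF assms(2)]
      linear_scale [OF assms(1)] linear_scale [OF assms(2)])
  then show ?thesis by (simp only: oe_expansion_im [OF assms(4)])
qed

lemma inner_ocnj: "inner (ocnj x) (ocnj y) = inner x y"
  by (cases x rule: oct_split; cases y rule: oct_split) (simp add: inner_complex_def)

lemma norm_ocnj [simp]: "norm (ocnj x) = norm x"
  by (simp add: norm_eq_sqrt_inner inner_ocnj)

lemma ocnj_ocnj [simp]: "ocnj (ocnj x) = x"
  by (cases x rule: oct_split) simp

lemma linear_ocnj: "linear ocnj"
  by (rule linearI) (simp_all add: ocnj_eq inner_add_left algebra_simps)

section \<open>Deformations of left and right multiplications\<close>

context unital_composition
begin

lemma linear_mul_left: "linear (\<lambda>z. z \<star> x)"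
  using bounded_linear_left bounded_linear.linear by blast

lemma linear_mul_right: "linear (\<lambda>z. x \<star> z)"
  using bounded_linear_right bounded_linear.linear by blast

lemma cnj_mul_swap: "ocnj x \<star> (y \<star> z) + ocnj y \<star> (x \<star> z) = (2 * inner x y) *\<^sub>R z"
proof (rule vector_eq_ldot [THEN iffD1], rule allI)
  fix w show "inner w (ocnj x \<star> (y \<star> z) + ocnj y \<star> (x \<star> z)) = inner w ((2 * inner x y) *\<^sub>R z)"
    using inner_mul_swap [of x w y z] by (simp add: inner_add_right flip: adjoint_left)
qed

lemma mul_cnj_swap: "x \<star> (ocnj y \<star> z) + y \<star> (ocnj x \<star> z) = (2 * inner x y) *\<^sub>R z"
  using cnj_mul_swap [of "ocnj x" "ocnj y" z] by (simp add: inner_ocnj)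

lemma mul_right_swap: "(z \<star> x) \<star> ocnj y + (z \<star> y) \<star> ocnj x = (2 * inner x y) *\<^sub>R z"
proof (rule vector_eq_ldot [THEN iffD1], rule allI)
  fix w show "inner w ((z \<star> x) \<star> ocnj y + (z \<star> y) \<star> ocnj x) = inner w ((2 * inner x y) *\<^sub>R z)"
    using inner_mul_swap [of w y z x]
      by (simp add: inner_add_right inner_commute [of "z \<star> y"] inner_commute [of y] mult.commute mult.left_commute
        flip: adjoint_right)
qed

lemma mul_right_swap': "(z \<star> ocnj x) \<star> y + (z \<star> ocnj y) \<star> x = (2 * inner x y) *\<^sub>R z"
  using mul_right_swap [of z "ocnj x" "ocnj y"] by (simp add: inner_ocnj)

text \<open>The left multiplications by \<open>oe 1\<close>, ..., \<open>oe 7\<close> form the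
  Clifford system, indexed here from 0 to 6; polarizing the orthogonality in X gives the deformation
  relation.\<close>

lemma left_deformation:
  assumes N: "bounded_bilinear N"
    and orth: "\<And>X Z. inner X (oe 0) = 0 \<Longrightarrow> inner (X \<star> Z) (N X Z) = 0"
  obtains V V' where "linear V" "linear V'" "\<And>z. inner (V z) z = 0" "\<And>z. inner (V' z) z = 0"
    "\<And>X Z. inner X (oe 0) = 0 \<Longrightarrow> N X Z = X \<star> V Z + V' (X \<star> Z)"
proof -
  interpret N: bounded_bilinear N by (rule N)
  have im: "inner (oe (Suc i)) (oe 0) = 0" if "i < 7" for i using that by (simp add: inner_oe)
  have "\<exists>V V'. linear V \<and> linear V' \<and> (\<forall>z. inner (V z) z = 0) \<and> (\<forall>z. inner (V' z) z = 0) \<and>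
    (\<forall>i<7. \<forall>z. N (oe (Suc i)) z = oe (Suc i) \<star> V z + V' (oe (Suc i) \<star> z))"
  proof (rule clifford_deformation [where S = "\<lambda>i z. oe (Suc i) \<star> z" and S' = "\<lambda>i z. ocnj (oe (Suc i)) \<star> z"])
    fix i j :: nat and z assume ij: "i < 7" "j < 7"
    show "inner (oe (Suc i) \<star> z) (N (oe (Suc j)) z) + inner (oe (Suc j) \<star> z) (N (oe (Suc i)) z) = 0"
      using orth [of "oe (Suc i) + oe (Suc j)" z] orth [of "oe (Suc i)" z] orth [of "oe (Suc j)" z] im ij
      by (simp add: add_left N.add_left inner_add_left inner_add_right)
  qed (auto simp: linear_mul_right adjoint_left cnj_mul_swap mul_cnj_swap inner_oe
        intro: bounded_linear.linear [OF N.bounded_linear_right])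
  then obtain V V' where V: "linear V" "linear V'" "\<And>z. inner (V z) z = 0" "\<And>z. inner (V' z) z = 0"
    and eq: "\<And>i z. i < 7 \<Longrightarrow> N (oe (Suc i)) z = oe (Suc i) \<star> V z + V' (oe (Suc i) \<star> z)"
    by blast
  have "N X Z = X \<star> V Z + V' (X \<star> Z)" if "inner X (oe 0) = 0" for X Z
  proof (rule linear_eq_oe_im [OF _ _ _ that])
    show "linear (\<lambda>X. N X Z)" by (rule bounded_linear.linear [OF N.bounded_linear_left])
    show "linear (\<lambda>X. X \<star> V Z + V' (X \<star> Z))"
      by (rule linearI) (simp_all add: add_left scaleR_left linear_add [OF V(2)] linear_scale [OF V(2)] algebra_simps)
    show "N (oe a) Z = oe a \<star> V Z + V' (oe a \<star> Z)" if "a \<in> {1..7}" for a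
      using eq [of "a - 1" Z] that by auto
  qed
  with V that show thesis by blast
qed

text \<open>The second argument now labels the operators: right multiplications by all eight basis
  elements form the system. Because N vanishes at the unit, the rotation of the target has to be
  minus left multiplication by A e0, so a single skew map remains.\<close>

lemma right_deformation:
  assumes N: "bounded_bilinear N"
    and one: "\<And>Z. N (oe 0) Z = 0"
    and orth: "\<And>X Z. inner (X \<star> Z) (N X Z) = 0"
  obtains A where "linear A" "\<And>z. inner (A z) z = 0"
    "\<And>X Z. N X Z = A X \<star> Z - A (oe 0) \<star> (X \<star> Z)"
proof -
  interpret N: bounded_bilinear N by (rule N)
  have "\<exists>V V'. linear V \<and> linear V' \<and> (\<forall>z. inner (V z) z = 0) \<and> (\<forall>z. inner (V' z) z = 0) \<and>
    (\<forall>i<8. \<forall>z. N z (oe i) = V z \<star> oe i + V' (z \<star> oe i))"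
  proof (rule clifford_deformation [where S = "\<lambda>i z. z \<star> oe i" and S' = "\<lambda>i z. z \<star> ocnj (oe i)"])
    fix i j :: nat and z
    show "inner (z \<star> oe i) (N z (oe j)) + inner (z \<star> oe j) (N z (oe i)) = 0"
      using orth [of z "oe i + oe j"] orth [of z "oe i"] orth [of z "oe j"]
      by (simp add: add_right N.add_right inner_add_left inner_add_right)
  next
    fix i j :: nat and z assume "i < 8" "j < 8"
    then show "z \<star> oe j \<star> ocnj (oe i) + z \<star> oe i \<star> ocnj (oe j) = (if i = j then 2 else 0) *\<^sub>R z"
      "z \<star> ocnj (oe j) \<star> oe i + z \<star> ocnj (oe i) \<star> oe j = (if i = j then 2 else 0) *\<^sub>R z"
      by (auto simp: mul_right_swap mul_right_swap' inner_oe)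
  qed (auto simp: linear_mul_left adjoint_right intro: bounded_linear.linear [OF N.bounded_linear_left])
  then obtain A V' where V: "linear A" "linear V'" "\<And>z. inner (A z) z = 0" "\<And>z. inner (V' z) z = 0"
    and eq: "\<And>i z. i < 8 \<Longrightarrow> N z (oe i) = A z \<star> oe i + V' (z \<star> oe i)"
    by blast
  have *: "N X Z = A X \<star> Z + V' (X \<star> Z)" for X Z
  proof (rule linear_eq_oe [of "\<lambda>Z. N X Z"])
    show "linear (\<lambda>Z. N X Z)" by (rule bounded_linear.linear [OF N.bounded_linear_right])
    show "linear (\<lambda>Z. A X \<star> Z + V' (X \<star> Z))"
      by (rule linearI) (simp_all add: add_right scaleR_right linear_add [OF V(2)] linear_scale [OF V(2)] algebra_simps)
  qed (use eq in auto)
  have "V' Z = - (A (oe 0) \<star> Z)" for Z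
    using * [of "oe 0" Z] by (simp add: one eq_neg_iff_add_eq_0 add.commute)
  with * V that show thesis by simp
qed

end

interpretation O: unital_composition "(\<cdot>)" by (rule omul_unital_composition)

text \<open>The trace condition makes the two infinitesimal rotations of the deformation cancel.\<close>

lemma skew_of_trace_condition:
  assumes N: "bounded_bilinear N"
    and orth: "\<And>X Z. inner X (oe 0) = 0 \<Longrightarrow> inner (X \<cdot> Z) (N X Z) = 0"
    and trace: "\<And>Z W. (\<Sum>b=1..7. inner (oe b \<cdot> Z) W * inner (N (oe b) Z) W) = 0"
    and X: "inner X (oe 0) = 0"
  shows "inner (N X Z) Z = 0"
proof -
  obtain V V' where V: "linear V" "linear V'" "\<And>z. inner (V z) z = 0" "\<And>z. inner (V' z) z = 0"
    and eq: "\<And>X Z. inner X (oe 0) = 0 \<Longrightarrow> N X Z = X \<cdot> V Z + V' (X \<cdot> Z)"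
    using O.left_deformation [OF N orth] by blast
  \<comment> \<open>The number <e_b Z, W> is the e_b-coordinate of W times the conjugate of Z, so
    the sum is a Parseval sum. The trace condition omits b = 0, whose term is split off in
    \<open>part\<close>.\<close>
  have full: "(\<Sum>b=0..7. inner (oe b \<cdot> Z) W * inner (oe b \<cdot> Z') W') = inner (W \<cdot> ocnj Z) (W' \<cdot> ocnj Z')" for Z W Z' W'
  proof -
    have "inner (oe b \<cdot> Z) W = inner (W \<cdot> ocnj Z) (oe b)" for b Z W
      by (metis O.adjoint_right inner_commute)
    then show ?thesis by (simp only: oe_parseval)
  qed
  have part: "(\<Sum>b=1..7. inner (oe b \<cdot> Z) W * inner (oe b \<cdot> Z') W') =
      inner (W \<cdot> ocnj Z) (W' \<cdot> ocnj Z') - inner Z W * inner Z' W'" for Z W Z' W'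
    using full [of Z W Z' W'] by (simp add: sum.atLeast_Suc_atMost)
  have 1: "inner Z W * (inner (V Z) W + inner (V' Z) W) = 0" for Z W
  proof -
    have "inner (N (oe b) Z) W = inner (oe b \<cdot> V Z) W - inner (oe b \<cdot> Z) (V' W)" if "b \<in> {1..7}" for b
      using that skew_polar [OF V(2,4), of "oe b \<cdot> Z" W]
      by (subst eq) (auto simp: inner_oe inner_add_left)
    then have "0 = (\<Sum>b=1..7. inner (oe b \<cdot> Z) W * inner (oe b \<cdot> V Z) W) -
       (\<Sum>b=1..7. inner (oe b \<cdot> Z) W * inner (oe b \<cdot> Z) (V' W))"
      using trace [of Z W] by (simp add: right_diff_distrib sum_subtractf)
    also have "\<dots> = - inner Z W * inner (V Z) W + inner Z W * inner Z (V' W)"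
      unfolding part using V(3) [of Z] V(4) [of W]
      by (simp add: O.inner_mul_left O.inner_mul_right inner_ocnj inner_commute)
    finally show ?thesis using skew_polar [OF V(2,4), of Z W] by (simp add: algebra_simps)
  qed
  have 2: "inner (V Z + V' Z) W = 0" for Z W
  proof (cases "inner Z W = 0")
    case True
    \<comment> \<open>For orthogonal Z and W the relation \<open>1\<close> is empty. Replacing W by
      W + Z makes the first factor positive for nonzero Z and, by skewness, does not alter the
      second.\<close>
    have "inner Z Z * (inner (V Z) W + inner (V' Z) W) = 0"
      using 1 [of Z "W + Z"] True V(3,4) [of Z] by (simp add: inner_add_right)
    then show ?thesis
      using linear_0 [OF V(1)] linear_0 [OF V(2)] by (cases "Z = 0") (simp_all add: inner_add_left)
  next
    case False
    then show ?thesis using 1 [of Z W] by (simp add: inner_add_left)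
  qed
  have V': "V' Z = - V Z" for Z
    using 2 [of Z "V Z + V' Z"] by (simp add: eq_neg_iff_add_eq_0 add.commute)
  have cX: "ocnj X = - X" using X by (simp add: ocnj_eq)
  \<comment> \<open>With V' = - V the operator N X is the bracket of left multiplication by X with
    V; a bracket of skew maps is skew.\<close>
  have "inner (N X Z) Z = inner (X \<cdot> V Z) Z - inner (V (X \<cdot> Z)) Z"
    using eq [OF X, of Z] by (simp add: V' inner_diff_left)
  also have "\<dots> = 0"
    using skew_polar [OF V(1,3), of "X \<cdot> Z" Z] O.adjoint_left [of X "V Z" Z]
    by (simp add: cX O.minus_left inner_commute [of "V Z"])
  finally show ?thesis .
qed

section \<open>Moufang identities and infinitesimal triality\<close>

text \<open>Three pairs of basis elements suffice: the vanishing of their associators with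
  \<open>b\<close> already removes all seven imaginary coordinates.\<close>

lemma nucleus_middle:
  assumes "\<And>u z. (u \<cdot> b) \<cdot> z = u \<cdot> (b \<cdot> z)"
  shows "b = inner b (oe 0) *\<^sub>R oe 0"
  using assms [of "oe 1" "oe 2"] assms [of "oe 1" "oe 4"] assms [of "oe 2" "oe 4"]
  by (cases b rule: oct_split) (simp add: oe_values [simplified] zero_prod_def inner_complex_def complex_eq_iff)

lemma nucleus_right:
  assumes "\<And>u z. (u \<cdot> z) \<cdot> b = u \<cdot> (z \<cdot> b)"
  shows "b = inner b (oe 0) *\<^sub>R oe 0"
  using assms [of "oe 1" "oe 2"] assms [of "oe 1" "oe 4"] assms [of "oe 2" "oe 4"]
  by (cases b rule: oct_split) (simp add: oe_values [simplified] zero_prod_def inner_complex_def complex_eq_iff)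

lemma moufang_left: "x \<cdot> (u \<cdot> (x \<cdot> z)) = ((x \<cdot> u) \<cdot> x) \<cdot> z"
  by (cases x; cases u; cases z; cases "fst x"; cases "snd x"; cases "fst u"; cases "snd u"; cases "fst z"; cases "snd z")
     (simp add: algebra_simps)

lemma moufang_right: "((z \<cdot> x) \<cdot> u) \<cdot> x = z \<cdot> (x \<cdot> (u \<cdot> x))"
  by (cases x; cases u; cases z; cases "fst x"; cases "snd x"; cases "fst u"; cases "snd u"; cases "fst z"; cases "snd z")
     (simp add: algebra_simps)

lemma flexible: "(x \<cdot> u) \<cdot> x = x \<cdot> (u \<cdot> x)"
  by (cases x; cases u; cases "fst x"; cases "snd x"; cases "fst u"; cases "snd u")
     (simp add: algebra_simps)

text \<open>Polarization of the quadratic equation satisfied by an octonion, x x = 2 <x, e0> x -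
  |x|^2 e0.\<close>

lemma omul_anticomm: "x \<cdot> u + u \<cdot> x = (2 * inner u (oe 0)) *\<^sub>R x + (2 * inner x (oe 0)) *\<^sub>R u - (2 * inner x u) *\<^sub>R oe 0"
  by (cases x rule: oct_split; cases u rule: oct_split)
     (simp add: oe_0 zero_prod_def complex_eq_iff inner_complex_def algebra_simps)

lemma omul_swap_left:
  "x \<cdot> (u \<cdot> z) = (2 * inner u (oe 0)) *\<^sub>R (x \<cdot> z) + (2 * inner x (oe 0)) *\<^sub>R (u \<cdot> z) - (2 * inner x u) *\<^sub>R z - u \<cdot> (x \<cdot> z)"
proof -
  have "x \<cdot> (u \<cdot> z) + u \<cdot> (x \<cdot> z) = (x \<cdot> u + u \<cdot> x) \<cdot> z"
    by (simp add: alt_left O.add_left)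
  then show ?thesis
    unfolding omul_anticomm
    by (simp add: O.add_left O.diff_left O.scaleR_left algebra_simps)
qed

lemma omul_swap_right:
  "(u \<cdot> z) \<cdot> x = (2 * inner z (oe 0)) *\<^sub>R (u \<cdot> x) + (2 * inner x (oe 0)) *\<^sub>R (u \<cdot> z) - (2 * inner x z) *\<^sub>R u - (u \<cdot> x) \<cdot> z"
proof -
  have "(u \<cdot> z) \<cdot> x + (u \<cdot> x) \<cdot> z = u \<cdot> (x \<cdot> z + z \<cdot> x)"
    by (simp add: alt_right O.add_right)
  then show ?thesis
    unfolding omul_anticomm
    by (simp add: O.add_right O.diff_right O.scaleR_right algebra_simps)
qed

lemma unit_cancel:
  assumes "norm \<alpha> = 1"
  shows "ocnj \<alpha> \<cdot> (\<alpha> \<cdot> z) = z" "\<alpha> \<cdot> (ocnj \<alpha> \<cdot> z) = z" "(z \<cdot> \<alpha>) \<cdot> ocnj \<alpha> = z" "(z \<cdot> ocnj \<alpha>) \<cdot> \<alpha> = z"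
  using assms O.cnj_mul_self [of \<alpha> z] O.cnj_mul_self [of "ocnj \<alpha>" z] O.mul_cnj_self [of z \<alpha>] O.mul_cnj_self [of z "ocnj \<alpha>"]
  by simp_all

text \<open>A finite form of triality: left multiplication by a unit \<alpha> distributes over a
  product, with companions u -> \<alpha> u \<alpha> and left multiplication by the conjugate. It
  carries infinitesimal triality over to the twisted products.\<close>

lemma moufang_unit_left:
  assumes "norm \<alpha> = 1"
  shows "\<alpha> \<cdot> (u \<cdot> z) = ((\<alpha> \<cdot> u) \<cdot> \<alpha>) \<cdot> (ocnj \<alpha> \<cdot> z)"
  using moufang_left [of \<alpha> u "ocnj \<alpha> \<cdot> z"] by (simp add: unit_cancel [OF assms])

lemma moufang_unit_right:
  assumes "norm \<alpha> = 1"
  shows "(z \<cdot> u) \<cdot> \<alpha> = (z \<cdot> ocnj \<alpha>) \<cdot> (\<alpha> \<cdot> (u \<cdot> \<alpha>))"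
  using moufang_right [of "z \<cdot> ocnj \<alpha>" \<alpha> u] by (simp add: unit_cancel [OF assms])

text \<open>Infinitesimal triality: the first of the three related rotations is determined by the third.\<close>

lemma triality_unique:
  assumes eq: "\<And>u z. b1 u \<cdot> z + u \<cdot> c1 z = b2 u \<cdot> z + u \<cdot> c2 z"
    and skew: "\<And>u. inner (b1 u) u = 0" "\<And>u. inner (b2 u) u = 0"
  shows "b1 u = b2 u"
proof -
  define \<beta> where "\<beta> u = b1 u - b2 u" for u
  define \<gamma> where "\<gamma> z = c2 z - c1 z" for z
  have *: "\<beta> u \<cdot> z = u \<cdot> \<gamma> z" for u z
    using eq [of u z] by (simp add: \<beta>_def \<gamma>_def O.diff_left O.diff_right algebra_simps)
  have \<gamma>: "\<gamma> z = \<beta> (oe 0) \<cdot> z" for z using * [of "oe 0" z] by simp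
  have \<beta>: "\<beta> u = u \<cdot> \<beta> (oe 0)" for u using * [of u "oe 0"] \<gamma> [of "oe 0"] by simp
  \<comment> \<open>The difference of the two companions satisfies \<beta> u \<cdot> z = u \<cdot>
    \<gamma> z, which places \<beta> e0 in the middle nucleus, that is, in the real line; skewness
    then removes the real part.\<close>
  have "\<beta> (oe 0) = inner (\<beta> (oe 0)) (oe 0) *\<^sub>R oe 0"
    by (rule nucleus_middle) (use * \<beta> \<gamma> in metis)
  moreover have "inner (\<beta> (oe 0)) (oe 0) = 0"
    using skew by (simp add: \<beta>_def inner_diff_left)
  ultimately have "\<beta> (oe 0) = 0" by simp
  with \<beta> [of u] show ?thesis by (simp add: \<beta>_def O.zero_right)
qed

text \<open>Writing (X wedge a) u = <X, u> a - <a, u> X, this is the bivector X wedge a + m wedge e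
  acting as a skew map. For skew V, a = V e and m = V X it is the bracket of V with X wedge e, which
  is how it occurs in the two rotation lemmas.\<close>

definition wedge4 :: "octonion \<Rightarrow> octonion \<Rightarrow> octonion \<Rightarrow> octonion \<Rightarrow> octonion \<Rightarrow> octonion" where
  "wedge4 X a m e u = inner X u *\<^sub>R a - inner a u *\<^sub>R X + inner m u *\<^sub>R e - inner e u *\<^sub>R m"

lemma wedge4_skew: "inner (wedge4 X a m e u) u = 0"
  by (simp add: wedge4_def inner_add_left inner_diff_left)

text \<open>The left multiplications by \<open>a\<close>, \<open>X\<close> and \<open>m\<close> are
  moved past \<open>u\<close> by the polarized alternative law; the scalar terms produced on the way
  assemble to the bivector acting on \<open>u\<close>.\<close>

lemma triality_left:
  assumes "inner X (oe 0) = 0" "inner a (oe 0) = 0"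
  shows "X \<cdot> (a \<cdot> (u \<cdot> z)) - m \<cdot> (u \<cdot> z) = (2 *\<^sub>R wedge4 X a m (oe 0) u) \<cdot> z
    + u \<cdot> (X \<cdot> (a \<cdot> z) + m \<cdot> z - (2 * inner m (oe 0)) *\<^sub>R z)"
proof -
  have 1: "X \<cdot> (a \<cdot> (u \<cdot> z)) = (2 * inner X u) *\<^sub>R (a \<cdot> z) - (2 * inner a u) *\<^sub>R (X \<cdot> z) + u \<cdot> (X \<cdot> (a \<cdot> z))"
    by (subst omul_swap_left [of a])
       (simp add: assms O.add_right O.diff_right O.scaleR_right omul_swap_left [of X u])
  show ?thesis
    unfolding 1 omul_swap_left [of m u z]
    by (simp add: wedge4_def O.add_right O.diff_right O.scaleR_right O.add_left O.diff_left O.scaleR_left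
        inner_commute algebra_simps)
qed

text \<open>Here \<open>circ a\<close> is left multiplication by \<open>a\<close> conjugated by
  right multiplication by \<alpha>. The right Moufang identity takes \<open>triality_left\<close>
  through the conjugation, and all four vectors of the bivector are thereby multiplied from the
  right by the conjugate of \<alpha>.\<close>

lemma triality_twist_left:
  assumes \<alpha>: "norm \<alpha> = 1" and "inner Y (oe 0) = 0" "inner a (oe 0) = 0"
    and circ: "\<And>a b. circ a b = (a \<cdot> (b \<cdot> ocnj \<alpha>)) \<cdot> \<alpha>"
  shows "\<exists>c. \<forall>u z. circ w (u \<cdot> z) - circ a (circ Y (u \<cdot> z)) =
    (- 2 *\<^sub>R wedge4 (a \<cdot> ocnj \<alpha>) (Y \<cdot> ocnj \<alpha>) (w \<cdot> ocnj \<alpha>) (ocnj \<alpha>) u) \<cdot> z + u \<cdot> c z"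
proof -
  define C1 where "C1 z = a \<cdot> (Y \<cdot> z) - w \<cdot> z" for z
  define c1 where "c1 z = a \<cdot> (Y \<cdot> z) + w \<cdot> z - (2 * inner w (oe 0)) *\<^sub>R z" for z
  have C1: "C1 (u \<cdot> z) = (2 *\<^sub>R wedge4 a Y w (oe 0) u) \<cdot> z + u \<cdot> c1 z" for u z
    unfolding C1_def c1_def by (rule triality_left) (use assms in auto)
  have C: "circ w z - circ a (circ Y z) = - (C1 (z \<cdot> ocnj \<alpha>) \<cdot> \<alpha>)" for z
    by (simp add: circ C1_def unit_cancel [OF \<alpha>] O.diff_left)
  have \<alpha>': "norm (ocnj \<alpha>) = 1" using \<alpha> by simp
  have "C1 ((u \<cdot> z) \<cdot> ocnj \<alpha>) \<cdot> \<alpha> =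
      ((2 *\<^sub>R wedge4 a Y w (oe 0) (u \<cdot> \<alpha>)) \<cdot> ocnj \<alpha>) \<cdot> z + u \<cdot> (\<alpha> \<cdot> (c1 (ocnj \<alpha> \<cdot> (z \<cdot> ocnj \<alpha>)) \<cdot> \<alpha>))" for u z
  proof -
    have "C1 ((u \<cdot> z) \<cdot> ocnj \<alpha>) = (2 *\<^sub>R wedge4 a Y w (oe 0) (u \<cdot> \<alpha>)) \<cdot> (ocnj \<alpha> \<cdot> (z \<cdot> ocnj \<alpha>))
        + (u \<cdot> \<alpha>) \<cdot> c1 (ocnj \<alpha> \<cdot> (z \<cdot> ocnj \<alpha>))"
      using C1 [of "u \<cdot> \<alpha>" "ocnj \<alpha> \<cdot> (z \<cdot> ocnj \<alpha>)"] moufang_unit_right [OF \<alpha>', of u z] by simp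
    moreover have "\<alpha> \<cdot> ((ocnj \<alpha> \<cdot> (z \<cdot> ocnj \<alpha>)) \<cdot> \<alpha>) = z"
      by (simp only: flexible [symmetric, of "ocnj \<alpha>" z] unit_cancel [OF \<alpha>])
    ultimately show ?thesis
      using moufang_unit_right [OF \<alpha>, of "2 *\<^sub>R wedge4 a Y w (oe 0) (u \<cdot> \<alpha>)" "ocnj \<alpha> \<cdot> (z \<cdot> ocnj \<alpha>)"]
        moufang_unit_right [OF \<alpha>, of "u \<cdot> \<alpha>" "c1 (ocnj \<alpha> \<cdot> (z \<cdot> ocnj \<alpha>))"]
      by (simp add: O.add_left unit_cancel [OF \<alpha>])
  qed
  moreover have "(2 *\<^sub>R wedge4 a Y w (oe 0) (u \<cdot> \<alpha>)) \<cdot> ocnj \<alpha> =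
    2 *\<^sub>R wedge4 (a \<cdot> ocnj \<alpha>) (Y \<cdot> ocnj \<alpha>) (w \<cdot> ocnj \<alpha>) (ocnj \<alpha>) u" for u
    by (simp add: wedge4_def O.add_left O.diff_left O.scaleR_left inner_commute [of _ "u \<cdot> \<alpha>"]
        O.adjoint_right [of u \<alpha>] inner_commute [of u])
  ultimately show ?thesis
    by (intro exI [of _ "\<lambda>z. - (\<alpha> \<cdot> (c1 (ocnj \<alpha> \<cdot> (z \<cdot> ocnj \<alpha>)) \<cdot> \<alpha>))"])
       (simp add: C O.minus_left O.minus_right O.scaleR_left)
qed

text \<open>Here \<open>circ a\<close> is right multiplication by \<open>a\<close> conjugated by
  left multiplication by \<alpha>, so the companion consists of right multiplications. Its useful
  property is that it anticommutes with J, which is right multiplication by Y conjugated by u ->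
  \<alpha> u \<alpha>.\<close>

lemma triality_twist_right:
  assumes \<alpha>: "norm \<alpha> = 1" and Y: "inner Y (oe 0) = 0" and a: "inner a (oe 0) = 0"
    and w: "inner w (oe 0) = - inner Y a" "inner w Y = 0"
    and circ: "\<And>a b. circ a b = \<alpha> \<cdot> ((ocnj \<alpha> \<cdot> b) \<cdot> a)"
    and J: "\<And>u. J u = (\<alpha> \<cdot> (((ocnj \<alpha> \<cdot> u) \<cdot> ocnj \<alpha>) \<cdot> Y)) \<cdot> \<alpha>"
  shows "\<exists>b c. (\<forall>u z. circ w (u \<cdot> z) - circ a (circ Y (u \<cdot> z)) = b u \<cdot> z + u \<cdot> c z) \<and>
    (\<forall>u. inner (b u) u = 0) \<and> (\<forall>u. b (J u) = - J (b u))"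
proof -
  define C1 where "C1 z = z \<cdot> w - (z \<cdot> Y) \<cdot> a" for z
  define b1 where "b1 u = - (u \<cdot> w) - (u \<cdot> Y) \<cdot> a + (2 * inner w (oe 0)) *\<^sub>R u" for u
  define c1 where "c1 z = (2 * inner z (oe 0)) *\<^sub>R w - (2 * inner w z) *\<^sub>R oe 0
      + (2 * inner Y z) *\<^sub>R a - (2 * inner a z) *\<^sub>R Y" for z
  have C1: "C1 (u \<cdot> z) = b1 u \<cdot> z + u \<cdot> c1 z" for u z
  proof -
    have "((u \<cdot> z) \<cdot> Y) \<cdot> a = (2 * inner a z) *\<^sub>R (u \<cdot> Y) - (2 * inner Y z) *\<^sub>R (u \<cdot> a) + ((u \<cdot> Y) \<cdot> a) \<cdot> z"
      by (subst omul_swap_right [of u z Y])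
         (simp add: Y a O.add_left O.diff_left O.scaleR_left omul_swap_right [of "u \<cdot> Y" z a])
    then show ?thesis
      unfolding C1_def b1_def c1_def
      by (simp add: omul_swap_right [of u z w] O.add_left O.diff_left O.scaleR_left O.minus_left O.add_right O.diff_right
          O.scaleR_right algebra_simps)
  qed
  \<comment> \<open>The prescribed real part of \<open>w\<close> is what makes the three scalar
    contributions cancel.\<close>
  have b1_skew: "inner (b1 u) u = 0" for u
  proof -
    have "inner (u \<cdot> w) u = inner w (oe 0) * (norm u)\<^sup>2"
      using O.inner_mul_left [of u w "oe 0"] by simp
    moreover have "inner ((u \<cdot> Y) \<cdot> a) u = inner w (oe 0) * (norm u)\<^sup>2"
      using O.inner_mul_left [of u Y "ocnj a"] a
      by (simp add: O.adjoint_right [of _ a] w ocnj_eq inner_commute [of "u \<cdot> Y"])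
    ultimately show ?thesis
      by (simp add: b1_def inner_add_left inner_diff_left power2_norm_eq_inner)
  qed
  have b1_anti: "b1 (u \<cdot> Y) = - (b1 u \<cdot> Y)" for u
  proof -
    have "(u \<cdot> Y) \<cdot> w + (u \<cdot> w) \<cdot> Y = (2 * inner w (oe 0)) *\<^sub>R (u \<cdot> Y)"
      using w Y by (simp add: omul_swap_right [of u Y w] inner_commute)
    moreover have "((u \<cdot> Y) \<cdot> Y) \<cdot> a + ((u \<cdot> Y) \<cdot> a) \<cdot> Y = (2 * inner w (oe 0)) *\<^sub>R (u \<cdot> Y)"
      using Y a by (simp add: omul_swap_right [of "u \<cdot> Y" Y a] w inner_commute)
    ultimately show ?thesis
      by (simp add: b1_def O.add_left O.diff_left O.scaleR_left O.minus_left algebra_simps)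
  qed
  define g where "g u = (\<alpha> \<cdot> u) \<cdot> \<alpha>" for u
  define h where "h u = (ocnj \<alpha> \<cdot> u) \<cdot> ocnj \<alpha>" for u
  have gh: "g (h u) = u" "h (g u) = u" for u
    by (simp_all only: g_def h_def flexible [of \<alpha> u] flexible [of "ocnj \<alpha>" u] unit_cancel [OF \<alpha>])
  have adj: "inner (g u) v = inner u (h v)" for u v
    by (simp add: g_def h_def O.adjoint_right [of _ \<alpha>] O.adjoint_left [of \<alpha>] flexible [of "ocnj \<alpha>" v])
  have C: "circ w z - circ a (circ Y z) = \<alpha> \<cdot> C1 (ocnj \<alpha> \<cdot> z)" for z
    by (simp add: circ C1_def unit_cancel [OF \<alpha>] O.diff_right)
  have \<alpha>': "norm (ocnj \<alpha>) = 1" using \<alpha> by simp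
  have *: "\<alpha> \<cdot> C1 (ocnj \<alpha> \<cdot> (u \<cdot> z)) = g (b1 (h u)) \<cdot> z + u \<cdot> (ocnj \<alpha> \<cdot> c1 (\<alpha> \<cdot> z))" for u z
  proof -
    have "C1 (ocnj \<alpha> \<cdot> (u \<cdot> z)) = b1 (h u) \<cdot> (\<alpha> \<cdot> z) + h u \<cdot> c1 (\<alpha> \<cdot> z)"
      using moufang_unit_left [OF \<alpha>', of u z] C1 by (simp add: h_def)
    then show ?thesis
      using gh(1) [of u] moufang_unit_left [OF \<alpha>, of "b1 (h u)" "\<alpha> \<cdot> z"]
        moufang_unit_left [OF \<alpha>, of "h u" "c1 (\<alpha> \<cdot> z)"]
      by (simp add: O.add_right unit_cancel [OF \<alpha>] g_def)
  qed
  have Jg: "J u = g (h u \<cdot> Y)" for u by (simp add: J g_def h_def)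
  have g_minus: "g (- u) = - g u" for u by (simp add: g_def O.minus_left O.minus_right)
  show ?thesis
  proof (intro exI conjI allI)
    show "circ w (u \<cdot> z) - circ a (circ Y (u \<cdot> z)) = g (b1 (h u)) \<cdot> z + u \<cdot> (ocnj \<alpha> \<cdot> c1 (\<alpha> \<cdot> z))" for u z
      by (simp only: C *)
    show "inner (g (b1 (h u))) u = 0" for u by (simp add: adj b1_skew)
    show "g (b1 (h (J u))) = - J (g (b1 (h u)))" for u by (simp add: Jg gh b1_anti g_minus)
  qed
qed

section \<open>Skew maps determined by their brackets with bivectors\<close>

lemma exists_orthogonal:
  fixes B :: "'a::euclidean_space set"
  assumes "finite B" "card B < DIM('a)"
  obtains x :: 'a where "x \<noteq> 0" "\<And>y. y \<in> B \<Longrightarrow> inner x y = 0"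
proof -
  have "dim B < DIM('a)" using dim_le_card' [OF assms(1)] assms(2) by linarith
  then obtain x :: 'a where "x \<noteq> 0" "\<And>y. y \<in> span B \<Longrightarrow> orthogonal x y"
    by (rule orthogonal_to_subspace_exists) blast
  then show thesis using that by (auto simp: orthogonal_def span_base)
qed

text \<open>The bivector in \<open>plane\<close> and \<open>perp\<close> is the bracket of V with X
  wedge e0, and the two hypotheses say that it is off-diagonal for the splitting into the plane of
  f, p and its complement. The rotation of this plane has that property for all bivectors; since e0
  lies outside the plane, the bivectors X wedge e0 are enough to exclude every other V.\<close>

lemma rotation_of_plane_condition:
  fixes f p :: octonion
  assumes V: "linear V" "\<And>z. inner (V z) z = 0"
    and fp: "inner f f = 1" "inner p p = 1" "inner f p = 0"
    and out: "oe 0 \<noteq> inner (oe 0) f *\<^sub>R f + inner (oe 0) p *\<^sub>R p"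
    and plane: "\<And>X. inner X (oe 0) = 0 \<Longrightarrow> inner (wedge4 X (V (oe 0)) (V X) (oe 0) f) p = 0"
    and perp: "\<And>X u v. inner X (oe 0) = 0 \<Longrightarrow> inner f u = 0 \<Longrightarrow> inner p u = 0 \<Longrightarrow> inner f v = 0 \<Longrightarrow>
      inner p v = 0 \<Longrightarrow> inner (wedge4 X (V (oe 0)) (V X) (oe 0) u) v = 0"
  shows "V u = inner (V f) p *\<^sub>R (inner f u *\<^sub>R p - inner p u *\<^sub>R f)"
proof -
  define a where "a = V (oe 0)"
  \<comment> \<open>The part of e0 orthogonal to the plane, nonzero by \<open>out\<close>. Once V is
    known to vanish on the complement of f, p and e0, it acts on the three-dimensional space spanned
    by f, p and h.\<close>
  define h where "h = oe 0 - inner (oe 0) f *\<^sub>R f - inner (oe 0) p *\<^sub>R p"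
  have e: "oe 0 = h + inner (oe 0) f *\<^sub>R f + inner (oe 0) p *\<^sub>R p" by (simp add: h_def)
  have hf: "inner h f = 0" "inner h p = 0"
    using fp by (simp_all add: h_def inner_diff_left inner_commute [of p f])
  then have hf': "inner f h = 0" "inner p h = 0" by (simp_all add: inner_commute)
  have "h \<noteq> 0" using out by (auto simp: h_def algebra_simps)
  then have \<eta>: "inner h h > 0" by simp
  have eh: "inner (oe 0) h = inner h h"
  proof -
    have "inner (oe 0) h = inner (h + inner (oe 0) f *\<^sub>R f + inner (oe 0) p *\<^sub>R p) h" by (simp only: e [symmetric])
    then show ?thesis using hf by (simp add: inner_add_left inner_commute [of f h] inner_commute [of p h])
  qed
  note sk = skew_polar [OF V]
  have az: "inner a z = 0" if z: "inner f z = 0" "inner p z = 0" "inner (oe 0) z = 0" for z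
  proof -
    \<comment> \<open>Eight dimensions leave room for a vector orthogonal to four given
      ones.\<close>
    obtain X where X: "X \<noteq> 0" "inner X (oe 0) = 0" "inner X z = 0" "inner X f = 0" "inner X p = 0"
    proof (rule exists_orthogonal [of "{oe 0, z, f, p}"])
      have "card {oe 0, z, f, p} \<le> 4" by (simp add: card_insert_if)
      then show "card {oe 0, z, f, p} < DIM(octonion)" by simp
    qed auto
    have "inner (wedge4 X a (V X) (oe 0) z) X = 0"
      unfolding a_def by (rule perp) (use X z in \<open>simp_all add: inner_commute\<close>)
    then show ?thesis using X z
      by (simp add: wedge4_def inner_diff_left inner_add_left inner_commute [of "oe 0" X])
  qed
  have Vz: "V z = 0" if z: "inner f z = 0" "inner p z = 0" "inner (oe 0) z = 0" for z
  proof -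
    have *: "inner (V X) z = 0" if X: "inner X (oe 0) = 0" "inner X z = 0" for X
    proof -
      have "inner (wedge4 X a (V X) (oe 0) z) h = 0"
        unfolding a_def by (rule perp) (use X z hf in \<open>simp_all add: inner_commute\<close>)
      then show ?thesis using X z az [OF z] \<eta> by (simp add: wedge4_def eh)
    qed
    \<comment> \<open>The choice X = V z is admissible by \<open>az\<close> and turns the left side
      into - |V z|^2.\<close>
    have "inner (V (V z)) z = 0"
      by (rule *) (use sk [of z "oe 0"] az [OF z] in \<open>simp_all add: a_def V inner_commute [of z "V (oe 0)"]\<close>)
    then show ?thesis using sk [of "V z" z] by simp
  qed
  define c where "c = inner (V f) p"
  define \<beta> where "\<beta> = inner (V f) h"
  define \<gamma> where "\<gamma> = inner (V p) h"
  note lV = linear_add [OF V(1)] linear_diff [OF V(1)] linear_scale [OF V(1)]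
  have pf: "inner p f = 0" using fp by (simp add: inner_commute)
  have Vv: "inner (V p) f = - c" "inner (V h) f = - \<beta>" "inner (V h) p = - \<gamma>"
    using sk [of p f] sk [of h f] sk [of h p] by (simp_all add: c_def \<beta>_def \<gamma>_def inner_commute)
  have zero: "\<beta> = 0 \<and> \<gamma> = 0"
  proof -
    define ef ep \<eta> where "ef = inner (oe 0) f" and "ep = inner (oe 0) p" and "\<eta> = inner h h"
    define \<kappa> where "\<kappa> = \<gamma> * ef - \<beta> * ep"
    \<comment> \<open>The coefficient \<kappa> makes X imaginary; for this X the plane condition
      becomes the sum of squares below, so that \<beta> and \<gamma> vanish.\<close>
    define X where "X = \<eta> *\<^sub>R (\<gamma> *\<^sub>R f - \<beta> *\<^sub>R p) - \<kappa> *\<^sub>R h"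
    have "inner X (oe 0) = 0"
      by (simp add: X_def inner_diff_left ef_def ep_def \<kappa>_def eh \<eta>_def inner_commute [of f "oe 0"] inner_commute
        [of p "oe 0"]
          inner_commute [of h "oe 0"] algebra_simps)
    then have "inner (wedge4 X a (V X) (oe 0) f) p = 0" unfolding a_def by (rule plane)
    moreover have "inner X f = \<eta> * \<gamma>" "inner X p = - \<eta> * \<beta>"
      by (simp_all add: X_def inner_diff_left fp hf pf)
    moreover have "a = V h + ef *\<^sub>R V f + ep *\<^sub>R V p"
      unfolding a_def ef_def ep_def by (subst e) (simp add: lV)
    then have "inner a p = - \<gamma> + ef * c" "inner a f = - \<beta> - ep * c"
      using V(2) by (simp_all add: inner_add_left Vv c_def)
    moreover have "inner (V X) f = \<eta> * \<beta> * c + \<kappa> * \<beta>" "inner (V X) p = \<eta> * \<gamma> * c + \<kappa> * \<gamma>"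
      using V(2) by (simp_all add: X_def lV inner_diff_left Vv c_def [symmetric] algebra_simps)
    ultimately have "\<eta> * \<gamma> * (- \<gamma> + ef * c) - (- \<beta> - ep * c) * (- \<eta> * \<beta>)
        + (\<eta> * \<beta> * c + \<kappa> * \<beta>) * ep - ef * (\<eta> * \<gamma> * c + \<kappa> * \<gamma>) = 0"
      by (simp add: wedge4_def inner_diff_left inner_add_left ef_def ep_def)
    then have "\<eta> * (\<gamma>\<^sup>2 + \<beta>\<^sup>2) + \<kappa>\<^sup>2 = 0"
      by (simp add: \<kappa>_def power2_eq_square algebra_simps)
    moreover have "\<eta> * (\<gamma>\<^sup>2 + \<beta>\<^sup>2) \<ge> 0" using \<eta> by (simp add: \<eta>_def)
    ultimately have "\<eta> * (\<gamma>\<^sup>2 + \<beta>\<^sup>2) = 0" by (smt (verit) zero_le_power2)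
    then show ?thesis using \<eta> by (simp add: \<eta>_def sum_power2_eq_zero_iff)
  qed
  have Vker: "V z = 0" if "inner f z = 0" "inner p z = 0" "inner h z = 0" for z
    by (rule Vz) (use that in \<open>simp_all add: e [THEN arg_cong, of "\<lambda>x. inner x z"] inner_add_left\<close>)
  have perp0: "inner (V y) z = 0" if "V z = 0" for y z
    using sk [of y z] that by simp
  have "inner (V f - c *\<^sub>R p) (V f - c *\<^sub>R p) = 0"
  proof -
    have "V (V f - c *\<^sub>R p) = 0"
      by (rule Vker) (use zero V(2) [of f] in \<open>simp_all add: inner_diff_right fp pf hf hf' c_def \<beta>_def inner_commute\<close>)
    from perp0 [OF this, of f] show ?thesis
      using fp by (simp add: inner_diff_left inner_diff_right c_def inner_commute)
  qed
  then have Vf: "V f = c *\<^sub>R p" by simp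
  have "inner (V p + c *\<^sub>R f) (V p + c *\<^sub>R f) = 0"
  proof -
    have "V (V p + c *\<^sub>R f) = 0"
      by (rule Vker) (use zero V(2) [of p] Vv in \<open>simp_all add: inner_add_right fp pf hf hf' \<gamma>_def inner_commute\<close>)
    from perp0 [OF this, of p] show ?thesis
      using fp Vv by (simp add: inner_add_left inner_add_right inner_commute)
  qed
  then have Vp: "V p = - (c *\<^sub>R f)" by (simp add: eq_neg_iff_add_eq_0)
  have "V (V h) = 0"
    by (rule Vker) (use zero V(2) [of h] Vv in \<open>simp_all add: inner_commute\<close>)
  from perp0 [OF this, of h] have Vh: "V h = 0" by simp
  define t where "t = inner h u / inner h h"
  define z where "z = u - inner f u *\<^sub>R f - inner p u *\<^sub>R p - t *\<^sub>R h"
  have "V z = 0"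
    by (rule Vker) (use \<eta> in \<open>simp_all add: z_def t_def inner_diff_right fp pf hf inner_commute [of f h]
      inner_commute [of p h]\<close>)
  then have "V u = inner f u *\<^sub>R V f + inner p u *\<^sub>R V p + t *\<^sub>R V h"
    by (simp add: z_def lV algebra_simps)
  then show ?thesis by (simp add: Vf Vp Vh fp algebra_simps)
qed

text \<open>Again the hypothesis concerns the bracket of V with X wedge e0, which now has to
  anticommute with J. Brackets with J itself always do so because J J = - 1; the lemma is the
  converse.\<close>

lemma rotation_of_complex_structure_condition:
  fixes V J :: "octonion \<Rightarrow> octonion"
  assumes V: "linear V" "\<And>z. inner (V z) z = 0"
    and J: "linear J" "\<And>z. inner (J z) z = 0" "\<And>z. J (J z) = - z"
    and anti: "\<And>X u. inner X (oe 0) = 0 \<Longrightarrow>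
      wedge4 X (V (oe 0)) (V X) (oe 0) (J u) = - J (wedge4 X (V (oe 0)) (V X) (oe 0) u)"
  shows "V u = inner (V (oe 0)) (J (oe 0)) *\<^sub>R J u"
proof -
  define a where "a = V (oe 0)"
  define j where "j = J (oe 0)"
  define \<kappa> where "\<kappa> = inner a j"
  note lV = linear_add [OF V(1)] linear_diff [OF V(1)] linear_scale [OF V(1)]
  note lJ = linear_add [OF J(1)] linear_diff [OF J(1)] linear_scale [OF J(1)] linear_neg [OF J(1)]
  note skV = skew_polar [OF V] and skJ = skew_polar [OF J(1,2)]
  have e: "inner (oe 0) (oe 0) = 1" by (simp add: inner_oe)
  have JJ: "inner (J x) (J y) = inner x y" for x y using skJ [of x "J y"] by (simp add: J)
  have j: "inner j j = 1" "inner j (oe 0) = 0" "inner (oe 0) j = 0"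
    using J(2) [of "oe 0"] by (simp_all add: j_def JJ e inner_commute)
  have a0: "inner a (oe 0) = 0" by (simp add: a_def V)
  have Je: "inner (J x) (oe 0) = - inner x j" "inner (oe 0) (J x) = - inner x j" for x
    using skJ [of x "oe 0"] by (simp_all add: j_def inner_commute)
  have Jj: "inner (J x) j = inner x (oe 0)" "inner j (J x) = inner x (oe 0)" for x
    using JJ [of x "oe 0"] by (simp_all add: j_def inner_commute)
  have aJ: "inner a (J X) = 0" if X: "inner X (oe 0) = 0" "inner X j = 0" for X
  proof (cases "X = 0")
    case False
    \<comment> \<open>Evaluating at u = X and pairing with X isolates the component of V e0 along J
      X, which turns out to equal its own negative.\<close>
    have "inner (wedge4 X a (V X) (oe 0) (J X)) X = - inner (J (wedge4 X a (V X) (oe 0) X)) X"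
      using anti [OF X(1), of X] by (simp add: a_def)
    then have "- inner a (J X) * inner X X = inner a (J X) * inner X X"
      using X J(2) [of X] V(2) [of X]
      by (auto simp: wedge4_def Je inner_add_left inner_diff_left lJ inner_commute [of "oe 0" X] inner_commute [of X "J X"]
          skJ [of a X])
    then show ?thesis using False by simp
  qed (simp add: linear_0 [OF J(1)])
  have aX: "inner a X = 0" if X: "inner X (oe 0) = 0" "inner X j = 0" for X
    using aJ [of "J X"] X by (simp add: Je Jj J)
  have aj: "a = \<kappa> *\<^sub>R j"
  proof -
    have "inner a (a - \<kappa> *\<^sub>R j) = 0"
      by (rule aX) (simp_all add: inner_diff_left a0 j \<kappa>_def)
    then have "inner (a - \<kappa> *\<^sub>R j) (a - \<kappa> *\<^sub>R j) = 0"
      by (simp add: inner_diff_left inner_diff_right j \<kappa>_def inner_commute [of j a])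
    then show ?thesis by simp
  qed
  have VX: "V X = \<kappa> *\<^sub>R J X" if X: "inner X (oe 0) = 0" "inner X j = 0" for X
  proof -
    have VX0: "inner (V X) (oe 0) = 0" using skV [of X "oe 0"] X by (simp add: aj flip: a_def)
    have "wedge4 X a (V X) (oe 0) j = - J (wedge4 X a (V X) (oe 0) (oe 0))"
      using anti [OF X(1), of "oe 0"] by (simp add: a_def j_def)
    then have "- \<kappa> *\<^sub>R X + inner (V X) j *\<^sub>R oe 0 = J (V X)"
      using X VX0 by (simp add: wedge4_def a0 j e \<kappa>_def linear_neg [OF J(1)])
    then have "J (- \<kappa> *\<^sub>R X + inner (V X) j *\<^sub>R oe 0) = - V X" by (simp add: J)
    then have eq: "V X = \<kappa> *\<^sub>R J X - inner (V X) j *\<^sub>R j"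
      by (simp add: lJ linear_neg [OF J(1)] j_def algebra_simps)
    have "inner (V X) j = inner (\<kappa> *\<^sub>R J X - inner (V X) j *\<^sub>R j) j" by (subst eq) simp
    then have "inner (V X) j = 0" using X by (simp add: inner_diff_left Jj j)
    with eq show ?thesis by simp
  qed
  have "V j + \<kappa> *\<^sub>R oe 0 = 0"
  proof -
    \<comment> \<open>This vector is orthogonal to e0 and j, so \<open>VX\<close> applies to it, and
      skewness then shows that it is orthogonal to itself.\<close>
    define d where "d = V j + \<kappa> *\<^sub>R oe 0"
    have d: "inner d (oe 0) = 0" "inner d j = 0"
      using skV [of j "oe 0"] V(2) [of j] by (simp_all add: d_def inner_add_left j e aj flip: a_def)
    have "inner (V j) d = 0" using skV [of j d] VX [OF d] d by (simp add: Jj)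
    then have "inner d d = 0" using d by (simp add: d_def inner_add_left inner_commute)
    then show ?thesis by (simp add: d_def)
  qed
  then have Vj: "V j = - (\<kappa> *\<^sub>R oe 0)" by (simp add: eq_neg_iff_add_eq_0)
  define X where "X = u - inner u (oe 0) *\<^sub>R oe 0 - inner u j *\<^sub>R j"
  have "V X = \<kappa> *\<^sub>R J X"
    by (rule VX) (simp_all add: X_def inner_diff_left e j)
  moreover have "J j = - oe 0" by (simp add: j_def J)
  ultimately have "V (X + s *\<^sub>R oe 0 + t *\<^sub>R j) = \<kappa> *\<^sub>R J (X + s *\<^sub>R oe 0 + t *\<^sub>R j)" for s t
    using Vj aj by (simp add: lV lJ scaleR_add_right scaleR_diff_right a_def j_def mult.commute)
  moreover have "u = X + inner u (oe 0) *\<^sub>R oe 0 + inner u j *\<^sub>R j" by (simp add: X_def)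
  ultimately have "V u = \<kappa> *\<^sub>R J u" by metis
  then show ?thesis by (simp add: \<kappa>_def a_def j_def)
qed

section \<open>Trilinear maps resembling a commutator\<close>

declare split_paired_All [simp del] split_paired_Ex [simp del] omul.simps [simp del]

definition twisted_product :: "octonion \<Rightarrow> (octonion \<Rightarrow> octonion \<Rightarrow> octonion) \<Rightarrow> bool" where
  "twisted_product \<alpha> circ \<longleftrightarrow> norm \<alpha> = 1 \<and>
     ((\<forall>a b. circ a b = (a \<cdot> (b \<cdot> ocnj \<alpha>)) \<cdot> \<alpha>) \<or> (\<forall>a b. circ a b = \<alpha> \<cdot> ((ocnj \<alpha> \<cdot> b) \<cdot> a)))"

lemma twisted_product_unital_composition:
  assumes "twisted_product \<alpha> circ"
  shows "unital_composition circ"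
proof -
  have \<alpha>: "norm \<alpha> = 1" using assms by (simp add: twisted_product_def)
  have "(\<forall>a b. circ a b = (a \<cdot> (b \<cdot> ocnj \<alpha>)) \<cdot> \<alpha>) \<or> (\<forall>a b. circ a b = \<alpha> \<cdot> ((ocnj \<alpha> \<cdot> b) \<cdot> a))"
    using assms by (simp add: twisted_product_def)
  then have "bilinear circ \<and> (\<forall>x y. norm (circ x y) = norm x * norm y) \<and> (\<forall>x. circ (oe 0) x = x) \<and> (\<forall>x. circ x (oe
    0) = x)" (is ?P)
  proof (elim disjE)
    assume c: "\<forall>a b. circ a b = (a \<cdot> (b \<cdot> ocnj \<alpha>)) \<cdot> \<alpha>"
    show ?P
      unfolding bilinear_def linear_iff c [rule_format]
      by (simp add: O.add_left O.add_right O.scaleR_left O.scaleR_right norm_omul \<alpha> unit_cancel [OF \<alpha>]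
          del: split_paired_All omul.simps)
  next
    assume c: "\<forall>a b. circ a b = \<alpha> \<cdot> ((ocnj \<alpha> \<cdot> b) \<cdot> a)"
    show ?P
      unfolding bilinear_def linear_iff c [rule_format]
      by (simp add: O.add_left O.add_right O.scaleR_left O.scaleR_right norm_omul \<alpha> unit_cancel [OF \<alpha>] mult.commute
          del: split_paired_All omul.simps)
  qed
  then show ?thesis
    by (intro unital_composition.intro) (simp_all add: bilinear_conv_bounded_bilinear)
qed

text \<open>The linear conditions that \<open>F\<close> being isoparametric imposes on the unknown trilinear part.\<close>

definition commutator_like ::
  "(octonion \<Rightarrow> octonion \<Rightarrow> octonion) \<Rightarrow> (octonion \<Rightarrow> octonion \<Rightarrow> octonion \<Rightarrow> octonion) \<Rightarrow> bool" where
  "commutator_like circ m \<longleftrightarrow>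
     (\<forall>Y. bounded_bilinear (\<lambda>X Z. m X Y Z)) \<and> (\<forall>X. bounded_bilinear (m X)) \<and>
     (\<forall>Y Z. m (oe 0) Y Z = 0) \<and> (\<forall>X Z. m X (oe 0) Z = 0) \<and>
     (\<forall>X Y Z. inner (m X Y Z) Z = 0 \<and> inner (X \<cdot> Z) (m X Y Z) = 0 \<and> inner (circ Y Z) (m X Y Z) = 0)"

text \<open>The result of \<open>right_deformation\<close> in the variable X, rewritten so that
  \<open>triality_left\<close> applies to it.\<close>

lemma commutator_like_left:
  assumes "commutator_like circ m"
  obtains V where "linear V" "\<And>z. inner (V z) z = 0"
    "\<And>X Z. inner X (oe 0) = 0 \<Longrightarrow> m X Y Z = X \<cdot> (V (oe 0) \<cdot> Z) - V X \<cdot> Z"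
proof -
  obtain A where A: "linear A" "\<And>z. inner (A z) z = 0"
    and eq: "\<And>X Z. m X Y Z = A X \<cdot> Z - A (oe 0) \<cdot> (X \<cdot> Z)"
    using O.right_deformation [of "\<lambda>X Z. m X Y Z"] assms unfolding commutator_like_def by metis
  define a where "a = A (oe 0)"
  \<comment> \<open>Moving \<open>a\<close> past an imaginary X turns - a \<cdot> (X \<cdot> Z) into
    X \<cdot> (a \<cdot> Z) plus a multiple of Z. The last term of V absorbs this multiple; the
    first one restores skewness and gives V e0 = a.\<close>
  define V where "V z = (2 * inner z (oe 0)) *\<^sub>R a - A z - (2 * inner a z) *\<^sub>R oe 0" for z
  have a0: "inner a (oe 0) = 0" by (simp add: a_def A)
  have Ve: "V (oe 0) = a" using a0 by (simp add: V_def inner_oe scaleR_2 flip: a_def)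
  show thesis
  proof
    show "linear V"
      by (rule linearI) (simp_all add: V_def linear_add [OF A(1)] linear_scale [OF A(1)] inner_add_left
        inner_add_right algebra_simps)
    show "inner (V z) z = 0" for z
      by (simp add: V_def inner_diff_left A inner_commute [of "oe 0" z])
    show "m X Y Z = X \<cdot> (V (oe 0) \<cdot> Z) - V X \<cdot> Z" if "inner X (oe 0) = 0" for X Z
      using that a0
      by (simp add: eq Ve omul_swap_left [of a X Z] flip: a_def)
         (simp add: V_def O.diff_left O.minus_left O.scaleR_left)
  qed
qed

lemma (in unital_composition) commutator_like_right:
  assumes "commutator_like mul m"
  obtains w a where "inner a (oe 0) = 0" "inner w (oe 0) = - inner Y a" "inner w Y = 0"
    "\<And>Z. m X Y Z = w \<star> Z - a \<star> (Y \<star> Z)"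
proof -
  obtain A where A: "linear A" "\<And>z. inner (A z) z = 0"
    and eq: "\<And>Y Z. m X Y Z = A Y \<star> Z - A (oe 0) \<star> (Y \<star> Z)"
    using right_deformation [of "m X"] assms unfolding commutator_like_def by metis
  show thesis
    by (rule that [of "A (oe 0)" "A Y"])
       (use A skew_polar [OF A, of Y "oe 0"] in \<open>simp_all add: eq inner_commute\<close>)
qed

text \<open>For fixed Y the map Z -> m X Y Z has two descriptions, one through left multiplications
  and one through \<open>circ\<close>, each with its own triality companion. The companions agree by
  \<open>triality_unique\<close>; this forces V onto a line that does not depend on m.\<close>

lemma commutator_like_line:
  assumes tw: "twisted_product \<alpha> circ"
    and Y: "norm Y = 1" "inner Y (oe 0) = 0" "\<And>s t. \<alpha> \<noteq> s *\<^sub>R oe 0 + t *\<^sub>R Y"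
  obtains V0 where "\<And>m. commutator_like circ m \<Longrightarrow>
    \<exists>\<kappa>. \<forall>X Z. inner X (oe 0) = 0 \<longrightarrow> m X Y Z = \<kappa> *\<^sub>R (X \<cdot> (V0 (oe 0) \<cdot> Z) - V0 X \<cdot> Z)"
proof -
  have \<alpha>: "norm \<alpha> = 1" using tw by (simp add: twisted_product_def)
  interpret C: unital_composition circ by (rule twisted_product_unital_composition [OF tw])
  note conclude = that
  have suffices: thesis
    if *: "\<And>V. linear V \<Longrightarrow> (\<And>z. inner (V z) z = 0) \<Longrightarrow> (\<exists>m. commutator_like circ m \<and>
        (\<forall>X Z. inner X (oe 0) = 0 \<longrightarrow> m X Y Z = X \<cdot> (V (oe 0) \<cdot> Z) - V X \<cdot> Z)) \<Longrightarrow>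
        \<exists>\<kappa>. \<forall>u. V u = \<kappa> *\<^sub>R V0 u" for V0
  proof (rule conclude)
    fix m assume m: "commutator_like circ m"
    obtain V where V: "linear V" "\<And>z. inner (V z) z = 0"
      and eq: "\<And>X Z. inner X (oe 0) = 0 \<Longrightarrow> m X Y Z = X \<cdot> (V (oe 0) \<cdot> Z) - V X \<cdot> Z"
      using commutator_like_left [OF m] by blast
    obtain \<kappa> where "\<And>u. V u = \<kappa> *\<^sub>R V0 u" using * [OF V] m eq by blast
    then show "\<exists>\<kappa>. \<forall>X Z. inner X (oe 0) = 0 \<longrightarrow> m X Y Z = \<kappa> *\<^sub>R (X \<cdot> (V0 (oe 0) \<cdot> Z) - V0 X \<cdot> Z)"
      by (intro exI [of _ \<kappa>]) (simp add: eq O.scaleR_left O.scaleR_right scaleR_diff_right)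
  qed
  from tw consider (left) "\<And>a b. circ a b = (a \<cdot> (b \<cdot> ocnj \<alpha>)) \<cdot> \<alpha>"
    | (right) "\<And>a b. circ a b = \<alpha> \<cdot> ((ocnj \<alpha> \<cdot> b) \<cdot> a)"
    by (auto simp: twisted_product_def)
  then show thesis
  proof cases
    case left
    \<comment> \<open>The images of e0 and Y under right multiplication by the conjugate of
      \<alpha>. Multiplying back by \<alpha> shows that e0 lies in their plane only if \<alpha> lies
      in the span of e0 and Y.\<close>
    define f p where "f = ocnj \<alpha>" and "p = Y \<cdot> ocnj \<alpha>"
    have twist: "inner (x \<cdot> ocnj \<alpha>) (y \<cdot> ocnj \<alpha>) = inner x y" for x y
      by (simp add: O.inner_mul_right \<alpha>)
    have twist0: "inner (x \<cdot> ocnj \<alpha>) f = inner x (oe 0)" for x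
      using twist [of x "oe 0"] by (simp add: f_def)
    have fp: "inner f f = 1" "inner p p = 1" "inner f p = 0"
      using Y \<alpha> twist0 [of Y] by (simp_all add: f_def p_def twist inner_commute flip: power2_norm_eq_inner)
         (simp_all add: norm_omul)
    have out: "oe 0 \<noteq> inner (oe 0) f *\<^sub>R f + inner (oe 0) p *\<^sub>R p"
    proof
      assume "oe 0 = inner (oe 0) f *\<^sub>R f + inner (oe 0) p *\<^sub>R p"
      then have "oe 0 \<cdot> \<alpha> = (inner (oe 0) f *\<^sub>R f + inner (oe 0) p *\<^sub>R p) \<cdot> \<alpha>" by metis
      also have "f \<cdot> \<alpha> = oe 0" using unit_cancel(4) [OF \<alpha>, of "oe 0"] by (simp add: f_def)
      ultimately show False
        using Y(3) [of "inner (oe 0) f" "inner (oe 0) p"]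
        by (simp add: O.add_left O.scaleR_left p_def unit_cancel [OF \<alpha>])
    qed
    show thesis
    proof (rule suffices [of "\<lambda>u. inner f u *\<^sub>R p - inner p u *\<^sub>R f"])
      fix V assume V: "linear V" "\<And>z. inner (V z) z = 0"
        and "\<exists>m. commutator_like circ m \<and>
          (\<forall>X Z. inner X (oe 0) = 0 \<longrightarrow> m X Y Z = X \<cdot> (V (oe 0) \<cdot> Z) - V X \<cdot> Z)"
      then obtain m where m: "commutator_like circ m"
        and eq: "\<And>X Z. inner X (oe 0) = 0 \<Longrightarrow> m X Y Z = X \<cdot> (V (oe 0) \<cdot> Z) - V X \<cdot> Z" by blast
      \<comment> \<open>The companion obtained from \<open>circ\<close> is a wedge p + w wedge f up
        to a factor: each summand contains a vector of the plane, and the orthogonalities of w and a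
        remove the component along f wedge p.\<close>
      have key: "\<exists>w a. inner w p = 0 \<and> inner a f = 0 \<and>
          (\<forall>u. wedge4 X (V (oe 0)) (V X) (oe 0) u = - wedge4 a p w f u)" if X: "inner X (oe 0) = 0" for X
      proof -
        obtain w a where wa: "inner a (oe 0) = 0" "inner w Y = 0"
          and eq': "\<And>Z. m X Y Z = circ w Z - circ a (circ Y Z)"
          using C.commutator_like_right [OF m] by metis
        obtain c where c: "\<And>u z. circ w (u \<cdot> z) - circ a (circ Y (u \<cdot> z)) =
            (- 2 *\<^sub>R wedge4 (a \<cdot> ocnj \<alpha>) p (w \<cdot> ocnj \<alpha>) f u) \<cdot> z + u \<cdot> c z"
          using triality_twist_left [OF \<alpha> Y(2) wa(1) left] unfolding f_def p_def by metis
        have "2 *\<^sub>R wedge4 X (V (oe 0)) (V X) (oe 0) u = - 2 *\<^sub>R wedge4 (a \<cdot> ocnj \<alpha>) p (w \<cdot> ocnj \<alpha>) f u" for u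
        proof (rule triality_unique [where ?b1.0 = "\<lambda>u. 2 *\<^sub>R wedge4 X (V (oe 0)) (V X) (oe 0) u" and
              ?b2.0 = "\<lambda>u. - 2 *\<^sub>R wedge4 (a \<cdot> ocnj \<alpha>) p (w \<cdot> ocnj \<alpha>) f u"])
          fix u z
          show "2 *\<^sub>R wedge4 X (V (oe 0)) (V X) (oe 0) u \<cdot> z +
              u \<cdot> (X \<cdot> (V (oe 0) \<cdot> z) + V X \<cdot> z - (2 * inner (V X) (oe 0)) *\<^sub>R z) =
              (- 2 *\<^sub>R wedge4 (a \<cdot> ocnj \<alpha>) p (w \<cdot> ocnj \<alpha>) f u) \<cdot> z + u \<cdot> c z"
            using triality_left [OF X V(2), of u z "V X"] eq [OF X, of "u \<cdot> z"] eq' [of "u \<cdot> z"] c [of u z] by simp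
        qed (simp_all add: wedge4_skew)
        then have "wedge4 X (V (oe 0)) (V X) (oe 0) u = - wedge4 (a \<cdot> ocnj \<alpha>) p (w \<cdot> ocnj \<alpha>) f u" for u
          by (metis scaleR_left.minus scaleR_cancel_left scaleR_minus_right zero_neq_numeral)
        then show ?thesis using wa by (intro exI) (auto simp: p_def twist twist0)
      qed
      have "V u = inner (V f) p *\<^sub>R (inner f u *\<^sub>R p - inner p u *\<^sub>R f)" for u
      proof (rule rotation_of_plane_condition [OF V fp out])
        fix X :: octonion assume X: "inner X (oe 0) = 0"
        then obtain w a where wa: "inner w p = 0" "inner a f = 0"
          "\<And>u. wedge4 X (V (oe 0)) (V X) (oe 0) u = - wedge4 a p w f u" using key by blast
        show "inner (wedge4 X (V (oe 0)) (V X) (oe 0) f) p = 0"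
          using fp by (simp add: wa) (simp add: wedge4_def wa inner_diff_left inner_add_left inner_commute [of p f])
        show "inner (wedge4 X (V (oe 0)) (V X) (oe 0) u) v = 0"
          if "inner f u = 0" "inner p u = 0" "inner f v = 0" "inner p v = 0" for u v
          using that by (simp add: wa) (simp add: wedge4_def inner_diff_left inner_add_left)
      qed
      then show "\<exists>\<kappa>. \<forall>u. V u = \<kappa> *\<^sub>R (inner f u *\<^sub>R p - inner p u *\<^sub>R f)" by blast
    qed
  next
    case right
    \<comment> \<open>The conjugate of right multiplication by Y under u -> \<alpha> u \<alpha>; it
      squares to - 1 because Y is an imaginary unit.\<close>
    define J where "J u = (\<alpha> \<cdot> (((ocnj \<alpha> \<cdot> u) \<cdot> ocnj \<alpha>) \<cdot> Y)) \<cdot> \<alpha>" for u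
    have J: "linear J" "\<And>z. inner (J z) z = 0" "\<And>z. J (J z) = - z"
    proof -
      show "linear J"
        by (rule linearI) (simp_all add: J_def O.add_left O.add_right O.scaleR_left O.scaleR_right)
      show "inner (J z) z = 0" for z
      proof -
        have "inner (J z) z = inner (((ocnj \<alpha> \<cdot> z) \<cdot> ocnj \<alpha>) \<cdot> Y) ((ocnj \<alpha> \<cdot> z) \<cdot> ocnj \<alpha>)"
          by (simp add: J_def O.adjoint_right [of _ \<alpha>] O.adjoint_left [of \<alpha>] flexible [of "ocnj \<alpha>" z])
        also have "\<dots> = 0"
          using O.inner_mul_left [of "(ocnj \<alpha> \<cdot> z) \<cdot> ocnj \<alpha>" Y "oe 0"] Y by simp
        finally show ?thesis .
      qed
      have YY: "(x \<cdot> Y) \<cdot> Y = - x" for x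
        using O.mul_cnj_self [of x Y] Y by (simp add: ocnj_eq O.minus_right minus_equation_iff)
      show "J (J z) = - z" for z
      proof -
        have "(ocnj \<alpha> \<cdot> J z) \<cdot> ocnj \<alpha> = ((ocnj \<alpha> \<cdot> z) \<cdot> ocnj \<alpha>) \<cdot> Y"
          by (simp only: J_def flexible [of \<alpha>] unit_cancel [OF \<alpha>] )
        then have "J (J z) = (\<alpha> \<cdot> - ((ocnj \<alpha> \<cdot> z) \<cdot> ocnj \<alpha>)) \<cdot> \<alpha>"
          by (simp only: J_def [of "J z"] YY)
        then show ?thesis
          by (simp only: O.minus_left O.minus_right flexible [of "ocnj \<alpha>" z] unit_cancel [OF \<alpha>])
      qed
    qed
    show thesis
    proof (rule suffices [of J])
      fix V assume V: "linear V" "\<And>z. inner (V z) z = 0"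
        and "\<exists>m. commutator_like circ m \<and>
          (\<forall>X Z. inner X (oe 0) = 0 \<longrightarrow> m X Y Z = X \<cdot> (V (oe 0) \<cdot> Z) - V X \<cdot> Z)"
      then obtain m where m: "commutator_like circ m"
        and eq: "\<And>X Z. inner X (oe 0) = 0 \<Longrightarrow> m X Y Z = X \<cdot> (V (oe 0) \<cdot> Z) - V X \<cdot> Z" by blast
      have "V u = inner (V (oe 0)) (J (oe 0)) *\<^sub>R J u" for u
      proof (rule rotation_of_complex_structure_condition [OF V J])
        fix X u :: octonion assume X: "inner X (oe 0) = 0"
        obtain w a where wa: "inner a (oe 0) = 0" "inner w (oe 0) = - inner Y a" "inner w Y = 0"
          and eq': "\<And>Z. m X Y Z = circ w Z - circ a (circ Y Z)"
          using C.commutator_like_right [OF m] by metis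
        obtain b c where b: "\<And>u z. circ w (u \<cdot> z) - circ a (circ Y (u \<cdot> z)) = b u \<cdot> z + u \<cdot> c z"
          and b': "\<And>u. inner (b u) u = 0" "\<And>u. b (J u) = - J (b u)"
          using triality_twist_right [OF \<alpha> Y(2) wa right J_def] by metis
        have "2 *\<^sub>R wedge4 X (V (oe 0)) (V X) (oe 0) u = b u" for u
        proof (rule triality_unique [where ?b1.0 = "\<lambda>u. 2 *\<^sub>R wedge4 X (V (oe 0)) (V X) (oe 0) u" and ?b2.0 = b])
          fix u z
          show "2 *\<^sub>R wedge4 X (V (oe 0)) (V X) (oe 0) u \<cdot> z +
              u \<cdot> (X \<cdot> (V (oe 0) \<cdot> z) + V X \<cdot> z - (2 * inner (V X) (oe 0)) *\<^sub>R z) = b u \<cdot> z + u \<cdot> c z"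
            using triality_left [OF X V(2), of u z "V X"] eq [OF X, of "u \<cdot> z"] eq' [of "u \<cdot> z"] b [of u z] by simp
        qed (simp_all add: wedge4_skew b')
        then have w: "wedge4 X (V (oe 0)) (V X) (oe 0) u = (1/2) *\<^sub>R b u" for u
          by (metis (no_types, lifting) scaleR_half_double scaleR_2)
        then show "wedge4 X (V (oe 0)) (V X) (oe 0) (J u) = - J (wedge4 X (V (oe 0)) (V X) (oe 0) u)"
          by (simp add: b' linear_scale [OF J(1)])
      qed
      then show "\<exists>\<kappa>. \<forall>u. V u = \<kappa> *\<^sub>R J u" by blast
    qed
  qed
qed

section \<open>The twisted commutator and the rigidity of its multiples\<close>

definition twisted_commutator ::
  "(octonion \<Rightarrow> octonion \<Rightarrow> octonion) \<Rightarrow> octonion \<Rightarrow> octonion \<Rightarrow> octonion \<Rightarrow> octonion" where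
  "twisted_commutator circ X Y Z = X \<cdot> circ Y Z - circ Y (X \<cdot> Z)"

lemma bounded_bilinear_diff_scaleR:
  fixes f g :: "'a::euclidean_space \<Rightarrow> 'b::euclidean_space \<Rightarrow> 'c::real_normed_vector"
  assumes "bounded_bilinear f" "bounded_bilinear g"
  shows "bounded_bilinear (\<lambda>x y. f x y - c *\<^sub>R g x y)"
  using assms unfolding bilinear_conv_bounded_bilinear [symmetric] bilinear_def
  by (auto intro!: linear_compose_sub linear_compose_scale_right)

context unital_composition
begin

lemma im_skew: "inner X (oe 0) = 0 \<Longrightarrow> inner (X \<star> z) w = - inner z (X \<star> w)"
  by (simp add: adjoint_left ocnj_eq minus_left)

lemma mul_im_decomp: "X \<star> z = inner X (oe 0) *\<^sub>R z + (X - inner X (oe 0) *\<^sub>R oe 0) \<star> z"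
  by (simp add: diff_left scaleR_left)

text \<open>Real parts of X and Y drop out of the commutator, and for imaginary X and Y both
  multiplications are skew. The three orthogonalities follow from this together with the composition
  law.\<close>

lemma commutator_like_twisted_commutator: "commutator_like mul (twisted_commutator mul)"
proof -
  define m where "m = twisted_commutator mul"
  define im where "im X = X - inner X (oe 0) *\<^sub>R oe 0" for X :: octonion
  have im0: "inner (im X) (oe 0) = 0" for X by (simp add: im_def inner_diff_left inner_oe)
  have X_im: "X = inner X (oe 0) *\<^sub>R oe 0 + im X" for X by (simp add: im_def)
  have m_im: "m X Y Z = im X \<cdot> (im Y \<star> Z) - im Y \<star> (im X \<cdot> Z)" for X Y Z
    by (simp add: m_def twisted_commutator_def im_def O.diff_left O.diff_right O.scaleR_left O.scaleR_right
        diff_left diff_right scaleR_left scaleR_right algebra_simps)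
  note sk = O.im_skew [OF im0] im_skew [OF im0]
  have skew: "inner (m X Y Z) Z = 0" for X Y Z
    using sk(1) [of X "im Y \<star> Z" Z] sk(2) [of Y "im X \<cdot> Z" Z]
    by (simp add: m_im inner_diff_left inner_diff_right inner_commute)
  have "inner (im X \<cdot> Z) (m X Y Z) = 0" for X Y Z
    using sk(2) [of Y Z Z] sk(2) [of Y "im X \<cdot> Z" "im X \<cdot> Z"]
    by (simp add: m_im inner_diff_right O.inner_mul_left inner_commute [of Z] inner_commute [of "im X \<cdot> Z"])
  then have 1: "inner (X \<cdot> Z) (m X Y Z) = 0" for X Y Z
    using skew [of X Y Z] O.mul_im_decomp [of X Z] by (simp add: inner_add_left inner_commute [of Z] flip: im_def)
  have "inner (im Y \<star> Z) (m X Y Z) = 0" for X Y Z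
    using sk(1) [of X Z Z] sk(1) [of X "im Y \<star> Z" "im Y \<star> Z"]
    by (simp add: m_im inner_diff_right inner_mul_left inner_commute [of Z] inner_commute [of "im Y \<star> Z"])
  then have 2: "inner (Y \<star> Z) (m X Y Z) = 0" for X Y Z
    using skew [of X Y Z] mul_im_decomp [of Y Z] by (simp add: inner_add_left inner_commute [of Z] flip: im_def)
  have "bilinear (\<lambda>X Z. m X Y Z)" "bilinear (m X)" for X Y
    unfolding bilinear_def linear_iff m_def twisted_commutator_def
    by (simp_all add: O.add_left O.add_right O.scaleR_left O.scaleR_right
        add_left add_right scaleR_left scaleR_right scaleR_diff_right del: split_paired_All)
  then show ?thesis
    unfolding commutator_like_def m_def [symmetric] bilinear_conv_bounded_bilinear
    using skew 1 2 by (simp add: m_def twisted_commutator_def)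
qed

text \<open>Evaluating a vanishing commutator at Z = e0 shows that Y acts as right multiplication by
  itself; commuting with all left multiplications then places Y in the right nucleus, which is
  real.\<close>

lemma twisted_commutator_nonzero:
  assumes "inner Y (oe 0) = 0" "\<And>X Z. inner X (oe 0) = 0 \<Longrightarrow> twisted_commutator mul X Y Z = 0"
  shows "Y = 0"
proof -
  have comm: "X \<cdot> (Y \<star> Z) = Y \<star> (X \<cdot> Z)" for X Z
  proof -
    define X' where "X' = X - inner X (oe 0) *\<^sub>R oe 0"
    have "inner X' (oe 0) = 0" by (simp add: X'_def inner_diff_left inner_oe)
    from assms(2) [OF this, of Z] show ?thesis
      by (simp add: twisted_commutator_def X'_def O.diff_left O.scaleR_left diff_right scaleR_right algebra_simps)
  qed
  have Y: "Y \<star> Z = Z \<cdot> Y" for Z using comm [of Z "oe 0"] by simp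
  have "Y = inner Y (oe 0) *\<^sub>R oe 0"
    by (rule nucleus_right) (use comm Y in simp)
  with assms(1) show ?thesis by simp
qed

end

text \<open>At each admissible Y both m and the twisted commutator lie on the line of
  \<open>commutator_like_line\<close>, so m is some multiple c(Y) of the commutator there. Linearity
  in Y makes these multiples equal and reaches the excluded Y; the norm condition leaves c = 1 or c
  = -1.\<close>

theorem commutator_like_rigidity:
  assumes tw: "twisted_product \<alpha> circ" and im: "\<And>s. \<alpha> \<noteq> s *\<^sub>R oe 0"
    and m: "commutator_like circ m"
    and len: "\<And>X Y Z. inner X (oe 0) = 0 \<Longrightarrow> inner Y (oe 0) = 0 \<Longrightarrow>
      norm (m X Y Z) = norm (twisted_commutator circ X Y Z)"
  obtains s :: real where "s \<in> {1, -1}" "\<And>X Y Z. m X Y Z = s *\<^sub>R twisted_commutator circ X Y Z"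
proof -
  interpret C: unital_composition circ by (rule twisted_product_unital_composition [OF tw])
  define q where "q = twisted_commutator circ"
  have q: "commutator_like circ q" unfolding q_def by (rule C.commutator_like_twisted_commutator)
  \<comment> \<open>The imaginary part of \<alpha>. For imaginary Y, \<alpha> lies in the span of e0
    and Y exactly when \<epsilon> is a multiple of Y.\<close>
  define \<epsilon> where "\<epsilon> = \<alpha> - inner \<alpha> (oe 0) *\<^sub>R oe 0"
  have \<epsilon>0: "\<epsilon> \<noteq> 0" using im [of "inner \<alpha> (oe 0)"] by (simp add: \<epsilon>_def)
  have nz: "\<exists>X Z. inner X (oe 0) = 0 \<and> q X Y Z \<noteq> 0" if "inner Y (oe 0) = 0" "Y \<noteq> 0" for Y
    using C.twisted_commutator_nonzero [OF that(1)] that(2) by (auto simp: q_def simp del: split_paired_Ex)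
  have linY: "linear (\<lambda>Y. k X Y Z)" if "commutator_like circ k" for k X Z
    using that bounded_linear.linear [OF bounded_bilinear.bounded_linear_left, of "k X" Z] unfolding
      commutator_like_def by blast
  have linX: "linear (\<lambda>X. k X Y Z)" if "commutator_like circ k" for k Y Z
    using that bounded_linear.linear [OF bounded_bilinear.bounded_linear_left, of "\<lambda>X Z. k X Y Z" Z]
    unfolding commutator_like_def by blast
  have line: "\<exists>c. \<forall>X Z. inner X (oe 0) = 0 \<longrightarrow> k X Y Z = c *\<^sub>R q X Y Z"
    if k: "commutator_like circ k" and Y: "inner Y (oe 0) = 0" and good: "\<And>t. \<epsilon> \<noteq> t *\<^sub>R Y" for k Y
  proof (cases "Y = 0")
    case True
    then show ?thesis using linear_0 [OF linY [OF k]] linear_0 [OF linY [OF q]] by simp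
  next
    case False
    define Y' where "Y' = Y /\<^sub>R norm Y"
    have YY': "Y = norm Y *\<^sub>R Y'" using False by (simp add: Y'_def)
    have Y': "norm Y' = 1" "inner Y' (oe 0) = 0" using False Y by (simp_all add: Y'_def)
    have "\<alpha> \<noteq> s *\<^sub>R oe 0 + t *\<^sub>R Y'" for s t
    proof
      assume *: "\<alpha> = s *\<^sub>R oe 0 + t *\<^sub>R Y'"
      then have "\<epsilon> = (t / norm Y) *\<^sub>R Y"
        using False Y by (simp add: \<epsilon>_def inner_add_left Y'(2) inner_oe) (simp add: Y'_def divide_inverse_commute)
      with good show False by blast
    qed
    then obtain V0 where V0: "\<And>m. commutator_like circ m \<Longrightarrow>
        \<exists>\<kappa>. \<forall>X Z. inner X (oe 0) = 0 \<longrightarrow> m X Y' Z = \<kappa> *\<^sub>R (X \<cdot> (V0 (oe 0) \<cdot> Z) - V0 X \<cdot> Z)"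
      using commutator_like_line [OF tw Y'] by metis
    obtain \<kappa> where \<kappa>: "\<And>X Z. inner X (oe 0) = 0 \<Longrightarrow> k X Y' Z = \<kappa> *\<^sub>R (X \<cdot> (V0 (oe 0) \<cdot> Z) - V0 X \<cdot> Z)"
      using V0 [OF k] by blast
    obtain \<mu> where \<mu>: "\<And>X Z. inner X (oe 0) = 0 \<Longrightarrow> q X Y' Z = \<mu> *\<^sub>R (X \<cdot> (V0 (oe 0) \<cdot> Z) - V0 X \<cdot> Z)"
      using V0 [OF q] by blast
    have "\<mu> \<noteq> 0" using nz [of Y'] Y' \<mu> by fastforce
    then have "k X Y' Z = (\<kappa> / \<mu>) *\<^sub>R q X Y' Z" if "inner X (oe 0) = 0" for X Z
      using that by (simp add: \<kappa> \<mu>)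
    then have "k X Y Z = (\<kappa> / \<mu>) *\<^sub>R q X Y Z" if "inner X (oe 0) = 0" for X Z
      using that linear_scale [OF linY [OF k], of X "norm Y" Y' Z] linear_scale [OF linY [OF q], of X "norm Y" Y' Z]
      by (simp flip: YY' add: mult.commute)
    then show ?thesis by blast
  qed
  \<comment> \<open>A reference direction orthogonal to \<epsilon>: then Y1 and all r \<epsilon> +
    Y1 are admissible.\<close>
  obtain Y1 where Y1: "Y1 \<noteq> 0" "inner Y1 (oe 0) = 0" "inner Y1 \<epsilon> = 0"
  proof (rule exists_orthogonal [of "{oe 0, \<epsilon>}"])
    show "card {oe 0, \<epsilon>} < DIM(octonion)" by (simp add: card_insert_if)
  qed auto
  have good1: "\<epsilon> \<noteq> t *\<^sub>R (r *\<^sub>R \<epsilon> + Y1)" for r t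
  proof
    assume *: "\<epsilon> = t *\<^sub>R (r *\<^sub>R \<epsilon> + Y1)"
    then have "inner Y1 \<epsilon> = t * (r * inner Y1 \<epsilon> + inner Y1 Y1)" by (metis inner_add_right inner_scaleR_right)
    then have "t = 0" using Y1 by simp
    with * \<epsilon>0 show False by simp
  qed
  obtain c where c: "\<And>X Z. inner X (oe 0) = 0 \<Longrightarrow> m X Y1 Z = c *\<^sub>R q X Y1 Z"
    using line [OF m Y1(2)] good1 [of _ 0] by auto
  define k where "k X Y Z = m X Y Z - c *\<^sub>R q X Y Z" for X Y Z
  have k: "commutator_like circ k"
    using m q unfolding commutator_like_def k_def
    by (auto simp: inner_diff_left inner_diff_right intro!: bounded_bilinear_diff_scaleR)
  have kY1: "k X Y1 Z = 0" if "inner X (oe 0) = 0" for X Z using c [OF that] by (simp add: k_def)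
  have kgood: "k X Y Z = 0" if X: "inner X (oe 0) = 0" and Y: "inner Y (oe 0) = 0" and good: "\<And>t. \<epsilon> \<noteq> t *\<^sub>R Y" for X Y Z
  proof -
    obtain d where d: "\<And>X Z. inner X (oe 0) = 0 \<Longrightarrow> k X Y Z = d *\<^sub>R q X Y Z"
      using line [OF k Y good] by blast
    \<comment> \<open>One of t = 1 and t = -1 works: since Y1 is orthogonal to \<epsilon>, failure
      of both would make |Y1|^2 zero.\<close>
    have "\<exists>t::real. t \<noteq> 0 \<and> (\<forall>r. \<epsilon> \<noteq> r *\<^sub>R (Y1 + t *\<^sub>R Y))"
    proof (rule ccontr)
      assume "\<not> ?thesis"
      then obtain r r' where r: "\<epsilon> = r *\<^sub>R (Y1 + 1 *\<^sub>R Y)" and r': "\<epsilon> = r' *\<^sub>R (Y1 + (- 1) *\<^sub>R Y)"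
        by (metis one_neq_zero neg_equal_0_iff_equal)
      have "r \<noteq> 0" "r' \<noteq> 0" using r r' \<epsilon>0 by auto
      moreover have "r * (inner Y1 Y1 + inner Y1 Y) = 0"
        using arg_cong [OF r, of "inner Y1"] Y1(3) by (simp add: inner_add_right)
      moreover have "r' * (inner Y1 Y1 - inner Y1 Y) = 0"
        using arg_cong [OF r', of "inner Y1"] Y1(3) by (simp add: inner_diff_right)
      ultimately have "inner Y1 Y1 = 0" by simp
      with Y1(1) show False by simp
    qed
    then obtain t where t: "t \<noteq> 0" "\<And>r. \<epsilon> \<noteq> r *\<^sub>R (Y1 + t *\<^sub>R Y)" by blast
    have "inner (Y1 + t *\<^sub>R Y) (oe 0) = 0" using Y Y1 by (simp add: inner_add_left)
    then obtain d' where d': "\<And>X Z. inner X (oe 0) = 0 \<Longrightarrow> k X (Y1 + t *\<^sub>R Y) Z = d' *\<^sub>R q X (Y1 + t *\<^sub>R Y) Z"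
      using line [OF k _ t(2)] by blast
    note lin = linear_add [OF linY [OF k]] linear_scale [OF linY [OF k]]
      linear_add [OF linY [OF q]] linear_scale [OF linY [OF q]] linear_diff [OF linY [OF q]]
    \<comment> \<open>Since k vanishes at Y1, its multiples at Y and at Y1 + t Y can be compared.
      The difference is a vector at which the commutator vanishes, and that vector must itself be
      zero.\<close>
    have q0: "q X (d' *\<^sub>R Y1 + (t * (d' - d)) *\<^sub>R Y) Z = 0" if "inner X (oe 0) = 0" for X Z
      using d' [OF that, of Z] d [OF that, of Z] kY1 [OF that, of Z]
      by (simp add: lin algebra_simps)
    have zero: "d' *\<^sub>R Y1 + (t * (d' - d)) *\<^sub>R Y = 0"
    proof (rule ccontr)
      assume "d' *\<^sub>R Y1 + (t * (d' - d)) *\<^sub>R Y \<noteq> 0"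
      moreover have "inner (d' *\<^sub>R Y1 + (t * (d' - d)) *\<^sub>R Y) (oe 0) = 0" using Y Y1 by (simp add: inner_add_left)
      ultimately obtain X Z where "inner X (oe 0) = 0" "q X (d' *\<^sub>R Y1 + (t * (d' - d)) *\<^sub>R Y) Z \<noteq> 0"
        using nz by blast
      with q0 show False by blast
    qed
    show ?thesis
    proof (cases "d' = 0")
      case True
      then have "d = 0 \<or> Y = 0" using zero t by simp
      then show ?thesis using d [OF X, of Z] linear_0 [OF linY [OF k], of X Z] by auto
    next
      case False
      define r where "r = - (t * (d' - d)) / d'"
      have "Y1 = (1 / d') *\<^sub>R (d' *\<^sub>R Y1)" using False by simp
      also have "\<dots> = r *\<^sub>R Y"
        using zero by (simp add: r_def add_eq_0_iff2 del: scaleR_scaleR) simp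
      finally have r: "Y1 = r *\<^sub>R Y" .
      then have "r \<noteq> 0" using Y1 by auto
      moreover have "r *\<^sub>R k X Y Z = 0" using kY1 [OF X, of Z] by (simp add: r lin)
      ultimately show ?thesis by simp
    qed
  qed
  have kim: "k X Y Z = 0" if X: "inner X (oe 0) = 0" and Y: "inner Y (oe 0) = 0" for X Y Z
  proof (cases "\<exists>t. \<epsilon> = t *\<^sub>R Y")
    case True
    then obtain t where t: "\<epsilon> = t *\<^sub>R Y" by blast
    with \<epsilon>0 have "Y = (1 / t) *\<^sub>R \<epsilon>" by auto
    \<comment> \<open>In the excluded direction, Y is reached as the difference of the admissible
      vectors Y + Y1 and Y1.\<close>
    then have "k X (Y + Y1) Z = 0"
      using kgood [OF X, of "Y + Y1" Z] good1 Y Y1 by (simp add: inner_add_left)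
    then show ?thesis using linear_add [OF linY [OF k]] kY1 [OF X, of Z] by simp
  qed (use kgood [OF X Y] in blast)
  have "k X Y Z = 0" for X Y Z
  proof -
    define im where "im X = X - inner X (oe 0) *\<^sub>R oe 0" for X :: octonion
    have im0: "inner (im X) (oe 0) = 0" for X by (simp add: im_def inner_diff_left inner_oe)
    have "k (im X) (im Y) Z = 0" by (rule kim) (rule im0)+
    moreover have "k (oe 0) Y Z = 0" "k X (oe 0) Z = 0" for X Y using k by (simp_all add: commutator_like_def)
    ultimately show ?thesis
      by (simp add: im_def linear_diff [OF linX [OF k]] linear_diff [OF linY [OF k]]
        linear_scale [OF linX [OF k]] linear_scale [OF linY [OF k]])
  qed
  then have eq: "m X Y Z = c *\<^sub>R twisted_commutator circ X Y Z" for X Y Z by (simp add: k_def q_def)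
  obtain X Z where XZ: "inner X (oe 0) = 0" "q X Y1 Z \<noteq> 0" using nz Y1 by blast
  have "\<bar>c\<bar> = 1" using len [OF XZ(1) Y1(2), of Z] XZ(2) by (simp add: eq q_def)
  then have "c \<in> {1, -1}" by auto
  from that [OF this eq] show thesis .
qed

section \<open>Tangent spaces of submanifolds\<close>

lemma Ck_on_cong:
  assumes "open U" "\<And>x. x \<in> U \<Longrightarrow> f x = g x"
  shows "Ck_on k U f \<longleftrightarrow> Ck_on k U g"
  using assms(2)
proof (induction k arbitrary: f g)
  case 0
  then show ?case by (simp cong: continuous_on_cong)
next
  case (Suc k)
  have der: "(f has_derivative D) (at x) \<longleftrightarrow> (g has_derivative D) (at x)" if "x \<in> U" for D x
    using Suc.prems assms(1) that by (metis has_derivative_transform_within_open)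
  then have diff: "f differentiable (at x) \<longleftrightarrow> g differentiable (at x)" if "x \<in> U" for x
    using that by (simp add: differentiable_def)
  have "frechet_derivative f (at x) = frechet_derivative g (at x)" if "x \<in> U" for x
    using der [OF that] by (simp add: frechet_derivative_def)
  then have "Ck_on k U (\<lambda>x. frechet_derivative f (at x) v) \<longleftrightarrow> Ck_on k U (\<lambda>x. frechet_derivative g (at x) v)" for v
    by (intro Suc.IH) simp
  then show ?case
    using diff assms(1) by (simp add: differentiable_on_eq_differentiable_at)
qed

lemma Ck_on_SucD: "Ck_on (Suc k) U f \<Longrightarrow> Ck_on k U f"
proof (induction k arbitrary: f)
  case 0
  then show ?case by (simp add: differentiable_imp_continuous_on)
next
  case (Suc k)
  then show ?case by (meson Ck_on.simps(2))
qed

lemma Ck_on_SucI: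
  assumes "open U" "\<And>x. x \<in> U \<Longrightarrow> (f has_derivative D x) (at x)"
    and "\<And>v. Ck_on k U (\<lambda>x. D x v)"
  shows "Ck_on (Suc k) U f"
proof -
  have D: "frechet_derivative f (at x) v = D x v" if "x \<in> U" for x v
    using assms(2) [OF that] frechet_derivative_at by metis
  have "Ck_on k U (\<lambda>x. frechet_derivative f (at x) v)" for v
    using Ck_on_cong [OF assms(1), of "\<lambda>x. frechet_derivative f (at x) v" "\<lambda>x. D x v" k] D assms(3) by blast
  moreover have "f differentiable_on U"
    using assms(1,2) by (auto simp: differentiable_on_eq_differentiable_at differentiable_def)
  ultimately show ?thesis by simp
qed

lemma Ck_on_SucE:
  assumes "open U" "Ck_on (Suc k) U f" "x \<in> U"
  shows "(f has_derivative frechet_derivative f (at x)) (at x)"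
  using assms by (auto simp: differentiable_on_eq_differentiable_at frechet_derivative_works)

lemma Ck_on_const: "open U \<Longrightarrow> Ck_on k U (\<lambda>x. c)"
  by (induction k arbitrary: c) (simp, rule Ck_on_SucI [where D = "\<lambda>x v. 0"], auto)

lemma Ck_on_add:
  assumes "open U" "Ck_on k U f" "Ck_on k U g"
  shows "Ck_on k U (\<lambda>x. f x + g x)"
  using assms(2,3)
proof (induction k arbitrary: f g)
  case (Suc k)
  show ?case
  proof (rule Ck_on_SucI [OF assms(1)])
    show "((\<lambda>x. f x + g x) has_derivative (\<lambda>v. frechet_derivative f (at x) v + frechet_derivative g (at x) v)) (at x)"
      if "x \<in> U" for x
      by (rule has_derivative_add; rule Ck_on_SucE [OF assms(1) _ that]; rule Suc.prems)
    show "Ck_on k U (\<lambda>x. frechet_derivative f (at x) v + frechet_derivative g (at x) v)" for v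
      using Suc.prems by (intro Suc.IH) auto
  qed
qed (simp add: continuous_on_add)

lemma Ck_on_bilinear:
  assumes "open U" "bounded_bilinear b" "Ck_on k U f" "Ck_on k U g"
  shows "Ck_on k U (\<lambda>x. b (f x) (g x))"
  using assms(3,4)
proof (induction k arbitrary: f g)
  case 0
  then show ?case by (simp add: bounded_bilinear.continuous_on [OF assms(2)])
next
  case (Suc k)
  show ?case
  proof (rule Ck_on_SucI [OF assms(1)])
    show "((\<lambda>x. b (f x) (g x)) has_derivative
       (\<lambda>v. b (f x) (frechet_derivative g (at x) v) + b (frechet_derivative f (at x) v) (g x))) (at x)"
      if "x \<in> U" for x
      by (rule bounded_bilinear.FDERIV [OF assms(2)]; rule Ck_on_SucE [OF assms(1) _ that]; rule Suc.prems)
    show "Ck_on k U (\<lambda>x. b (f x) (frechet_derivative g (at x) v) + b (frechet_derivative f (at x) v) (g x))" for v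
      using Suc.prems Ck_on_SucD [OF Suc.prems(1)] Ck_on_SucD [OF Suc.prems(2)]
      by (intro Ck_on_add assms(1) Suc.IH) auto
  qed
qed

lemma Ck_on_affine:
  fixes f :: "'a::euclidean_space \<Rightarrow> 'b::real_normed_vector"
  assumes "open U" "open I" "\<And>s. s \<in> I \<Longrightarrow> c + s *\<^sub>R l \<in> U" "Ck_on k U f"
  shows "Ck_on k I (\<lambda>s::real. f (c + s *\<^sub>R l))"
  using assms(4)
proof (induction k arbitrary: f)
  case 0
  then show ?case
    by (auto intro!: continuous_on_compose2 [of U f] continuous_intros assms(3))
next
  case (Suc k)
  show ?case
  proof (rule Ck_on_SucI [OF assms(2)])
    fix s assume "s \<in> I"
    then have "(f has_derivative frechet_derivative f (at (c + s *\<^sub>R l))) (at (c + s *\<^sub>R l))"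
      by (intro Ck_on_SucE [OF assms(1) Suc.prems] assms(3))
    moreover have "((\<lambda>s. c + s *\<^sub>R l) has_derivative (\<lambda>v. v *\<^sub>R l)) (at s)"
      by (auto intro!: derivative_eq_intros)
    ultimately show "((\<lambda>s. f (c + s *\<^sub>R l)) has_derivative (\<lambda>v. frechet_derivative f (at (c + s *\<^sub>R l)) (v *\<^sub>R l))) (at s)"
      by (rule has_derivative_compose [rotated])
  next
    show "Ck_on k I (\<lambda>x. frechet_derivative f (at (c + x *\<^sub>R l)) (v *\<^sub>R l))" for v
      using Suc.prems by (intro Suc.IH) simp
  qed
qed

lemma smooth_on_has_derivative:
  assumes "smooth_on U f" "open U" "x \<in> U"
  shows "(f has_derivative frechet_derivative f (at x)) (at x)"
  using assms Ck_on_SucE [of U 0 f x] by (simp only: smooth_on_def)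

text \<open>The derivative of the inverse chart is injective and maps L into velocities of curves.
  Only this inclusion is taken from the charts; the upper bound for the tangent space will come from
  the equations for F.\<close>

lemma submanifold_tangent_space:
  fixes M :: "'a::euclidean_space set"
  assumes "submanifold d M" "p \<in> M"
  obtains S where "subspace S" "dim S = d" "S \<subseteq> tangent_space M p"
proof -
  obtain W and W' :: "'a set" and \<Phi> \<Psi> and L :: "'a set" where W: "open W" "open W'" "p \<in> W" "homeomorphism W W' \<Phi> \<Psi>"
    "smooth_on W \<Phi>" "smooth_on W' \<Psi>" and L: "subspace L" "dim L = d" "\<Phi> ` (M \<inter> W) = L \<inter> W'"
    using bspec [OF assms(1) [unfolded submanifold_def] assms(2)] by blast
  define c where "c = \<Phi> p"
  have c: "c \<in> L" "c \<in> W'" "\<Psi> c = p"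
    using W(3,4) L(3) assms(2)
    by (auto simp: c_def homeomorphism_def)
  define D where "D = frechet_derivative \<Psi> (at c)"
  have D: "(\<Psi> has_derivative D) (at c)"
    unfolding D_def by (rule smooth_on_has_derivative [of W']) (use W c in auto)
  have D': "(\<Phi> has_derivative frechet_derivative \<Phi> (at p)) (at (\<Psi> c))"
    unfolding c by (rule smooth_on_has_derivative [of W]) (use W in auto)
  have "(id has_derivative frechet_derivative \<Phi> (at p) \<circ> D) (at c)"
  proof (rule has_derivative_transform_within_open [of "\<Phi> \<circ> \<Psi>" _ _ UNIV W'])
    show "(\<Phi> \<circ> \<Psi> has_derivative frechet_derivative \<Phi> (at p) \<circ> D) (at c)"
      using diff_chain_at [OF D D'] .
  qed (use W c in \<open>auto simp: homeomorphism_def\<close>)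
  then have "frechet_derivative \<Phi> (at p) \<circ> D = id"
    using has_derivative_unique has_derivative_id by blast
  then have inj: "inj D" by (metis inj_on_id inj_on_imageI2)
  have linD: "linear D" using D has_derivative_linear by blast
  show thesis
  proof
    show "subspace (D ` L)" by (rule linear_subspace_image [OF linD L(1)])
    show "dim (D ` L) = d" using dim_image_eq [OF linD] inj L(2) by (metis inj_on_subset subset_UNIV)
    show "D ` L \<subseteq> tangent_space M p"
    proof clarify
      fix l assume l: "l \<in> L"
      have "open ((\<lambda>s. c + s *\<^sub>R l) -` W')"
        by (intro open_vimage W continuous_intros)
      moreover have "0 \<in> (\<lambda>s. c + s *\<^sub>R l) -` W'" using c by simp
      ultimately obtain \<epsilon> where \<epsilon>: "\<epsilon> > 0" "ball 0 \<epsilon> \<subseteq> (\<lambda>s. c + s *\<^sub>R l) -` W'"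
        by (meson openE)
      have in_W': "c + s *\<^sub>R l \<in> W'" if "s \<in> {-\<epsilon><..<\<epsilon>}" for s
        using \<epsilon>(2) that by (auto simp: ball_def dist_real_def subset_iff)
      define \<gamma> where "\<gamma> s = \<Psi> (c + s *\<^sub>R l)" for s
      have "smooth_on {-\<epsilon><..<\<epsilon>} \<gamma>"
        unfolding smooth_on_def \<gamma>_def using W in_W'
        by (auto intro!: Ck_on_affine [of W'] simp: smooth_on_def)
      moreover have "\<gamma> s \<in> M" if "s \<in> {-\<epsilon><..<\<epsilon>}" for s
      proof -
        have "c + s *\<^sub>R l \<in> L \<inter> W'"
          using in_W' [OF that] c l L(1) by (auto intro: subspace_add subspace_scale)
        then obtain m where "m \<in> M \<inter> W" "c + s *\<^sub>R l = \<Phi> m" using L(3) by blast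
        then show ?thesis using W(4) by (auto simp: \<gamma>_def homeomorphism_def)
      qed
      moreover have "(\<gamma> has_vector_derivative D l) (at 0)"
      proof -
        have "((\<lambda>s. c + s *\<^sub>R l) has_derivative (\<lambda>v. v *\<^sub>R l)) (at 0)"
          by (auto intro!: derivative_eq_intros)
        moreover have "(\<Psi> has_derivative D) (at (c + 0 *\<^sub>R l))" using D by simp
        ultimately have "((\<lambda>s. \<Psi> (c + s *\<^sub>R l)) has_derivative (\<lambda>v. D (v *\<^sub>R l))) (at 0)"
          by (rule has_derivative_compose)
        then show ?thesis
          by (simp add: has_vector_derivative_def linear_scale [OF linD] flip: \<gamma>_def [abs_def])
      qed
      ultimately show "D l \<in> tangent_space M p"
        using \<epsilon>(1) c unfolding tangent_space_def smooth_curve_in_def by (auto simp: \<gamma>_def intro!: exI [of _ \<epsilon>] exI [of _ \<gamma>])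
    qed
  qed
qed

section \<open>Quartic forms and their focal points\<close>

text \<open>Evaluation at 0, 1, -1, 2, -2 gives an invertible Vandermonde system.\<close>

lemma poly4_coeffs_zero:
  fixes c0 c1 c2 c3 c4 :: real
  assumes "\<And>t. c0 + c1 * t + c2 * t^2 + c3 * t^3 + c4 * t^4 = 0"
  shows "c0 = 0" "c1 = 0" "c2 = 0" "c3 = 0" "c4 = 0"
  using assms [of 0] assms [of 1] assms [of "-1"] assms [of 2] assms [of "-2"] by simp_all

lemma poly6_coeffs_zero:
  fixes c0 c1 c2 c3 c4 c5 c6 :: real
  assumes "\<And>t. c0 + c1 * t + c2 * t^2 + c3 * t^3 + c4 * t^4 + c5 * t^5 + c6 * t^6 = 0"
  shows "c2 = 0" "c3 = 0" "c4 = 0"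
  using assms [of 0] assms [of 1] assms [of "-1"] assms [of 2] assms [of "-2"] assms [of 3] assms [of "-3"] by simp_all

text \<open>The gradient of z -> <G z z z, z> is 4 G z z z, so \<open>norm_G\<close> is the gradient
  equation of Cartan and Muenzner.\<close>

locale quartic_form =
  fixes G :: "'a::euclidean_space \<Rightarrow> 'a \<Rightarrow> 'a \<Rightarrow> 'a"
  assumes lin: "linear (G a b)"
    and swap12: "G a b c = G b a c"
    and swap23: "G a b c = G a c b"
    and inner_swap: "inner (G a b c) d = inner (G a b d) c"
    and norm_G: "(norm (G z z z))\<^sup>2 = norm z ^ 6"
begin

lemma lin2: "linear (\<lambda>b. G a b c)"
  using lin [of a c] by (simp add: swap23 [of a _ c])

lemma lin1: "linear (\<lambda>a. G a b c)"
  using lin2 [of b c] by (simp add: swap12 [of _ b c])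

lemma G_add: "G (a + a') b c = G a b c + G a' b c" "G a (b + b') c = G a b c + G a b' c"
  "G a b (c + c') = G a b c + G a b c'"
  using linear_add [OF lin1, of a a' b c] linear_add [OF lin2, of a b b' c] linear_add [OF lin, of a b c c'] by auto

lemma G_diff: "G (a - a') b c = G a b c - G a' b c" "G a (b - b') c = G a b c - G a b' c"
  "G a b (c - c') = G a b c - G a b c'"
  using linear_diff [OF lin1, of a a' b c] linear_diff [OF lin2, of a b b' c] linear_diff [OF lin, of a b c c'] by auto

lemma G_scale: "G (r *\<^sub>R a) b c = r *\<^sub>R G a b c" "G a (r *\<^sub>R b) c = r *\<^sub>R G a b c"
  "G a b (r *\<^sub>R c) = r *\<^sub>R G a b c"
  using linear_scale [OF lin1, of r a b c] linear_scale [OF lin2, of a r b c] linear_scale [OF lin, of a b r c] by auto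

lemma G_minus: "G (- a) b c = - G a b c" "G a (- b) c = - G a b c" "G a b (- c) = - G a b c"
  using linear_neg [OF lin1, of a b c] linear_neg [OF lin2, of a b c] linear_neg [OF lin, of a b c] by auto

lemma G_zero [simp]: "G 0 b c = 0" "G a 0 c = 0" "G a b 0 = 0"
  using linear_0 [OF lin1, of b c] linear_0 [OF lin2, of a c] linear_0 [OF lin, of a b] by auto

lemmas G_sym = swap12 swap23

lemma G_cube: "G (u + s *\<^sub>R v) (u + s *\<^sub>R v) (u + s *\<^sub>R v) =
    G u u u + (3 * s) *\<^sub>R G u u v + (3 * s\<^sup>2) *\<^sub>R G u v v + (s ^ 3) *\<^sub>R G v v v"
proof -
  have "G v u u = G u u v" "G u v u = G u u v" "G v u v = G u v v" "G v v u = G u v v"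
    by (metis G_sym)+
  then show ?thesis
    by (simp add: G_add G_scale power2_eq_square power3_eq_cube scaleR_add_right)
      (simp add: algebra_simps flip: scaleR_add_left)
qed

lemma G_square: "G a (u + s *\<^sub>R v) (u + s *\<^sub>R v) = G a u u + (2 * s) *\<^sub>R G a u v + (s\<^sup>2) *\<^sub>R G a v v"
  by (simp add: G_add G_scale power2_eq_square scaleR_add_right swap23 [of a v u])
    (simp add: algebra_simps flip: scaleR_add_left)

section \<open>Eigenspaces of the Hessian at a focal point\<close>

definition focal_point :: "'a \<Rightarrow> bool" where
  "focal_point p \<longleftrightarrow> norm p = 1 \<and> inner (G p p p) p = 1"

text \<open>The eigenvalue 1/3 here and -1 in \<open>normal\<close> correspond to the coefficient 2
  |y|^2 - 6 |w|^2 of t^2 in the expansion of F at the point, which equals 6 <G p p (y + w), y +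
  w>.\<close>

definition tang :: "'a \<Rightarrow> 'a set" where
  "tang p = {y. inner y p = 0 \<and> G p p y = (1/3) *\<^sub>R y}"

definition normal :: "'a \<Rightarrow> 'a set" where
  "normal p = {w. G p p w = - w}"

context
  fixes p assumes fp: "focal_point p"
begin

lemma focal_inner: "inner p p = 1"
  using fp by (simp add: focal_point_def flip: power2_norm_eq_inner)

lemma focal_G: "G p p p = p"
proof -
  have "inner (G p p p - p) (G p p p - p) = (norm (G p p p))\<^sup>2 - 2 * inner (G p p p) p + (norm p)\<^sup>2"
    by (simp add: inner_diff_left inner_diff_right power2_norm_eq_inner inner_commute)
  also have "\<dots> = 0" using fp by (simp add: norm_G focal_point_def)
  finally show ?thesis by simp
qed

lemma inner_Gpp: "inner (G p p v) p = inner v p"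
  using inner_swap [of p p v p] by (simp add: focal_G inner_commute)

text \<open>The coefficients of s^2, s^3 and s^4 in the equation for \<open>norm_G\<close> at p + s
  v.\<close>

lemma expansion:
  assumes "inner v p = 0"
  shows "9 * (norm (G p p v))\<^sup>2 + 6 * inner (G p p v) v = 3 * (norm v)\<^sup>2"
    and "inner (G p v v) v + 9 * inner (G p v v) (G p p v) = 0"
    and "9 * (norm (G p v v))\<^sup>2 + 6 * inner (G p p v) (G v v v) = 3 * (norm v) ^ 4"
proof -
  define h k g r where "h = G p p v" and "k = G p v v" and "g = G v v v" and "r = (norm v)\<^sup>2"
  have ph: "inner p h = 0" using inner_Gpp [of v] assms by (simp add: h_def inner_commute)
  have pk: "inner p k = inner h v"
    using inner_swap [of p v v p] swap23 [of p v p] by (simp add: k_def h_def inner_commute)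
  have pg: "inner p g = inner k v"
    using inner_swap [of v v v p] swap12 [of v p v] swap23 [of v v p] by (simp add: k_def g_def inner_commute)
  have eq: "(norm (G (p + s *\<^sub>R v) (p + s *\<^sub>R v) (p + s *\<^sub>R v)))\<^sup>2 = (1 + s\<^sup>2 * r) ^ 3" for s
  proof -
    have "(norm (p + s *\<^sub>R v))\<^sup>2 = 1 + s\<^sup>2 * r"
      unfolding r_def power2_norm_eq_inner
      using assms by (simp add: inner_add_left inner_add_right focal_inner inner_commute power2_eq_square)
    then have "norm (p + s *\<^sub>R v) ^ 6 = (1 + s\<^sup>2 * r) ^ 3"
      using power_mult [of "norm (p + s *\<^sub>R v)" 2 3] by simp
    then show ?thesis by (simp add: norm_G)
  qed
  have lhs: "(norm (G (p + s *\<^sub>R v) (p + s *\<^sub>R v) (p + s *\<^sub>R v)))\<^sup>2 = 1 + (9 * inner h h + 6 * inner h v) * s^2 +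
      (2 * inner k v + 18 * inner h k) * s^3 + (9 * inner k k + 6 * inner h g) * s^4 + 6 * inner k g * s^5 + inner
        g g * s^6" for s
    unfolding G_cube focal_G power2_norm_eq_inner
    by (simp add: inner_add_left inner_add_right focal_inner ph pk pg inner_commute [of h p] inner_commute [of k p]
        inner_commute [of g p] inner_commute [of k h] inner_commute [of g h] inner_commute [of g k] flip: h_def k_def g_def)
      (simp add: algebra_simps power2_eq_square eval_nat_numeral)
  have "0 + 0 * s + (9 * inner h h + 6 * inner h v - 3 * r) * s^2 +
      (2 * inner k v + 18 * inner h k) * s^3 + (9 * inner k k + 6 * inner h g - 3 * r\<^sup>2) * s^4 + 6 * inner k g * s^5
      + (inner g g - r ^ 3) * s^6 = 0" for s
    using eq [of s] unfolding lhs by (simp add: algebra_simps power2_eq_square eval_nat_numeral)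
  note z = poly6_coeffs_zero [OF this]
  show "9 * (norm (G p p v))\<^sup>2 + 6 * inner (G p p v) v = 3 * (norm v)\<^sup>2"
    using z(1) by (simp add: h_def r_def power2_norm_eq_inner)
  show "inner (G p v v) v + 9 * inner (G p v v) (G p p v) = 0"
    using z(2) by (simp add: h_def k_def inner_commute)
  show "9 * (norm (G p v v))\<^sup>2 + 6 * inner (G p p v) (G v v v) = 3 * (norm v) ^ 4"
    using z(3) power_mult [of "norm v" 2 2] by (simp add: h_def k_def g_def r_def power2_norm_eq_inner)
qed

text \<open>The polarized second-order equation. On the complement of p it reads (3 H - 1)(H + 1) =
  0 for H = G p p, hence the two eigenspaces.\<close>

lemma Gpp_quadratic:
  assumes v: "inner v p = 0"
  shows "3 *\<^sub>R G p p (G p p v) + 2 *\<^sub>R G p p v = v"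
proof -
  define H where "H = G p p"
  have H: "linear H" unfolding H_def by (rule lin)
  have sym: "inner (H u) w = inner u (H w)" for u w
    using inner_swap [of p p u w] by (simp add: H_def inner_commute)
  have q: "9 * inner (H u) (H u) + 6 * inner (H u) u = 3 * inner u u" if "inner u p = 0" for u
    using expansion(1) [OF that] by (simp add: H_def power2_norm_eq_inner)
  define z where "z = 3 *\<^sub>R H (H v) + 2 *\<^sub>R H v - v"
  have Hp: "inner (H u) p = inner u p" for u by (simp add: H_def inner_Gpp)
  have zp: "inner z p = 0" by (simp add: z_def inner_add_left inner_diff_left Hp v)
  have "9 * inner (H v) (H z) + 6 * inner (H v) z = 3 * inner v z"
    using q [of v] q [of z] q [of "v + z"] v zp
    by (simp add: linear_add [OF H] inner_add_left inner_add_right inner_commute [of z v] inner_commute [of "H z" "H v"]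
        sym [of z v] inner_commute [of z "H v"])
  moreover have "inner (H v) (H z) = inner (H (H v)) z" by (simp add: sym [of "H v" z])
  ultimately have "3 * inner z z = 0"
    by (simp add: z_def inner_add_left inner_diff_left algebra_simps)
  then show ?thesis by (simp add: z_def H_def)
qed

lemma normal_perp: "w \<in> normal p \<Longrightarrow> inner w p = 0"
  using inner_Gpp [of w] by (simp add: normal_def)

lemma tang_normal_perp:
  assumes "y \<in> tang p" "w \<in> normal p" shows "inner y w = 0" "inner w y = 0"
proof -
  have "inner (G p p y) w = inner (G p p w) y" by (rule inner_swap)
  then show "inner y w = 0" "inner w y = 0" using assms by (simp_all add: tang_def normal_def inner_commute)
qed

lemma subspace_tang: "subspace (tang p)"
  by (auto simp: subspace_def tang_def inner_add_left G_add G_scale scaleR_add_right)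

lemma subspace_normal: "subspace (normal p)"
  by (auto simp: subspace_def normal_def G_add G_scale)

lemma decomposition:
  obtains y w where "y \<in> tang p" "w \<in> normal p" "v = inner v p *\<^sub>R p + y + w"
proof -
  define u where "u = v - inner v p *\<^sub>R p"
  have up: "inner u p = 0" by (simp add: u_def inner_diff_left focal_inner)
  note q = Gpp_quadratic [OF up]
  \<comment> \<open>The spectral projections (3/4)(H + 1) and (1/4)(1 - 3 H) belonging to this
    factorization.\<close>
  define y w where "y = (3/4) *\<^sub>R (G p p u + u)" and "w = (1/4) *\<^sub>R (u - 3 *\<^sub>R G p p u)"
  have "3 *\<^sub>R G p p (G p p u) = u - 2 *\<^sub>R G p p u"
    using q by (metis add_diff_cancel_right')
  then have "(1/3) *\<^sub>R (3 *\<^sub>R G p p (G p p u)) = (1/3) *\<^sub>R (u - 2 *\<^sub>R G p p u)" by simp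
  then have q': "G p p (G p p u) = (1/3) *\<^sub>R u - (2/3) *\<^sub>R G p p u"
    by (simp add: scaleR_diff_right)
  show thesis
  proof
    show "y \<in> tang p"
      by (simp add: tang_def y_def inner_add_left up inner_Gpp G_add G_scale q' algebra_simps)
        (simp flip: scaleR_add_left)
    show "w \<in> normal p"
      by (simp add: normal_def w_def G_diff G_scale q' algebra_simps) (simp flip: scaleR_add_left)
    show "v = inner v p *\<^sub>R p + y + w"
      by (simp add: y_def w_def u_def algebra_simps) (simp flip: scaleR_add_left)
  qed
qed

end

context
  fixes p assumes fp: "focal_point p"
begin

lemma perp_eq_radial:
  assumes "\<And>y. y \<in> tang p \<Longrightarrow> inner a y = 0" "\<And>w. w \<in> normal p \<Longrightarrow> inner a w = 0"
  shows "a = inner a p *\<^sub>R p"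
proof -
  obtain y w where d: "y \<in> tang p" "w \<in> normal p" "a = inner a p *\<^sub>R p + y + w"
    by (rule decomposition [OF fp])
  have "inner a y = inner (inner a p *\<^sub>R p + y + w) y" "inner a w = inner (inner a p *\<^sub>R p + y + w) w"
    using d(3) by simp_all
  moreover have "inner p y = 0" "inner p w = 0" "inner y w = 0" "inner w y = 0"
    using d tang_normal_perp [OF fp d(1,2)] normal_perp [OF fp d(2)]
    by (simp_all add: tang_def inner_commute)
  ultimately have "inner y y = 0" "inner w w = 0"
    using assms(1) [OF d(1)] assms(2) [OF d(2)] by (simp_all add: inner_add_left)
  then show ?thesis using d(3) by simp
qed

lemma perp_mem_tang:
  assumes "inner a p = 0" "\<And>w. w \<in> normal p \<Longrightarrow> inner a w = 0"
  shows "a \<in> tang p"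
proof -
  obtain y w where d: "y \<in> tang p" "w \<in> normal p" "a = inner a p *\<^sub>R p + y + w"
    by (rule decomposition [OF fp])
  have "inner a w = inner (inner a p *\<^sub>R p + y + w) w" using d(3) by simp
  then have "inner w w = 0"
    using assms(1) assms(2) [OF d(2)] tang_normal_perp [OF fp d(1,2)] by (simp only: inner_add_left) simp
  then show ?thesis using d assms(1) by simp
qed

section \<open>Third- and fourth-order terms at a focal point\<close>

lemma trilinear_vanishes:
  assumes S: "subspace S" and Q: "\<And>v. v \<in> S \<Longrightarrow> inner (G p v v) v = 0"
    and uvw: "u \<in> S" "v \<in> S" "w \<in> S"
  shows "inner (G p u v) w = 0"
proof -
  have 1: "inner (G p u u) w = 0" if u: "u \<in> S" and w: "w \<in> S" for u w
  proof -
    have "inner (G p (u + w) (u + w)) (u + w) = 0" "inner (G p (u - w) (u - w)) (u - w) = 0"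
      using S u w by (auto intro!: Q subspace_add subspace_diff)
    moreover have "inner (G p u w) u = inner (G p u u) w" "inner (G p u w) w = inner (G p w w) u"
      "inner (G p w u) u = inner (G p u u) w" "inner (G p w u) w = inner (G p w w) u"
      using inner_swap [of p u w u] inner_swap [of p w u w] swap23 [of p u w] by simp_all
    ultimately show ?thesis
      using Q [OF u] Q [OF w] by (simp add: G_add G_diff inner_add_left inner_add_right inner_diff_left inner_diff_right)
  qed
  show ?thesis
    using 1 [of "u + v" w] 1 [of u w] 1 [of v w] subspace_add [OF S] uvw swap23 [of p v u]
    by (simp add: G_add inner_add_left)
qed

lemma cubic_part_vanishes:
  assumes y: "y \<in> tang p" and w: "w \<in> normal p"
  shows "inner (G p y y) y = 0" "inner (G p w w) y = 0" "inner (G p w w) w = 0"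
proof -
  have yp: "inner y p = 0" "G p p y = (1/3) *\<^sub>R y" and wp: "inner w p = 0" "G p p w = - w"
    using y w normal_perp [OF fp] by (auto simp: tang_def normal_def)
  define A B C D where "A = inner (G p y y) y" and "B = inner (G p y y) w" and "C = inner (G p w w) y"
    and "D = inner (G p w w) w"
  have B: "inner (G p y w) y = B" and C: "inner (G p y w) w = C"
    using inner_swap [of p y w y] inner_swap [of p w y w] swap23 [of p y w] by (simp_all add: B_def C_def)
  \<comment> \<open>The tangential part of v enters with weight 1 + 9/3 = 4, the normal part with 1
    - 9 = -8. The two contributions of B to the coefficient of t cancel: B, the second fundamental
    form, stays free.\<close>
  have "4 * A + 0 * t + (- 12 * C) * t^2 + (- 8 * D) * t^3 + 0 * t^4 = 0" for t
  proof -
    define v where "v = y + t *\<^sub>R w"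
    have "inner (G p v v) v + 9 * inner (G p v v) (G p p v) = 0"
      by (rule expansion(2) [OF fp]) (simp add: v_def inner_add_left yp wp)
    then show ?thesis
      unfolding v_def G_square
      by (simp add: G_add G_scale inner_add_left inner_add_right yp wp B C flip: A_def B_def C_def D_def)
        (simp add: B C A_def [symmetric] B_def [symmetric] C_def [symmetric] D_def [symmetric]
          algebra_simps power2_eq_square power3_eq_cube)
  qed
  from poly4_coeffs_zero [OF this] show "inner (G p y y) y = 0" "inner (G p w w) y = 0" "inner (G p w w) w = 0"
    by (simp_all add: A_def C_def D_def)
qed

lemma tang_cubic: "y \<in> tang p \<Longrightarrow> y' \<in> tang p \<Longrightarrow> y'' \<in> tang p \<Longrightarrow> inner (G p y y') y'' = 0"
  by (rule trilinear_vanishes [OF subspace_tang [OF fp]])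
    (auto intro: cubic_part_vanishes(1) [of _ 0] simp: normal_def)

lemma G_normal_normal:
  assumes "w \<in> normal p" "w' \<in> normal p"
  shows "G p w w' = - inner w w' *\<^sub>R p"
proof -
  have zero: "0 \<in> tang p" "0 \<in> normal p" by (auto simp: tang_def normal_def)
  have n: "inner (G p w w') w'' = 0" if "w'' \<in> normal p" for w''
    by (rule trilinear_vanishes [OF subspace_normal [OF fp]])
      (use assms that cubic_part_vanishes(3) [OF zero(1)] in auto)
  have t: "inner (G p w w') y = 0" if "y \<in> tang p" for y
    using cubic_part_vanishes(2) [OF that assms(1)] cubic_part_vanishes(2) [OF that assms(2)]
      cubic_part_vanishes(2) [OF that subspace_add [OF subspace_normal [OF fp] assms]] swap23 [of p w' w]
    by (simp add: G_add inner_add_left)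
  have "inner (G p w w') p = - inner w w'"
    using inner_swap [of p w w' p] swap23 [of p w p] assms by (simp add: normal_def)
  with perp_eq_radial [OF t n] show ?thesis by simp
qed

text \<open>The fourth-order equation at v = y + t w, separated by powers of t.\<close>

lemma quartic_part:
  assumes y: "y \<in> tang p" and w: "w \<in> normal p"
  shows "9 * (norm (G p y y))\<^sup>2 + 2 * inner (G y y y) y = 3 * norm y ^ 4"
    and "inner (G w w y) y = 3 * (norm (G p y w))\<^sup>2 - (norm y)\<^sup>2 * (norm w)\<^sup>2"
    and "inner (G w w w) y = 0"
    and "inner (G w w w) w = norm w ^ 4"
proof -
  have yp: "inner y p = 0" "G p p y = (1/3) *\<^sub>R y" and wp: "inner w p = 0" "G p p w = - w"
    using y w normal_perp [OF fp] by (auto simp: tang_def normal_def)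
  have yw: "inner y w = 0" "inner w y = 0" using tang_normal_perp [OF fp y w] by auto
  define a b where "a = G p y y" and "b = G p y w"
  define ry rw where "ry = inner y y" and "rw = inner w w"
  define e0 e1 e2 e3 e4 where "e0 = inner (G y y y) y" and "e1 = inner (G y y y) w" and "e2 = inner (G y y w) w"
    and "e3 = inner (G w w w) y" and "e4 = inner (G w w w) w"
  have e: "inner (G y y w) y = e1" "inner (G y w w) y = e2" "inner (G y w w) w = e3" "inner (G w w y) y = e2"
    unfolding e0_def e1_def e2_def e3_def e4_def by (metis inner_swap G_sym)+
  have ap: "inner a p = ry / 3" and bp: "inner b p = 0"
    using inner_swap [of p y y p] inner_swap [of p y w p] swap23 [of p y p] yp yw by (simp_all add: a_def b_def ry_def)
  have pp: "inner p p = 1" by (rule focal_inner [OF fp])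
  have Gww: "G p w w = - rw *\<^sub>R p" unfolding rw_def by (rule G_normal_normal [OF w w])
  have "(9 * inner a a + 2 * e0 - 3 * ry\<^sup>2) + (36 * inner a b) * t + (36 * inner b b - 12 * ry * rw - 12 * e2) * t^2
      + (- 16 * e3) * t^3 + (6 * rw\<^sup>2 - 6 * e4) * t^4 = 0" for t
  proof -
    define v where "v = y + t *\<^sub>R w"
    define k where "k = a + (2 * t) *\<^sub>R b - (t\<^sup>2 * rw) *\<^sub>R p"
    have "9 * (norm (G p v v))\<^sup>2 + 6 * inner (G p p v) (G v v v) = 3 * (norm v) ^ 4"
      by (rule expansion(3) [OF fp]) (simp add: v_def inner_add_left yp wp)
    moreover have "G p v v = k"
      unfolding v_def G_square by (simp add: k_def a_def b_def Gww)
    moreover have "norm v ^ 4 = (ry + t\<^sup>2 * rw)\<^sup>2"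
    proof -
      have "(norm v)\<^sup>2 = ry + t\<^sup>2 * rw"
        unfolding power2_norm_eq_inner v_def ry_def rw_def
        by (simp add: inner_add_left inner_add_right yw power2_eq_square)
      then show ?thesis using power_mult [of "norm v" 2 2] by simp
    qed
    moreover have "(norm k)\<^sup>2 = inner a a + 4 * t * inner a b + t\<^sup>2 * (4 * inner b b - 2 * rw * ry / 3) + t^4 * rw\<^sup>2"
      unfolding power2_norm_eq_inner k_def
      by (simp add: inner_add_left inner_add_right inner_diff_left inner_diff_right ap bp pp inner_commute [of p a]
        inner_commute [of p b] inner_commute [of b a])
        (simp add: algebra_simps power2_eq_square eval_nat_numeral)
    moreover have "inner (G p p v) (G v v v) = e0 / 3 + t\<^sup>2 * (- 2 * e2) + t^3 * (- 8/3 * e3) - t^4 * e4"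
      unfolding v_def G_cube
      by (simp add: G_add G_scale yp wp inner_add_left inner_add_right inner_diff_left inner_diff_right
            inner_commute [of y "G _ _ _"] inner_commute [of w "G _ _ _"] e flip: e0_def e1_def e2_def e3_def e4_def)
        (simp add: algebra_simps power2_eq_square eval_nat_numeral)
    ultimately show ?thesis
      by (simp add: algebra_simps power2_eq_square eval_nat_numeral)
  qed
  note z = poly4_coeffs_zero [OF this]
  have n4: "norm u ^ 4 = (inner u u)\<^sup>2" for u :: 'a
    using power_mult [of "norm u" 2 2] by (simp add: power2_norm_eq_inner)
  show "9 * (norm (G p y y))\<^sup>2 + 2 * inner (G y y y) y = 3 * norm y ^ 4"
    using z(1) by (simp add: n4 power2_norm_eq_inner [of "G p y y"] a_def e0_def ry_def)
  show "inner (G w w y) y = 3 * (norm (G p y w))\<^sup>2 - (norm y)\<^sup>2 * (norm w)\<^sup>2"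
    using z(3) by (simp add: e power2_norm_eq_inner b_def ry_def rw_def)
  show "inner (G w w w) y = 0" using z(4) by (simp add: e3_def)
  show "inner (G w w w) w = norm w ^ 4" using z(5) by (simp add: n4 e4_def rw_def)
qed

text \<open>On the normal space the quartic form is |w|^4, so polarization gives the normal
  component of the cube; the tangential and radial components vanish by \<open>quartic_part\<close>
  and \<open>G_normal_normal\<close>. It follows that unit normals are focal points, which is what
  makes mirror constructions possible.\<close>

lemma G_normal_cube:
  assumes w: "w \<in> normal p"
  shows "G w w w = (norm w)\<^sup>2 *\<^sub>R w"
proof -
  define a where "a = G w w w - (norm w)\<^sup>2 *\<^sub>R w"
  have zero: "0 \<in> tang p" by (auto simp: tang_def)
  have t: "inner a y = 0" if "y \<in> tang p" for y
    using quartic_part(3) [OF that w] tang_normal_perp [OF fp that w] by (simp add: a_def inner_diff_left)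
  have n: "inner a w' = 0" if w': "w' \<in> normal p" for w'
  proof -
    define c where "c = inner w w'"
    have "0 + 4 * (inner (G w w w) w' - (norm w)\<^sup>2 * c) * t + (6 * inner (G w w w') w' - 2 * (norm w)\<^sup>2 * (norm
      w')\<^sup>2 - 4 * c\<^sup>2) * t^2
        + (4 * inner (G w' w' w') w - 4 * c * (norm w')\<^sup>2) * t^3 + 0 * t^4 = 0" for t
    proof -
      define v where "v = w + t *\<^sub>R w'"
      have "inner (G v v v) v = norm v ^ 4"
        unfolding v_def by (rule quartic_part(4) [OF zero]) (intro subspace_add subspace_scale subspace_normal [OF fp] w w')
      also have "(norm v)\<^sup>2 = (norm w)\<^sup>2 + 2 * t * c + t\<^sup>2 * (norm w')\<^sup>2"
        unfolding v_def c_def power2_norm_eq_inner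
        by (simp add: inner_add_left inner_add_right inner_commute power2_eq_square algebra_simps)
      then have "norm v ^ 4 = ((norm w)\<^sup>2 + 2 * t * c + t\<^sup>2 * (norm w')\<^sup>2)\<^sup>2"
        using power_mult [of "norm v" 2 2] by simp
      finally have 1: "inner (G v v v) v = ((norm w)\<^sup>2 + 2 * t * c + t\<^sup>2 * (norm w')\<^sup>2)\<^sup>2" .
      have s: "inner (G w w w') w = inner (G w w w) w'" "inner (G w w' w') w = inner (G w w w') w'"
        "inner (G w w' w') w' = inner (G w' w' w') w"
        by (metis inner_swap G_sym)+
      have "inner (G v v v) v = (norm w)^4 + 4 * t * inner (G w w w) w' + 6 * t\<^sup>2 * inner (G w w w') w'
          + 4 * t^3 * inner (G w' w' w') w + t^4 * (norm w')^4"
        unfolding v_def G_cube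
        by (simp add: inner_add_left inner_add_right s quartic_part(4) [OF zero w] quartic_part(4) [OF zero w'])
          (simp add: algebra_simps power2_eq_square eval_nat_numeral)
      with 1 show ?thesis
        by (simp add: algebra_simps power2_eq_square eval_nat_numeral)
    qed
    from poly4_coeffs_zero(2) [OF this] show ?thesis by (simp add: a_def c_def inner_diff_left)
  qed
  have "inner (G w w w) p = 0"
    using inner_swap [of w w w p] swap23 [of w w p] swap12 [of w p w] G_normal_normal [OF w w]
      normal_perp [OF fp w] by (simp add: inner_commute)
  then have "inner a p = 0" by (simp add: a_def inner_diff_left normal_perp [OF fp w])
  with perp_eq_radial [OF t n] show ?thesis by (simp add: a_def)
qed

lemma G_normal_focal: "w \<in> normal p \<Longrightarrow> norm w = 1 \<Longrightarrow> focal_point w"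
  by (simp add: focal_point_def G_normal_cube flip: power2_norm_eq_inner)

lemma G_tang_normal_mem:
  assumes y: "y \<in> tang p" and w: "w \<in> normal p"
  shows "G p w y \<in> tang p"
proof (rule perp_mem_tang)
  show "inner (G p w y) p = 0"
    using inner_swap [of p w y p] swap23 [of p w p] w tang_normal_perp [OF fp y w] by (simp add: normal_def)
  show "inner (G p w y) w' = 0" if "w' \<in> normal p" for w'
    using inner_swap [of p w y w'] G_normal_normal [OF w that] y by (simp add: tang_def inner_commute)
qed

text \<open>By \<open>quartic_part\<close> the quadratic form of the difference T of the two sides
  vanishes on \<open>tang p\<close>; T is symmetric and preserves that space. The identity expresses
  G w w there through the square of the shape operator.\<close>

lemma G_normal_normal_tang:
  assumes y: "y \<in> tang p" and w: "w \<in> normal p"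
  shows "G w w y = 3 *\<^sub>R G p w (G p w y) - (norm w)\<^sup>2 *\<^sub>R y"
proof -
  have Gt: "G w w y \<in> tang p"
  proof (rule perp_mem_tang)
    show "inner (G w w y) p = 0"
      using inner_swap [of w w y p] swap23 [of w w p] swap12 [of w p w] G_normal_normal [OF w w] y
      by (simp add: tang_def inner_commute)
    fix w' assume w': "w' \<in> normal p"
    have "inner (G (w + t *\<^sub>R w') (w + t *\<^sub>R w') (w + t *\<^sub>R w')) y = 0" for t
      by (rule quartic_part(3) [OF y]) (intro subspace_add subspace_scale subspace_normal [OF fp] w w')
    from this [of 1] this [of "-1"] have "inner (G w w w') y = 0"
      using quartic_part(3) [OF y w] quartic_part(3) [OF y w'] unfolding G_cube by (simp add: inner_add_left inner_diff_left)
    then show "inner (G w w y) w' = 0" by (simp add: inner_swap [of w w y])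
  qed
  define T where "T y = 3 *\<^sub>R G p w (G p w y) - (norm w)\<^sup>2 *\<^sub>R y - G w w y" for y
  have Tt: "T y \<in> tang p"
    unfolding T_def by (intro subspace_diff subspace_scale subspace_tang [OF fp] G_tang_normal_mem y w Gt)
  have sym: "inner (T u) v = inner u (T v)" for u v
    using inner_swap [of p w "G p w u" v] inner_swap [of p w "G p w v" u] inner_swap [of w w u v]
    by (simp add: T_def inner_diff_left inner_diff_right inner_commute [of u] inner_commute [of "G p w v"])
  have T0: "inner (T u) u = 0" if u: "u \<in> tang p" for u
  proof -
    have "inner (G p w (G p w u)) u = (norm (G p u w))\<^sup>2"
      using inner_swap [of p w "G p w u" u] swap23 [of p u w] by (simp add: power2_norm_eq_inner)
    then show ?thesis
      using quartic_part(2) [OF u w] by (simp add: T_def inner_diff_left power2_norm_eq_inner)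
  qed
  have linT: "T (a + b) = T a + T b" for a b by (simp add: T_def G_add algebra_simps)
  \<comment> \<open>The quadratic form vanishes at y, at T y and at their sum, so the cross term 2
    |T y|^2 vanishes too.\<close>
  have "inner (T y) (T y) = 0"
    using T0 [OF y] T0 [OF Tt] T0 [OF subspace_add [OF subspace_tang [OF fp] y Tt]] sym [of y "T y"]
    by (simp add: linT inner_add_left inner_add_right inner_commute)
  then show ?thesis by (simp add: T_def)
qed

end

end

text \<open>The coefficients of F along rays through 0 up to degree four, each given by some
  multilinear map. Symmetry is deliberately left out: without it the property passes directly to
  products, and one symmetrization at the end suffices.\<close>

definition quartic_jet where
  "quartic_jet F c L B T Q \<longleftrightarrow> linear L \<and> (\<forall>a. linear (B a)) \<and> (\<forall>b. linear (\<lambda>a. B a b)) \<and>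
    (\<forall>a b. linear (T a b)) \<and> (\<forall>a c. linear (\<lambda>b. T a b c)) \<and> (\<forall>b c. linear (\<lambda>a. T a b c)) \<and>
    (\<forall>a b c. linear (Q a b c)) \<and> (\<forall>a b d. linear (\<lambda>c. Q a b c d)) \<and>
    (\<forall>a c d. linear (\<lambda>b. Q a b c d)) \<and> (\<forall>b c d. linear (\<lambda>a. Q a b c d)) \<and>
    (\<forall>x. \<exists>p. (\<forall>t. F (t *\<^sub>R x) = poly p t) \<and> coeff p 0 = c \<and> coeff p 1 = L x \<and> coeff p 2 = B x x \<and>
      coeff p 3 = T x x x \<and> coeff p 4 = Q x x x x)"
  for F :: "'a::euclidean_space \<Rightarrow> real"

text \<open>Induction over polynomial functions. The jet of a product is the Cauchy product of the
  jets, multilinear because the two factors receive disjoint sets of arguments.\<close>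

lemma polynomial_quartic_jet:
  assumes "real_polynomial_function F"
  shows "\<exists>c L B T Q. quartic_jet F c L B T Q"
  using assms
proof induction
  case (linear f)
  then have l: "linear f" by (simp add: bounded_linear.linear)
  show ?case
    unfolding quartic_jet_def
  proof (intro exI conjI allI)
    fix x
    show "f (t *\<^sub>R x) = poly [:0, f x:] t" for t by (simp add: linear_scale [OF l])
  qed (auto simp: l linear_zero coeff_pCons split: nat.split)
next
  case (const c)
  show ?case
    unfolding quartic_jet_def
    by (intro exI [of _ c] exI [of _ "\<lambda>_. 0"] exI [of _ "\<lambda>_ _. 0"] exI [of _ "\<lambda>_ _ _. 0"] exI [of _ "\<lambda>_ _ _ _. 0"]
      conjI allI)
      (auto simp: linear_zero intro!: exI [of _ "[:c:]"] simp: coeff_pCons split: nat.split)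
next
  case (add f g)
  then obtain c L B T Q c' L' B' T' Q' where jets: "quartic_jet f c L B T Q" "quartic_jet g c' L' B' T' Q'"
    by blast
  from jets(1) have f: "linear L" "\<And>a. linear (B a)" "\<And>b. linear (\<lambda>a. B a b)"
    "\<And>a b. linear (T a b)" "\<And>a c. linear (\<lambda>b. T a b c)" "\<And>b c. linear (\<lambda>a. T a b c)"
    "\<And>a b c. linear (Q a b c)" "\<And>a b d. linear (\<lambda>c. Q a b c d)"
    "\<And>a c d. linear (\<lambda>b. Q a b c d)" "\<And>b c d. linear (\<lambda>a. Q a b c d)"
    "\<And>x. \<exists>p. (\<forall>t. f (t *\<^sub>R x) = poly p t) \<and> coeff p 0 = c \<and> coeff p 1 = L x \<and> coeff p 2 = B x x \<and>
      coeff p 3 = T x x x \<and> coeff p 4 = Q x x x x"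
    unfolding quartic_jet_def by auto
  from jets(2) have g: "linear L'" "\<And>a. linear (B' a)" "\<And>b. linear (\<lambda>a. B' a b)"
    "\<And>a b. linear (T' a b)" "\<And>a c. linear (\<lambda>b. T' a b c)" "\<And>b c. linear (\<lambda>a. T' a b c)"
    "\<And>a b c. linear (Q' a b c)" "\<And>a b d. linear (\<lambda>c. Q' a b c d)"
    "\<And>a c d. linear (\<lambda>b. Q' a b c d)" "\<And>b c d. linear (\<lambda>a. Q' a b c d)"
    "\<And>x. \<exists>p. (\<forall>t. g (t *\<^sub>R x) = poly p t) \<and> coeff p 0 = c' \<and> coeff p 1 = L' x \<and> coeff p 2 = B' x x \<and>
      coeff p 3 = T' x x x \<and> coeff p 4 = Q' x x x x"
    unfolding quartic_jet_def by auto
  show ?case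
    unfolding quartic_jet_def
  proof (intro exI [of _ "c + c'"] exI [of _ "\<lambda>a. L a + L' a"] exI [of _ "\<lambda>a b. B a b + B' a b"]
      exI [of _ "\<lambda>a b c. T a b c + T' a b c"] exI [of _ "\<lambda>a b c d. Q a b c d + Q' a b c d"] conjI allI)
    fix x
    obtain p p' where "\<forall>t. f (t *\<^sub>R x) = poly p t" "coeff p 0 = c" "coeff p 1 = L x" "coeff p 2 = B x x"
      "coeff p 3 = T x x x" "coeff p 4 = Q x x x x" "\<forall>t. g (t *\<^sub>R x) = poly p' t" "coeff p' 0 = c'" "coeff p' 1 = L' x"
      "coeff p' 2 = B' x x" "coeff p' 3 = T' x x x" "coeff p' 4 = Q' x x x x"
      using f(11) g(11) by metis
    then show "\<exists>p. (\<forall>t. f (t *\<^sub>R x) + g (t *\<^sub>R x) = poly p t) \<and> coeff p 0 = c + c' \<and> coeff p 1 = L x + L' x \<and>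
        coeff p 2 = B x x + B' x x \<and> coeff p 3 = T x x x + T' x x x \<and> coeff p 4 = Q x x x x + Q' x x x x"
      by (intro exI [of _ "p + p'"]) simp
  qed (intro linear_compose_add f g)+
next
  case (mult f g)
  then obtain c L B T Q c' L' B' T' Q' where jets: "quartic_jet f c L B T Q" "quartic_jet g c' L' B' T' Q'"
    by blast
  from jets(1) have f: "linear L" "\<And>a. linear (B a)" "\<And>b. linear (\<lambda>a. B a b)"
    "\<And>a b. linear (T a b)" "\<And>a c. linear (\<lambda>b. T a b c)" "\<And>b c. linear (\<lambda>a. T a b c)"
    "\<And>a b c. linear (Q a b c)" "\<And>a b d. linear (\<lambda>c. Q a b c d)"
    "\<And>a c d. linear (\<lambda>b. Q a b c d)" "\<And>b c d. linear (\<lambda>a. Q a b c d)"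
    "\<And>x. \<exists>p. (\<forall>t. f (t *\<^sub>R x) = poly p t) \<and> coeff p 0 = c \<and> coeff p 1 = L x \<and> coeff p 2 = B x x \<and>
      coeff p 3 = T x x x \<and> coeff p 4 = Q x x x x"
    unfolding quartic_jet_def by auto
  from jets(2) have g: "linear L'" "\<And>a. linear (B' a)" "\<And>b. linear (\<lambda>a. B' a b)"
    "\<And>a b. linear (T' a b)" "\<And>a c. linear (\<lambda>b. T' a b c)" "\<And>b c. linear (\<lambda>a. T' a b c)"
    "\<And>a b c. linear (Q' a b c)" "\<And>a b d. linear (\<lambda>c. Q' a b c d)"
    "\<And>a c d. linear (\<lambda>b. Q' a b c d)" "\<And>b c d. linear (\<lambda>a. Q' a b c d)"
    "\<And>x. \<exists>p. (\<forall>t. g (t *\<^sub>R x) = poly p t) \<and> coeff p 0 = c' \<and> coeff p 1 = L' x \<and> coeff p 2 = B' x x \<and>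
      coeff p 3 = T' x x x \<and> coeff p 4 = Q' x x x x"
    unfolding quartic_jet_def by auto
  have lc: "linear (\<lambda>a. r * h a)" "linear (\<lambda>a. h a * r)" if "linear h" for h :: "'a \<Rightarrow> real" and r
    using linear_compose_scale_right [OF that, of r] by (simp_all add: mult.commute)
  show ?case
    unfolding quartic_jet_def
  proof (intro exI [of _ "c * c'"] exI [of _ "\<lambda>a. c * L' a + L a * c'"] exI [of _ "\<lambda>a b. c * B' a b + L a * L' b +
    B a b * c'"]
      exI [of _ "\<lambda>a b d. c * T' a b d + L a * B' b d + B a b * L' d + T a b d * c'"]
      exI [of _ "\<lambda>a b d e. c * Q' a b d e + L a * T' b d e + B a b * B' d e + T a b d * L' e + Q a b d e * c'"] conjI allI)
    fix x
    obtain p p' where p: "\<forall>t. f (t *\<^sub>R x) = poly p t" "coeff p 0 = c" "coeff p 1 = L x" "coeff p 2 = B x x"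
      "coeff p 3 = T x x x" "coeff p 4 = Q x x x x" "\<forall>t. g (t *\<^sub>R x) = poly p' t" "coeff p' 0 = c'" "coeff p' 1 = L' x"
      "coeff p' 2 = B' x x" "coeff p' 3 = T' x x x" "coeff p' 4 = Q' x x x x"
      using f(11) g(11) by metis
    have sums: "(\<Sum>i\<le>0. h i) = h 0" "(\<Sum>i\<le>1. h i) = h 0 + h 1" "(\<Sum>i\<le>2. h i) = h 0 + h 1 + h 2"
      "(\<Sum>i\<le>3. h i) = h 0 + h 1 + h 2 + h 3" "(\<Sum>i\<le>4. h i) = h 0 + h 1 + h 2 + h 3 + h 4" for h :: "nat \<Rightarrow> real"
      by (simp_all add: eval_nat_numeral)
    show "\<exists>p. (\<forall>t. f (t *\<^sub>R x) * g (t *\<^sub>R x) = poly p t) \<and> coeff p 0 = c * c' \<and> coeff p 1 = c * L' x + L x * c' \<and>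
        coeff p 2 = c * B' x x + L x * L' x + B x x * c' \<and>
        coeff p 3 = c * T' x x x + L x * B' x x + B x x * L' x + T x x x * c' \<and>
        coeff p 4 = c * Q' x x x x + L x * T' x x x + B x x * B' x x + T x x x * L' x + Q x x x x * c'"
      by (intro exI [of _ "p * p'"] conjI) (simp_all only: coeff_mult sums poly_mult, simp_all add: p p(3)
        [unfolded One_nat_def] p(9) [unfolded One_nat_def])
  qed (intro linear_compose_add lc f g)+
qed

section \<open>Focal submanifolds of isoparametric hypersurfaces\<close>

context quartic_form
begin

lemma bounded_bilinear_G: "bounded_bilinear (\<lambda>a b. G a b c)"
  "bounded_bilinear (\<lambda>a c. G a b c)" "bounded_bilinear (\<lambda>b c. G a b c)"
  unfolding bilinear_conv_bounded_bilinear [symmetric] bilinear_def by (simp_all add: lin lin1 lin2)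

lemma G_basis_sum: "G a b c = (\<Sum>i\<in>Basis. inner a i *\<^sub>R G i b c)"
proof -
  have "G (\<Sum>i\<in>Basis. inner a i *\<^sub>R i) b c = (\<Sum>i\<in>Basis. inner a i *\<^sub>R G i b c)"
    by (simp add: linear_sum [OF lin1] G_scale)
  then show ?thesis by (simp add: euclidean_representation)
qed

text \<open>The product rule for a trilinear map, reduced to the bilinear rule by expanding the
  first argument in the basis.\<close>

lemma G_has_vector_derivative:
  fixes a b c :: "real \<Rightarrow> 'a"
  assumes a: "(a has_vector_derivative a') (at t)" and b: "(b has_vector_derivative b') (at t)"
    and c: "(c has_vector_derivative c') (at t)"
  shows "((\<lambda>s. G (a s) (b s) (c s)) has_vector_derivative (G a' (b t) (c t) + G (a t) b' (c t) + G (a t) (b t) c')) (at t)"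
proof -
  have "((\<lambda>s. \<Sum>i\<in>Basis. inner (a s) i *\<^sub>R G i (b s) (c s)) has_vector_derivative
      (\<Sum>i\<in>Basis. inner (a t) i *\<^sub>R (G i (b t) c' + G i b' (c t)) + inner a' i *\<^sub>R G i (b t) (c t))) (at t)"
  proof (rule has_vector_derivative_sum)
    fix i :: 'a assume "i \<in> Basis"
    have "((\<lambda>s. inner (a s) i) has_vector_derivative inner a' i) (at t)"
      by (rule bounded_linear.has_vector_derivative [OF bounded_linear_inner_left a])
    then show "((\<lambda>s. inner (a s) i *\<^sub>R G i (b s) (c s)) has_vector_derivative
        inner (a t) i *\<^sub>R (G i (b t) c' + G i b' (c t)) + inner a' i *\<^sub>R G i (b t) (c t)) (at t)"
      by (intro bounded_bilinear.has_vector_derivative [OF bounded_bilinear_scaleR]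
          bounded_bilinear.has_vector_derivative [OF bounded_bilinear_G(3)] b c)
  qed
  moreover have "(\<Sum>i\<in>Basis. inner (a t) i *\<^sub>R (G i (b t) c' + G i b' (c t)) + inner a' i *\<^sub>R G i (b t) (c t)) =
      G a' (b t) (c t) + G (a t) b' (c t) + G (a t) (b t) c'"
    unfolding G_basis_sum [of a' "b t" "c t"] G_basis_sum [of "a t" b' "c t"] G_basis_sum [of "a t" "b t" c']
    by (simp add: sum.distrib scaleR_add_right)
  moreover have "(\<lambda>s. \<Sum>i\<in>Basis. inner (a s) i *\<^sub>R G i (b s) (c s)) = (\<lambda>s. G (a s) (b s) (c s))"
    by (rule ext) (rule G_basis_sum [symmetric])
  ultimately show ?thesis by simp
qed

text \<open>The orthogonal projection onto \<open>tang p\<close> is 3/4 times G p p + 1 - 2 <., p>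
  p: it gives 0, 1, 0 on p, \<open>tang p\<close> and \<open>normal p\<close>. Its trace is the
  dimension.\<close>

lemma trace_projection:
  assumes fp: "focal_point p"
  shows "real (dim (tang p)) = 3/4 * ((\<Sum>b\<in>Basis. inner (G p p b) b) + real DIM('a) - 2)"
proof -
  obtain B where B: "B \<subseteq> tang p" "pairwise orthogonal B" "\<And>x. x \<in> B \<Longrightarrow> norm x = 1"
    "independent B" "card B = dim (tang p)" "span B = tang p"
    using orthonormal_basis_subspace [OF subspace_tang [OF fp]] by metis
  have finB: "finite B" using B(4) by (rule independent_imp_finite)
  have key: "3/4 * (inner (G p p v) v + inner v v - 2 * (inner v p)\<^sup>2) = (\<Sum>u\<in>B. (inner v u)\<^sup>2)" for v
  proof -
    obtain y w where d: "y \<in> tang p" "w \<in> normal p" "v = inner v p *\<^sub>R p + y + w"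
      by (rule decomposition [OF fp])
    define s where "s = inner v p"
    have v: "v = s *\<^sub>R p + y + w" using d(3) by (simp add: s_def)
    have o: "inner y w = 0" "inner w y = 0" "inner p w = 0" "inner w p = 0" "inner p y = 0" "inner y p = 0" "inner p p = 1"
      using tang_normal_perp [OF fp d(1,2)] normal_perp [OF fp d(2)] d(1) focal_inner [OF fp]
      by (simp_all add: tang_def inner_commute)
    have "G p p v = s *\<^sub>R p + (1/3) *\<^sub>R y - w"
      using d(1,2) by (simp add: v G_add G_scale focal_G [OF fp] tang_def normal_def)
    then have 1: "3/4 * (inner (G p p v) v + inner v v - 2 * s\<^sup>2) = inner y y"
      by (simp add: v inner_add_left inner_add_right inner_diff_left o power2_eq_square)
    have "y = (\<Sum>u\<in>B. inner y u *\<^sub>R u)"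
    proof -
      have "y \<in> span B" using B d by simp
      then obtain c where c: "y = (\<Sum>u\<in>B. c u *\<^sub>R u)" using span_finite [OF finB] by auto
      have "inner y u = c u" if "u \<in> B" for u
      proof -
        have "inner y u = (\<Sum>u'\<in>B. c u' * inner u' u)" by (simp add: c inner_sum_left)
        also have "\<dots> = (\<Sum>u'\<in>B. if u' = u then c u else 0)"
          using B(2,3) that by (intro sum.cong) (auto simp: pairwise_def orthogonal_def norm_eq_sqrt_inner)
        finally show ?thesis using finB that by simp
      qed
      then show ?thesis using c by (metis (no_types, lifting) sum.cong)
    qed
    then have "inner y y = inner y (\<Sum>u\<in>B. inner y u *\<^sub>R u)" by simp
    also have "\<dots> = (\<Sum>u\<in>B. (inner y u)\<^sup>2)" by (simp add: inner_sum_right power2_eq_square)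
    also have "\<dots> = (\<Sum>u\<in>B. (inner v u)\<^sup>2)"
    proof (rule sum.cong [OF refl])
      fix u assume "u \<in> B"
      then have "u \<in> tang p" using B(1) by blast
      then have "inner p u = 0" "inner w u = 0"
        using tang_normal_perp [OF fp _ d(2), of u] by (simp_all add: tang_def inner_commute)
      then show "(inner y u)\<^sup>2 = (inner v u)\<^sup>2" by (simp add: v inner_add_left)
    qed
    finally show ?thesis using 1 by (simp add: s_def)
  qed
  have "3/4 * ((\<Sum>b\<in>Basis. inner (G p p b) b) + real DIM('a) - 2) =
      (\<Sum>b\<in>Basis. 3/4 * (inner (G p p b) b + inner b b - 2 * (inner b p)\<^sup>2))"
  proof -
    have "(\<Sum>b\<in>Basis. (inner b p)\<^sup>2) = inner p p"
      using euclidean_inner [of p p] by (simp add: power2_eq_square inner_commute)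
    then have p: "(\<Sum>b\<in>Basis. (inner b p)\<^sup>2) = 1" by (simp add: focal_inner [OF fp])
    have "(\<Sum>b\<in>Basis. inner (G p p b) b + inner b b - 2 * (inner b p)\<^sup>2) =
        (\<Sum>b\<in>Basis. inner (G p p b) b) + (\<Sum>b\<in>(Basis::'a set). inner b b) - 2 * (\<Sum>b\<in>Basis. (inner b p)\<^sup>2)"
      by (simp add: sum.distrib sum_subtractf sum_distrib_left)
    also have "\<dots> = (\<Sum>b\<in>Basis. inner (G p p b) b) + real DIM('a) - 2" by (simp add: p)
    finally show ?thesis by (simp only: sum_distrib_left [symmetric])
  qed
  also have "\<dots> = (\<Sum>b\<in>Basis. \<Sum>u\<in>B. (inner b u)\<^sup>2)" by (simp only: key)
  also have "\<dots> = (\<Sum>u\<in>B. \<Sum>b\<in>Basis. (inner b u)\<^sup>2)" by (rule sum.swap)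
  also have "\<dots> = (\<Sum>u\<in>B. inner u u)"
  proof (rule sum.cong [OF refl])
    show "(\<Sum>b\<in>Basis. (inner b u)\<^sup>2) = inner u u" for u :: 'a
      using euclidean_inner [of u u] by (simp add: power2_eq_square inner_commute)
  qed
  also have "\<dots> = real (card B)"
    using B(3) by (simp add: norm_eq_sqrt_inner)
  finally show ?thesis using B(5) by simp
qed

end

text \<open>\<open>\<tau>\<close> is the constant in the Laplace equation, restated as a trace of G,
  and \<open>dims\<close> is the dimension of \<open>tang p\<close> that this trace predicts. Both
  focal submanifolds are instances, the second with - G and - F.\<close>

locale focal_geometry = quartic_form G
  for G :: "'a::euclidean_space \<Rightarrow> 'a \<Rightarrow> 'a \<Rightarrow> 'a" +
  fixes F :: "'a \<Rightarrow> real" and \<tau> :: real and d :: nat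
  assumes F_eq: "F z = inner (G z z z) z"
    and trace: "(\<Sum>b\<in>Basis. inner (G z z b) b) = \<tau> * (norm z)\<^sup>2"
    and dims: "real d = 3/4 * (\<tau> + real DIM('a) - 2)"
    and submfd: "submanifold d (focal F)"
begin

section \<open>Tangent spaces, normal spaces and shape operators in terms of G\<close>

lemma focal_iff: "p \<in> focal F \<longleftrightarrow> focal_point p"
  by (simp add: focal_def focal_point_def F_eq)

text \<open>Differentiation of G \<gamma> \<gamma> \<gamma> = \<gamma> along a curve of focal points
  gives 3 G p p v = v.\<close>

lemma tangent_space_subset:
  assumes p: "p \<in> focal F"
  shows "tangent_space (focal F) p \<subseteq> tang p"
proof
  fix v assume "v \<in> tangent_space (focal F) p"
  then obtain \<epsilon> \<gamma> where \<gamma>: "smooth_curve_in (focal F) \<epsilon> \<gamma>" "\<gamma> 0 = p" "(\<gamma> has_vector_derivative v) (at 0)"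
    by (auto simp: tangent_space_def)
  then have \<epsilon>: "open {-\<epsilon><..<\<epsilon>}" "0 \<in> {-\<epsilon><..<\<epsilon>}" "\<And>s. s \<in> {-\<epsilon><..<\<epsilon>} \<Longrightarrow> focal_point (\<gamma> s)"
    by (auto simp: smooth_curve_in_def focal_iff)
  have "((\<lambda>s. G (\<gamma> s) (\<gamma> s) (\<gamma> s)) has_vector_derivative v) (at 0)"
    by (rule has_vector_derivative_transform_within_open [OF \<gamma>(3) \<epsilon>(1,2)]) (simp add: \<epsilon>(3) focal_G)
  moreover have "((\<lambda>s. G (\<gamma> s) (\<gamma> s) (\<gamma> s)) has_vector_derivative (G v p p + G p v p + G p p v)) (at 0)"
    using G_has_vector_derivative [OF \<gamma>(3) \<gamma>(3) \<gamma>(3)] by (simp add: \<gamma>(2))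
  ultimately have "v = G v p p + G p v p + G p p v" by (rule vector_derivative_unique_at)
  moreover have "G v p p = G p p v" "G p v p = G p p v" by (metis G_sym)+
  moreover have "3 *\<^sub>R G p p v = G p p v + G p p v + G p p v"
    using scaleR_left_distrib [of 2 1 "G p p v"] by (simp add: scaleR_2)
  ultimately have "v = 3 *\<^sub>R G p p v" by simp
  then have "(1/3) *\<^sub>R v = (1/3) *\<^sub>R (3 *\<^sub>R G p p v)" by simp
  then have g: "G p p v = (1/3) *\<^sub>R v" by simp
  have "inner (G p p v) p = inner v p" using p by (simp add: inner_Gpp focal_iff)
  then have "inner v p = 0" by (simp add: g)
  with g show "v \<in> tang p" by (simp add: tang_def)
qed

text \<open>The tangent space lies between a d-dimensional subspace coming from the chart and
  \<open>tang p\<close>, which has dimension d by the trace formula.\<close>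

lemma tangent_space_eq:
  assumes p: "p \<in> focal F"
  shows "tangent_space (focal F) p = tang p"
proof -
  have fp: "focal_point p" using p by (simp add: focal_iff)
  obtain S where S: "subspace S" "dim S = d" "S \<subseteq> tangent_space (focal F) p"
    by (rule submanifold_tangent_space [OF submfd p])
  have "norm p = 1" using fp by (simp add: focal_point_def)
  then have "real (dim (tang p)) = real d"
    using trace_projection [OF fp] trace [of p] dims by simp
  then have "S = tang p"
    using S tangent_space_subset [OF p] subspace_tang [OF fp] by (intro subspace_dim_equal) auto
  then show ?thesis using S tangent_space_subset [OF p] by auto
qed

lemma normal_space_eq:
  assumes p: "p \<in> focal F"
  shows "normal_space (focal F) p = normal p"
proof -
  have fp: "focal_point p" using p by (simp add: focal_iff)
  have "\<nu> \<in> normal p" if \<nu>: "inner \<nu> p = 0" "\<forall>v\<in>tang p. inner \<nu> v = 0" for \<nu>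
  proof -
    obtain y w where d: "y \<in> tang p" "w \<in> normal p" "\<nu> = inner \<nu> p *\<^sub>R p + y + w"
      by (rule decomposition [OF fp])
    then have "inner y y = 0" using \<nu> tang_normal_perp [OF fp d(1,2)]
      by (metis add_cancel_right_left inner_add_left scaleR_zero_left add.left_neutral add.right_neutral)
    then show ?thesis using d \<nu> by simp
  qed
  then show ?thesis
    unfolding normal_space_def tangent_space_eq [OF p]
    using normal_perp [OF fp] tang_normal_perp [OF fp] by blast
qed

text \<open>Differentiating G \<gamma> \<gamma> N = - N and pairing with a tangent z gives - (4/3)
  <N', z> = 2 <G p \<nu> y, z>, hence the factor 3/2. As \<open>shape_operator\<close> is a definite
  description, uniqueness has to be shown as well, and this requires a normal field along some
  curve.\<close>

lemma shape_operator_eq: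
  assumes p: "p \<in> focal F" and \<nu>: "\<nu> \<in> normal p" and y: "y \<in> tang p"
  shows "shape_operator (focal F) p \<nu> y = (3/2) *\<^sub>R G p \<nu> y"
proof -
  have fp: "focal_point p" using p by (simp add: focal_iff)
  have mem: "(3/2) *\<^sub>R G p \<nu> y \<in> tang p"
    by (intro subspace_scale subspace_tang fp G_tang_normal_mem y \<nu>)
  have weingarten: "inner N' z = - inner ((3/2) *\<^sub>R G p \<nu> y) z"
    if c: "smooth_curve_in (focal F) \<epsilon> \<gamma>" "\<gamma> 0 = p" "(\<gamma> has_vector_derivative y) (at 0)"
      and N: "\<forall>s\<in>{-\<epsilon><..<\<epsilon>}. N s \<in> normal_space (focal F) (\<gamma> s)" "N 0 = \<nu>"
        "(N has_vector_derivative N') (at 0)" and z: "z \<in> tang p" for \<epsilon> \<gamma> N N' z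
  proof -
    have \<epsilon>: "open {-\<epsilon><..<\<epsilon>}" "0 \<in> {-\<epsilon><..<\<epsilon>}" "\<And>s. s \<in> {-\<epsilon><..<\<epsilon>} \<Longrightarrow> \<gamma> s \<in> focal F"
      using c(1) by (auto simp: smooth_curve_in_def)
    have "((\<lambda>s. G (\<gamma> s) (\<gamma> s) (N s)) has_vector_derivative - N') (at 0)"
    proof (rule has_vector_derivative_transform_within_open [OF _ \<epsilon>(1,2)])
      show "((\<lambda>s. - N s) has_vector_derivative - N') (at 0)" using N(3) by (rule has_vector_derivative_minus)
      show "- N s = G (\<gamma> s) (\<gamma> s) (N s)" if "s \<in> {-\<epsilon><..<\<epsilon>}" for s
      proof -
        have "N s \<in> normal (\<gamma> s)" using N(1) that normal_space_eq [OF \<epsilon>(3) [OF that]] by blast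
        then show ?thesis by (simp add: normal_def)
      qed
    qed
    moreover have "((\<lambda>s. G (\<gamma> s) (\<gamma> s) (N s)) has_vector_derivative (G y p \<nu> + G p y \<nu> + G p p N')) (at 0)"
      using G_has_vector_derivative [OF c(3) c(3) N(3)] by (simp add: c(2) N(2))
    ultimately have "- N' = G y p \<nu> + G p y \<nu> + G p p N'" by (rule vector_derivative_unique_at)
    moreover have "G y p \<nu> = G p \<nu> y" "G p y \<nu> = G p \<nu> y" by (metis G_sym)+
    ultimately have "inner (- N') z = inner (G p \<nu> y + G p \<nu> y + G p p N') z" by simp
    then have "- inner N' z = 2 * inner (G p \<nu> y) z + inner (G p p N') z" by (simp add: inner_add_left)
    also have "inner (G p p N') z = inner N' z / 3"
      using inner_swap [of p p N' z] z by (simp add: tang_def inner_commute)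
    finally show ?thesis by simp
  qed
  obtain \<epsilon> \<gamma> where \<gamma>: "smooth_curve_in (focal F) \<epsilon> \<gamma>" "\<gamma> 0 = p" "(\<gamma> has_vector_derivative y) (at 0)"
  proof -
    have "y \<in> tangent_space (focal F) p" using y tangent_space_eq [OF p] by simp
    then show thesis using that by (auto simp: tangent_space_def)
  qed
  \<comment> \<open>The orthogonal projection of \<nu> onto the normal space at \<gamma> s; written
    through G, it is visibly smooth in s.\<close>
  define N where "N s = (1/4) *\<^sub>R \<nu> + ((1/2) *\<^sub>R (inner (\<gamma> s) \<nu> *\<^sub>R \<gamma> s) + (-3/4) *\<^sub>R G (\<gamma> s) (\<gamma> s) \<nu>)" for s
  have "smooth_on {-\<epsilon><..<\<epsilon>} N"
    unfolding smooth_on_def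
  proof
    fix k
    have \<gamma>k: "Ck_on k {-\<epsilon><..<\<epsilon>} \<gamma>" using \<gamma>(1) by (simp add: smooth_curve_in_def smooth_on_def)
    have b: "bounded_bilinear (\<lambda>u v. (1/2) *\<^sub>R (inner u \<nu> *\<^sub>R v) + (-3/4) *\<^sub>R G u v \<nu>)"
      unfolding bilinear_conv_bounded_bilinear [symmetric] bilinear_def linear_iff
      by (simp add: G_add G_scale inner_add_left algebra_simps)
    show "Ck_on k {-\<epsilon><..<\<epsilon>} N"
      unfolding N_def by (intro Ck_on_add Ck_on_const Ck_on_bilinear [OF _ b] \<gamma>k) auto
  qed
  have "N s \<in> normal_space (focal F) (\<gamma> s)" if s: "s \<in> {-\<epsilon><..<\<epsilon>}" for s
  proof -
    have "\<gamma> s \<in> focal F" using \<gamma>(1) s by (simp add: smooth_curve_in_def)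
    then have f: "focal_point (\<gamma> s)" by (simp add: focal_iff)
    obtain y w where d: "y \<in> tang (\<gamma> s)" "w \<in> normal (\<gamma> s)" "\<nu> = inner \<nu> (\<gamma> s) *\<^sub>R \<gamma> s + y + w"
      by (rule decomposition [OF f])
    define r where "r = inner (\<gamma> s) \<nu>"
    have \<nu>': "\<nu> = r *\<^sub>R \<gamma> s + y + w" using d(3) by (simp add: r_def inner_commute)
    have G\<nu>: "G (\<gamma> s) (\<gamma> s) \<nu> = r *\<^sub>R \<gamma> s + (1/3) *\<^sub>R y - w"
      using d(1,2) by (subst \<nu>') (simp add: G_add G_scale focal_G [OF f] tang_def normal_def)
    have "N s = (1/4) *\<^sub>R \<nu> + ((1/2) *\<^sub>R (r *\<^sub>R \<gamma> s) + (-3/4) *\<^sub>R (r *\<^sub>R \<gamma> s + (1/3) *\<^sub>R y - w))"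
      by (simp only: N_def G\<nu> r_def)
    also have "\<dots> = w" unfolding \<nu>'
      by (rule vector_eq_ldot [THEN iffD1], rule allI) (simp add: inner_add_right inner_diff_right field_simps)
    finally show ?thesis using d(2) normal_space_eq [OF \<open>\<gamma> s \<in> focal F\<close>] by simp
  qed
  moreover have N0: "N 0 = \<nu>"
    using \<nu> normal_perp [OF fp \<nu>] by (simp add: N_def \<gamma>(2) normal_def inner_commute flip: scaleR_add_left)
  moreover have "(N has_vector_derivative frechet_derivative N (at 0) 1) (at 0)"
  proof -
    have "(N has_derivative frechet_derivative N (at 0)) (at 0)"
      by (rule smooth_on_has_derivative [OF \<open>smooth_on {-\<epsilon><..<\<epsilon>} N\<close>]) (use \<gamma>(1) in \<open>auto simp: smooth_curve_in_def\<close>)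
    moreover from this have "frechet_derivative N (at 0) = (\<lambda>h. h *\<^sub>R frechet_derivative N (at 0) 1)"
      by (intro ext) (metis has_derivative_linear linear_scale mult.right_neutral real_scaleR_def)
    ultimately show ?thesis by (simp add: has_vector_derivative_def)
  qed
  moreover note \<open>smooth_on {-\<epsilon><..<\<epsilon>} N\<close>
  ultimately have unique: "v = (3/2) *\<^sub>R G p \<nu> y"
    if v: "v \<in> tang p" "\<forall>\<epsilon> \<gamma> N N'. smooth_curve_in (focal F) \<epsilon> \<gamma> \<and> \<gamma> 0 = p \<and> (\<gamma> has_vector_derivative y) (at 0) \<and>
            smooth_on {-\<epsilon><..<\<epsilon>} N \<and> (\<forall>s\<in>{-\<epsilon><..<\<epsilon>}. N s \<in> normal_space (focal F) (\<gamma> s)) \<and>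
            N 0 = \<nu> \<and> (N has_vector_derivative N') (at 0) \<longrightarrow>
            (\<forall>z\<in>tang p. inner v z = - inner N' z)" for v
  proof -
    define N' where "N' = frechet_derivative N (at 0) 1"
    have N: "\<forall>s\<in>{-\<epsilon><..<\<epsilon>}. N s \<in> normal_space (focal F) (\<gamma> s)" "(N has_vector_derivative N') (at 0)"
      using \<open>\<And>s. s \<in> {-\<epsilon><..<\<epsilon>} \<Longrightarrow> N s \<in> normal_space (focal F) (\<gamma> s)\<close>
        \<open>(N has_vector_derivative frechet_derivative N (at 0) 1) (at 0)\<close> by (auto simp: N'_def)
    define z where "z = v - (3/2) *\<^sub>R G p \<nu> y"
    have z: "z \<in> tang p" unfolding z_def by (intro subspace_diff subspace_tang fp v mem)
    have "inner v z = - inner N' z"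
      using v(2) [rule_format, of \<epsilon> \<gamma> N N' z] \<gamma> N N0 \<open>smooth_on {-\<epsilon><..<\<epsilon>} N\<close> z by blast
    moreover have "inner N' z = - inner ((3/2) *\<^sub>R G p \<nu> y) z"
      by (rule weingarten [OF \<gamma> N(1) N0 N(2) z])
    ultimately have "inner z z = 0" by (simp add: z_def inner_diff_left)
    then show ?thesis by (simp add: z_def)
  qed
  show ?thesis
    unfolding shape_operator_def tangent_space_eq [OF p]
  proof (rule the_equality)
    show "(3/2) *\<^sub>R G p \<nu> y \<in> tang p \<and> (\<forall>\<epsilon> \<gamma> N N'. smooth_curve_in (focal F) \<epsilon> \<gamma> \<and> \<gamma> 0 = p \<and>
            (\<gamma> has_vector_derivative y) (at 0) \<and>
            smooth_on {-\<epsilon><..<\<epsilon>} N \<and> (\<forall>s\<in>{-\<epsilon><..<\<epsilon>}. N s \<in> normal_space (focal F) (\<gamma> s)) \<and>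
            N 0 = \<nu> \<and> (N has_vector_derivative N') (at 0) \<longrightarrow>
            (\<forall>z\<in>tang p. inner ((3/2) *\<^sub>R G p \<nu> y) z = - inner N' z))"
      using mem weingarten by (metis add.inverse_inverse)
  qed (use unique in blast)
qed

end

text \<open>Homogeneity leaves only the degree-four part of the jet. It is averaged over all
  permutations, and the inner product turns the last argument of the resulting symmetric form into
  the value of G.\<close>

lemma homogeneous_quartic_form:
  fixes F :: "'a::euclidean_space \<Rightarrow> real"
  assumes "real_polynomial_function F" and hom: "\<And>c x. F (c *\<^sub>R x) = c ^ 4 * F x"
  obtains G :: "'a \<Rightarrow> 'a \<Rightarrow> 'a \<Rightarrow> 'a" where "\<And>a b. linear (G a b)" "\<And>a b c. G a b c = G b a c" "\<And>a b c. G a b c = G a c b"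
    "\<And>a b c d. inner (G a b c) d = inner (G a b d) c" "\<And>z. F z = inner (G z z z) z"
proof -
  obtain c L B T Q where "quartic_jet F c L B T Q"
    using polynomial_quartic_jet [OF assms(1)] by blast
  then have linQ: "\<And>a b c. linear (Q a b c)" "\<And>a b d. linear (\<lambda>c. Q a b c d)"
      "\<And>a c d. linear (\<lambda>b. Q a b c d)" "\<And>b c d. linear (\<lambda>a. Q a b c d)"
    and "\<forall>x. \<exists>p. (\<forall>t. F (t *\<^sub>R x) = poly p t) \<and> coeff p 0 = c \<and> coeff p 1 = L x \<and> coeff p 2 = B x x \<and>
      coeff p 3 = T x x x \<and> coeff p 4 = Q x x x x"
    unfolding quartic_jet_def by simp_all
  then have jet: "\<And>x. \<exists>p. (\<forall>t. F (t *\<^sub>R x) = poly p t) \<and> coeff p 4 = Q x x x x" by blast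
  have FQ: "F x = Q x x x x" for x
  proof -
    obtain p where p: "\<And>t. F (t *\<^sub>R x) = poly p t" "coeff p 4 = Q x x x x" using jet by blast
    have "poly p t = poly (monom (F x) 4) t" for t
      using p(1) [of t] by (simp add: hom poly_monom mult.commute)
    then have "p = monom (F x) 4" by (simp add: poly_eq_poly_eq_iff [symmetric] fun_eq_iff)
    with p(2) show ?thesis by simp
  qed
  define P where "P q b c d = q b c d + q b d c + q c b d + q c d b + q d b c + q d c b" for q :: "'a \<Rightarrow> 'a \<Rightarrow> 'a \<Rightarrow>
    real" and b c d
  \<comment> \<open>Each argument takes the first slot once and \<open>P\<close> runs through the
    six orders of the other three: 24 terms.\<close>
  define S where "S a b c d = (P (Q a) b c d + P (Q b) a c d + P (Q c) a b d + P (Q d) a b c) * (1/24)" for a b c d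
  have S_sym: "S a b c d = S b a c d" "S a b c d = S a c b d" "S a b c d = S a b d c" for a b c d
    by (simp_all add: S_def P_def)
  have S_F: "S z z z z = F z" for z by (simp add: S_def P_def FQ)
  have mult: "linear (\<lambda>a. h a * r)" if "linear h" for h :: "'a \<Rightarrow> real" and r
    using linear_compose_scale_right [OF that, of r] by (simp add: mult.commute)
  have linS: "linear (S a b c)" for a b c
    unfolding S_def P_def by (intro mult linear_compose_add linQ)
  have linS': "linear (\<lambda>c. S a b c d)" for a b d using linS [of a b d] by (simp add: S_sym(3) [of a b _ d])
  define G where "G a b c = (\<Sum>i\<in>Basis. S a b c i *\<^sub>R i)" for a b c
  have inner_G: "inner (G a b c) d = S a b c d" for a b c d
  proof -
    have "S a b c d = S a b c (\<Sum>i\<in>Basis. inner d i *\<^sub>R i)" by (simp add: euclidean_representation)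
    also have "\<dots> = (\<Sum>i\<in>Basis. inner d i * S a b c i)"
      by (simp add: linear_sum [OF linS] linear_scale [OF linS])
    also have "\<dots> = inner (G a b c) d"
      by (subst inner_commute) (simp add: G_def inner_sum_right mult.commute)
    finally show ?thesis by simp
  qed
  show thesis
  proof
    show "linear (G a b)" for a b
      unfolding G_def
      by (rule linearI) (simp_all add: linear_add [OF linS'] linear_scale [OF linS'] scaleR_add_left sum.distrib
        scaleR_sum_right)
    show "G a b c = G b a c" for a b c by (simp only: G_def S_sym(1) [of a b c])
    show "G a b c = G a c b" for a b c by (simp only: G_def S_sym(2) [of a b c])
    show "inner (G a b c) d = inner (G a b d) c" for a b c d
      by (simp add: inner_G S_sym(3) [of a b c])
    show "F z = inner (G z z z) z" for z by (simp add: inner_G S_F)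
  qed
qed

text \<open>The first derivative of F is 4 G z z z and the second 12 G z z; the factor 2/3 is 8
  divided by 12.\<close>

lemma cartan_munzner_quartic_form:
  fixes F :: "'a::euclidean_space \<Rightarrow> real"
  assumes cm: "cartan_munzner m1 m2 F"
  obtains G where "quartic_form G" "\<And>z. F z = inner (G z z z) z"
    "\<And>z. (\<Sum>b\<in>Basis. inner (G z z b) b) = 2/3 * (real m2 - real m1) * (norm z)\<^sup>2"
proof -
  have poly: "real_polynomial_function F" and hom: "\<And>c x. F (c *\<^sub>R x) = c ^ 4 * F x"
    and grad: "\<And>x. \<exists>D. GDERIV F x :> D \<and> (norm D)\<^sup>2 = 16 * norm x ^ 6"
    and lap: "\<And>x. laplacian F x = 8 * (real m2 - real m1) * (norm x)\<^sup>2"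
    using cm by (auto simp: cartan_munzner_def)
  obtain G :: "'a \<Rightarrow> 'a \<Rightarrow> 'a \<Rightarrow> 'a" where lin: "\<And>a b. linear (G a b)" and sym: "\<And>a b c. G a b c = G b a c"
    "\<And>a b c. G a b c = G a c b"
    and swap: "\<And>a b c d. inner (G a b c) d = inner (G a b d) c" and F: "\<And>z. F z = inner (G z z z) z"
    using homogeneous_quartic_form [OF poly hom] by blast
  have lin2: "linear (\<lambda>b. G a b c)" for a c using lin [of a c] by (simp add: sym(2) [of a _ c])
  have lin1: "linear (\<lambda>a. G a b c)" for b c using lin2 [of b c] by (simp add: sym(1) [of _ b c])
  note G_add = linear_add [OF lin1] linear_add [OF lin2] linear_add [OF lin]
  note G_scale = linear_scale [OF lin1] linear_scale [OF lin2] linear_scale [OF lin]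
  have G3: "G b a a = G a a b" "G a b a = G a a b" for a b by (metis sym)+
  have line: "((\<lambda>s. z + s *\<^sub>R h) has_derivative (\<lambda>s. s *\<^sub>R h)) (at 0)" for z h :: 'a
    by (auto intro!: derivative_eq_intros)
  have frechet_line: "((\<lambda>s. f (z + s *\<^sub>R h)) has_real_derivative f' h) (at 0)"
    if "(f has_derivative f') (at z)" for f :: "'a \<Rightarrow> real" and f' z h
  proof -
    have "(f has_derivative f') (at (z + 0 *\<^sub>R h))" using that by simp
    from has_derivative_compose [OF line this]
    have "((\<lambda>s. f (z + s *\<^sub>R h)) has_derivative (\<lambda>s. f' (s *\<^sub>R h))) (at 0)" .
    moreover have "(\<lambda>s. f' (s *\<^sub>R h)) = (*) (f' h)"
      by (rule ext) (simp add: linear_scale [OF has_derivative_linear [OF that]] mult.commute)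
    ultimately show ?thesis by (simp add: has_field_derivative_def)
  qed
  have DF: "D = 4 *\<^sub>R G z z z" if "GDERIV F z :> D" for D z
  proof (rule vector_eq_ldot [THEN iffD1], rule allI)
    fix h
    have "((\<lambda>s. F (z + s *\<^sub>R h)) has_real_derivative inner h D) (at 0)"
      using frechet_line [of F "\<lambda>h. inner h D" z h] that by (simp add: gderiv_def)
    moreover have "F (z + s *\<^sub>R h) = F z + s * (4 * inner (G z z z) h) + s\<^sup>2 * (6 * inner (G z z h) h)
        + s^3 * (4 * inner (G h h h) z) + s^4 * F h" for s
      using swap [of z z h z] swap [of z h h z] sym(2) [of z h z] swap [of h h z h] sym(1) [of z h h] sym(2) [of h z h]
      by (simp add: F G_add G_scale inner_add_left inner_add_right G3)
        (simp add: algebra_simps eval_nat_numeral)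
    then have "((\<lambda>s. F (z + s *\<^sub>R h)) has_real_derivative 4 * inner (G z z z) h) (at 0)"
      by (auto intro!: derivative_eq_intros)
    ultimately show "inner h D = inner h (4 *\<^sub>R G z z z)"
      using DERIV_unique by (fastforce simp: inner_commute)
  qed
  have gd: "GDERIV F z :> 4 *\<^sub>R G z z z" for z using grad [of z] DF [of z] by blast
  have norm: "(norm (G z z z))\<^sup>2 = norm z ^ 6" for z
  proof -
    obtain D where D: "GDERIV F z :> D" "(norm D)\<^sup>2 = 16 * norm z ^ 6" using grad by blast
    from D(2) show ?thesis by (simp add: DF [OF D(1)] power_mult_distrib)
  qed
  have qf: "quartic_form G" by (rule quartic_form.intro [OF lin sym swap norm])
  then interpret quartic_form G .
  have fd: "frechet_derivative F (at z) b = 4 * inner (G z z z) b" for z b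
    using frechet_derivative_at [OF gd [unfolded gderiv_def]] by (metis inner_commute inner_scaleR_left)
  have "frechet_derivative (\<lambda>z. 4 * inner (G z z z) b) (at x) b = 12 * inner (G x x b) b" for x b
  proof -
    \<comment> \<open>Expanding two arguments leaves coordinate functions times a linear map, from
      which differentiability is immediate.\<close>
    have "G z z z = (\<Sum>i\<in>Basis. \<Sum>j\<in>Basis. (inner z i * inner z j) *\<^sub>R G i j z)" for z
      by (subst G_basis_sum, subst swap12, subst G_basis_sum)
        (simp add: swap12 scaleR_sum_right)
    then have "(\<lambda>z. 4 * inner (G z z z) b) = (\<lambda>z. 4 * inner (\<Sum>i\<in>Basis. \<Sum>j\<in>Basis. (inner z i * inner z j) *\<^sub>R G i j z) b)"
      by simp
    moreover have "(\<lambda>z. 4 * inner (\<Sum>i\<in>Basis. \<Sum>j\<in>Basis. (inner z i * inner z j) *\<^sub>R G i j z) b) differentiable (at x)"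
    proof -
      have "(\<lambda>z. G i j z) differentiable (at x)" for i j
        by (intro linear_imp_differentiable lin)
      then show ?thesis
        by (auto intro!: derivative_intros differentiable_sum differentiable_scaleR differentiable_mult differentiable_inner)
    qed
    ultimately have "(\<lambda>z. 4 * inner (G z z z) b) differentiable (at x)" by simp
    then have "((\<lambda>z. 4 * inner (G z z z) b) has_derivative frechet_derivative (\<lambda>z. 4 * inner (G z z z) b) (at x)) (at x)"
      by (simp add: frechet_derivative_works)
    then have "((\<lambda>s. 4 * inner (G (x + s *\<^sub>R b) (x + s *\<^sub>R b) (x + s *\<^sub>R b)) b) has_real_derivative
        frechet_derivative (\<lambda>z. 4 * inner (G z z z) b) (at x) b) (at 0)"
      by (rule frechet_line)
    moreover have "((\<lambda>s. 4 * inner (G (x + s *\<^sub>R b) (x + s *\<^sub>R b) (x + s *\<^sub>R b)) b) has_real_derivative 12 * inner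
      (G x x b) b) (at 0)"
      unfolding G_cube inner_add_left inner_scaleR_left by (auto intro!: derivative_eq_intros)
    ultimately show ?thesis by (rule DERIV_unique)
  qed
  then have "laplacian F z = (\<Sum>b\<in>Basis. 12 * inner (G z z b) b)" for z
    by (simp add: laplacian_def fd)
  then have L: "12 * (\<Sum>b\<in>Basis. inner (G z z b) b) = 8 * (real m2 - real m1) * (norm z)\<^sup>2" for z
    using lap [of z] by (simp add: sum_distrib_left)
  have "(\<Sum>b\<in>Basis. inner (G z z b) b) = 2/3 * (real m2 - real m1) * (norm z)\<^sup>2" for z
    using L [of z] by (simp add: algebra_simps)
  with that qf F show thesis by blast
qed

text \<open>The dimensions are 32 - 1 - 8 = 23 and 32 - 1 - 9 = 22, in agreement with (3/4)(30 +
  2/3) and (3/4)(30 - 2/3).\<close>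

lemma isoparametric_focal_geometry:
  fixes F :: "real ^ 32 \<Rightarrow> real"
  assumes iso: "isoparametric 7 8 F M"
  obtains G where "focal_geometry G F (2/3) 23" "focal_geometry (\<lambda>a b c. - G a b c) (\<lambda>z. - F z) (- 2/3) 22"
proof -
  have cm: "cartan_munzner 7 8 F" using iso by (simp add: isoparametric_def)
  obtain G where G: "quartic_form G" "\<And>z. F z = inner (G z z z) z"
    and tr: "\<And>z. (\<Sum>b\<in>Basis. inner (G z z b) b) = 2/3 * (real 8 - real 7) * (norm z)\<^sup>2"
    using cartan_munzner_quartic_form [OF cm] by blast
  have sub: "submanifold 23 (focal F)" "submanifold 22 (focal (\<lambda>z. - F z))"
    using iso by (simp_all add: isoparametric_def)
  interpret quartic_form G by (rule G(1))
  have neg: "quartic_form (\<lambda>a b c. - G a b c)"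
    by (rule quartic_form.intro) (auto simp: norm_G linear_compose_neg [OF lin] intro: swap12 swap23 inner_swap)
  show thesis
  proof
    show "focal_geometry G F (2/3) 23"
      by (intro focal_geometry.intro focal_geometry_axioms.intro G sub) (simp_all add: tr)
    show "focal_geometry (\<lambda>a b c. - G a b c) (\<lambda>z. - F z) (- 2/3) 22"
      by (intro focal_geometry.intro focal_geometry_axioms.intro neg sub) (simp_all add: tr G(2) sum_negf)
  qed
qed

section \<open>The third fundamental form at a mirror point\<close>

lemma norm_linear_isometry:
  assumes "linear f" "\<And>z. norm (f z) = norm z"
  shows "inner (f z) (f w) = inner z w"
  using assms(2) [of "z + w"] assms(2) [of z] assms(2) [of w]
  by (simp add: dot_norm linear_add [OF assms(1), symmetric])

definition im :: "octonion \<Rightarrow> octonion" where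
  "im X = X - inner X (oe 0) *\<^sub>R oe 0"

lemma inner_oe_0: "inner (oe 0) (oe 0) = 1"
  by (simp add: inner_oe)

lemma im_orth [simp]: "inner (im X) (oe 0) = 0"
  by (simp add: im_def inner_diff_left inner_oe_0)

lemma im_im [simp]: "im (im X) = im X"
  by (simp add: im_def [of "im X"])

lemma im_decomp: "X = inner X (oe 0) *\<^sub>R oe 0 + im X"
  by (simp add: im_def)

lemma im_eq: "inner X (oe 0) = 0 \<Longrightarrow> im X = X"
  by (simp add: im_def)

lemma linear_im: "linear im"
  by (rule linearI) (simp_all add: im_def inner_add_left algebra_simps)

lemma im_oe: "im (oe 0) = 0" "b \<in> {1..7} \<Longrightarrow> im (oe b) = oe b"
  by (simp_all add: im_def inner_oe)

lemma norm_im: "(norm X)\<^sup>2 = (inner X (oe 0))\<^sup>2 + (norm (im X))\<^sup>2"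
proof -
  have "inner X X = inner (inner X (oe 0) *\<^sub>R oe 0 + im X) (inner X (oe 0) *\<^sub>R oe 0 + im X)"
    by (simp only: im_decomp [symmetric])
  also have "\<dots> = (inner X (oe 0))\<^sup>2 + inner (im X) (im X)"
    by (simp add: inner_add_left inner_add_right inner_oe_0 inner_commute [of "oe 0" "im X"] power2_eq_square)
  finally show ?thesis by (simp only: power2_norm_eq_inner)
qed

text \<open>Here \<phi> parametrizes the normal space at x and \<psi> the normal space at n0, with
  \<psi> e0 = x and \<phi> e0 = n0; \<open>\<phi>p\<close> and \<open>\<phi>m\<close> parametrize
  V_+ and V_-. \<open>G_x\<close> and \<open>G_n\<close> are the second fundamental forms at these
  two points. The main unknown is G (\<phi> X) (\<psi> Y) on V_+ + V_- for imaginary X and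
  Y.\<close>

locale mirror_frame = quartic_form G + C: unital_composition circ
  for G :: "'a::euclidean_space \<Rightarrow> 'a \<Rightarrow> 'a \<Rightarrow> 'a" and circ :: "octonion \<Rightarrow> octonion \<Rightarrow> octonion"  (infixl \<open>\<star>\<close> 70) +
  fixes \<phi> \<psi> \<phi>p \<phi>m :: "octonion \<Rightarrow> 'a"
  assumes lin_frame: "linear \<phi>" "linear \<psi>" "linear \<phi>p" "linear \<phi>m"
    and iso: "inner (\<phi> z) (\<phi> w) = inner z w" "inner (\<psi> z) (\<psi> w) = inner z w"
      "inner (\<phi>p z) (\<phi>p w) = inner z w" "inner (\<phi>m z) (\<phi>m w) = inner z w"
    and orth: "inner (\<phi> z) (\<psi> w) = 0" "inner (\<phi> z) (\<phi>p w) = 0" "inner (\<phi> z) (\<phi>m w) = 0"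
      "inner (\<psi> z) (\<phi>p w) = 0" "inner (\<psi> z) (\<phi>m w) = 0" "inner (\<phi>p z) (\<phi>m w) = 0"
    and spanning: "\<exists>X Y W Z. v = \<phi> X + \<psi> Y + \<phi>p W + \<phi>m Z"
    and G_ppp: "G (\<phi> X) (\<phi> X) (\<phi> X) = (norm X)\<^sup>2 *\<^sub>R \<phi> X"
    and G_ppr: "G (\<phi> X) (\<phi> X) (\<psi> Y) = - ((norm X)\<^sup>2 *\<^sub>R \<psi> Y)"
    and G_ppv: "G (\<phi> X) (\<phi> X) (\<phi>p W + \<phi>m Z) = ((norm X)\<^sup>2 / 3) *\<^sub>R (\<phi>p W + \<phi>m Z)"
    and G_rrr: "G (\<psi> Y) (\<psi> Y) (\<psi> Y) = (norm Y)\<^sup>2 *\<^sub>R \<psi> Y"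
    and G_rrp: "G (\<psi> Y) (\<psi> Y) (\<phi> X) = - ((norm Y)\<^sup>2 *\<^sub>R \<phi> X)"
    and G_rrv: "G (\<psi> Y) (\<psi> Y) (\<phi>p W + \<phi>m Z) = ((norm Y)\<^sup>2 / 3) *\<^sub>R (\<phi>p W + \<phi>m Z)"
    and G_x: "G (\<phi> X) (\<psi> (oe 0)) (\<phi>p W + \<phi>m Z) =
      (2/3) *\<^sub>R (\<phi>p (inner X (oe 0) *\<^sub>R W + im X \<cdot> Z) - \<phi>m (im X \<cdot> W + inner X (oe 0) *\<^sub>R Z))"
    and G_n: "G (\<phi> (oe 0)) (\<psi> Y) (\<phi>p W + \<phi>m Z) =
      (2/3) *\<^sub>R (\<phi>p (inner Y (oe 0) *\<^sub>R W + im Y \<star> Z) - \<phi>m (im Y \<star> W + inner Y (oe 0) *\<^sub>R Z))"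
begin

definition V where "V W Z = \<phi>p W + \<phi>m Z"

lemmas frame_add = linear_add [OF lin_frame(1)] linear_add [OF lin_frame(2)] linear_add [OF lin_frame(3)]
  linear_add [OF lin_frame(4)]
lemmas frame_scale = linear_scale [OF lin_frame(1)] linear_scale [OF lin_frame(2)] linear_scale [OF lin_frame(3)]
  linear_scale [OF lin_frame(4)]
lemmas frame_0 = linear_0 [OF lin_frame(1)] linear_0 [OF lin_frame(2)] linear_0 [OF lin_frame(3)] linear_0 [OF lin_frame(4)]
lemmas frame_diff = linear_diff [OF lin_frame(1)] linear_diff [OF lin_frame(2)] linear_diff [OF lin_frame(3)]
  linear_diff [OF lin_frame(4)]
lemmas frame_neg = linear_neg [OF lin_frame(1)] linear_neg [OF lin_frame(2)] linear_neg [OF lin_frame(3)]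
  linear_neg [OF lin_frame(4)]

lemma orth': "inner (\<psi> w) (\<phi> z) = 0" "inner (\<phi>p w) (\<phi> z) = 0" "inner (\<phi>m w) (\<phi> z) = 0"
      "inner (\<phi>p w) (\<psi> z) = 0" "inner (\<phi>m w) (\<psi> z) = 0" "inner (\<phi>m w) (\<phi>p z) = 0"
  using orth by (simp_all add: inner_commute)

lemma inner_V: "inner (V W Z) (V W' Z') = inner W W' + inner Z Z'" "inner (V W Z) (\<phi> X) = 0" "inner (V W Z) (\<psi> X) = 0"
    "inner (\<phi> X) (V W Z) = 0" "inner (\<psi> X) (V W Z) = 0"
  by (simp_all add: V_def inner_add_left inner_add_right iso orth orth')

lemma V_scale: "r *\<^sub>R V W Z = V (r *\<^sub>R W) (r *\<^sub>R Z)"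
  by (simp add: V_def frame_scale scaleR_add_right)

lemma V_norm: "(norm (V W Z))\<^sup>2 = (norm W)\<^sup>2 + (norm Z)\<^sup>2"
  by (simp add: power2_norm_eq_inner inner_V)

lemma norm_frame: "norm (\<phi> X) = norm X" "norm (\<psi> X) = norm X"
  by (simp_all add: norm_eq_sqrt_inner iso)

lemma focal_\<phi>: "norm X = 1 \<Longrightarrow> focal_point (\<phi> X)"
  by (simp add: focal_point_def norm_frame G_ppp iso flip: power2_norm_eq_inner)

lemma focal_\<psi>: "norm X = 1 \<Longrightarrow> focal_point (\<psi> X)"
  by (simp add: focal_point_def norm_frame G_rrr iso flip: power2_norm_eq_inner)

lemma V_tang_\<phi>: "norm X = 1 \<Longrightarrow> V W Z \<in> tang (\<phi> X)"
  by (simp add: tang_def inner_V) (simp add: V_def G_ppv)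

lemma V_tang_\<psi>: "norm X = 1 \<Longrightarrow> V W Z \<in> tang (\<psi> X)"
  by (simp add: tang_def inner_V) (simp add: V_def G_rrv)

lemma \<psi>_normal_\<phi>: "norm X = 1 \<Longrightarrow> \<psi> Y \<in> normal (\<phi> X)"
  by (simp add: normal_def G_ppr)

lemma unit_multiple:
  fixes X :: octonion
  obtains r X' where "X = r *\<^sub>R X'" "norm X' = 1" "r = norm X"
proof (cases "X = 0")
  case True
  then show thesis using that [of 0 "oe 0"] by (simp add: norm_oe)
next
  case False
  then show thesis using that [of "norm X" "X /\<^sub>R norm X"] by simp
qed

lemma V_cubic_\<phi>: "inner (G (\<phi> X) (V W Z) (V W' Z')) (V W'' Z'') = 0"
proof -
  obtain r X' where X: "X = r *\<^sub>R X'" "norm X' = 1" by (rule unit_multiple [of X]) 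
  then show ?thesis
    using tang_cubic [OF focal_\<phi> [OF X(2)] V_tang_\<phi> [OF X(2)] V_tang_\<phi> [OF X(2)] V_tang_\<phi> [OF X(2)], of W Z W' Z'
      W'' Z''] by (simp add: frame_scale G_scale)
qed

lemma V_cubic_\<psi>: "inner (G (\<psi> X) (V W Z) (V W' Z')) (V W'' Z'') = 0"
proof -
  obtain r X' where X: "X = r *\<^sub>R X'" "norm X' = 1" by (rule unit_multiple [of X]) 
  then show ?thesis
    using tang_cubic [OF focal_\<psi> [OF X(2)] V_tang_\<psi> [OF X(2)] V_tang_\<psi> [OF X(2)] V_tang_\<psi> [OF X(2)], of W Z W' Z'
      W'' Z''] by (simp add: frame_scale G_scale)
qed

text \<open>For a unit X', \<psi> Y is normal at the focal point \<phi> X'. There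
  \<open>quartic_part\<close> and \<open>G_rrv\<close> express three times this squared norm as (1/3
  + 1) |Y|^2 |v|^2.\<close>

lemma norm_G_prv: "(norm (G (\<phi> X) (\<psi> Y) (V W Z)))\<^sup>2 = 4/9 * ((norm X)\<^sup>2 * (norm Y)\<^sup>2 * ((norm W)\<^sup>2 + (norm Z)\<^sup>2))"
proof -
  obtain r X' where X: "X = r *\<^sub>R X'" "norm X' = 1" "r = norm X" by (rule unit_multiple [of X])
  have "inner (G (\<psi> Y) (\<psi> Y) (V W Z)) (V W Z) =
      3 * (norm (G (\<phi> X') (V W Z) (\<psi> Y)))\<^sup>2 - (norm (V W Z))\<^sup>2 * (norm (\<psi> Y))\<^sup>2"
    by (rule quartic_part(2) [OF focal_\<phi> V_tang_\<phi> \<psi>_normal_\<phi>]) (rule X(2))+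
  moreover have "inner (G (\<psi> Y) (\<psi> Y) (V W Z)) (V W Z) = (norm Y)\<^sup>2 / 3 * (norm (V W Z))\<^sup>2"
    using G_rrv [of Y W Z] by (simp add: power2_norm_eq_inner flip: V_def)
  ultimately have "(norm (G (\<phi> X') (\<psi> Y) (V W Z)))\<^sup>2 = 4/9 * ((norm Y)\<^sup>2 * (norm (V W Z))\<^sup>2)"
    by (simp add: norm_frame swap23 [of "\<phi> X'" "V W Z"])
  then show ?thesis
    by (simp add: X(1) frame_scale G_scale power_mult_distrib V_norm) (simp add: X(2,3))
qed

text \<open>By symmetry of G, a component along \<phi> or \<psi> would contradict the polarized
  forms of \<open>G_ppv\<close> or \<open>G_rrv\<close>, which preserve V_+ + V_-.\<close>

lemma G_prv_mem: "\<exists>W' Z'. G (\<phi> X) (\<psi> Y) (V W Z) = V W' Z'"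
proof -
  obtain A B W' Z' where *: "G (\<phi> X) (\<psi> Y) (V W Z) = \<phi> A + \<psi> B + \<phi>p W' + \<phi>m Z'" using spanning by blast
  have A: "inner (G (\<phi> X) (\<psi> Y) (V W Z)) (\<phi> A) = 0"
  proof -
    have "inner (G (\<phi> (X + t *\<^sub>R A)) (\<phi> (X + t *\<^sub>R A)) (V W Z)) (\<psi> Y) = 0" for t
      using G_ppv [of "X + t *\<^sub>R A" W Z] by (simp add: inner_V flip: V_def)
    from this [of 1] this [of "-1"] have "inner (G (\<phi> X) (\<phi> A) (V W Z)) (\<psi> Y) = 0"
      by (simp add: frame_add frame_diff frame_neg G_add G_diff G_minus inner_add_left inner_diff_left swap12 [of
        "\<phi> A" "\<phi> X"])
    then show ?thesis by (metis inner_swap G_sym)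
  qed
  have B: "inner (G (\<phi> X) (\<psi> Y) (V W Z)) (\<psi> B) = 0"
  proof -
    have "inner (G (\<psi> (Y + t *\<^sub>R B)) (\<psi> (Y + t *\<^sub>R B)) (V W Z)) (\<phi> X) = 0" for t
      using G_rrv [of "Y + t *\<^sub>R B" W Z] by (simp add: inner_V flip: V_def)
    from this [of 1] this [of "-1"] have "inner (G (\<psi> Y) (\<psi> B) (V W Z)) (\<phi> X) = 0"
      by (simp add: frame_add frame_diff frame_neg G_add G_diff G_minus inner_add_left inner_diff_left swap12 [of
        "\<psi> B" "\<psi> Y"])
    then show ?thesis by (metis inner_swap G_sym)
  qed
  have "inner A A = 0" "inner B B = 0"
    using A B by (simp_all add: * inner_add_left iso orth orth')
  then show ?thesis using * by (auto simp: V_def frame_0)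
qed

text \<open>The block from V_- to V_+ of the unknown part, with the factor 3/2 of shape operators.
  It will be - 1/2 times the third fundamental form at the mirror point.\<close>

definition m :: "octonion \<Rightarrow> octonion \<Rightarrow> octonion \<Rightarrow> octonion" where
  "m X Y Z = (3/2) *\<^sub>R adjoint \<phi>p (G (\<phi> (im X)) (\<psi> (im Y)) (\<phi>m Z))"

lemma adjoint_\<phi>p: "inner (adjoint \<phi>p v) W = inner v (\<phi>p W)"
  by (metis adjoint_works inner_commute lin_frame(3))

lemma inner_m: "inner (m X Y Z) W = 3/2 * inner (G (\<phi> (im X)) (\<psi> (im Y)) (\<phi>m Z)) (\<phi>p W)"
  by (simp add: m_def adjoint_\<phi>p)

text \<open>\<open>norm_G_prv\<close>, polarized in X and then in Y.\<close>

lemma inner_G_prv_swap: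
  assumes "inner X X' = 0" "inner Y Y' = 0"
  shows "inner (G (\<phi> X) (\<psi> Y) (V W Z)) (G (\<phi> X') (\<psi> Y') (V W Z))
       + inner (G (\<phi> X) (\<psi> Y') (V W Z)) (G (\<phi> X') (\<psi> Y) (V W Z)) = 0"
proof -
  define g where "g X Y = G (\<phi> X) (\<psi> Y) (V W Z)" for X Y
  define c where "c = 4/9 * ((norm W)\<^sup>2 + (norm Z)\<^sup>2)"
  have n: "inner (g X Y) (g X Y) = c * (inner X X * inner Y Y)" for X Y
    using norm_G_prv [of X Y W Z] by (simp add: g_def c_def power2_norm_eq_inner)
  have a: "g (X + X') Y = g X Y + g X' Y" "g X (Y + Y') = g X Y + g X Y'" for X X' Y Y'
    by (simp_all add: g_def frame_add G_add)
  have 1: "inner (g X Y) (g X' Y) = 0" if "inner X X' = 0" for X X' Y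
    using n [of "X + X'" Y] n [of X Y] n [of X' Y] that
    by (simp add: a inner_add_left inner_add_right inner_commute algebra_simps)
  show ?thesis
    using 1 [OF assms(1), of "Y + Y'"] 1 [OF assms(1), of Y] 1 [OF assms(1), of Y']
    by (simp add: a inner_add_left inner_add_right flip: g_def)
qed

lemma inner_G_prv_left:
  assumes "inner X X' = 0"
  shows "inner (G (\<phi> X) (\<psi> Y) (V W Z)) (G (\<phi> X') (\<psi> Y) (V W Z)) = 0"
proof -
  define g where "g X = G (\<phi> X) (\<psi> Y) (V W Z)" for X
  have n: "inner (g X) (g X) = 4/9 * (inner X X * inner Y Y * ((norm W)\<^sup>2 + (norm Z)\<^sup>2))" for X
    using norm_G_prv [of X Y W Z] by (simp add: g_def power2_norm_eq_inner)
  have a: "g (X + X') = g X + g X'" by (simp add: g_def frame_add G_add)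
  show ?thesis
    using n [of "X + X'"] n [of X] n [of X'] assms
    by (simp add: a inner_add_left inner_add_right inner_commute algebra_simps flip: g_def)
qed

lemma inner_G_prv_right:
  assumes "inner Y Y' = 0"
  shows "inner (G (\<phi> X) (\<psi> Y) (V W Z)) (G (\<phi> X) (\<psi> Y') (V W Z)) = 0"
proof -
  define g where "g Y = G (\<phi> X) (\<psi> Y) (V W Z)" for Y
  have n: "inner (g Y) (g Y) = 4/9 * (inner X X * inner Y Y * ((norm W)\<^sup>2 + (norm Z)\<^sup>2))" for Y
    using norm_G_prv [of X Y W Z] by (simp add: g_def power2_norm_eq_inner)
  have a: "g (Y + Y') = g Y + g Y'" by (simp add: g_def frame_add G_add)
  show ?thesis
    using n [of "Y + Y'"] n [of Y] n [of Y'] assms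
    by (simp add: a inner_add_left inner_add_right inner_commute algebra_simps flip: g_def)
qed

lemma orth_oe0: "inner (im X) (oe 0) = 0" "inner (oe 0) (im X) = 0"
  by (simp_all add: inner_commute [of "oe 0"])

lemma m_orth_left: "inner (im X \<cdot> Z) (m X Y Z) = 0"
proof -
  have "inner (G (\<phi> (im X)) (\<psi> (im Y)) (V 0 Z)) (G (\<phi> (im X)) (\<psi> (oe 0)) (V 0 Z)) = 0"
    by (rule inner_G_prv_right) (simp add: orth_oe0)
  then show ?thesis
    using G_x [of "im X" 0 Z] by (simp add: V_def frame_0 inner_m inner_commute [of "im X \<cdot> Z"] O.zero_right)
qed

lemma m_orth_right: "inner (im Y \<star> Z) (m X Y Z) = 0"
proof -
  have "inner (G (\<phi> (im X)) (\<psi> (im Y)) (V 0 Z)) (G (\<phi> (oe 0)) (\<psi> (im Y)) (V 0 Z)) = 0"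
    by (rule inner_G_prv_left) (simp add: orth_oe0)
  then show ?thesis
    using G_n [of "im Y" 0 Z] by (simp add: V_def frame_0 inner_m inner_commute [of "im Y \<star> Z"] C.zero_right)
qed

text \<open>\<open>inner_G_prv_swap\<close> pairs the unknown operator with G (\<phi> e0) (\<psi>
  e0), which is 2/3 on V_+ and - 2/3 on V_-; its partner in that identity involves only the two
  known second fundamental forms.\<close>

lemma diagonal_blocks:
  "inner (G (\<phi> (im X)) (\<psi> (im Y)) (\<phi>m Z)) (\<phi>m Z) = 2/3 * inner (im X \<cdot> Z) (im Y \<star> Z)"
  "inner (G (\<phi> (im X)) (\<psi> (im Y)) (\<phi>p W)) (\<phi>p W) = - (2/3) * inner (im X \<cdot> W) (im Y \<star> W)"
proof -
  have s: "inner (G (\<phi> (im X)) (\<psi> (im Y)) (V W Z)) (G (\<phi> (oe 0)) (\<psi> (oe 0)) (V W Z))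
       + inner (G (\<phi> (im X)) (\<psi> (oe 0)) (V W Z)) (G (\<phi> (oe 0)) (\<psi> (im Y)) (V W Z)) = 0" for W Z
    by (rule inner_G_prv_swap) (simp_all add: orth_oe0)
  show "inner (G (\<phi> (im X)) (\<psi> (im Y)) (\<phi>m Z)) (\<phi>m Z) = 2/3 * inner (im X \<cdot> Z) (im Y \<star> Z)"
    using s [of 0 Z] G_x [of "im X" 0 Z] G_n [of "im Y" 0 Z] G_n [of "oe 0" 0 Z]
    by (simp add: V_def frame_0 im_oe inner_oe_0 C.zero_right O.zero_right C.zero_left iso)
  show "inner (G (\<phi> (im X)) (\<psi> (im Y)) (\<phi>p W)) (\<phi>p W) = - (2/3) * inner (im X \<cdot> W) (im Y \<star> W)"
    using s [of W 0] G_x [of "im X" W 0] G_n [of "im Y" W 0] G_n [of "oe 0" W 0]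
    by (simp add: V_def frame_0 im_oe inner_oe_0 C.zero_right O.zero_right C.zero_left iso)
qed

end

lemma symmetric_operator_zero:
  fixes D :: "'a::real_inner \<Rightarrow> 'a"
  assumes "linear D" "\<And>z w. inner (D z) w = inner z (D w)" "\<And>z. inner (D z) z = 0"
  shows "D z = 0"
proof -
  have "inner (D z) (D z) = 0"
    using assms(3) [of "z + D z"] assms(3) [of z] assms(3) [of "D z"] assms(2) [of z "D z"]
    by (simp add: linear_add [OF assms(1)] inner_add_left inner_add_right inner_commute)
  then show ?thesis by simp
qed

section \<open>The quartic form on V_+ + V_- and the trace condition\<close>

context mirror_frame
begin

lemma G_rvv:
  defines "A \<equiv> \<lambda>Y W Z. adjoint \<phi> (G (\<psi> Y) (V W Z) (V W Z))"
  shows "G (\<psi> Y) (V W Z) (V W Z) = \<phi> (A Y W Z) + ((norm (V W Z))\<^sup>2 / 3) *\<^sub>R \<psi> Y"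
    and "inner (A Y W Z) X = inner (G (\<phi> X) (\<psi> Y) (V W Z)) (V W Z)"
proof -
  define v where "v = V W Z"
  have inner_A: "inner (A Y W Z) X = inner (G (\<psi> Y) v v) (\<phi> X)" for X
    unfolding A_def v_def by (metis adjoint_works inner_commute lin_frame(1))
  have "inner (G (\<psi> Y) v v) (\<phi> X) = inner (G (\<phi> X) (\<psi> Y) v) v" for X by (metis inner_swap G_sym)
  then show "inner (A Y W Z) X = inner (G (\<phi> X) (\<psi> Y) (V W Z)) (V W Z)"
    by (simp add: inner_A flip: v_def)
  obtain a b c d where *: "G (\<psi> Y) v v = \<phi> a + \<psi> b + \<phi>p c + \<phi>m d" using spanning by blast
  have "inner a X = inner (A Y W Z) X" for X
    unfolding inner_A * by (simp add: inner_add_left iso orth orth')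
  then have a: "a = A Y W Z" using vector_eq_rdot by blast
  have "inner (G (\<psi> Y) v v) (V c d) = 0" using V_cubic_\<psi> [of Y W Z W Z c d] by (simp add: v_def)
  then have "inner c c + inner d d = 0"
    unfolding * by (simp add: V_def inner_add_left inner_add_right iso orth orth')
  then have cd: "c = 0" "d = 0" by (metis add_nonneg_eq_0_iff inner_eq_zero_iff inner_ge_zero)+
  have "inner b Y' = inner (((norm v)\<^sup>2 / 3) *\<^sub>R Y) Y'" for Y'
  proof -
    have rr: "inner (G (\<psi> (Y + t *\<^sub>R Y')) (\<psi> (Y + t *\<^sub>R Y')) v) v = (norm (Y + t *\<^sub>R Y'))\<^sup>2 / 3 * (norm v)\<^sup>2" for t
      using G_rrv [of "Y + t *\<^sub>R Y'" W Z] by (simp add: v_def power2_norm_eq_inner flip: V_def)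
    have "4 * inner (G (\<psi> Y) (\<psi> Y') v) v = 4 * (inner Y Y' / 3 * (norm v)\<^sup>2)"
      using rr [of 1] rr [of "-1"] swap12 [of "\<psi> Y'" "\<psi> Y" v]
      by (simp add: frame_add frame_diff frame_neg G_add G_diff inner_add_left inner_diff_left power2_norm_eq_inner
        [of "_ + _"]
          power2_norm_eq_inner [of "_ - _"] inner_add_right inner_diff_right inner_commute [of Y' Y] field_simps)
    moreover have "inner (G (\<psi> Y) v v) (\<psi> Y') = inner (G (\<psi> Y) (\<psi> Y') v) v" by (metis inner_swap G_sym)
    moreover have "inner (G (\<psi> Y) v v) (\<psi> Y') = inner b Y'"
      unfolding * by (simp add: inner_add_left iso orth orth')
    ultimately show ?thesis by (simp add: mult.commute)
  qed
  then have "b = ((norm v)\<^sup>2 / 3) *\<^sub>R Y" using vector_eq_rdot by blast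
  then show "G (\<psi> Y) (V W Z) (V W Z) = \<phi> (A Y W Z) + ((norm (V W Z))\<^sup>2 / 3) *\<^sub>R \<psi> Y"
    using * by (simp add: a cd frame_0 frame_scale flip: v_def)
qed

text \<open>The first identity of \<open>quartic_part\<close> at the focal point \<psi> Y'. The
  direction of Y does not enter the right side: the known case Y = e0 therefore determines F on V_+
  + V_-, and polarization in Y becomes a condition on m.\<close>

lemma G_rvv_norm:
  "(norm (adjoint \<phi> (G (\<psi> Y) (V W Z) (V W Z))))\<^sup>2
    = (norm Y)\<^sup>2 * (2/9 * (norm (V W Z) ^ 4 - inner (G (V W Z) (V W Z) (V W Z)) (V W Z)))"
proof -
  obtain r Y' where Y: "Y = r *\<^sub>R Y'" "norm Y' = 1" "r = norm Y" by (rule unit_multiple [of Y])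
  define v where "v = V W Z"
  define a where "a = adjoint \<phi> (G (\<psi> Y') v v)"
  have e: "G (\<psi> Y') v v = \<phi> a + ((norm v)\<^sup>2 / 3) *\<^sub>R \<psi> Y'"
    unfolding a_def v_def by (rule G_rvv(1))
  have "(norm (G (\<psi> Y') v v))\<^sup>2 = (norm a)\<^sup>2 + (norm v) ^ 4 / 9"
  proof -
    have "(norm (\<phi> a + s *\<^sub>R \<psi> Y'))\<^sup>2 = inner a a + s\<^sup>2 * inner Y' Y'" for s
      unfolding power2_norm_eq_inner by (simp add: inner_add_left inner_add_right iso orth orth' power2_eq_square)
    then show ?thesis using Y(2) by (simp add: e dot_square_norm power_divide flip: power_mult)
  qed
  moreover have "9 * (norm (G (\<psi> Y') v v))\<^sup>2 + 2 * inner (G v v v) v = 3 * norm v ^ 4"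
    unfolding v_def
    by (rule quartic_part(1) [OF focal_\<psi> V_tang_\<psi>, where w = 0]) (simp_all add: Y(2) normal_def)
  ultimately have "(norm a)\<^sup>2 = 2/9 * (norm v ^ 4 - inner (G v v v) v)" by simp
  moreover have "adjoint \<phi> (G (\<psi> Y) v v) = r *\<^sub>R a"
    by (simp add: Y(1) a_def frame_scale G_scale linear_scale [OF adjoint_linear [OF lin_frame(1)]])
  ultimately show ?thesis by (simp add: v_def power_mult_distrib) (simp add: Y(2,3))
qed

lemma G_xvv:
  "adjoint \<phi> (G (\<psi> (oe 0)) (V W Z) (V W Z)) =
    (2/3) *\<^sub>R (((norm W)\<^sup>2 - (norm Z)\<^sup>2) *\<^sub>R oe 0 + 2 *\<^sub>R im (W \<cdot> ocnj Z))"
proof (rule vector_eq_rdot [THEN iffD1], rule allI)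
  fix X
  have s: "inner (im X \<cdot> W) Z = - inner (im X \<cdot> Z) W"
    using O.im_skew [OF im_orth, of X W Z] by (simp only: inner_commute [of W])
  have "inner (im X \<cdot> Z) W = inner (im (W \<cdot> ocnj Z)) X"
  proof -
    have "inner (im X \<cdot> Z) W = inner (im X) (W \<cdot> ocnj Z)" by (rule O.adjoint_right)
    also have "\<dots> = inner (im X) (im (W \<cdot> ocnj Z))"
      by (subst im_decomp [of "W \<cdot> ocnj Z"]) (simp add: inner_add_right)
    also have "\<dots> = inner X (im (W \<cdot> ocnj Z))"
      by (subst (2) im_decomp [of X]) (simp add: inner_add_left orth_oe0)
    finally show ?thesis by (simp add: inner_commute)
  qed
  then show "inner (adjoint \<phi> (G (\<psi> (oe 0)) (V W Z) (V W Z))) X =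
      inner ((2/3) *\<^sub>R (((norm W)\<^sup>2 - (norm Z)\<^sup>2) *\<^sub>R oe 0 + 2 *\<^sub>R im (W \<cdot> ocnj Z))) X"
    unfolding G_rvv(2) unfolding V_def G_x
    by (simp add: inner_add_left inner_add_right inner_diff_left iso orth orth' s power2_norm_eq_inner
      inner_commute [of "oe 0"] algebra_simps)
qed

text \<open>Comparison of \<open>G_rvv_norm\<close> at Y = e0 with the explicit vector of
  \<open>G_xvv\<close>.\<close>

lemma quartic_V:
  "inner (G (V W Z) (V W Z) (V W Z)) (V W Z) = 8 * (inner W Z)\<^sup>2 - ((norm W)\<^sup>2 + (norm Z)\<^sup>2)\<^sup>2"
proof -
  define Q where "Q = inner (G (V W Z) (V W Z) (V W Z)) (V W Z)"
  have "inner (W \<cdot> ocnj Z) (oe 0) = inner W Z"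
    using O.adjoint_right [of "oe 0" Z W] by (simp add: inner_commute)
  then have im2: "(norm (im (W \<cdot> ocnj Z)))\<^sup>2 = (norm W)\<^sup>2 * (norm Z)\<^sup>2 - (inner W Z)\<^sup>2"
    using norm_im [of "W \<cdot> ocnj Z"] by (simp add: norm_omul power_mult_distrib)
  have "norm (V W Z) ^ 4 = ((norm W)\<^sup>2 + (norm Z)\<^sup>2)\<^sup>2"
    using V_norm [of W Z] power_mult [of "norm (V W Z)" 2 2] by simp
  then have "2/9 * (((norm W)\<^sup>2 + (norm Z)\<^sup>2)\<^sup>2 - Q) =
      (norm ((2/3) *\<^sub>R (((norm W)\<^sup>2 - (norm Z)\<^sup>2) *\<^sub>R oe 0 + 2 *\<^sub>R im (W \<cdot> ocnj Z))))\<^sup>2"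
    using G_rvv_norm [of "oe 0" W Z] by (simp add: G_xvv norm_oe Q_def)
  also have "\<dots> = 4/9 * (((norm W)\<^sup>2 - (norm Z)\<^sup>2)\<^sup>2 + 4 * (norm (im (W \<cdot> ocnj Z)))\<^sup>2)"
  proof -
    have *: "(norm (r *\<^sub>R (s *\<^sub>R oe 0 + 2 *\<^sub>R im U)))\<^sup>2 = r\<^sup>2 * (s\<^sup>2 + 4 * (norm (im U))\<^sup>2)" for r s U
      unfolding power2_norm_eq_inner
      by (simp add: inner_add_left inner_add_right inner_oe_0 orth_oe0 power2_eq_square algebra_simps)
    show ?thesis unfolding * by (simp add: power2_eq_square)
  qed
  finally show ?thesis unfolding im2 Q_def by (simp add: power2_eq_square algebra_simps)
qed

lemma inner_G_V:
  "inner (G (\<phi> X) (\<psi> Y) (V W Z)) (V W Z) = inner (G (\<phi> X) (\<psi> Y) (\<phi>p W)) (\<phi>p W)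
     + 2 * inner (G (\<phi> X) (\<psi> Y) (\<phi>m Z)) (\<phi>p W) + inner (G (\<phi> X) (\<psi> Y) (\<phi>m Z)) (\<phi>m Z)"
  using inner_swap [of "\<phi> X" "\<psi> Y" "\<phi>p W" "\<phi>m Z"] by (simp add: V_def G_add inner_add_left inner_add_right)

text \<open>By \<open>G_rvv_norm\<close> the \<phi>-component of G (\<psi> Y) v v depends
  conformally on Y, so its values at e0 and at an imaginary Y are orthogonal. Adding this relation
  for Z and for - Z, where \<open>g\<close> and \<open>S\<close> change sign, leaves only the block
  m.\<close>

lemma m_trace: "inner (m (W \<cdot> ocnj Z) Y Z) W = 0"
proof -
  have polar: "inner (adjoint \<phi> (G (\<psi> (oe 0)) (V W Z) (V W Z))) (adjoint \<phi> (G (\<psi> (im Y)) (V W Z) (V W Z))) = 0" for Z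
  proof -
    define a where "a Y = adjoint \<phi> (G (\<psi> Y) (V W Z) (V W Z))" for Y
    define \<kappa> where "\<kappa> = 2/9 * (norm (V W Z) ^ 4 - inner (G (V W Z) (V W Z) (V W Z)) (V W Z))"
    have add: "a (Y + Y') = a Y + a Y'" for Y Y'
      by (simp add: a_def frame_add G_add linear_add [OF adjoint_linear [OF lin_frame(1)]])
    have "inner (a Y) (a Y) = inner Y Y * \<kappa>" for Y
      using G_rvv_norm [of Y W Z] by (simp only: a_def \<kappa>_def power2_norm_eq_inner)
    from this [of "oe 0 + im Y"] this [of "oe 0"] this [of "im Y"] have "inner (a (oe 0)) (a (im Y)) = 0"
      by (simp add: add inner_add_left inner_add_right orth_oe0 inner_commute [of "a (im Y)" "a (oe 0)"] algebra_simps)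
    then show ?thesis by (simp add: a_def)
  qed
  define S where "S = im (W \<cdot> ocnj Z)"
  define g where "g Z = inner (adjoint \<phi> (G (\<psi> (im Y)) (V W Z) (V W Z))) (oe 0)" for Z
  have gZ: "g (- Z) = - g Z" for Z
    using O.im_skew [of "im Y" W Z] C.im_skew [of "im Y" W Z]
    unfolding g_def G_rvv(2) unfolding V_def G_n
    by (simp add: inner_add_left inner_add_right inner_diff_left inner_diff_right iso orth orth' C.minus_right frame_neg)
  have 1: "(norm W)\<^sup>2 * g Z - (norm Z)\<^sup>2 * g Z + 2 * inner (G (\<phi> S) (\<psi> (im Y)) (V W Z)) (V W Z) = 0"
    using polar [of Z] unfolding G_xvv
    by (simp add: inner_add_left g_def S_def inner_commute [of "im (W \<cdot> ocnj Z)"] inner_commute [of "oe 0"]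
      G_rvv(2) algebra_simps)
  have "im (W \<cdot> ocnj (- Z)) = - S"
    by (simp add: S_def linear_neg [OF linear_ocnj] O.minus_right linear_neg [OF linear_im])
  then have 2: "- ((norm W)\<^sup>2 * g Z) + (norm Z)\<^sup>2 * g Z - 2 * inner (G (\<phi> S) (\<psi> (im Y)) (V W (- Z))) (V W (- Z)) = 0"
    using polar [of "- Z"] gZ [of Z] unfolding G_xvv
    by (simp add: inner_add_left g_def inner_commute [of S] inner_commute [of "oe 0"] G_rvv(2) algebra_simps)
  have "inner (G (\<phi> S) (\<psi> (im Y)) (\<phi>m Z)) (\<phi>p W) = 0"
    using 1 2 unfolding inner_G_V by (simp add: frame_neg G_minus)
  then show ?thesis by (simp add: inner_m S_def)
qed

lemma linear_m: "linear (\<lambda>X. m X Y Z)" "linear (\<lambda>Y. m X Y Z)" "linear (\<lambda>Z. m X Y Z)"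
  unfolding m_def
  by (rule linearI; simp add: linear_add [OF linear_im] linear_scale [OF linear_im] frame_add frame_scale G_add G_scale
      linear_add [OF adjoint_linear [OF lin_frame(3)]] linear_scale [OF adjoint_linear [OF lin_frame(3)]] algebra_simps)+

text \<open>\<open>m_trace\<close>, expanded in the basis, is the trace condition of
  \<open>skew_of_trace_condition\<close>: the coefficients <e_b Z, W> are the imaginary coordinates
  of W times the conjugate of Z.\<close>

lemma m_skew: "inner (m X Y Z) Z = 0"
proof -
  have b: "bounded_bilinear (\<lambda>X Z. m X Y Z)"
    unfolding bilinear_conv_bounded_bilinear [symmetric] bilinear_def using linear_m by blast
  have "inner (m (im X) Y Z) Z = 0"
  proof (rule skew_of_trace_condition [OF b])
    show "inner (X \<cdot> Z) (m X Y Z) = 0" if "inner X (oe 0) = 0" for X Z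
      using m_orth_left [of X Z Y] that by (simp add: im_eq)
    fix Z W
    have "(\<Sum>b=1..7. inner (oe b \<cdot> Z) W * inner (m (oe b) Y Z) W) =
        inner (m (\<Sum>b=1..7. inner (im (W \<cdot> ocnj Z)) (oe b) *\<^sub>R oe b) Y Z) W"
      unfolding linear_sum [OF linear_m(1)] linear_scale [OF linear_m(1)] inner_sum_left
    proof (rule sum.cong [OF refl])
      fix b :: nat assume b: "b \<in> {1..7}"
      have "inner (oe b \<cdot> Z) W = inner (oe b) (W \<cdot> ocnj Z)" by (rule O.adjoint_right)
      also have "\<dots> = inner (oe b) (inner (W \<cdot> ocnj Z) (oe 0) *\<^sub>R oe 0 + im (W \<cdot> ocnj Z))"
        by (simp only: im_decomp [symmetric])
      also have "\<dots> = inner (im (W \<cdot> ocnj Z)) (oe b)"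
        using b by (simp add: inner_add_right inner_oe inner_commute [of "oe b"])
      finally show "inner (oe b \<cdot> Z) W * inner (m (oe b) Y Z) W = inner (inner (im (W \<cdot> ocnj Z)) (oe b) *\<^sub>R m (oe b) Y Z) W"
        by simp
    qed
    also have "\<dots> = inner (m (im (W \<cdot> ocnj Z)) Y Z) W" by (simp only: oe_expansion_im [OF im_orth])
    also have "\<dots> = 0" using m_trace [of W Z Y] by (simp add: m_def)
    finally show "(\<Sum>b=1..7. inner (oe b \<cdot> Z) W * inner (m (oe b) Y Z) W) = 0" .
  qed simp
  then show ?thesis by (simp add: m_def)
qed

lemma commutator_like_m: "commutator_like (\<star>) (\<lambda>X Y Z. - 2 *\<^sub>R m X Y Z)"
proof -
  have "inner (X \<cdot> Z) (m X Y Z) = 0" for X Y Z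
    using m_orth_left [of X Z Y] m_skew [of X Y Z] O.mul_im_decomp [of X Z]
    by (simp add: inner_add_left inner_commute [of Z] flip: im_def)
  moreover have "inner (Y \<star> Z) (m X Y Z) = 0" for X Y Z
    using m_orth_right [of Y Z X] m_skew [of X Y Z] C.mul_im_decomp [of Y Z]
    by (simp add: inner_add_left inner_commute [of Z] flip: im_def)
  moreover have "m (oe 0) Y Z = 0" "m X (oe 0) Z = 0" for X Y Z
    by (simp_all add: m_def im_oe frame_0 linear_0 [OF adjoint_linear [OF lin_frame(3)]])
  moreover have "bilinear (\<lambda>X Z. - 2 *\<^sub>R m X Y Z)" "bilinear (\<lambda>Y Z. - 2 *\<^sub>R m X Y Z)" for X Y
    unfolding bilinear_def by (intro conjI allI linear_compose_scale_right linear_m)+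
  ultimately show ?thesis
    unfolding commutator_like_def bilinear_conv_bounded_bilinear using m_skew by simp
qed

text \<open>The diagonal block on V_- is - 1/3 times the anticommutator of the two multiplications,
  and the total norm is fixed by \<open>norm_G_prv\<close>. By the parallelogram law the remaining
  norm is that of the commutator.\<close>

lemma norm_m:
  assumes X: "inner X (oe 0) = 0" and Y: "inner Y (oe 0) = 0"
  shows "norm (- 2 *\<^sub>R m X Y Z) = norm (twisted_commutator (\<star>) X Y Z)"
proof -
  define R where "R z = adjoint \<phi>m (G (\<phi> X) (\<psi> Y) (\<phi>m z))" for z
  define R' where "R' z = (- 1/3) *\<^sub>R (X \<cdot> (Y \<star> z) + Y \<star> (X \<cdot> z))" for z
  have inner_R: "inner (R z) w = inner (G (\<phi> X) (\<psi> Y) (\<phi>m z)) (\<phi>m w)" for z w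
    unfolding R_def by (metis adjoint_works inner_commute lin_frame(4))
  note sk = O.im_skew [OF X] C.im_skew [OF Y]
  have inner_R': "inner (R' z) w = 1/3 * (inner (Y \<star> z) (X \<cdot> w) + inner (X \<cdot> z) (Y \<star> w))" for z w
    by (simp add: R'_def inner_add_left sk) (simp add: field_simps)
  \<comment> \<open>Both operators are symmetric and have the same quadratic form by
    \<open>diagonal_blocks\<close>.\<close>
  have "R z - R' z = 0" for z
  proof (rule symmetric_operator_zero [where D = "\<lambda>z. R z - R' z"])
    show "linear (\<lambda>z. R z - R' z)"
      by (rule linearI) (simp_all add: R_def R'_def frame_add frame_scale G_add G_scale O.add_right O.scaleR_right
        C.add_right C.scaleR_right
          linear_add [OF adjoint_linear [OF lin_frame(4)]] linear_scale [OF adjoint_linear [OF lin_frame(4)]] algebra_simps)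
    show "inner (R z - R' z) w = inner z (R w - R' w)" for z w
      using inner_swap [of "\<phi> X" "\<psi> Y" "\<phi>m z" "\<phi>m w"]
      by (simp add: inner_diff_left inner_diff_right inner_R inner_R' inner_commute [of z "R w"] inner_commute [of z "R' w"]
          inner_commute [of "X \<cdot> z"] inner_commute [of "X \<cdot> w"])
    show "inner (R z - R' z) z = 0" for z
      using diagonal_blocks(1) [of X Y z]
      by (simp add: inner_diff_left inner_R inner_R' im_eq X Y inner_commute [of "Y \<star> z"])
  qed
  then have RR': "R Z = R' Z" by simp
  obtain W' Z' where WZ: "G (\<phi> X) (\<psi> Y) (V 0 Z) = V W' Z'" using G_prv_mem by blast
  have Z': "Z' = R Z"
    by (rule vector_eq_rdot [THEN iffD1]) (use WZ in \<open>simp add: inner_R V_def frame_0 inner_add_left iso orth orth'\<close>)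
  have W': "W' = (2/3) *\<^sub>R m X Y Z"
    by (rule vector_eq_rdot [THEN iffD1]) (use WZ in \<open>simp add: inner_m V_def frame_0 inner_add_left iso orth orth'
      im_eq X Y\<close>)
  have 1: "(norm W')\<^sup>2 + (norm Z')\<^sup>2 = 4/9 * ((norm X)\<^sup>2 * (norm Y)\<^sup>2 * (norm Z)\<^sup>2)"
    using norm_G_prv [of X Y 0 Z] by (simp add: WZ V_norm)
  have "(norm (X \<cdot> (Y \<star> Z) + Y \<star> (X \<cdot> Z)))\<^sup>2 + (norm (X \<cdot> (Y \<star> Z) - Y \<star> (X \<cdot> Z)))\<^sup>2 =
      2 * (norm (X \<cdot> (Y \<star> Z)))\<^sup>2 + 2 * (norm (Y \<star> (X \<cdot> Z)))\<^sup>2"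
    by (simp add: power2_norm_eq_inner inner_add_left inner_add_right inner_diff_left inner_diff_right)
  then have 2: "(norm (X \<cdot> (Y \<star> Z) + Y \<star> (X \<cdot> Z)))\<^sup>2 + (norm (twisted_commutator (\<star>) X Y Z))\<^sup>2 =
      4 * ((norm X)\<^sup>2 * (norm Y)\<^sup>2 * (norm Z)\<^sup>2)"
    by (simp add: twisted_commutator_def norm_omul C.norm_mul power_mult_distrib)
  have "(norm (- 2 *\<^sub>R m X Y Z))\<^sup>2 = (norm (twisted_commutator (\<star>) X Y Z))\<^sup>2"
    using 1 2 by (simp add: W' Z' RR' R'_def power_mult_distrib power_divide)
  then show ?thesis by (rule power2_eq_imp_eq) simp_all
qed

section \<open>The polynomial in terms of the commutator\<close>

lemma m_eq_commutator:
  assumes "twisted_product \<alpha> (\<star>)" and "\<And>s. \<alpha> \<noteq> s *\<^sub>R oe 0"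
  obtains s :: real where "s \<in> {1, -1}" "\<And>X Y Z. - 2 *\<^sub>R m X Y Z = s *\<^sub>R twisted_commutator (\<star>) X Y Z"
  using commutator_like_rigidity [OF assms commutator_like_m norm_m] by blast

text \<open>With m known, the contributions of the real and imaginary parts of X and Y are exactly
  the terms of a single inner product. Its arguments W + Z and W - Z explain the rotation by 45
  degrees in the final isometry.\<close>

lemma inner_G_formula:
  assumes m: "\<And>X Y Z. - 2 *\<^sub>R m X Y Z = twisted_commutator (\<star>) X Y Z"
  shows "inner (G (\<phi> X) (\<psi> Y) (V W Z)) (V W Z) = 2/3 * inner (X \<cdot> (W + Z)) (ocnj Y \<star> (W - Z))"
proof -
  define X0 Y0 X' Y' where "X0 = inner X (oe 0)" and "Y0 = inner Y (oe 0)" and "X' = im X" and "Y' = im Y"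
  have X: "X = X0 *\<^sub>R oe 0 + X'" and Y: "Y = Y0 *\<^sub>R oe 0 + Y'"
    by (simp_all add: X0_def Y0_def X'_def Y'_def flip: im_decomp)
  have im0: "inner X' (oe 0) = 0" "inner Y' (oe 0) = 0" "im X' = X'" "im Y' = Y'" by (simp_all add: X'_def Y'_def)
  note sk = O.im_skew [OF im0(1)] C.im_skew [OF im0(2)]
  have "ocnj Y = Y0 *\<^sub>R oe 0 - Y'" by (simp add: ocnj_eq Y inner_add_left im0 inner_oe_0 algebra_simps)
      (simp flip: scaleR_add_left)
  have l: "inner (G (\<phi> X) (\<psi> (oe 0)) (V W Z)) (V W Z) = 2/3 * (X0 * (inner W W - inner Z Z) + 2 * inner (X' \<cdot> Z) W)"
    unfolding V_def G_x
    by (simp add: inner_add_left inner_add_right inner_diff_left iso orth orth' sk(1) inner_commute [of W "_ \<cdot> _"]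
      inner_commute [of W "_ \<star> _"] flip: X0_def X'_def)
      (simp add: field_simps)
  have r: "inner (G (\<phi> (oe 0)) (\<psi> Y') (V W Z)) (V W Z) = 4/3 * inner (Y' \<star> Z) W"
    unfolding V_def G_n
    by (simp add: inner_add_left inner_add_right inner_diff_left iso orth orth' sk(2) im0 inner_commute [of W "_ \<cdot>
      _"] inner_commute [of W "_ \<star> _"])
  have mid: "inner (G (\<phi> X') (\<psi> Y') (V W Z)) (V W Z) =
      - (2/3) * inner (X' \<cdot> W) (Y' \<star> W) - 2/3 * inner (X' \<cdot> (Y' \<star> Z) - Y' \<star> (X' \<cdot> Z)) W + 2/3 * inner (X' \<cdot> Z) (Y' \<star> Z)"
  proof -
    have "- 2 * inner (m X' Y' Z) W = inner (- 2 *\<^sub>R m X' Y' Z) W" by simp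
    also have "\<dots> = inner (X' \<cdot> (Y' \<star> Z) - Y' \<star> (X' \<cdot> Z)) W" by (simp only: m twisted_commutator_def)
    finally show ?thesis
      using diagonal_blocks(1) [of X' Y' Z] diagonal_blocks(2) [of X' Y' W] inner_m [of X' Y' Z W]
      unfolding inner_G_V im0(3,4) by simp
  qed
  have "inner (G (\<phi> X) (\<psi> (Y0 *\<^sub>R oe 0 + Y')) (V W Z)) (V W Z) =
      Y0 * inner (G (\<phi> X) (\<psi> (oe 0)) (V W Z)) (V W Z) + inner (G (\<phi> X) (\<psi> Y') (V W Z)) (V W Z)"
    "inner (G (\<phi> (X0 *\<^sub>R oe 0 + X')) (\<psi> Y') (V W Z)) (V W Z) =
      X0 * inner (G (\<phi> (oe 0)) (\<psi> Y') (V W Z)) (V W Z) + inner (G (\<phi> X') (\<psi> Y') (V W Z)) (V W Z)"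
    by (simp_all add: frame_add frame_scale G_add G_scale inner_add_left)
  then have "inner (G (\<phi> X) (\<psi> Y) (V W Z)) (V W Z) = Y0 * inner (G (\<phi> X) (\<psi> (oe 0)) (V W Z)) (V W Z)
      + X0 * inner (G (\<phi> (oe 0)) (\<psi> Y') (V W Z)) (V W Z) + inner (G (\<phi> X') (\<psi> Y') (V W Z)) (V W Z)"
    by (simp only: X [symmetric] Y [symmetric] add.assoc)
  also have "\<dots> = 2/3 * inner (X0 *\<^sub>R (W + Z) + X' \<cdot> (W + Z)) (Y0 *\<^sub>R (W - Z) - Y' \<star> (W - Z))"
  proof -
    have "inner (X' \<cdot> W) W = 0" "inner (X' \<cdot> Z) Z = 0" "inner W (Y' \<star> W) = 0" "inner Z (Y' \<star> Z) = 0"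
      using sk(1) [of W W] sk(1) [of Z Z] sk(2) [of W W] sk(2) [of Z Z] by (simp_all add: inner_commute)
    moreover have "inner (X' \<cdot> W) Z = - inner (X' \<cdot> Z) W" "inner Z (Y' \<star> W) = - inner (Y' \<star> Z) W"
        "inner (X' \<cdot> (Y' \<star> Z)) W = - inner (X' \<cdot> W) (Y' \<star> Z)" "inner (Y' \<star> (X' \<cdot> Z)) W = - inner (X' \<cdot> Z) (Y' \<star> W)"
      using sk(1) [of W Z] sk(2) [of Z W] sk(1) [of "Y' \<star> Z" W] sk(2) [of "X' \<cdot> Z" W] by (simp_all add: inner_commute)
    ultimately show ?thesis
      unfolding l r mid
      by (simp add: inner_add_left inner_add_right inner_diff_left inner_diff_right O.add_right C.diff_right
          inner_commute [of W "Y' \<star> Z"] inner_commute [of Z W]) (simp add: field_simps)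
  qed
  also have "\<dots> = 2/3 * inner (X \<cdot> (W + Z)) (ocnj Y \<star> (W - Z))"
    by (simp add: X \<open>ocnj Y = Y0 *\<^sub>R oe 0 - Y'\<close> O.add_left O.scaleR_left C.diff_left C.scaleR_left)
  finally show ?thesis .
qed

text \<open>A multinomial expansion. The coefficient 12 counts the arrangements of a, b, c, c, and
  this is the only term into which m enters.\<close>

lemma quartic_formula:
  "inner (G (\<phi> X + \<psi> Y + V W Z) (\<phi> X + \<psi> Y + V W Z) (\<phi> X + \<psi> Y + V W Z)) (\<phi> X + \<psi> Y + V W Z) =
    norm X ^ 4 + norm Y ^ 4 - 6 * (norm X)\<^sup>2 * (norm Y)\<^sup>2
    + 2 * ((norm X)\<^sup>2 + (norm Y)\<^sup>2) * ((norm W)\<^sup>2 + (norm Z)\<^sup>2)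
    + 12 * inner (G (\<phi> X) (\<psi> Y) (V W Z)) (V W Z) + 8 * (inner W Z)\<^sup>2 - ((norm W)\<^sup>2 + (norm Z)\<^sup>2)\<^sup>2"
proof -
  define a b c where "a = \<phi> X" and "b = \<psi> Y" and "c = V W Z"
  have n: "inner a a = (norm X)\<^sup>2" "inner b b = (norm Y)\<^sup>2" "inner c c = (norm W)\<^sup>2 + (norm Z)\<^sup>2"
    "inner a b = 0" "inner b a = 0" "inner a c = 0" "inner c a = 0" "inner b c = 0" "inner c b = 0"
    by (simp_all add: a_def b_def c_def iso orth orth' inner_V norm_frame V_norm flip: power2_norm_eq_inner)
  have g: "G a a a = (norm X)\<^sup>2 *\<^sub>R a" "G a a b = - ((norm X)\<^sup>2 *\<^sub>R b)" "G a a c = ((norm X)\<^sup>2 / 3) *\<^sub>R c"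
    "G b b b = (norm Y)\<^sup>2 *\<^sub>R b" "G b b a = - ((norm Y)\<^sup>2 *\<^sub>R a)" "G b b c = ((norm Y)\<^sup>2 / 3) *\<^sub>R c"
    by (simp_all add: a_def b_def c_def V_def G_ppp G_ppr G_ppv G_rrr G_rrp G_rrv)
  define \<gamma> where "\<gamma> = inner (G a b c) c"
  have i: "inner (G a b c) a = inner (G a a b) c" "inner (G a b c) b = inner (G b b a) c"
    "inner (G a c c) a = inner (G a a c) c" "inner (G a c c) b = \<gamma>" "inner (G b c c) a = \<gamma>"
    "inner (G b c c) b = inner (G b b c) c" "inner (G c c c) a = inner (G a c c) c" "inner (G c c c) b = inner (G b c c) c"
    unfolding \<gamma>_def by (metis inner_swap G_sym)+
  have z: "inner (G a c c) c = 0" "inner (G b c c) c = 0"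
    unfolding a_def b_def c_def by (rule V_cubic_\<phi> V_cubic_\<psi>)+
  have s: "G a b a = G a a b" "G b a a = G a a b" "G a b b = G b b a" "G b a b = G b b a" "G a c a = G a a c" "G c
    a a = G a a c"
    "G b c b = G b b c" "G c b b = G b b c" "G c a c = G a c c" "G c c a = G a c c" "G c b c = G b c c" "G c c b = G b c c"
    "G a c b = G a b c" "G b a c = G a b c" "G b c a = G a b c" "G c a b = G a b c" "G c b a = G a b c"
    by (metis G_sym)+
  have "inner (G (a + b + c) (a + b + c) (a + b + c)) (a + b + c) =
      norm X ^ 4 + norm Y ^ 4 - 6 * (norm X)\<^sup>2 * (norm Y)\<^sup>2 + 2 * ((norm X)\<^sup>2 + (norm Y)\<^sup>2) * inner c c + 12 * \<gamma> +
        inner (G c c c) c"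
    by (simp add: G_add s inner_add_left inner_add_right i z)
      (simp add: g n \<gamma>_def [symmetric] algebra_simps power2_eq_square eval_nat_numeral)
  then show ?thesis
    using quartic_V [of W Z] by (simp add: a_def b_def c_def \<gamma>_def n(3) [unfolded c_def])
qed

text \<open>Only the six arrangements of a, b, c pair nontrivially with V_+: products with a
  repeated \<phi>- or \<psi>-vector are multiples of a, b or c, those with two c vanish by the cubic
  lemmas, and c c c is treated by \<open>quartic_V\<close>. The factor is 6 times 2/3.\<close>

lemma cubic_form_V:
  assumes "inner X (oe 0) = 0" "inner Y (oe 0) = 0"
  shows "inner (G (\<phi> X + \<psi> Y + \<phi>m Z) (\<phi> X + \<psi> Y + \<phi>m Z) (\<phi> X + \<psi> Y + \<phi>m Z)) (\<phi>p W) = 4 * inner (m X Y Z) W"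
proof -
  define a b c where "a = \<phi> X" and "b = \<psi> Y" and "c = \<phi>m Z"
  have c: "c = V 0 Z" and w: "\<phi>p W = V W 0" by (simp_all add: c_def V_def frame_0)
  have g: "G a a a = (norm X)\<^sup>2 *\<^sub>R a" "G a a b = - ((norm X)\<^sup>2 *\<^sub>R b)" "G a a c = ((norm X)\<^sup>2 / 3) *\<^sub>R c"
    "G b b b = (norm Y)\<^sup>2 *\<^sub>R b" "G b b a = - ((norm Y)\<^sup>2 *\<^sub>R a)" "G b b c = ((norm Y)\<^sup>2 / 3) *\<^sub>R c"
    by (simp_all add: a_def b_def c V_def G_ppp G_ppr G_ppv G_rrr G_rrp G_rrv)
  have s: "G a b a = G a a b" "G b a a = G a a b" "G a b b = G b b a" "G b a b = G b b a" "G a c a = G a a c" "G c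
    a a = G a a c"
    "G b c b = G b b c" "G c b b = G b b c" "G c a c = G a c c" "G c c a = G a c c" "G c b c = G b c c" "G c c b = G b c c"
    "G a c b = G a b c" "G b a c = G a b c" "G b c a = G a b c" "G c a b = G a b c" "G c b a = G a b c"
    by (metis G_sym)+
  have z: "inner (G a c c) (\<phi>p W) = 0" "inner (G b c c) (\<phi>p W) = 0"
    unfolding a_def b_def c w by (rule V_cubic_\<phi> V_cubic_\<psi>)+
  have ccc: "inner (G c c c) (\<phi>p W) = 0"
  proof -
    define u where "u = \<phi>p W"
    have v: "V (t *\<^sub>R W) Z = c + t *\<^sub>R u" for t by (simp add: V_def c_def u_def frame_scale add.commute)
    have e: "inner (G c c u) c = inner (G c c c) u" "inner (G c u u) c = inner (G c c u) u"
      "inner (G c u u) u = inner (G u u u) c"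
      by (metis inner_swap G_sym)+
    have "inner (G (c + t *\<^sub>R u) (c + t *\<^sub>R u) (c + t *\<^sub>R u)) (c + t *\<^sub>R u) = 8 * t\<^sup>2 * (inner W Z)\<^sup>2 - (t\<^sup>2 *
      (norm W)\<^sup>2 + (norm Z)\<^sup>2)\<^sup>2" for t
      using quartic_V [of "t *\<^sub>R W" Z] by (simp add: v power_mult_distrib)
    \<comment> \<open>The right side is even in t; four values of t separate the linear coefficient
      on the left from the cubic one.\<close>
    from this [of 1] this [of "-1"] this [of 2] this [of "-2"]
    show ?thesis
      unfolding G_cube u_def [symmetric]
      by (simp add: inner_add_left inner_add_right inner_diff_left inner_diff_right e algebra_simps)
  qed
  have o: "inner a (\<phi>p W) = 0" "inner b (\<phi>p W) = 0" "inner c (\<phi>p W) = 0"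
    by (simp_all add: a_def b_def c_def orth orth')
  have "inner (G (a + b + c) (a + b + c) (a + b + c)) (\<phi>p W) = 6 * inner (G a b c) (\<phi>p W)"
    by (simp add: G_add s inner_add_left z ccc) (simp add: g o)
  also have "\<dots> = 4 * inner (m X Y Z) W" using assms by (simp add: inner_m a_def b_def c_def im_eq)
  finally show ?thesis by (simp add: a_def b_def c_def)
qed

end

section \<open>Coordinates at a point of Condition A\<close>

text \<open>By Pythagoras, |v|^2 is the sum of the squared norms of its projection to the range of f
  and of the remainder.\<close>

lemma isometry_adjoint_exact:
  fixes f :: "'a::euclidean_space \<Rightarrow> 'b::euclidean_space"
  assumes f: "linear f" "\<And>z w. inner (f z) (f w) = inner z w" and v: "norm v \<le> norm (adjoint f v)"
  shows "v = f (adjoint f v)"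
proof -
  define z where "z = adjoint f v"
  have "inner v (f z) = inner z z" unfolding z_def by (metis adjoint_works f(1) inner_commute)
  then have "inner (v - f z) (v - f z) = (norm v)\<^sup>2 - (norm z)\<^sup>2"
    by (simp add: inner_diff_left inner_diff_right f(2) inner_commute [of "f z"] power2_norm_eq_inner)
  also have "\<dots> \<le> 0" using v by (simp add: z_def)
  finally have "inner (v - f z) (v - f z) = 0" using inner_ge_zero by (metis order_antisym)
  then show ?thesis by (simp add: z_def)
qed

section \<open>The spectrum of the shape operators\<close>

context quartic_form
begin

text \<open>The normal w is itself a focal point, so H = G w w also satisfies 3 H^2 + 2 H = 1 on the
  tangent vectors at p. Inserting H = (4/3) S^2 - 1 gives S^4 = S^2.\<close>

lemma shape_fourth_power:
  assumes fp: "focal_point p" and w: "w \<in> normal p" "norm w = 1" and y: "y \<in> tang p"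
  defines "S \<equiv> \<lambda>v. (3/2) *\<^sub>R G p w v"
  shows "S (S (S (S y))) = S (S y)"
proof -
  have H: "G w w v = (4/3) *\<^sub>R S (S v) - v" if "v \<in> tang p" for v
    using G_normal_normal_tang [OF fp that w(1)] w(2) by (simp add: S_def G_scale)
  have St: "S v \<in> tang p" if "v \<in> tang p" for v
    unfolding S_def by (intro subspace_scale subspace_tang fp G_tang_normal_mem that w)
  have "inner y w = 0" by (rule tang_normal_perp [OF fp y w(1)])
  then have "3 *\<^sub>R G w w (G w w y) + 2 *\<^sub>R G w w y = y"
    by (rule Gpp_quadratic [OF G_normal_focal [OF fp w]])
  moreover have "(4/3) *\<^sub>R S (S y) - y \<in> tang p"
    by (intro subspace_diff subspace_scale subspace_tang fp St y)
  moreover have "S ((4/3) *\<^sub>R a - b) = (4/3) *\<^sub>R S a - S b" for a b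
    by (simp add: S_def G_diff G_scale scaleR_diff_right)
  ultimately have "3 *\<^sub>R ((4/3) *\<^sub>R ((4/3) *\<^sub>R S (S (S (S y))) - S (S y)) - ((4/3) *\<^sub>R S (S y) - y))
      + 2 *\<^sub>R ((4/3) *\<^sub>R S (S y) - y) = y"
    by (simp add: H y)
  then have e: "inner (3 *\<^sub>R ((4/3) *\<^sub>R ((4/3) *\<^sub>R S (S (S (S y))) - S (S y)) - ((4/3) *\<^sub>R S (S y) - y))
      + 2 *\<^sub>R ((4/3) *\<^sub>R S (S y) - y)) z = inner y z" for z by simp
  show ?thesis
  proof (rule vector_eq_rdot [THEN iffD1], rule allI)
    fix z show "inner (S (S (S (S y)))) z = inner (S (S y)) z"
      using e [of z] by (simp add: inner_add_left inner_diff_left)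
  qed
qed

lemma shape_symmetric: "inner ((3/2) *\<^sub>R G p w v) v' = inner v ((3/2) *\<^sub>R G p w v')"
  using inner_swap [of p w v v'] by (simp add: inner_commute)

text \<open>S is symmetric, so |S^3 y - S y|^2 = <y, (S^6 - 2 S^4 + S^2) y>, and this vanishes by
  the fourth-power relation. The eigenvalues are thus among 1, -1, 0.\<close>

lemma shape_cubed:
  assumes fp: "focal_point p" and w: "w \<in> normal p" "norm w = 1" and y: "y \<in> tang p"
  defines "S \<equiv> \<lambda>v. (3/2) *\<^sub>R G p w v"
  shows "S (S (S y)) = S y"
proof -
  have sym: "inner (S v) v' = inner v (S v')" for v v' unfolding S_def by (rule shape_symmetric)
  have S4: "S (S (S (S v))) = S (S v)" if "v \<in> tang p" for v
    unfolding S_def by (rule shape_fourth_power [OF fp w that])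
  have St: "S v \<in> tang p" if "v \<in> tang p" for v
    unfolding S_def by (intro subspace_scale subspace_tang fp G_tang_normal_mem that w)
  have "inner (S (S (S y)) - S y) (S (S (S y)) - S y) =
      inner (S (S (S y))) (S (S (S y))) - 2 * inner (S (S (S y))) (S y) + inner (S y) (S y)"
    by (simp add: inner_diff_left inner_diff_right inner_commute)
  also have "\<dots> = inner y (S (S (S (S (S (S y)))))) - 2 * inner y (S (S (S (S y)))) + inner y (S (S y))"
    by (simp only: sym)
  also have "\<dots> = 0" by (simp add: S4 St y)
  finally show ?thesis by simp
qed

lemma shape_bound:
  assumes fp: "focal_point p" and w: "w \<in> normal p" "norm w = 1" and y: "y \<in> tang p"
  shows "norm ((3/2) *\<^sub>R G p w y) \<le> norm y"
proof -
  define S where "S v = (3/2) *\<^sub>R G p w v" for v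
  have sym: "inner (S v) v' = inner v (S v')" for v v' unfolding S_def by (rule shape_symmetric)
  have S4: "S (S (S (S y))) = S (S y)"
    unfolding S_def by (rule shape_fourth_power [OF fp w y])
  have "inner (S (S y)) (S (S y)) = inner y (S (S (S (S y))))" by (simp only: sym)
  also have "\<dots> = inner (S y) (S y)" by (simp only: S4 sym)
  finally have "norm (S (S y)) = norm (S y)" by (simp add: norm_eq_sqrt_inner)
  moreover have "norm (S y) * norm (S y) = inner y (S (S y))"
    by (simp add: sym flip: power2_norm_eq_inner power2_eq_square) (simp add: power2_norm_eq_inner sym)
  ultimately have "norm (S y) * norm (S y) \<le> norm y * norm (S y)" by (metis norm_cauchy_schwarz)
  then have "norm (S y) \<le> norm y" by (cases "norm (S y) = 0") auto
  then show ?thesis by (simp add: S_def)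
qed

text \<open>The shape operator does not increase length while its block L preserves it, so no
  component outside the range of f can occur. Symmetry of the operator supplies the opposite
  block.\<close>

lemma shape_block:
  fixes f g :: "octonion \<Rightarrow> 'a"
  assumes fp: "focal_point p" and w: "w \<in> normal p" "norm w = 1"
    and f: "linear f" "\<And>z w. inner (f z) (f w) = inner z w" "\<And>z. f z \<in> tang p"
    and g: "linear g" "\<And>z w. inner (g z) (g w) = inner z w" "\<And>z. g z \<in> tang p"
    and L: "\<And>z. norm (L z) = norm z" "\<And>z w. inner (L z) w = - inner z (L w)"
    and block: "\<And>z. adjoint f ((3/2) *\<^sub>R G p w (g z)) = L z"
  shows "G p w (g z) = (2/3) *\<^sub>R f (L z)" "G p w (f z) = - ((2/3) *\<^sub>R g (L z))"
proof -
  have ng: "norm (g z) = norm z" "norm (f z) = norm z" for z by (simp_all add: norm_eq_sqrt_inner f g)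
  have 1: "(3/2) *\<^sub>R G p w (g z) = f (L z)" for z
    using isometry_adjoint_exact [OF f(1,2), of "(3/2) *\<^sub>R G p w (g z)"] shape_bound [OF fp w g(3) [of z]]
    by (simp only: block L(1) ng)
  have adj: "adjoint g ((3/2) *\<^sub>R G p w (f z)) = - L z"
  proof (rule vector_eq_rdot [THEN iffD1], rule allI)
    fix v
    have "inner (adjoint g ((3/2) *\<^sub>R G p w (f z))) v = inner ((3/2) *\<^sub>R G p w (f z)) (g v)"
      by (metis adjoint_works g(1) inner_commute)
    also have "\<dots> = inner (f z) (f (L v))" by (simp only: shape_symmetric 1)
    also have "\<dots> = inner (- L z) v" by (simp add: f(2) L(2))
    finally show "inner (adjoint g ((3/2) *\<^sub>R G p w (f z))) v = inner (- L z) v" .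
  qed
  have 2: "(3/2) *\<^sub>R G p w (f z) = - g (L z)"
    using isometry_adjoint_exact [OF g(1,2), of "(3/2) *\<^sub>R G p w (f z)"] shape_bound [OF fp w f(3) [of z]]
    by (simp only: adj L(1) ng norm_minus_cancel linear_neg [OF g(1)])
  have "(2/3) *\<^sub>R ((3/2) *\<^sub>R v) = v" for v :: 'a by simp
  then show "G p w (g z) = (2/3) *\<^sub>R f (L z)" "G p w (f z) = - ((2/3) *\<^sub>R g (L z))"
    using 1 2 by (metis, metis scaleR_minus_right)
qed

end

section \<open>Frames built from adapted bases\<close>

definition frame_map :: "(nat \<Rightarrow> 'a::real_inner) \<Rightarrow> octonion \<Rightarrow> 'a" where
  "frame_map w X = (\<Sum>b=0..7. inner X (oe b) *\<^sub>R w b)"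

lemma linear_frame_map: "linear (frame_map w)"
  unfolding frame_map_def
  by (rule linearI) (simp_all add: inner_add_left scaleR_add_left sum.distrib scaleR_sum_right)

lemma frame_map_oe: "b \<le> 7 \<Longrightarrow> frame_map w (oe b) = w b"
proof -
  assume b: "b \<le> 7"
  have "frame_map w (oe b) = (\<Sum>c=0..7. if c = b then w b else 0)"
    unfolding frame_map_def by (rule sum.cong) (use b in \<open>auto simp: inner_oe\<close>)
  then show ?thesis using b by simp
qed

lemma inner_frame_map:
  assumes "\<And>i j. i \<le> 7 \<Longrightarrow> j \<le> 7 \<Longrightarrow> inner (w i) (w j) = (if i = j then 1 else 0)"
  shows "inner (frame_map w X) (frame_map w Y) = inner X Y"
proof -
  have "inner (frame_map w X) (frame_map w Y) = (\<Sum>b=0..7. inner X (oe b) * inner (w b) (frame_map w Y))"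
    by (simp add: frame_map_def [of w X] inner_sum_left)
  also have "\<dots> = (\<Sum>b=0..7. inner X (oe b) * inner Y (oe b))"
  proof (rule sum.cong [OF refl])
    fix b :: nat assume b: "b \<in> {0..7}"
    have "inner (w b) (frame_map w Y) = (\<Sum>c=0..7. if c = b then inner Y (oe b) else 0)"
      unfolding frame_map_def inner_sum_right by (rule sum.cong) (use b assms in auto)
    also have "\<dots> = inner Y (oe b)" using b by simp
    finally show "inner X (oe b) * inner (w b) (frame_map w Y) = inner X (oe b) * inner Y (oe b)" by simp
  qed
  also have "\<dots> = inner X Y" by (rule oe_parseval)
  finally show ?thesis .
qed

lemma frame_map_mem:
  assumes "subspace S" "\<And>b. b \<le> 7 \<Longrightarrow> w b \<in> S"
  shows "frame_map w X \<in> S"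
  unfolding frame_map_def by (intro subspace_sum subspace_scale assms) auto

lemma span_frame_map: "range (frame_map w) = span (w ` {0..7})"
proof
  show "range (frame_map w) \<subseteq> span (w ` {0..7})"
  proof clarify
    fix X show "frame_map w X \<in> span (w ` {0..7})"
      by (rule frame_map_mem [OF subspace_span]) (auto intro: span_base)
  qed
  have "w b \<in> range (frame_map w)" if "b \<in> {0..7}" for b
    using frame_map_oe [of b w] that by (metis atLeastAtMost_iff rangeI)
  then show "span (w ` {0..7}) \<subseteq> range (frame_map w)"
    by (intro span_minimal linear_subspace_image linear_frame_map) auto
qed

locale adapted_frame = focal_geometry G F \<tau> d + C: unital_composition circ
  for G :: "real ^ 32 \<Rightarrow> real ^ 32 \<Rightarrow> real ^ 32 \<Rightarrow> real ^ 32" and F \<tau> d and circ :: "octonion \<Rightarrow> octonion \<Rightarrow> octonion" 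
    (infixl \<open>\<star>\<close> 70) +
  fixes x :: "real ^ 32" and n u :: "nat \<Rightarrow> real ^ 32" and \<phi>p \<phi>m :: "octonion \<Rightarrow> real ^ 32"
  assumes condA: "condition_A F x" and adapted: "adapted_bases F x n \<phi>p \<phi>m u"
    and circ_eq: "circ = mirror_product F n \<phi>p \<phi>m u"
begin

definition \<phi> where "\<phi> = frame_map n"
definition \<psi> where "\<psi> = frame_map (\<lambda>b. if b = 0 then x else u b)"

lemma x_focal: "x \<in> focal F" "focal_point x"
  using condA focal_iff by (auto simp: condition_A_def)

lemma adaptedD:
  shows inner_n: "i \<le> 7 \<Longrightarrow> j \<le> 7 \<Longrightarrow> inner (n i) (n j) = (if i = j then 1 else 0)"
    and span_n: "span (n ` {0..7}) = normal x"
    and p: "linear \<phi>p" "inner (\<phi>p z) (\<phi>p w) = inner z w" "range \<phi>p = shape_eigenspace (focal F) x (n 0) 1"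
    and m: "linear \<phi>m" "inner (\<phi>m z) (\<phi>m w) = inner z w" "range \<phi>m = shape_eigenspace (focal F) x (n 0) (-1)"
    and inner_u: "i \<in> {1..7} \<Longrightarrow> j \<in> {1..7} \<Longrightarrow> inner (u i) (u j) = (if i = j then 1 else 0)"
    and span_u: "span (u ` {1..7}) = shape_eigenspace (focal F) x (n 0) 0"
    and blk: "a \<in> {1..7} \<Longrightarrow> block \<phi>p \<phi>m (shape_operator (focal F) x (n a)) z = oe a \<cdot> z"
  using adapted norm_linear_isometry [of \<phi>p] norm_linear_isometry [of \<phi>m]
  unfolding adapted_bases_def orthonormal_basis_def normal_space_eq [OF x_focal(1)] by auto

lemma n_normal: "b \<le> 7 \<Longrightarrow> n b \<in> normal x"
  using span_n by (metis atLeastAtMost_iff imageI le0 span_base)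

lemma norm_n: "b \<le> 7 \<Longrightarrow> norm (n b) = 1"
  using inner_n [of b b] by (simp add: norm_eq_sqrt_inner)

lemma eigenspace_iff:
  assumes "\<nu> \<in> normal x"
  shows "y \<in> shape_eigenspace (focal F) x \<nu> c \<longleftrightarrow> y \<in> tang x \<and> G x \<nu> y = (2/3 * c) *\<^sub>R y"
proof -
  have "(3/2) *\<^sub>R G x \<nu> y = c *\<^sub>R y \<longleftrightarrow> G x \<nu> y = (2/3 * c) *\<^sub>R y"
  proof
    assume "(3/2) *\<^sub>R G x \<nu> y = c *\<^sub>R y"
    then have "(2/3) *\<^sub>R ((3/2) *\<^sub>R G x \<nu> y) = (2/3) *\<^sub>R (c *\<^sub>R y)" by simp
    then show "G x \<nu> y = (2/3 * c) *\<^sub>R y" by simp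
  qed simp
  then show ?thesis
    unfolding shape_eigenspace_def tangent_space_eq [OF x_focal(1)]
    using shape_operator_eq [OF x_focal(1) assms] by auto
qed

lemma V_tang: "\<phi>p z \<in> tang x" "\<phi>m z \<in> tang x"
  and G_n0: "G x (n 0) (\<phi>p z) = (2/3) *\<^sub>R \<phi>p z" "G x (n 0) (\<phi>m z) = - ((2/3) *\<^sub>R \<phi>m z)"
  using eigenspace_iff [OF n_normal, of 0 "\<phi>p z" 1] eigenspace_iff [OF n_normal, of 0 "\<phi>m z" "- 1"] p(3) m(3) by auto

lemma u_tang: "b \<in> {1..7} \<Longrightarrow> u b \<in> tang x"
  and G_n_u: "a \<le> 7 \<Longrightarrow> b \<in> {1..7} \<Longrightarrow> G x (n a) (u b) = 0"
proof -
  have *: "u b \<in> shape_eigenspace (focal F) x (n 0) 0" if "b \<in> {1..7}" for b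
    using span_u that by (metis imageI span_base)
  then show "b \<in> {1..7} \<Longrightarrow> u b \<in> tang x" using eigenspace_iff [OF n_normal, of 0] by auto
  assume a: "a \<le> 7" and b: "b \<in> {1..7}"
  \<comment> \<open>Condition A: all unit normals share the kernel spanned by the
    \<open>u b\<close>.\<close>
  have "u b \<in> shape_eigenspace (focal F) x (n a) 0"
    using condA * [OF b] n_normal [OF a] n_normal [of 0] norm_n [OF a] norm_n [of 0]
    unfolding condition_A_def normal_space_eq [OF x_focal(1)] by blast
  then show "G x (n a) (u b) = 0" using eigenspace_iff [OF n_normal [OF a]] by simp
qed

lemma G_phi_u: "b \<in> {1..7} \<Longrightarrow> G x (\<phi> X) (u b) = 0"
  unfolding \<phi>_def frame_map_def by (simp add: linear_sum [OF lin2] G_scale G_n_u)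

lemma phi_normal: "\<phi> X \<in> normal x"
  unfolding \<phi>_def by (rule frame_map_mem [OF subspace_normal [OF x_focal(2)] n_normal])

lemma phi_psi_oe: "\<phi> (oe 0) = n 0" "b \<in> {1..7} \<Longrightarrow> \<phi> (oe b) = n b" "\<psi> (oe 0) = x" "b \<in> {1..7} \<Longrightarrow> \<psi> (oe b) = u b"
  by (simp_all add: \<phi>_def \<psi>_def frame_map_oe)

lemma linear_phi_psi: "linear \<phi>" "linear \<psi>"
  by (simp_all add: \<phi>_def \<psi>_def linear_frame_map)

lemma inner_eigen: "inner (\<phi>p z) (\<phi>m w) = 0" "b \<in> {1..7} \<Longrightarrow> inner (u b) (\<phi>p z) = 0" "b \<in> {1..7} \<Longrightarrow> inner (u b) (\<phi>m z) = 0"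
proof -
  have "inner (G x (n 0) (\<phi>p z)) (\<phi>m w) = inner (G x (n 0) (\<phi>m w)) (\<phi>p z)" by (rule inner_swap)
  then show "inner (\<phi>p z) (\<phi>m w) = 0" by (simp add: G_n0 inner_commute)
  assume b: "b \<in> {1..7}"
  have "inner (G x (n 0) (u b)) (\<phi>p z) = inner (G x (n 0) (\<phi>p z)) (u b)" by (rule inner_swap)
  then show "inner (u b) (\<phi>p z) = 0" using G_n_u [of 0 b] b by (simp add: G_n0 inner_commute)
  have "inner (G x (n 0) (u b)) (\<phi>m z) = inner (G x (n 0) (\<phi>m z)) (u b)" by (rule inner_swap)
  then show "inner (u b) (\<phi>m z) = 0" using G_n_u [of 0 b] b by (simp add: G_n0 inner_commute)
qed

lemma inner_x: "inner x x = 1" "b \<in> {1..7} \<Longrightarrow> inner (u b) x = 0" "inner (\<phi>p z) x = 0" "inner (\<phi>m z) x = 0" "inner (\<phi> X) x = 0"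
  using focal_inner [OF x_focal(2)] u_tang V_tang normal_perp [OF x_focal(2) phi_normal] by (auto simp: tang_def)

lemma inner_x': "b \<in> {1..7} \<Longrightarrow> inner x (u b) = 0" "inner x (\<phi>p z) = 0" "inner x (\<phi>m z) = 0" "inner x (\<phi> X) = 0"
  using inner_x(2-5) by (metis inner_commute)+

lemma inner_phi_psi: "inner (\<phi> X) (\<phi> Y) = inner X Y" "inner (\<psi> X) (\<psi> Y) = inner X Y"
proof -
  show "inner (\<phi> X) (\<phi> Y) = inner X Y" unfolding \<phi>_def by (rule inner_frame_map) (rule inner_n)
  show "inner (\<psi> X) (\<psi> Y) = inner X Y" unfolding \<psi>_def
    by (rule inner_frame_map) (use inner_u inner_x inner_x' in auto)
qed

lemma psi_orth:
  assumes "inner x v = 0" "\<And>b. b \<in> {1..7} \<Longrightarrow> inner (u b) v = 0"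
  shows "inner (\<psi> Y) v = 0"
  unfolding \<psi>_def frame_map_def inner_sum_left by (rule sum.neutral) (use assms in auto)

lemma frame_orth: "inner (\<phi> z) (\<psi> w) = 0" "inner (\<phi> z) (\<phi>p w) = 0" "inner (\<phi> z) (\<phi>m w) = 0"
      "inner (\<psi> z) (\<phi>p w) = 0" "inner (\<psi> z) (\<phi>m w) = 0"
proof -
  have "inner (\<psi> w) (\<phi> z) = 0"
    by (rule psi_orth) (use inner_x' tang_normal_perp [OF x_focal(2) u_tang phi_normal] in auto)
  then show "inner (\<phi> z) (\<psi> w) = 0" by (simp add: inner_commute)
  show "inner (\<phi> z) (\<phi>p w) = 0" "inner (\<phi> z) (\<phi>m w) = 0"
    using tang_normal_perp [OF x_focal(2) V_tang(1) phi_normal] tang_normal_perp [OF x_focal(2) V_tang(2) phi_normal] by auto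
  show "inner (\<psi> z) (\<phi>p w) = 0" "inner (\<psi> z) (\<phi>m w) = 0"
    by (rule psi_orth; use inner_x' inner_eigen in simp)+
qed

text \<open>From S^3 = S, the maps (S^2 + S)/2, (S^2 - S)/2 and 1 - S^2 project the tangent space
  onto V_+, V_- and V_0.\<close>

lemma frame_spanning: "\<exists>X Y W Z. v = \<phi> X + \<psi> Y + \<phi>p W + \<phi>m Z"
proof -
  obtain y w where d: "y \<in> tang x" "w \<in> normal x" "v = inner v x *\<^sub>R x + y + w"
    by (rule decomposition [OF x_focal(2)])
  have "w \<in> range (frame_map n)" using d(2) unfolding span_frame_map span_n .
  then obtain X where X: "w = \<phi> X" unfolding \<phi>_def by (rule rangeE)
  define S where "S v = (3/2) *\<^sub>R G x (n 0) v" for v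
  have S3: "S (S (S y)) = S y"
    unfolding S_def by (rule shape_cubed [OF x_focal(2) n_normal norm_n d(1)]) auto
  have St: "S v \<in> tang x" if "v \<in> tang x" for v
    unfolding S_def by (intro subspace_scale subspace_tang x_focal G_tang_normal_mem that n_normal) auto
  have S_lin: "S (a + b) = S a + S b" "S (a - b) = S a - S b" "S (r *\<^sub>R a) = r *\<^sub>R S a" for a b r
    by (simp_all add: S_def G_add G_diff G_scale scaleR_add_right scaleR_diff_right)
  have eig: "v \<in> shape_eigenspace (focal F) x (n 0) c" if "v \<in> tang x" "S v = c *\<^sub>R v" for v c
    using that shape_operator_eq [OF x_focal(1) n_normal, of 0 v]
    by (simp add: shape_eigenspace_def tangent_space_eq [OF x_focal(1)] S_def)
  have "(1/2) *\<^sub>R (S (S y) + S y) \<in> range \<phi>p" unfolding p(3)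
    by (rule eig) (intro subspace_scale subspace_add subspace_tang x_focal St d, simp add: S_lin S3 add.commute)
  then obtain W where W: "(1/2) *\<^sub>R (S (S y) + S y) = \<phi>p W" by blast
  have "(1/2) *\<^sub>R (S (S y) - S y) \<in> range \<phi>m" unfolding m(3)
    by (rule eig) (intro subspace_scale subspace_diff subspace_tang x_focal St d, simp add: S_lin S3 scaleR_diff_right)
  then obtain Z where Z: "(1/2) *\<^sub>R (S (S y) - S y) = \<phi>m Z" by blast
  have "y - S (S y) \<in> span (u ` {1..7})" unfolding span_u
    by (rule eig) (intro subspace_scale subspace_diff subspace_tang x_focal St d, simp add: S_lin S3)
  then have "inner v x *\<^sub>R x + (y - S (S y)) \<in> range \<psi>"
    unfolding \<psi>_def span_frame_map
    by (intro span_add span_scale) (auto intro: span_base simp: image_iff elim!: subsetD [OF span_mono, rotated]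
      bexI [of _ 0])
  then obtain Y where Y: "inner v x *\<^sub>R x + (y - S (S y)) = \<psi> Y" by blast
  have "v = \<phi> X + (inner v x *\<^sub>R x + (y - S (S y))) + (1/2) *\<^sub>R (S (S y) + S y) + (1/2) *\<^sub>R (S (S y) - S y)"
    using d(3) by (simp add: X algebra_simps)
  then show ?thesis unfolding W Z Y by blast
qed

lemma iso_pm: "norm (\<phi>p z) = norm z" "norm (\<phi>m z) = norm z"
  by (simp_all add: norm_eq_sqrt_inner p m)

lemma G_x_formula: "G x (\<phi> X) (\<phi>p W + \<phi>m Z) =
    (2/3) *\<^sub>R (\<phi>p (inner X (oe 0) *\<^sub>R W + im X \<cdot> Z) - \<phi>m (im X \<cdot> W + inner X (oe 0) *\<^sub>R Z))"
proof (rule linear_eq_oe [where f = "\<lambda>X. G x (\<phi> X) (\<phi>p W + \<phi>m Z)"])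
  show "linear (\<lambda>X. G x (\<phi> X) (\<phi>p W + \<phi>m Z))"
    by (rule linearI) (simp_all add: linear_add [OF linear_phi_psi(1)] linear_scale [OF linear_phi_psi(1)] G_add
      G_scale scaleR_add_right)
  show "linear (\<lambda>X. (2/3) *\<^sub>R (\<phi>p (inner X (oe 0) *\<^sub>R W + im X \<cdot> Z) - \<phi>m (im X \<cdot> W + inner X (oe 0) *\<^sub>R Z)))"
    by (rule linearI) (simp_all add: linear_add [OF p(1)] linear_scale [OF p(1)] linear_add [OF m(1)] linear_scale [OF m(1)]
        linear_add [OF linear_im] linear_scale [OF linear_im] O.add_left O.scaleR_left inner_add_left algebra_simps)
  fix a :: nat assume a: "a \<in> {0..7}"
  show "G x (\<phi> (oe a)) (\<phi>p W + \<phi>m Z) = (2/3) *\<^sub>R (\<phi>p (inner (oe a) (oe 0) *\<^sub>R W + im (oe a) \<cdot> Z) - \<phi>m (im (oe a) \<cdot>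
    W + inner (oe a) (oe 0) *\<^sub>R Z))"
  proof (cases "a = 0")
    case True
    then show ?thesis
      by (simp add: phi_psi_oe G_add G_n0 inner_oe_0 im_oe O.zero_left scaleR_diff_right)
  next
    case False
    with a have a': "a \<in> {1..7}" by auto
    have im: "inner (oe a) (oe 0) = 0" using a' by (simp add: inner_oe)
    have "adjoint \<phi>p ((3/2) *\<^sub>R G x (n a) (\<phi>m z)) = oe a \<cdot> z" for z
      using blk [OF a', of z] shape_operator_eq [OF x_focal(1) n_normal V_tang(2), of a z] a' by (simp add: block_def)
    note sb = shape_block [OF x_focal(2) n_normal norm_n p(1,2) V_tang(1) m(1,2) V_tang(2) _ _ this]
    have "G x (n a) (\<phi>m z) = (2/3) *\<^sub>R \<phi>p (oe a \<cdot> z)" "G x (n a) (\<phi>p z) = - ((2/3) *\<^sub>R \<phi>m (oe a \<cdot> z))" for z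
      by (rule sb; use a' in \<open>simp add: norm_omul norm_oe O.im_skew [OF im]\<close>)+
    then show ?thesis
      using a' by (simp add: phi_psi_oe G_add im im_oe scaleR_diff_right)
  qed
qed

text \<open>Multiplication by im X squares to - |im X|^2. With the opposite signs on V_+ and V_- the
  block operator therefore squares to |X|^2, and its cross terms cancel.\<close>

lemma V_square:
  assumes "unital_composition mul"
  defines "T \<equiv> \<lambda>X W Z. \<phi>p (inner X (oe 0) *\<^sub>R W + mul (im X) Z) - \<phi>m (mul (im X) W + inner X (oe 0) *\<^sub>R Z)"
  shows "T X (inner X (oe 0) *\<^sub>R W + mul (im X) Z) (- (mul (im X) W + inner X (oe 0) *\<^sub>R Z)) = (norm X)\<^sup>2 *\<^sub>R (\<phi>p W + \<phi>m Z)"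
proof -
  interpret M: unital_composition mul by fact
  have "mul (im X) (mul (im X) v) = - ((norm (im X))\<^sup>2 *\<^sub>R v)" for v
  proof -
    have "- mul (im X) (mul (im X) v) = (norm (im X))\<^sup>2 *\<^sub>R v"
      using M.cnj_mul_self [of "im X" v] by (simp add: ocnj_eq M.minus_left)
    then show ?thesis by (metis minus_minus)
  qed
  moreover have "inner X (oe 0) * inner X (oe 0) + (norm (im X))\<^sup>2 = (norm X)\<^sup>2"
    using norm_im [of X] by (simp add: power2_eq_square)
  ultimately have sq: "(inner X (oe 0) * inner X (oe 0)) *\<^sub>R v - mul (im X) (mul (im X) v) = (norm X)\<^sup>2 *\<^sub>R v" for v
    by (simp flip: scaleR_add_left)
  have "inner X (oe 0) *\<^sub>R (inner X (oe 0) *\<^sub>R W + mul (im X) Z) + mul (im X) (- (mul (im X) W + inner X (oe 0) *\<^sub>R Z))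
      = (inner X (oe 0) * inner X (oe 0)) *\<^sub>R W - mul (im X) (mul (im X) W)"
    by (simp add: M.minus_right M.add_right M.scaleR_right M.diff_right scaleR_add_right)
  moreover have "mul (im X) (inner X (oe 0) *\<^sub>R W + mul (im X) Z) + inner X (oe 0) *\<^sub>R (- (mul (im X) W + inner X
    (oe 0) *\<^sub>R Z))
      = - ((inner X (oe 0) * inner X (oe 0)) *\<^sub>R Z - mul (im X) (mul (im X) Z))"
    by (simp add: M.add_right M.scaleR_right scaleR_add_right scaleR_diff_right)
  ultimately have "inner X (oe 0) *\<^sub>R (inner X (oe 0) *\<^sub>R W + mul (im X) Z) + mul (im X) (- (mul (im X) W + inner X
    (oe 0) *\<^sub>R Z)) = (norm X)\<^sup>2 *\<^sub>R W"
    "mul (im X) (inner X (oe 0) *\<^sub>R W + mul (im X) Z) + inner X (oe 0) *\<^sub>R (- (mul (im X) W + inner X (oe 0) *\<^sub>R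
      Z)) = - ((norm X)\<^sup>2 *\<^sub>R Z)"
    by (simp_all only: sq)
  then show ?thesis
    unfolding T_def by (simp add: linear_scale [OF p(1)] linear_scale [OF m(1)] linear_neg [OF m(1)] scaleR_add_right)
qed

text \<open>The formula makes (3/2) G q w square to |X|^2, and \<open>G_normal_normal_tang\<close>
  then gives the factor 4/3 - 1 = 1/3.\<close>

lemma normal_square:
  assumes fp: "focal_point q" and w: "w \<in> normal q" and V: "\<And>W Z. \<phi>p W + \<phi>m Z \<in> tang q" and mul: "unital_composition mul"
    and formula: "\<And>W Z. G q w (\<phi>p W + \<phi>m Z) =
      (2/3) *\<^sub>R (\<phi>p (inner X (oe 0) *\<^sub>R W + mul (im X) Z) - \<phi>m (mul (im X) W + inner X (oe 0) *\<^sub>R Z))"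
    and nw: "norm w = norm X"
  shows "G w w (\<phi>p W + \<phi>m Z) = ((norm X)\<^sup>2 / 3) *\<^sub>R (\<phi>p W + \<phi>m Z)"
proof -
  define W' Z' where "W' = inner X (oe 0) *\<^sub>R W + mul (im X) Z" and "Z' = - (mul (im X) W + inner X (oe 0) *\<^sub>R Z)"
  have "G q w (\<phi>p W + \<phi>m Z) = (2/3) *\<^sub>R (\<phi>p W' + \<phi>m Z')"
    unfolding formula by (simp only: W'_def Z'_def linear_neg [OF m(1)] diff_conv_add_uminus)
  moreover have "G q w (\<phi>p W' + \<phi>m Z') = (2/3) *\<^sub>R ((norm X)\<^sup>2 *\<^sub>R (\<phi>p W + \<phi>m Z))"
    unfolding formula by (simp only: W'_def Z'_def V_square [OF mul])
  ultimately show ?thesis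
    using G_normal_normal_tang [OF fp V w, of W Z] by (simp add: G_scale nw flip: scaleR_diff_left)
qed

lemma V_tang_x: "\<phi>p W + \<phi>m Z \<in> tang x"
  by (intro subspace_add subspace_tang x_focal V_tang)

lemma norm_phi_psi: "norm (\<phi> X) = norm X" "norm (\<psi> X) = norm X"
  by (simp_all add: norm_eq_sqrt_inner inner_phi_psi)

lemma G_ppv_formula: "G (\<phi> X) (\<phi> X) (\<phi>p W + \<phi>m Z) = ((norm X)\<^sup>2 / 3) *\<^sub>R (\<phi>p W + \<phi>m Z)"
  by (rule normal_square [OF x_focal(2) phi_normal V_tang_x O.unital_composition_axioms G_x_formula norm_phi_psi(1)])

lemma G_ppp_formula: "G (\<phi> X) (\<phi> X) (\<phi> X) = (norm X)\<^sup>2 *\<^sub>R \<phi> X"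
  using G_normal_cube [OF x_focal(2) phi_normal, of X] by (simp add: norm_phi_psi)

text \<open>By Condition A, G x (\<phi> X) annihilates the \<open>u b\<close>, so
  \<open>G_normal_normal_tang\<close> retains only the term - |X|^2. For X = e0 this says that x and
  V_0 are normal to the focal submanifold at n0.\<close>

lemma G_ppr_formula: "G (\<phi> X) (\<phi> X) (\<psi> Y) = - ((norm X)\<^sup>2 *\<^sub>R \<psi> Y)"
proof (rule linear_eq_oe [where f = "\<lambda>Y. G (\<phi> X) (\<phi> X) (\<psi> Y)"])
  show "linear (\<lambda>Y. G (\<phi> X) (\<phi> X) (\<psi> Y))" "linear (\<lambda>Y. - ((norm X)\<^sup>2 *\<^sub>R \<psi> Y))"
    by (rule linearI; simp add: linear_add [OF linear_phi_psi(2)] linear_scale [OF linear_phi_psi(2)] G_add G_scale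
      scaleR_add_right)+
  fix a :: nat assume a: "a \<in> {0..7}"
  show "G (\<phi> X) (\<phi> X) (\<psi> (oe a)) = - ((norm X)\<^sup>2 *\<^sub>R \<psi> (oe a))"
  proof (cases "a = 0")
    case True
    have "G (\<phi> X) (\<phi> X) x = G x (\<phi> X) (\<phi> X)" by (metis G_sym)
    then show ?thesis using True G_normal_normal [OF x_focal(2) phi_normal phi_normal, of X X]
      by (simp add: phi_psi_oe inner_phi_psi power2_norm_eq_inner)
  next
    case False
    then show ?thesis using a G_normal_normal_tang [OF x_focal(2) u_tang phi_normal, of a X]
      by (simp add: phi_psi_oe G_phi_u norm_phi_psi)
  qed
qed

lemma n0_focal: "focal_point (n 0)" "n 0 \<in> focal F"
  using G_normal_focal [OF x_focal(2) n_normal norm_n, of 0] by (auto simp: focal_iff)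

lemma psi_normal: "\<psi> Y \<in> normal (n 0)"
  using G_ppr_formula [of "oe 0" Y] by (simp add: normal_def phi_psi_oe norm_oe)

lemma V_tang_n0: "\<phi>p W + \<phi>m Z \<in> tang (n 0)"
proof -
  have "inner (\<phi>p W + \<phi>m Z) (n 0) = 0" using tang_normal_perp [OF x_focal(2) V_tang_x n_normal, of 0 W Z] by simp
  then show ?thesis using G_ppv_formula [of "oe 0" W Z] by (simp add: tang_def phi_psi_oe norm_oe)
qed

lemma V_tang_n0': "\<phi>p W \<in> tang (n 0)" "\<phi>m Z \<in> tang (n 0)"
  using V_tang_n0 [of W 0] V_tang_n0 [of 0 Z] by (simp_all add: linear_0 [OF p(1)] linear_0 [OF m(1)])

lemma mirror_block_eq: "a \<in> {1..7} \<Longrightarrow> mirror_block F n \<phi>p \<phi>m u a z = adjoint \<phi>p ((3/2) *\<^sub>R G (n 0) (u a) (\<phi>m z))"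
  using shape_operator_eq [OF n0_focal(2) psi_normal V_tang_n0'(2), of "oe a" z]
  by (simp add: mirror_block_def block_def phi_psi_oe)

lemma circ_oe: "a \<in> {1..7} \<Longrightarrow> oe a \<star> z = adjoint \<phi>p ((3/2) *\<^sub>R G (n 0) (u a) (\<phi>m z))"
proof (rule linear_eq_oe [where f = "\<lambda>z. oe a \<star> z"])
  show "linear (\<lambda>z. oe a \<star> z)" by (rule C.linear_mul_right)
  show "linear (\<lambda>z. adjoint \<phi>p ((3/2) *\<^sub>R G (n 0) (u a) (\<phi>m z)))"
    by (rule linearI) (simp_all add: linear_add [OF m(1)] linear_scale [OF m(1)] G_add G_scale scaleR_add_right
        linear_add [OF adjoint_linear [OF p(1)]] linear_scale [OF adjoint_linear [OF p(1)]])
  fix c :: nat assume a: "a \<in> {1..7}" and c: "c \<in> {0..7}"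
  have "oe a \<star> oe c = (\<Sum>a'=0..7. \<Sum>b=0..7. if a' = a \<and> b = c then mirror_block F n \<phi>p \<phi>m u a (oe c) else 0)"
    unfolding circ_eq mirror_product_def
    by (intro sum.cong refl) (use a c in \<open>auto simp: inner_oe\<close>)
  also have "\<dots> = (\<Sum>a'=0..7. if a' = a then mirror_block F n \<phi>p \<phi>m u a (oe c) else 0)"
    by (intro sum.cong refl) (use c in auto)
  also have "\<dots> = mirror_block F n \<phi>p \<phi>m u a (oe c)" using a by simp
  finally show "oe a \<star> oe c = adjoint \<phi>p ((3/2) *\<^sub>R G (n 0) (u a) (\<phi>m (oe c)))"
    using mirror_block_eq [OF a] by simp
qed

lemma G_n_formula: "G (n 0) (\<psi> Y) (\<phi>p W + \<phi>m Z) =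
    (2/3) *\<^sub>R (\<phi>p (inner Y (oe 0) *\<^sub>R W + im Y \<star> Z) - \<phi>m (im Y \<star> W + inner Y (oe 0) *\<^sub>R Z))"
proof (rule linear_eq_oe [where f = "\<lambda>Y. G (n 0) (\<psi> Y) (\<phi>p W + \<phi>m Z)"])
  show "linear (\<lambda>Y. G (n 0) (\<psi> Y) (\<phi>p W + \<phi>m Z))"
    by (rule linearI) (simp_all add: linear_add [OF linear_phi_psi(2)] linear_scale [OF linear_phi_psi(2)] G_add
      G_scale scaleR_add_right)
  show "linear (\<lambda>Y. (2/3) *\<^sub>R (\<phi>p (inner Y (oe 0) *\<^sub>R W + im Y \<star> Z) - \<phi>m (im Y \<star> W + inner Y (oe 0) *\<^sub>R Z)))"
    by (rule linearI) (simp_all add: linear_add [OF p(1)] linear_scale [OF p(1)] linear_add [OF m(1)] linear_scale [OF m(1)]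
        linear_add [OF linear_im] linear_scale [OF linear_im] C.add_left C.scaleR_left inner_add_left algebra_simps)
  fix a :: nat assume a: "a \<in> {0..7}"
  show "G (n 0) (\<psi> (oe a)) (\<phi>p W + \<phi>m Z) = (2/3) *\<^sub>R (\<phi>p (inner (oe a) (oe 0) *\<^sub>R W + im (oe a) \<star> Z) - \<phi>m (im (oe
    a) \<star> W + inner (oe a) (oe 0) *\<^sub>R Z))"
  proof (cases "a = 0")
    case True
    then show ?thesis
      by (simp add: phi_psi_oe G_add G_n0 swap12 [of "n 0" x] inner_oe_0 im_oe C.zero_left scaleR_diff_right)
  next
    case False
    with a have a': "a \<in> {1..7}" by auto
    have im: "inner (oe a) (oe 0) = 0" using a' by (simp add: inner_oe)
    have un: "u a \<in> normal (n 0)" "norm (u a) = 1"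
      using psi_normal [of "oe a"] norm_phi_psi(2) [of "oe a"] a' by (simp_all add: phi_psi_oe norm_oe)
    have "G (n 0) (u a) (\<phi>m z) = (2/3) *\<^sub>R \<phi>p (oe a \<star> z)" "G (n 0) (u a) (\<phi>p z) = - ((2/3) *\<^sub>R \<phi>m (oe a \<star> z))" for z
    proof -
      note sb = shape_block [OF n0_focal(1) un p(1,2) V_tang_n0'(1) m(1,2) V_tang_n0'(2) _ _ circ_oe [OF a', symmetric]]
      show "G (n 0) (u a) (\<phi>m z) = (2/3) *\<^sub>R \<phi>p (oe a \<star> z)" "G (n 0) (u a) (\<phi>p z) = - ((2/3) *\<^sub>R \<phi>m (oe a \<star> z))"
        by (rule sb; use a' in \<open>simp add: C.norm_mul norm_oe C.im_skew [OF im]\<close>)+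
    qed
    then show ?thesis
      using a' by (simp add: phi_psi_oe G_add im im_oe scaleR_diff_right)
  qed
qed

text \<open>The counterpart of \<open>G_ppr_formula\<close> at n0. The imaginary part of \<phi> X is
  tangent there and annihilated by the shape operators, as one sees by polarizing
  \<open>G_ppp_formula\<close> and \<open>G_ppr_formula\<close> around e0.\<close>

lemma G_rrp_formula: "G (\<psi> Y) (\<psi> Y) (\<phi> X) = - ((norm Y)\<^sup>2 *\<^sub>R \<phi> X)"
proof -
  define X' where "X' = im X"
  note lphi = linear_add [OF linear_phi_psi(1)] linear_diff [OF linear_phi_psi(1)] linear_scale [OF linear_phi_psi(1)]
  have X: "\<phi> X = inner X (oe 0) *\<^sub>R n 0 + \<phi> X'"
    by (subst im_decomp) (simp only: lphi phi_psi_oe X'_def)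
  have nX: "(norm (oe 0 + X'))\<^sup>2 = 1 + (norm X')\<^sup>2" "(norm (oe 0 - X'))\<^sup>2 = 1 + (norm X')\<^sup>2"
    unfolding power2_norm_eq_inner
    by (simp_all add: X'_def inner_add_left inner_add_right inner_diff_left inner_diff_right inner_oe_0
      inner_commute [of "oe 0" "im X"])
  have 1: "G (n 0) (\<phi> X') (\<psi> Y) = 0"
  proof -
    have "G (\<phi> (oe 0 + X')) (\<phi> (oe 0 + X')) (\<psi> Y) - G (\<phi> (oe 0 - X')) (\<phi> (oe 0 - X')) (\<psi> Y) = 0"
      unfolding G_ppr_formula nX by simp
    moreover have "inner z (G (\<phi> (oe 0 + X')) (\<phi> (oe 0 + X')) (\<psi> Y) - G (\<phi> (oe 0 - X')) (\<phi> (oe 0 - X')) (\<psi> Y))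
        = 4 * inner z (G (n 0) (\<phi> X') (\<psi> Y))" for z
      by (simp only: lphi phi_psi_oe G_add G_diff swap12 [of "\<phi> X'" "n 0"] inner_add_right inner_diff_right)
    ultimately have "inner z (G (n 0) (\<phi> X') (\<psi> Y)) = 0" for z by simp
    then show ?thesis using vector_eq_ldot [of "G (n 0) (\<phi> X') (\<psi> Y)" 0] by simp
  qed
  have 2: "6 *\<^sub>R G (n 0) (n 0) (\<phi> X') = 2 *\<^sub>R \<phi> X'"
  proof (rule vector_eq_ldot [THEN iffD1], rule allI)
    fix z
    have "inner z (G (\<phi> (oe 0) + s *\<^sub>R \<phi> X') (\<phi> (oe 0) + s *\<^sub>R \<phi> X') (\<phi> (oe 0) + s *\<^sub>R \<phi> X'))
        = inner z ((norm (oe 0 + s *\<^sub>R X'))\<^sup>2 *\<^sub>R (\<phi> (oe 0) + s *\<^sub>R \<phi> X'))" for s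
      using G_ppp_formula [of "oe 0 + s *\<^sub>R X'"] by (simp add: lphi)
    from this [of 1] this [of "-1"] show "inner z (6 *\<^sub>R G (n 0) (n 0) (\<phi> X')) = inner z (2 *\<^sub>R \<phi> X')"
      unfolding G_cube
      by (simp add: phi_psi_oe inner_add_right inner_diff_right nX nX [unfolded add.commute [of "oe 0" X']]
        G_ppp_formula algebra_simps)
  qed
  have "inner (\<phi> X') (n 0) = 0" using inner_phi_psi(1) [of X' "oe 0"] by (simp add: phi_psi_oe X'_def)
  moreover have "G (n 0) (n 0) (\<phi> X') = (1/3) *\<^sub>R \<phi> X'"
  proof -
    have "(1/6) *\<^sub>R (6 *\<^sub>R G (n 0) (n 0) (\<phi> X')) = (1/6) *\<^sub>R (2 *\<^sub>R \<phi> X')" using 2 by simp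
    then show ?thesis by simp
  qed
  ultimately have t: "\<phi> X' \<in> tang (n 0)" by (simp add: tang_def)
  have "G (\<psi> Y) (\<psi> Y) (\<phi> X') = - ((norm Y)\<^sup>2 *\<^sub>R \<phi> X')"
    using G_normal_normal_tang [OF n0_focal(1) t psi_normal, of Y] 1 swap23 [of "n 0" "\<psi> Y" "\<phi> X'"]
      by (simp add: norm_phi_psi)
  moreover have "G (\<psi> Y) (\<psi> Y) (n 0) = - ((norm Y)\<^sup>2 *\<^sub>R n 0)"
    using G_normal_normal [OF n0_focal(1) psi_normal psi_normal, of Y Y] swap12 [of "n 0"
      "\<psi> Y" "\<psi> Y"] swap23 [of "\<psi> Y" "n 0" "\<psi> Y"]
    by (simp add: inner_phi_psi power2_norm_eq_inner)
  ultimately show ?thesis unfolding X by (simp add: G_add G_scale algebra_simps)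
qed

sublocale mirror_frame G circ \<phi> \<psi> \<phi>p \<phi>m
proof (intro mirror_frame.intro mirror_frame_axioms.intro)
  show "quartic_form G" by (rule quartic_form_axioms)
  show "unital_composition circ" by (rule C.unital_composition_axioms)
  show "G (\<psi> Y) (\<psi> Y) (\<psi> Y) = (norm Y)\<^sup>2 *\<^sub>R \<psi> Y" for Y
    using G_normal_cube [OF n0_focal(1) psi_normal, of Y] by (simp add: norm_phi_psi)
  show "G (\<psi> Y) (\<psi> Y) (\<phi>p W + \<phi>m Z) = ((norm Y)\<^sup>2 / 3) *\<^sub>R (\<phi>p W + \<phi>m Z)" for Y W Z
    by (rule normal_square [OF n0_focal(1) psi_normal V_tang_n0 C.unital_composition_axioms G_n_formula norm_phi_psi(2)])
  show "G (\<phi> X) (\<psi> (oe 0)) (\<phi>p W + \<phi>m Z) =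
      (2/3) *\<^sub>R (\<phi>p (inner X (oe 0) *\<^sub>R W + im X \<cdot> Z) - \<phi>m (im X \<cdot> W + inner X (oe 0) *\<^sub>R Z))" for X W Z
    using G_x_formula [of X W Z] swap12 [of x "\<phi> X"] by (simp add: phi_psi_oe)
qed (fact linear_phi_psi p m inner_phi_psi frame_orth inner_eigen frame_spanning G_ppp_formula G_ppr_formula G_ppv_formula
    G_rrp_formula G_n_formula [folded phi_psi_oe(1)])+

end

section \<open>The Ferus-Karcher-Muenzner polynomial\<close>

context quartic_form
begin

lemma quartic_odd_part:
  "inner (G (y + s *\<^sub>R v) (y + s *\<^sub>R v) (y + s *\<^sub>R v)) (y + s *\<^sub>R v) - inner (G (y - s *\<^sub>R v) (y - s *\<^sub>R v) (y - s
    *\<^sub>R v)) (y - s *\<^sub>R v)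
    = 8 * s * inner (G y y y) v + 8 * s ^ 3 * inner (G v v v) y"
proof -
  have e: "inner (G (y + s *\<^sub>R v) (y + s *\<^sub>R v) (y + s *\<^sub>R v)) (y + s *\<^sub>R v) =
      inner (G y y y) y + 4 * s * inner (G y y y) v + 6 * s\<^sup>2 * inner (G y y v) v + 4 * s ^ 3 * inner (G v v v) y
      + s ^ 4 * inner (G v v v) v" for s
  proof -
    have "inner (G y y v) y = inner (G y y y) v"
      "inner (G y v v) y = inner (G y y v) v" "inner (G y v v) v = inner (G v v v) y"
      by (metis inner_swap G_sym)+
    then show ?thesis
      unfolding G_cube by (simp add: inner_add_left inner_add_right power2_eq_square power3_eq_cube power4_eq_xxxx
        algebra_simps)
  qed
  show ?thesis using e [of s] e [of "- s"] by simp
qed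

end

section \<open>The mirror point\<close>

context mirror_frame
begin

lemma G_ppr_polar: "G (\<phi> X) (\<phi> X') (\<psi> Y) = - (inner X X' *\<^sub>R \<psi> Y)"
proof (rule vector_eq_ldot [THEN iffD1], rule allI)
  fix z
  have "inner z (G (\<phi> (X + X')) (\<phi> (X + X')) (\<psi> Y)) = - ((norm (X + X'))\<^sup>2 * inner z (\<psi> Y))"
    "inner z (G (\<phi> X) (\<phi> X) (\<psi> Y)) = - ((norm X)\<^sup>2 * inner z (\<psi> Y))"
    "inner z (G (\<phi> X') (\<phi> X') (\<psi> Y)) = - ((norm X')\<^sup>2 * inner z (\<psi> Y))"
    by (simp_all add: G_ppr)
  then show "inner z (G (\<phi> X) (\<phi> X') (\<psi> Y)) = inner z (- (inner X X' *\<^sub>R \<psi> Y))"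
    unfolding power2_norm_eq_inner
    by (simp add: frame_add G_add swap12 [of "\<phi> X'"
      "\<phi> X"] inner_add_right inner_add_left inner_commute [of X' X] algebra_simps)
qed

lemma G_rrp_polar: "G (\<psi> Y) (\<psi> Y') (\<phi> X) = - (inner Y Y' *\<^sub>R \<phi> X)"
proof (rule vector_eq_ldot [THEN iffD1], rule allI)
  fix z
  have "inner z (G (\<psi> (Y + Y')) (\<psi> (Y + Y')) (\<phi> X)) = - ((norm (Y + Y'))\<^sup>2 * inner z (\<phi> X))"
    "inner z (G (\<psi> Y) (\<psi> Y) (\<phi> X)) = - ((norm Y)\<^sup>2 * inner z (\<phi> X))"
    "inner z (G (\<psi> Y') (\<psi> Y') (\<phi> X)) = - ((norm Y')\<^sup>2 * inner z (\<phi> X))"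
    by (simp_all add: G_rrp)
  then show "inner z (G (\<psi> Y) (\<psi> Y') (\<phi> X)) = inner z (- (inner Y Y' *\<^sub>R \<phi> X))"
    unfolding power2_norm_eq_inner
    by (simp add: frame_add G_add swap12 [of "\<psi> Y'"
      "\<psi> Y"] inner_add_right inner_add_left inner_commute [of Y' Y] algebra_simps)
qed

lemma cube_polar:
  fixes f :: "octonion \<Rightarrow> 'a"
  assumes f: "linear f" "\<And>X. G (f X) (f X) (f X) = (norm X)\<^sup>2 *\<^sub>R f X" and orth: "inner X X' = 0"
  shows "G (f X) (f X) (f X') = ((norm X)\<^sup>2 / 3) *\<^sub>R f X'"
proof (rule vector_eq_ldot [THEN iffD1], rule allI)
  fix z
  have "inner z (G (f X + s *\<^sub>R f X') (f X + s *\<^sub>R f X') (f X + s *\<^sub>R f X')) =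
      ((norm X)\<^sup>2 + s\<^sup>2 * (norm X')\<^sup>2) * (inner z (f X) + s * inner z (f X'))" for s
  proof -
    have "(norm (X + s *\<^sub>R X'))\<^sup>2 = (norm X)\<^sup>2 + s\<^sup>2 * (norm X')\<^sup>2"
      unfolding power2_norm_eq_inner using orth inner_commute [of X' X]
      by (simp add: inner_add_left inner_add_right power2_eq_square)
    then show ?thesis
      using f(2) [of "X + s *\<^sub>R X'"] by (simp add: linear_add [OF f(1)] linear_scale [OF f(1)] inner_add_right)
  qed
  from this [of 1] this [of "-1"] show "inner z (G (f X) (f X) (f X')) = inner z (((norm X)\<^sup>2 / 3) *\<^sub>R f X')"
    unfolding G_cube by (simp add: inner_add_right inner_diff_right f(2) algebra_simps)
qed

text \<open>The identity G p p p = - p gives F p = -1, so p lies on the other focal submanifold. Its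
  quartic form is - G, which is why the tangent vectors appear with eigenvalue -1/3 of G p
  p.\<close>

lemma mirror_point_tang:
  defines "p \<equiv> (\<psi> (oe 0) + \<phi> (oe 0)) /\<^sub>R sqrt 2"
  shows "norm p = 1" "G p p p = - p"
    and "inner X (oe 0) = 0 \<Longrightarrow> inner Y (oe 0) = 0 \<Longrightarrow> inner (\<phi> X + \<psi> Y + \<phi>m Z) p = 0"
    and "inner X (oe 0) = 0 \<Longrightarrow> inner Y (oe 0) = 0 \<Longrightarrow>
      G p p (\<phi> X + \<psi> Y + \<phi>m Z) = - ((1/3) *\<^sub>R (\<phi> X + \<psi> Y + \<phi>m Z))"
proof -
  define a b where "a = \<psi> (oe 0)" and "b = \<phi> (oe 0)"
  have p: "p = inverse (sqrt 2) *\<^sub>R (a + b)" by (simp add: p_def a_def b_def)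
  have Gpp: "G p p y = (1/2) *\<^sub>R (G a a y + G b b y + 2 *\<^sub>R G b a y)" for y
  proof -
    have "inverse (sqrt 2) *\<^sub>R (inverse (sqrt 2) *\<^sub>R v) = (1/2) *\<^sub>R v" for v :: 'a
      by (simp flip: mult.assoc inverse_mult_distrib)
    then have "G p p y = (1/2) *\<^sub>R G (a + b) (a + b) y" by (simp only: p G_scale)
    then show ?thesis by (simp add: G_add swap12 [of a b] scaleR_2 add_ac)
  qed
  have ab: "inner a a = 1" "inner b b = 1" "inner a b = 0" "inner b a = 0"
    by (simp_all add: a_def b_def iso orth orth' inner_oe_0)
  have "inner p p = 1" unfolding p by (simp add: inner_add_left inner_add_right ab) (simp add: field_simps)
  then show "norm p = 1" by (simp add: norm_eq_sqrt_inner)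
  have "G a a a = a" "G b b b = b" "G a a b = - b" "G b a a = - b" "G b b a = - a" "G b a b = - a"
    using G_rrr [of "oe 0"] G_ppp [of "oe 0"] G_rrp [of "oe 0"
      "oe 0"] G_ppr [of "oe 0" "oe 0"] swap23 [of b a b] swap12 [of b a a] swap23 [of a a b]
    by (simp_all add: a_def b_def norm_oe)
  then have "G p p (a + b) = - (a + b)"
    unfolding Gpp by (simp add: G_add scaleR_add_right flip: scaleR_2)
  then show "G p p p = - p" by (simp add: p G_scale flip: scaleR_minus_right)
  assume X: "inner X (oe 0) = 0" and Y: "inner Y (oe 0) = 0"
  show "inner (\<phi> X + \<psi> Y + \<phi>m Z) p = 0"
    by (simp add: p a_def b_def inner_add_left inner_add_right iso orth orth' X Y)
  have X': "inner (oe 0) X = 0" and Y': "inner (oe 0) Y = 0" using X Y by (simp_all add: inner_commute)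
  have 1: "G a a (\<phi> X) = - \<phi> X" "G b b (\<phi> X) = (1/3) *\<^sub>R \<phi> X" "G b a (\<phi> X) = 0"
    using G_rrp [of "oe 0" X] cube_polar [OF lin_frame(1) G_ppp X'] G_ppr_polar [of "oe 0" X "oe 0"] swap23 [of b a "\<phi> X"] X'
    by (simp_all add: a_def b_def norm_oe)
  have 2: "G a a (\<psi> Y) = (1/3) *\<^sub>R \<psi> Y" "G b b (\<psi> Y) = - \<psi> Y" "G b a (\<psi> Y) = 0"
    using G_ppr [of "oe 0" Y] cube_polar [OF lin_frame(2) G_rrr Y'] G_rrp_polar [of "oe 0" Y "oe 0"] swap12 [of b a
      "\<psi> Y"] swap23 [of a b "\<psi> Y"] Y'
    by (simp_all add: a_def b_def norm_oe)
  have 3: "G a a (\<phi>m Z) = (1/3) *\<^sub>R \<phi>m Z" "G b b (\<phi>m Z) = (1/3) *\<^sub>R \<phi>m Z" "G b a (\<phi>m Z) = - ((2/3) *\<^sub>R \<phi>m Z)"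
    using G_rrv [of "oe 0" 0 Z] G_ppv [of "oe 0" 0 Z] G_x [of "oe 0" 0 Z]
    by (simp_all add: a_def b_def norm_oe frame_0 im_oe O.zero_left inner_oe_0)
  have "G p p (\<phi> X) = - ((1/3) *\<^sub>R \<phi> X)" "G p p (\<psi> Y) = - ((1/3) *\<^sub>R \<psi> Y)" "G p p (\<phi>m Z) = - ((1/3) *\<^sub>R \<phi>m Z)"
    by (rule vector_eq_ldot [THEN iffD1], rule allI, simp add: Gpp 1 2 3 inner_add_right inner_diff_right)+
  then show "G p p (\<phi> X + \<psi> Y + \<phi>m Z) = - ((1/3) *\<^sub>R (\<phi> X + \<psi> Y + \<phi>m Z))"
    by (simp add: G_add scaleR_add_right)
qed

end

text \<open>At t = 0, with w concentrated in one normal direction, every term of the expansion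
  except the one with \<open>q i\<close> is even in r.\<close>

lemma third_form_odd_part:
  assumes q: "third_fundamental_form F p I N q" and I: "finite I" "i \<in> I" and y: "y \<in> tangent_space (focal F) p"
  shows "F (y + r *\<^sub>R N i) - F (y - r *\<^sub>R N i) = 16 * r * q i y"
proof -
  define w where "w r a = (if a = i then r else 0 :: real)" for r a
  define P where "P a = second_form F p (N a)" for a
  define D where "D a = gradient_on (tangent_space (focal F) p) (P a) y" for a
  define E where "E r = norm y ^ 4 - 6 * (norm y)\<^sup>2 * (norm (r *\<^sub>R N i))\<^sup>2 + norm (r *\<^sub>R N i) ^ 4 - 2 * (\<Sum>a\<in>I. (P a y)\<^sup>2)
      + 2 * (\<Sum>a\<in>I. \<Sum>b\<in>I. inner (D a) (D b) * w r a * w r b)" for r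
  have W: "(\<Sum>a\<in>I. w r a *\<^sub>R N a) = r *\<^sub>R N i" for r
  proof -
    have "(\<Sum>a\<in>I. w r a *\<^sub>R N a) = (\<Sum>a\<in>I. if a = i then r *\<^sub>R N i else 0)"
      by (rule sum.cong) (auto simp: w_def)
    then show ?thesis using I by simp
  qed
  have Q: "(\<Sum>a\<in>I. q a y * w r a) = r * q i y" for r
  proof -
    have "(\<Sum>a\<in>I. q a y * w r a) = (\<Sum>a\<in>I. if a = i then r * q i y else 0)"
      by (rule sum.cong) (auto simp: w_def)
    then show ?thesis using I by simp
  qed
  have "\<And>t w. F (t *\<^sub>R p + y + (\<Sum>a\<in>I. w a *\<^sub>R N a)) =
      t ^ 4 + (2 * (norm y)\<^sup>2 - 6 * (norm (\<Sum>a\<in>I. w a *\<^sub>R N a))\<^sup>2) * t\<^sup>2 + 8 * (\<Sum>a\<in>I. P a y * w a) * t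
      + norm y ^ 4 - 6 * (norm y)\<^sup>2 * (norm (\<Sum>a\<in>I. w a *\<^sub>R N a))\<^sup>2 + norm (\<Sum>a\<in>I. w a *\<^sub>R N a) ^ 4
      - 2 * (\<Sum>a\<in>I. (P a y)\<^sup>2) + 8 * (\<Sum>a\<in>I. q a y * w a)
      + 2 * (\<Sum>a\<in>I. \<Sum>b\<in>I. inner (D a) (D b) * w a * w b)"
    using q y unfolding third_fundamental_form_def Let_def P_def D_def by blast
  from this [of 0 "w r" for r] have E: "F (y + r *\<^sub>R N i) = E r + 8 * (r * q i y)" for r
    unfolding W Q E_def by simp
  have "w (- r) a = - w r a" for a by (simp add: w_def)
  then have "E (- r) = E r" by (simp add: E_def)
  then show ?thesis using E [of r] E [of "- r"] by simp
qed

lemma isometry_frechet_derivative: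
  fixes S :: "'b::euclidean_space \<Rightarrow> 'a::euclidean_space"
  assumes S: "linear S" and F: "(F has_derivative F') (at (S v))"
  shows "frechet_derivative (\<lambda>v. - F (S v)) (at v) w = - F' (S w)"
proof -
  have "(S has_derivative S) (at v)" using S by (simp add: linear_imp_has_derivative)
  from has_derivative_compose [OF this F]
  have "((\<lambda>v. - F (S v)) has_derivative (\<lambda>w. - F' (S w))) (at v)" by (rule has_derivative_minus)
  from frechet_derivative_at [OF this] show ?thesis by metis
qed

lemma regular_level_set_isometry:
  fixes S :: "'b::euclidean_space \<Rightarrow> 'a::euclidean_space"
  assumes S: "linear S" "\<And>v. norm (S v) = norm v" "surj S"
    and F: "\<And>z. F differentiable (at z)" and M: "regular_level_set F M"
  shows "regular_level_set (\<lambda>v. - F (S v)) (inv S ` M)"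
proof -
  have inner_S: "inner (S v) (S w) = inner v w" for v w
    using norm_linear_isometry [OF S(1,2)] .
  have inj: "inj S" using S(1,2) by (metis linear_injective_0 norm_eq_zero)
  have SI: "S (inv S z) = z" for z using S(3) by (rule surj_f_inv_f)
  have IS: "inv S (S v) = v" for v using inj by simp
  from M obtain c where c: "M = {x \<in> sphere 0 1. F x = c}" and ne: "M \<noteq> {}"
    and reg: "\<And>x. x \<in> M \<Longrightarrow> \<exists>v. inner v x = 0 \<and> frechet_derivative F (at x) v \<noteq> 0"
    unfolding regular_level_set_def by blast
  have img: "inv S ` M = {v \<in> sphere 0 1. - F (S v) = - c}"
  proof (intro set_eqI iffI)
    fix v assume "v \<in> inv S ` M"
    then obtain z where z: "z \<in> M" "v = inv S z" by blast
    then show "v \<in> {v \<in> sphere 0 1. - F (S v) = - c}" using S(2) [of v] by (simp add: c SI)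
  next
    fix v assume "v \<in> {v \<in> sphere 0 1. - F (S v) = - c}"
    then have "S v \<in> M" using S(2) [of v] by (simp add: c)
    then show "v \<in> inv S ` M" by (rule image_eqI [rotated]) (simp add: IS)
  qed
  have "\<exists>w. inner w v = 0 \<and> frechet_derivative (\<lambda>v. - F (S v)) (at v) w \<noteq> 0" if "v \<in> inv S ` M" for v
  proof -
    from that have "S v \<in> M" using SI by auto
    from reg [OF this] obtain z where z: "inner z (S v) = 0" "frechet_derivative F (at (S v)) z \<noteq> 0" by blast
    have "inner (inv S z) v = 0" using inner_S [of "inv S z" v] z(1) by (simp add: SI)
    moreover have "(F has_derivative frechet_derivative F (at (S v))) (at (S v))" using F
      by (simp flip: frechet_derivative_works)
    ultimately show ?thesis using z(2) isometry_frechet_derivative [OF S(1), of F _ v "inv S z"] by (auto simp: SI)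
  qed
  then show ?thesis unfolding regular_level_set_def using img ne by blast
qed

section \<open>The explicit Clifford system and its polynomial\<close>

context unital_composition
begin

lemma fkm_system_simps:
  "fkm_system mul (- 1) (A, X, Y, B) = (A, - X, Y, - B)"
  "0 \<le> a \<Longrightarrow> fkm_system mul a (A, X, Y, B) =
    (- (X \<cdot> oe (nat a)), - (A \<cdot> ocnj (oe (nat a))), - (B \<star> ocnj (oe (nat a))), - (Y \<star> oe (nat a)))"
  by simp_all

text \<open>The operators of index at least 0 consist of right multiplications by e_a and by its
  conjugate, for each of the two products; their relations are the polarized composition law. The
  operator of index -1 is the grading they reverse.\<close>

lemma fkm_system_clifford: "symmetric_clifford_system {-1..7} (fkm_system mul)"
proof -
  have idx: "a = -1 \<or> 0 \<le> a" if "a \<in> {-1..7}" for a :: int using that by auto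
  have "linear (fkm_system mul a)" if a: "a \<in> {-1..7}" for a
  proof (rule linearI)
    fix v w :: octonion4 and r :: real
    obtain A X Y B A' X' Y' B' where v: "v = (A, X, Y, B)" "w = (A', X', Y', B')" by (metis surj_pair)
    show "fkm_system mul a (v + w) = fkm_system mul a v + fkm_system mul a w"
      using idx [OF a] by (auto simp: v fkm_system_simps O.add_left add_left simp del: fkm_system.simps)
    show "fkm_system mul a (r *\<^sub>R v) = r *\<^sub>R fkm_system mul a v"
      using idx [OF a] by (auto simp: v fkm_system_simps O.scaleR_left scaleR_left scaleR_minus_right simp del:
        fkm_system.simps)
  qed
  moreover have "inner (fkm_system mul a v) w = inner v (fkm_system mul a w)" if a: "a \<in> {-1..7}" for a v w
  proof -
    obtain A X Y B A' X' Y' B' where v: "v = (A, X, Y, B)" "w = (A', X', Y', B')" by (metis surj_pair)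
    define c where "c = oe (nat a)"
    have "inner (X \<cdot> c) A' = inner X (A' \<cdot> ocnj c)" "inner (A \<cdot> ocnj c) X' = inner A (X' \<cdot> c)"
      "inner (B \<star> ocnj c) Y' = inner B (Y' \<star> c)" "inner (Y \<star> c) B' = inner Y (B' \<star> ocnj c)"
      using O.adjoint_right adjoint_right by simp_all
    then show ?thesis
      using idx [OF a] by (auto simp: v fkm_system_simps simp flip: c_def simp del: fkm_system.simps)
  qed
  moreover have "fkm_system mul a (fkm_system mul b v) + fkm_system mul b (fkm_system mul a v) = (if a = b then 2
    else 0) *\<^sub>R v"
    if a: "a \<in> {-1..7}" and b: "b \<in> {-1..7}" for a b v
  proof -
    obtain A X Y B where v: "v = (A, X, Y, B)" by (metis surj_pair)
    have *: "inner (oe (nat a)) (oe (nat b)) = (if a = b then 1 else 0)" if "0 \<le> a" "0 \<le> b"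
      using a b that by (simp add: inner_oe nat_le_iff eq_nat_nat_iff)
    have **: "inner (oe (nat b)) (oe (nat a)) = (if a = b then 1 else 0)" if "0 \<le> a" "0 \<le> b"
      using * [OF that] by (simp add: inner_commute)
    consider "a = -1" "b = -1" | "a = -1" "0 \<le> b" | "b = -1" "0 \<le> a" | "0 \<le> a" "0 \<le> b"
      using idx [OF a] idx [OF b] by blast
    then show ?thesis
    proof cases
      case 4
      show ?thesis unfolding v fkm_system_simps(2) [OF 4(1)] fkm_system_simps(2) [OF 4(2)]
        using * [OF 4] ** [OF 4]
        by (simp add: O.minus_left minus_left mul_right_swap mul_right_swap' O.mul_right_swap O.mul_right_swap')
    qed (auto simp: v fkm_system_simps O.minus_left minus_left scaleR_2 zero_prod_def simp del: fkm_system.simps)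
  qed
  ultimately show ?thesis unfolding symmetric_clifford_system_def by blast
qed

text \<open>By the adjoint formulas the eight forms of index 0, ..., 7 are coordinates of one
  octonion, so Parseval turns the sum of their squares into one squared norm.\<close>

lemma fkm_polynomial_eq:
  "fkm_polynomial mul (A, X, Y, B) = ((norm A)\<^sup>2 + (norm X)\<^sup>2 + (norm Y)\<^sup>2 + (norm B)\<^sup>2)\<^sup>2
    - 2 * ((norm A)\<^sup>2 - (norm X)\<^sup>2 + (norm Y)\<^sup>2 - (norm B)\<^sup>2)\<^sup>2 - 8 * (norm (ocnj X \<cdot> A + ocnj Y \<star> B))\<^sup>2"
proof -
  define v where "v = (A, X, Y, B)"
  have nv: "(norm v)\<^sup>2 = (norm A)\<^sup>2 + (norm X)\<^sup>2 + (norm Y)\<^sup>2 + (norm B)\<^sup>2"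
    unfolding power2_norm_eq_inner by (simp add: v_def)
  have "norm v ^ 4 = ((norm v)\<^sup>2)\<^sup>2" by (simp flip: power_mult)
  then have n4: "norm v ^ 4 = ((norm A)\<^sup>2 + (norm X)\<^sup>2 + (norm Y)\<^sup>2 + (norm B)\<^sup>2)\<^sup>2" by (simp add: nv)
  have "inner (fkm_system mul (int a) v) v = - 2 * inner (ocnj X \<cdot> A + ocnj Y \<star> B) (oe a)" for a
  proof -
    define c where "c = oe a"
    have "inner (X \<cdot> c) A = inner (ocnj X \<cdot> A) c" "inner (A \<cdot> ocnj c) X = inner (ocnj X \<cdot> A) c"
      "inner (B \<star> ocnj c) Y = inner (ocnj Y \<star> B) c" "inner (Y \<star> c) B = inner (ocnj Y \<star> B) c"
      using O.adjoint_left [of X c A] O.adjoint_right [of X c A] adjoint_left [of Y c B] adjoint_right [of Y c B]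
      by (simp_all add: inner_commute)
    then show ?thesis
      by (simp add: v_def fkm_system_simps inner_add_left flip: c_def del: fkm_system.simps)
  qed
  then have "(\<Sum>a=0..7. (inner (fkm_system mul (int a) v) v)\<^sup>2) = 4 * (\<Sum>a=0..7. inner (ocnj X \<cdot> A + ocnj Y \<star> B) (oe
    a) * inner (ocnj X \<cdot> A + ocnj Y \<star> B) (oe a))"
    by (simp add: power_mult_distrib sum_distrib_left power2_eq_square)
  also have "\<dots> = 4 * (norm (ocnj X \<cdot> A + ocnj Y \<star> B))\<^sup>2" by (simp only: oe_parseval power2_norm_eq_inner)
  finally have s: "(\<Sum>a=0..7. (inner (fkm_system mul (int a) v) v)\<^sup>2) = 4 * (norm (ocnj X \<cdot> A + ocnj Y \<star> B))\<^sup>2" .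
  have "inner (fkm_system mul (- 1) v) v = (norm A)\<^sup>2 - (norm X)\<^sup>2 + (norm Y)\<^sup>2 - (norm B)\<^sup>2"
    unfolding power2_norm_eq_inner by (simp add: v_def)
  moreover have "(\<Sum>a\<in>{-1..7}. (inner (fkm_system mul a v) v)\<^sup>2) =
      (inner (fkm_system mul (- 1) v) v)\<^sup>2 + (\<Sum>a=0..7. (inner (fkm_system mul (int a) v) v)\<^sup>2)"
  proof -
    have "{-1..7::int} = insert (- 1) (int ` {0..7})" by (auto simp: image_int_atLeastAtMost)
    moreover have "(- 1 :: int) \<notin> int ` {0..7}" by auto
    ultimately show ?thesis by (simp add: sum.reindex)
  qed
  ultimately show ?thesis unfolding fkm_polynomial_def v_def [symmetric] n4 s by simp
qed

end

section \<open>The isometry onto the explicit polynomial\<close>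

context mirror_frame
begin

text \<open>S is the inverse of the isometry sought. The factor h = 1/sqrt 2 makes W + Z and W - Z
  multiples of A and B, and the conjugate of X is what matches \<open>inner_G_formula\<close> with
  the mixed term of \<open>fkm_polynomial_eq\<close>.\<close>

lemma fkm_type_of_commutator:
  assumes m: "\<And>X Y Z. - 2 *\<^sub>R m X Y Z = twisted_commutator (\<star>) X Y Z"
    and F: "\<And>z. F z = inner (G z z z) z" "\<And>z. F differentiable (at z)" and M: "regular_level_set F M"
  shows "fkm_type (\<star>) F M"
proof -
  define h where "h = inverse (sqrt 2)"
  have h: "h * h = 1/2" "h\<^sup>2 = 1/2" by (simp_all add: h_def power2_eq_square flip: inverse_mult_distrib)
  define S :: "octonion4 \<Rightarrow> 'a" where
    "S = (\<lambda>(A, X, Y, B). \<phi> (ocnj X) + \<psi> Y + V (h *\<^sub>R (A + B)) (h *\<^sub>R (A - B)))"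
  have S: "S (A, X, Y, B) = \<phi> (ocnj X) + \<psi> Y + V (h *\<^sub>R (A + B)) (h *\<^sub>R (A - B))" for A X Y B
    by (simp add: S_def)
  have cnj: "ocnj (X + X') = ocnj X + ocnj X'" "ocnj (r *\<^sub>R X) = r *\<^sub>R ocnj X" for X X' r
    by (simp_all add: linear_add [OF linear_ocnj] linear_scale [OF linear_ocnj])
  have lin: "linear S"
  proof (rule linearI)
    fix v w :: octonion4 and r :: real
    obtain A X Y B A' X' Y' B' where v: "v = (A, X, Y, B)" "w = (A', X', Y', B')" by (metis surj_pair)
    show "S (v + w) = S v + S w"
      by (simp add: v S V_def frame_add frame_diff frame_scale cnj algebra_simps)
    show "S (r *\<^sub>R v) = r *\<^sub>R S v"
      by (simp add: v S V_def frame_add frame_diff frame_scale cnj algebra_simps)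
  qed
  have sq: "(norm (h *\<^sub>R (A + B)))\<^sup>2 = ((norm A)\<^sup>2 + (norm B)\<^sup>2) / 2 + inner A B"
    "(norm (h *\<^sub>R (A - B)))\<^sup>2 = ((norm A)\<^sup>2 + (norm B)\<^sup>2) / 2 - inner A B"
    "inner (h *\<^sub>R (A + B)) (h *\<^sub>R (A - B)) = ((norm A)\<^sup>2 - (norm B)\<^sup>2) / 2" for A B :: octonion
  proof -
    have "inner (h *\<^sub>R v) (h *\<^sub>R w) = inner v w / 2" for v w :: octonion by (simp add: h flip: mult.assoc)
    then show "(norm (h *\<^sub>R (A + B)))\<^sup>2 = ((norm A)\<^sup>2 + (norm B)\<^sup>2) / 2 + inner A B"
      "(norm (h *\<^sub>R (A - B)))\<^sup>2 = ((norm A)\<^sup>2 + (norm B)\<^sup>2) / 2 - inner A B"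
      "inner (h *\<^sub>R (A + B)) (h *\<^sub>R (A - B)) = ((norm A)\<^sup>2 - (norm B)\<^sup>2) / 2"
      unfolding power2_norm_eq_inner
      by (simp_all only:) (simp_all add: inner_add_left inner_add_right inner_diff_left inner_diff_right
        inner_commute [of B A] field_simps)
  qed
  have norm_S: "norm (S v) = norm v" for v
  proof -
    obtain A X Y B where v: "v = (A, X, Y, B)" by (metis surj_pair)
    have "inner (S v) (S v) = inner v v"
      using sq(1,2) [of A B] unfolding power2_norm_eq_inner
      by (simp add: v S inner_add_left inner_add_right iso orth orth' inner_V inner_ocnj del: inner_scaleR_left
        inner_scaleR_right)
    then show ?thesis by (simp add: norm_eq_sqrt_inner)
  qed
  have surj: "surj S"
    unfolding surj_def
  proof
    fix z
    obtain X Y W Z where z: "z = \<phi> X + \<psi> Y + \<phi>p W + \<phi>m Z" using spanning by blast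
    have hh: "h *\<^sub>R (h *\<^sub>R (W + Z) + h *\<^sub>R (W - Z)) = W" "h *\<^sub>R (h *\<^sub>R (W + Z) - h *\<^sub>R (W - Z)) = Z"
    proof -
      have "(h * h) *\<^sub>R (2 *\<^sub>R v) = v" for v :: octonion by (simp add: h)
      then show "h *\<^sub>R (h *\<^sub>R (W + Z) + h *\<^sub>R (W - Z)) = W" "h *\<^sub>R (h *\<^sub>R (W + Z) - h *\<^sub>R (W - Z)) = Z"
        by (simp_all add: scaleR_2 algebra_simps) 
    qed
    have "S (h *\<^sub>R (W + Z), ocnj X, Y, h *\<^sub>R (W - Z)) = z"
      unfolding S hh by (simp add: z V_def add.assoc)
    then show "\<exists>v. z = S v" by blast
  qed
  have poly: "- F (S v) = fkm_polynomial (\<star>) v" for v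
  proof -
    obtain A X Y B where v: "v = (A, X, Y, B)" by (metis surj_pair)
    define W Z g where "W = h *\<^sub>R (A + B)" and "Z = h *\<^sub>R (A - B)" and "g = inner (ocnj X \<cdot> A) (ocnj Y \<star> B)"
    have "W + Z = (2 * h) *\<^sub>R A" "W - Z = (2 * h) *\<^sub>R B"
      by (simp_all add: W_def Z_def algebra_simps flip: scaleR_2)
    then have g: "inner (G (\<phi> (ocnj X)) (\<psi> Y) (V W Z)) (V W Z) = 4/3 * g"
      using inner_G_formula [OF m, of "ocnj X" Y W Z] h
      by (simp add: g_def O.scaleR_right C.scaleR_right algebra_simps)
    have n: "(norm (ocnj X \<cdot> A + ocnj Y \<star> B))\<^sup>2 = (norm X)\<^sup>2 * (norm A)\<^sup>2 + (norm Y)\<^sup>2 * (norm B)\<^sup>2 + 2 * g"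
    proof -
      have "(norm (ocnj X \<cdot> A + ocnj Y \<star> B))\<^sup>2 = (norm (ocnj X \<cdot> A))\<^sup>2 + (norm (ocnj Y \<star> B))\<^sup>2 + 2 * g"
        unfolding power2_norm_eq_inner g_def
        by (simp add: inner_add_left inner_add_right inner_commute [of "ocnj Y \<star> B" "ocnj X \<cdot> A"])
      then show ?thesis by (simp add: norm_omul C.norm_mul power_mult_distrib)
    qed
    have "norm X ^ 4 = ((norm X)\<^sup>2)\<^sup>2" for X :: octonion by (simp flip: power_mult)
    moreover have "F (S v) = norm X ^ 4 + norm Y ^ 4 - 6 * (norm X)\<^sup>2 * (norm Y)\<^sup>2
      + 2 * ((norm X)\<^sup>2 + (norm Y)\<^sup>2) * ((norm W)\<^sup>2 + (norm Z)\<^sup>2)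
      + 16 * g + 8 * (inner W Z)\<^sup>2 - ((norm W)\<^sup>2 + (norm Z)\<^sup>2)\<^sup>2"
      using quartic_formula [of "ocnj X" Y W Z] by (simp add: F(1) v S g flip: W_def Z_def)
    ultimately have Fv: "F (S v) = ((norm X)\<^sup>2)\<^sup>2 + ((norm Y)\<^sup>2)\<^sup>2 - 6 * (norm X)\<^sup>2 * (norm Y)\<^sup>2
      + 2 * ((norm X)\<^sup>2 + (norm Y)\<^sup>2) * ((norm A)\<^sup>2 + (norm B)\<^sup>2)
      + 16 * g + 8 * (((norm A)\<^sup>2 - (norm B)\<^sup>2) / 2)\<^sup>2 - ((norm A)\<^sup>2 + (norm B)\<^sup>2)\<^sup>2"
      using sq [of A B] by (simp add: W_def Z_def del: norm_scaleR inner_scaleR_left inner_scaleR_right)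
    \<comment> \<open>In the squared norms and g the claim is an identity of real
      polynomials.\<close>
    have alg: "- (x\<^sup>2 + y\<^sup>2 - 6 * x * y + 2 * (x + y) * (a + b) + 16 * g + 8 * ((a - b) / 2)\<^sup>2 - (a + b)\<^sup>2)
        = (a + x + y + b)\<^sup>2 - 2 * (a - x + y - b)\<^sup>2 - 8 * (x * a + y * b + 2 * g)" for x y a b :: real
      by (simp add: power_divide) (simp add: power2_eq_square algebra_simps)
    show ?thesis unfolding Fv unfolding v C.fkm_polynomial_eq n by (rule alg)
  qed
  have "v = 0" if "S v = 0" for v using norm_S [of v] that by simp
  then have inj: "inj S" unfolding linear_injective_0 [OF lin] by blast
  define T where "T = inv S"
  have ST: "S (T z) = z" for z unfolding T_def by (rule surj_f_inv_f [OF surj])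
  have "linear T"
    by (rule linearI; rule injD [OF inj]) (simp_all add: ST linear_add [OF lin] linear_scale [OF lin])
  moreover have "bij T" unfolding T_def by (rule bij_imp_bij_inv) (simp add: bij_def inj surj)
  moreover have "norm (T z) = norm z" for z using norm_S [of "T z"] by (simp add: ST)
  moreover have "- F z = fkm_polynomial (\<star>) (T z)" for z using poly [of "T z"] by (simp add: ST)
  moreover have "regular_level_set (fkm_polynomial (\<star>)) (T ` M)"
    using regular_level_set_isometry [OF lin norm_S surj F(2) M] by (simp add: poly T_def)
  ultimately show ?thesis
    unfolding fkm_type_def using C.fkm_system_clifford by blast
qed

end

section \<open>The third fundamental form and the choice of sign\<close>

context adapted_frame
begin

lemma frame_map_im:
  "(\<Sum>b=1..7. inner X (oe b) *\<^sub>R n b) = \<phi> (im X)" "(\<Sum>b=1..7. inner X (oe b) *\<^sub>R u b) = \<psi> (im X)"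
proof -
  have "inner (im X) (oe b) = inner X (oe b)" if "b \<in> {1..7}" for b
    using that by (simp add: im_def inner_diff_left inner_oe)
  moreover have "(\<Sum>b=0..7. f b) = f 0 + (\<Sum>b=1..7. f b)" for f :: "nat \<Rightarrow> real ^ 32"
    by (simp add: sum.atLeast_Suc_atMost)
  ultimately show "(\<Sum>b=1..7. inner X (oe b) *\<^sub>R n b) = \<phi> (im X)" "(\<Sum>b=1..7. inner X (oe b) *\<^sub>R u b) = \<psi> (im X)"
    by (simp_all add: \<phi>_def \<psi>_def frame_map_def)
qed

text \<open>The odd part of - F in the direction v = \<open>\<phi>p (oe a)\<close> gives - 2 q = <G
  y y y, v>, while \<open>cubic_form_V\<close> evaluates the same number as 4 <m X Y Z, e_a>; hence
  the factor -2.\<close>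

lemma mirror_third_form_eq:
  assumes N: "focal_geometry (\<lambda>a b c. - G a b c) (\<lambda>z. - F z) \<tau>' d'"
    and q: "third_fundamental_form (\<lambda>z. - F z) (mirror_point x n) {-1..7} (mirror_normal x n \<phi>p) q"
  shows "mirror_third_form n \<phi>m u q X Y Z = - 2 *\<^sub>R m X Y Z"
proof -
  interpret N: focal_geometry "\<lambda>a b c. - G a b c" "\<lambda>z. - F z" \<tau>' d' by fact
  define y where "y = \<phi> (im X) + \<psi> (im Y) + \<phi>m Z"
  have pt: "mirror_point x n = (\<psi> (oe 0) + \<phi> (oe 0)) /\<^sub>R sqrt 2" by (simp add: mirror_point_def phi_psi_oe)
  note mt = mirror_point_tang [folded pt]
  have "N.focal_point (mirror_point x n)"
    using mt(1,2) by (simp add: N.focal_point_def power2_norm_eq_inner [symmetric])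
  then have foc: "mirror_point x n \<in> focal (\<lambda>z. - F z)" by (simp add: N.focal_iff)
  have y: "y \<in> tangent_space (focal (\<lambda>z. - F z)) (mirror_point x n)"
    unfolding N.tangent_space_eq [OF foc] N.tang_def y_def using mt(3,4) [of "im X" "im Y" Z] by simp
  have qa: "q (int a) y = - 2 * inner (m X Y Z) (oe a)" if a: "a \<in> {0..7}" for a
  proof -
    define v where "v = \<phi>p (oe a)"
    have mn: "mirror_normal x n \<phi>p (int a) = v" by (simp add: mirror_normal_def v_def)
    have *: "- F (y + r *\<^sub>R v) - - F (y - r *\<^sub>R v) = 16 * r * q (int a) y" for r
      using third_form_odd_part [OF q _ _ y, of "int a" r] a by (simp add: mn)
    have e: "- (8 * r * inner (G y y y) v + 8 * r ^ 3 * inner (G v v v) y) = 16 * r * q (int a) y" for r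
      using * [of r] quartic_odd_part [of y r v] by (simp add: F_eq)
    \<comment> \<open>Two values of r separate the linear from the cubic term in r.\<close>
    have "inner (G y y y) v = - 2 * q (int a) y" using e [of 1] e [of 2] by simp
    moreover have "inner (G y y y) v = 4 * inner (m X Y Z) (oe a)"
      using cubic_form_V [of "im X" "im Y" Z "oe a"] by (simp add: y_def v_def m_def)
    ultimately show ?thesis by simp
  qed
  have "mirror_third_form n \<phi>m u q X Y Z = (\<Sum>a=0..7. q (int a) y *\<^sub>R oe a)"
    by (simp only: mirror_third_form_def frame_map_im y_def)
  also have "\<dots> = (\<Sum>a=0..7. - 2 *\<^sub>R (inner (m X Y Z) (oe a) *\<^sub>R oe a))"
    by (rule sum.cong) (simp_all add: qa)
  also have "\<dots> = - 2 *\<^sub>R m X Y Z" by (simp only: oe_expansion flip: scaleR_sum_right)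
  finally show ?thesis .
qed

lemma mirror_third_form_sign:
  assumes "focal_geometry (\<lambda>a b c. - G a b c) (\<lambda>z. - F z) \<tau>' d'"
    and "third_fundamental_form (\<lambda>z. - F z) (mirror_point x n) {-1..7} (mirror_normal x n \<phi>p) q"
  shows "mirror_third_form (sign_normals s n) (\<lambda>z. s *\<^sub>R \<phi>m z) (\<lambda>a. s *\<^sub>R u a) q X Y Z = s ^ 3 *\<^sub>R (- 2 *\<^sub>R m X Y Z)"
proof -
  have "(\<Sum>b=1..7. inner X (oe b) *\<^sub>R sign_normals s n b) = (\<Sum>b=1..7. inner (s *\<^sub>R X) (oe b) *\<^sub>R n b)"
    by (rule sum.cong) (simp_all add: sign_normals_def)
  then have "mirror_third_form (sign_normals s n) (\<lambda>z. s *\<^sub>R \<phi>m z) (\<lambda>a. s *\<^sub>R u a) q X Y Z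
      = mirror_third_form n \<phi>m u q (s *\<^sub>R X) (s *\<^sub>R Y) (s *\<^sub>R Z)"
    by (simp add: mirror_third_form_def linear_scale [OF m(1)] mult.commute)
  also have "\<dots> = s ^ 3 *\<^sub>R (- 2 *\<^sub>R m X Y Z)"
    unfolding mirror_third_form_eq [OF assms]
    by (simp add: linear_scale [OF linear_m(1)] linear_scale [OF linear_m(2)] linear_scale [OF linear_m(3)]
      power3_eq_cube mult_ac)
  finally show ?thesis .
qed

text \<open>In each block the sign of the normal vector meets the sign of \<open>\<phi>m\<close>,
  and s s = 1. The third form has three such arguments and therefore does change sign.\<close>

lemma sign_change:
  assumes s: "s \<in> {1, -1}"
  shows "adapted_frame G F \<tau> d (\<star>) x (sign_normals s n) (\<lambda>a. s *\<^sub>R u a) \<phi>p (\<lambda>z. s *\<^sub>R \<phi>m z)"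
proof -
  have ss: "s * s = 1" using s by auto
  have span_sign: "span ((\<lambda>i. f i *\<^sub>R b i) ` I) = span (b ` I)"
    if "\<And>i. i \<in> I \<Longrightarrow> f i * f i = 1" for f :: "nat \<Rightarrow> real" and b :: "nat \<Rightarrow> real ^ 32" and I
  proof (rule antisym)
    show "span ((\<lambda>i. f i *\<^sub>R b i) ` I) \<subseteq> span (b ` I)"
      by (rule span_minimal) (auto intro: span_scale span_base)
    have "b i \<in> span ((\<lambda>i. f i *\<^sub>R b i) ` I)" if i: "i \<in> I" for i
    proof -
      have "f i *\<^sub>R (f i *\<^sub>R b i) \<in> span ((\<lambda>i. f i *\<^sub>R b i) ` I)" by (intro span_scale span_base imageI i)
      then show ?thesis using \<open>\<And>i. i \<in> I \<Longrightarrow> f i * f i = 1\<close> [OF i] by simp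
    qed
    then show "span (b ` I) \<subseteq> span ((\<lambda>i. f i *\<^sub>R b i) ` I)" by (intro span_minimal) auto
  qed
  have nf: "sign_normals s n = (\<lambda>i. (if i = 0 then 1 else s) *\<^sub>R n i)" by (auto simp: sign_normals_def)
  have onb_n: "orthonormal_basis {0..7} (sign_normals s n) (normal_space (focal F) x)"
    using adapted span_sign [of "{0..7}" "\<lambda>i. if i = 0 then 1 else s" n] ss
    unfolding adapted_bases_def orthonormal_basis_def nf by (auto simp flip: mult.assoc)
  have onb_u: "orthonormal_basis {1..7} (\<lambda>a. s *\<^sub>R u a) (shape_eigenspace (focal F) x (n 0) 0)"
    using adapted span_sign [of "{1..7}" "\<lambda>i. s" u] ss
    unfolding adapted_bases_def orthonormal_basis_def by (auto simp flip: mult.assoc)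
  have shape_sign: "block \<phi>p (\<lambda>z. s *\<^sub>R \<phi>m z) (shape_operator (focal F) p (s *\<^sub>R \<nu>)) z = block \<phi>p \<phi>m
    (shape_operator (focal F) p \<nu>) z"
    if "p \<in> focal F" "focal_point p" "\<nu> \<in> normal p" "\<And>z. \<phi>m z \<in> tang p" for p \<nu> z
  proof -
    have "s *\<^sub>R \<nu> \<in> normal p" "s *\<^sub>R \<phi>m z \<in> tang p"
      by (intro subspace_scale subspace_normal subspace_tang that)+
    then show ?thesis
      unfolding block_def using ss shape_operator_eq [OF that(1)] that(3,4) by (simp add: G_scale flip: mult.assoc)
  qed
  have un: "u a \<in> normal (n 0)" if "a \<in> {1..7}" for a using psi_normal [of "oe a"] that by (simp add: phi_psi_oe)
  have mb: "mirror_block F (sign_normals s n) \<phi>p (\<lambda>z. s *\<^sub>R \<phi>m z) (\<lambda>a. s *\<^sub>R u a) a z = mirror_block F n \<phi>p \<phi>m u a z"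
    if "a \<in> {1..7}" for a z
    using shape_sign [OF n0_focal(2,1) un [OF that] V_tang_n0'(2)] by (simp add: mirror_block_def sign_normals_def)
  have bl: "block \<phi>p (\<lambda>z. s *\<^sub>R \<phi>m z) (shape_operator (focal F) x (sign_normals s n a)) z = oe a \<cdot> z" if "a \<in> {1..7}" for a z
    using shape_sign [OF x_focal n_normal V_tang(2), of a] blk [OF that] that by (simp add: sign_normals_def)
  have "range (\<lambda>z. s *\<^sub>R \<phi>m z) = range \<phi>m"
  proof -
    have "\<phi>m z = s *\<^sub>R \<phi>m (s *\<^sub>R z)" for z using ss by (simp add: linear_scale [OF m(1)])
    moreover have "s *\<^sub>R \<phi>m z = \<phi>m (s *\<^sub>R z)" for z by (simp add: linear_scale [OF m(1)])
    ultimately show ?thesis by (metis (mono_tags, lifting) image_iff set_eqI UNIV_I)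
  qed
  moreover have "linear (\<lambda>z. s *\<^sub>R \<phi>m z)" by (intro linear_compose_scale_right m)
  moreover have "norm (s *\<^sub>R \<phi>m z) = norm z" for z using s by (auto simp: iso_pm)
  ultimately have ad: "adapted_bases F x (sign_normals s n) \<phi>p (\<lambda>z. s *\<^sub>R \<phi>m z) (\<lambda>a. s *\<^sub>R u a)"
    using adapted onb_n onb_u bl mb
    unfolding adapted_bases_def by (simp add: sign_normals_def [of s n 0])
  have mp: "(\<star>) = mirror_product F (sign_normals s n) \<phi>p (\<lambda>z. s *\<^sub>R \<phi>m z) (\<lambda>a. s *\<^sub>R u a)"
  proof (intro ext)
    fix y z
    show "y \<star> z = mirror_product F (sign_normals s n) \<phi>p (\<lambda>z. s *\<^sub>R \<phi>m z) (\<lambda>a. s *\<^sub>R u a) y z"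
      unfolding circ_eq mirror_product_def by (intro sum.cong refl) (simp add: mb)
  qed
  show ?thesis
    by (intro adapted_frame.intro adapted_frame_axioms.intro focal_geometry_axioms C.unital_composition_axioms condA ad mp)
qed

end

theorem theorem2:
  fixes F :: "real ^ 32 \<Rightarrow> real" and M :: "(real ^ 32) set" and x :: "real ^ 32"
    and n u :: "nat \<Rightarrow> real ^ 32" and \<phi>p \<phi>m :: "octonion \<Rightarrow> real ^ 32"
    and circ :: "octonion \<Rightarrow> octonion \<Rightarrow> octonion" and \<alpha> e :: octonion and \<theta> :: real
    and q :: "int \<Rightarrow> real ^ 32 \<Rightarrow> real"
  assumes "isoparametric 7 8 F M"
    and "condition_A F x"
    and "adapted_bases F x n \<phi>p \<phi>m u"
    and "circ = mirror_product F n \<phi>p \<phi>m u"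
    and "norm e = 1" and "inner e (oe 0) = 0"
    and "\<alpha> = cos \<theta> *\<^sub>R oe 0 + sin \<theta> *\<^sub>R e"
    and "(\<forall>a b. circ a b = (a \<cdot> (b \<cdot> ocnj \<alpha>)) \<cdot> \<alpha>) \<or> (\<forall>a b. circ a b = \<alpha> \<cdot> ((ocnj \<alpha> \<cdot> b) \<cdot> a))"
    and "third_fundamental_form (\<lambda>z. - F z) (mirror_point x n) {-1..7} (mirror_normal x n \<phi>p) q"
    and "\<not> [\<theta> = 0] (rmod (2 * pi))" and "\<not> [\<theta> = pi] (rmod (2 * pi))"
  shows "(\<exists>s\<in>{1, -1}.
            adapted_bases F x (sign_normals s n) \<phi>p (\<lambda>z. s *\<^sub>R \<phi>m z) (\<lambda>a. s *\<^sub>R u a) \<and>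
            mirror_product F (sign_normals s n) \<phi>p (\<lambda>z. s *\<^sub>R \<phi>m z) (\<lambda>a. s *\<^sub>R u a) = circ \<and>
            (\<forall>X Y Z. mirror_third_form (sign_normals s n) (\<lambda>z. s *\<^sub>R \<phi>m z) (\<lambda>a. s *\<^sub>R u a) q X Y Z
                     = X \<cdot> circ Y Z - circ Y (X \<cdot> Z)))
         \<and> fkm_type circ F M"
proof -
  have e: "inner e e = 1" using assms(5) by (simp add: norm_eq_sqrt_inner)
  have e0: "inner (oe 0) e = 0" using assms(6) by (simp add: inner_commute)
  have "inner \<alpha> \<alpha> = (cos \<theta>)\<^sup>2 + (sin \<theta>)\<^sup>2"
    unfolding assms(7) by (simp add: inner_add_left inner_add_right e e0 assms(6) inner_oe_0 power2_eq_square)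
  then have "norm \<alpha> = 1" by (simp add: norm_eq_sqrt_inner)
  with assms(8) have tw: "twisted_product \<alpha> circ" by (simp add: twisted_product_def)
  \<comment> \<open>A zero of the sine is a multiple of pi, and its parity decides which of the two
    excluded residue classes contains \<theta>.\<close>
  have "sin \<theta> \<noteq> 0"
  proof
    assume "sin \<theta> = 0"
    then obtain i where i: "\<theta> = of_int i * pi" by (auto simp: sin_zero_iff_int2)
    show False
    proof (cases "even i")
      case True
      then obtain k where "i = 2 * k" by blast
      then have "0 = \<theta> + of_int (- k) * (2 * pi)" by (simp add: i)
      then show False using assms(10) unfolding rcong_altdef by blast
    next
      case False
      then obtain k where "i = 2 * k + 1" by (rule oddE)
      then have "pi = \<theta> + of_int (- k) * (2 * pi)" by (simp add: i algebra_simps)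
      then show False using assms(11) unfolding rcong_altdef by blast
    qed
  qed
  moreover have "inner \<alpha> e = sin \<theta>" by (simp add: assms(7) inner_add_left e e0)
  ultimately have real: "\<alpha> \<noteq> r *\<^sub>R oe 0" for r using e0 by auto
  obtain G where G: "focal_geometry G F (2/3) 23" and N: "focal_geometry (\<lambda>a b c. - G a b c) (\<lambda>z. - F z) (- 2/3) 22"
    by (rule isoparametric_focal_geometry [OF assms(1)])
  interpret A: adapted_frame G F "2/3" 23 circ x n u \<phi>p \<phi>m
    by (intro adapted_frame.intro adapted_frame_axioms.intro G twisted_product_unital_composition [OF tw] assms(2-4))
  obtain s :: real where s: "s \<in> {1, -1}" and m: "\<And>X Y Z. - 2 *\<^sub>R A.m X Y Z = s *\<^sub>R twisted_commutator circ X Y Z"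
    by (rule A.m_eq_commutator [OF tw real]) (rule that)
  have form: "mirror_third_form (sign_normals s n) (\<lambda>z. s *\<^sub>R \<phi>m z) (\<lambda>a. s *\<^sub>R u a) q X Y Z = twisted_commutator
    circ X Y Z" for X Y Z
    unfolding A.mirror_third_form_sign [OF N assms(9)] m using s by auto
  \<comment> \<open>The same geometry in the frame with the chosen sign: there the commutator
    formula holds exactly, as the computation of F requires.\<close>
  interpret B: adapted_frame G F "2/3" 23 circ x "sign_normals s n" "\<lambda>a. s *\<^sub>R u a" \<phi>p "\<lambda>z. s *\<^sub>R \<phi>m z"
    by (rule A.sign_change [OF s])
  have pt: "mirror_point x (sign_normals s n) = mirror_point x n"
    "mirror_normal x (sign_normals s n) \<phi>p = mirror_normal x n \<phi>p"
    by (auto simp: mirror_point_def mirror_normal_def sign_normals_def)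
  \<comment> \<open>The mirror point and its normals do not involve s, so the same q serves both
    frames and transfers the commutator formula to \<open>B.m\<close>.\<close>
  have comm: "- 2 *\<^sub>R B.m X Y Z = twisted_commutator circ X Y Z" for X Y Z
    using B.mirror_third_form_eq [OF N, of q X Y Z] assms(9) form [of X Y Z] by (simp add: pt)
  have "F differentiable (at z)" for z
    using assms(1) unfolding isoparametric_def cartan_munzner_def gderiv_def differentiable_def by blast
  then have "fkm_type circ F M"
    using assms(1) by (intro B.fkm_type_of_commutator comm A.F_eq) (auto simp: isoparametric_def)
  then show ?thesis
    using s B.adapted B.circ_eq form by (auto simp: twisted_commutator_def)
qed

end
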